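(* The bounded arithmetic theory $S^2_2$ (the second level of Buss's hierarchy) proves the consistency of $\mathrm{PV}^-$; that is, $S^2_2$ proves that there is no $\mathrm{PV}^-$-derivation of the equation $\epsilon = s_1\epsilon$.
   Context: $\mathrm{PV}^-$ is the following purely equational theory, formulated over binary strings. Its language has the constant $\epsilon$ (empty string), the binary successors $s_0, s_1$ (written without parentheses, e.g. $s_0s_1x$), and a function symbol for every function given by a Cobham-style derivation from the initial functions: the constant functions $\epsilon^n$ ($n\ge 1$), the projections $\mathrm{proj}^i_n$ ($1\le i\le n$), closure under composition, and closure under recursion on notation. Formulas are equations $t_1 = t_2$ between terms, with no propositional connectives or quantifiers. Axioms: the defining equations $\epsilon^n(x_1,\dots,x_n)=\epsilon$; $\mathrm{proj}^i_n(x_1,\dots,x_n)=x_i$; for $f$ defined by composition, $f(\bar x)=g(h_1(\bar x),\dots,h_m(\bar x))$; for $f$ defined by recursion on notation from $g_\epsilon,g_0,g_1$: $f(\epsilon,\bar x)=g_\epsilon(\bar x)$, $f(s_0x,\bar x)=g_0(x,f(x,\bar x),\bar x)$, $f(s_1x,\bar x)=g_1(x,f(x,\bar x),\bar x)$ (no defining equations for $s_0,s_1$); and the identity axioms $t=t$. Inference rules: from $u=t$ infer $t=u$; from $t=u$ and $u=r$ infer $t=r$; from $t_1=u_1,\dots,t_n=u_n$ infer $f(t_1,\dots,t_n)=f(u_1,\dots,u_n)$; and the substitution rule: from $t(x)=u(x)$ infer $t(r)=u(r)$. (The theory $\mathrm{PV}$ additionally has an induction rule; $\mathrm{PV}^-$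 has none.) Proofs, terms and symbols are Gödel-numbered in the standard way so that the consistency statement is a formula of bounded arithmetic. *)

theory Defs
  imports Main
begin

section \<open>First-order logic over the language of bounded arithmetic\<close>

text \<open>Variables are de Bruijn indices.\<close>

datatype tm =
    Var nat
  | Zero
  | Succ tm
  | Add tm tm  (infixl "\<^bold>+" 65)
  | Mult tm tm  (infixl "\<^bold>*" 70)
  | Smash tm tm  (infixl "\<^bold>#" 75)
  | Len tm
  | Half tm

datatype fm =
    Eq tm tm  (infix "\<^bold>=" 50)
  | Leq tm tm  (infix "\<^bold>\<le>" 50)
  | Neg fm  ("\<^bold>\<not> _" [40] 40)
  | And fm fm  (infixr "\<^bold>\<and>" 35)
  | Or fm fm  (infixr "\<^bold>\<or>" 30)
  | Imp fm fm  (infixr "\<^bold>\<longrightarrow>" 25)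
  | Forall fm
  | Exists fm

abbreviation Iff :: "fm \<Rightarrow> fm \<Rightarrow> fm"  (infix "\<^bold>\<longleftrightarrow>" 24) where
  "A \<^bold>\<longleftrightarrow> B \<equiv> (A \<^bold>\<longrightarrow> B) \<^bold>\<and> (B \<^bold>\<longrightarrow> A)"

abbreviation One :: tm where "One \<equiv> Succ Zero"
abbreviation Two :: tm where "Two \<equiv> Succ (Succ Zero)"

primrec tsub :: "(nat \<Rightarrow> tm) \<Rightarrow> tm \<Rightarrow> tm" where
  "tsub \<sigma> (Var n) = \<sigma> n"
| "tsub \<sigma> Zero = Zero"
| "tsub \<sigma> (Succ t) = Succ (tsub \<sigma> t)"
| "tsub \<sigma> (t \<^bold>+ u) = tsub \<sigma> t \<^bold>+ tsub \<sigma> u"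
| "tsub \<sigma> (t \<^bold>* u) = tsub \<sigma> t \<^bold>* tsub \<sigma> u"
| "tsub \<sigma> (t \<^bold># u) = tsub \<sigma> t \<^bold># tsub \<sigma> u"
| "tsub \<sigma> (Len t) = Len (tsub \<sigma> t)"
| "tsub \<sigma> (Half t) = Half (tsub \<sigma> t)"

definition tlift :: "tm \<Rightarrow> tm" where
  "tlift = tsub (\<lambda>n. Var (Suc n))"

definition up :: "(nat \<Rightarrow> tm) \<Rightarrow> nat \<Rightarrow> tm" where
  "up \<sigma> = case_nat (Var 0) (\<lambda>n. tlift (\<sigma> n))"

primrec fsub :: "(nat \<Rightarrow> tm) \<Rightarrow> fm \<Rightarrow> fm" where
  "fsub \<sigma> (t \<^bold>= u) = (tsub \<sigma> t \<^bold>= tsub \<sigma> u)"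
| "fsub \<sigma> (t \<^bold>\<le> u) = (tsub \<sigma> t \<^bold>\<le> tsub \<sigma> u)"
| "fsub \<sigma> (\<^bold>\<not> A) = (\<^bold>\<not> fsub \<sigma> A)"
| "fsub \<sigma> (A \<^bold>\<and> B) = (fsub \<sigma> A \<^bold>\<and> fsub \<sigma> B)"
| "fsub \<sigma> (A \<^bold>\<or> B) = (fsub \<sigma> A \<^bold>\<or> fsub \<sigma> B)"
| "fsub \<sigma> (A \<^bold>\<longrightarrow> B) = (fsub \<sigma> A \<^bold>\<longrightarrow> fsub \<sigma> B)"
| "fsub \<sigma> (Forall A) = Forall (fsub (up \<sigma>) A)"
| "fsub \<sigma> (Exists A) = Exists (fsub (up \<sigma>) A)"

definition flift :: "fm \<Rightarrow> fm" where
  "flift = fsub (\<lambda>n. Var (Suc n))"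

definition inst :: "tm \<Rightarrow> fm \<Rightarrow> fm" where
  "inst t = fsub (case_nat t Var)"

text \<open>
  Classical natural deduction with equality. The non-logical axioms \<open>T\<close> are not affected by the
  lifting of the context in \<open>ForallI\<close> and \<open>ExistsE\<close>: an axiom with free variables stands for its
  universal closure.
\<close>

inductive prov :: "fm set \<Rightarrow> fm list \<Rightarrow> fm \<Rightarrow> bool" for T where
  Axiom: "A \<in> T \<Longrightarrow> prov T \<Gamma> A"
| Assm: "A \<in> set \<Gamma> \<Longrightarrow> prov T \<Gamma> A"
| AndI: "prov T \<Gamma> A \<Longrightarrow> prov T \<Gamma> B \<Longrightarrow> prov T \<Gamma> (A \<^bold>\<and> B)"
| AndE1: "prov T \<Gamma> (A \<^bold>\<and> B) \<Longrightarrow> prov T \<Gamma> A"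
| AndE2: "prov T \<Gamma> (A \<^bold>\<and> B) \<Longrightarrow> prov T \<Gamma> B"
| OrI1: "prov T \<Gamma> A \<Longrightarrow> prov T \<Gamma> (A \<^bold>\<or> B)"
| OrI2: "prov T \<Gamma> B \<Longrightarrow> prov T \<Gamma> (A \<^bold>\<or> B)"
| OrE: "prov T \<Gamma> (A \<^bold>\<or> B) \<Longrightarrow> prov T (A # \<Gamma>) C \<Longrightarrow> prov T (B # \<Gamma>) C \<Longrightarrow> prov T \<Gamma> C"
| ImpI: "prov T (A # \<Gamma>) B \<Longrightarrow> prov T \<Gamma> (A \<^bold>\<longrightarrow> B)"
| ImpE: "prov T \<Gamma> (A \<^bold>\<longrightarrow> B) \<Longrightarrow> prov T \<Gamma> A \<Longrightarrow> prov T \<Gamma> B"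
| NegI: "prov T (A # \<Gamma>) B \<Longrightarrow> prov T (A # \<Gamma>) (\<^bold>\<not> B) \<Longrightarrow> prov T \<Gamma> (\<^bold>\<not> A)"
| Contr: "prov T ((\<^bold>\<not> A) # \<Gamma>) B \<Longrightarrow> prov T ((\<^bold>\<not> A) # \<Gamma>) (\<^bold>\<not> B) \<Longrightarrow> prov T \<Gamma> A"
| ForallI: "prov T (map flift \<Gamma>) A \<Longrightarrow> prov T \<Gamma> (Forall A)"
| ForallE: "prov T \<Gamma> (Forall A) \<Longrightarrow> prov T \<Gamma> (inst t A)"
| ExistsI: "prov T \<Gamma> (inst t A) \<Longrightarrow> prov T \<Gamma> (Exists A)"
| ExistsE: "prov T \<Gamma> (Exists A) \<Longrightarrow> prov T (A # map flift \<Gamma>) (flift B) \<Longrightarrow> prov T \<Gamma> B"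
| EqRefl: "prov T \<Gamma> (t \<^bold>= t)"
| EqSub: "prov T \<Gamma> (t \<^bold>= u) \<Longrightarrow> prov T \<Gamma> (inst t A) \<Longrightarrow> prov T \<Gamma> (inst u A)"

definition provable :: "fm set \<Rightarrow> fm \<Rightarrow> bool"  (infix "\<turnstile>" 50) where
  "(T \<turnstile> A) \<longleftrightarrow> prov T [] A"


section \<open>Buss's theories\<close>

definition BASIC :: "fm set" where
  "BASIC = (let x = Var 0; y = Var 1; z = Var 2; u = Var 2; v = Var 3 in
   {y \<^bold>\<le> x \<^bold>\<longrightarrow> y \<^bold>\<le> Succ x,
    \<^bold>\<not> x \<^bold>= Succ x,
    Zero \<^bold>\<le> x,
    (x \<^bold>\<le> y \<^bold>\<and> \<^bold>\<not> x \<^bold>= y) \<^bold>\<longleftrightarrow> Succ x \<^bold>\<le> y,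
    \<^bold>\<not> x \<^bold>= Zero \<^bold>\<longrightarrow> \<^bold>\<not> Two \<^bold>* x \<^bold>= Zero,
    y \<^bold>\<le> x \<^bold>\<or> x \<^bold>\<le> y,
    x \<^bold>\<le> y \<^bold>\<and> y \<^bold>\<le> x \<^bold>\<longrightarrow> x \<^bold>= y,
    x \<^bold>\<le> y \<^bold>\<and> y \<^bold>\<le> z \<^bold>\<longrightarrow> x \<^bold>\<le> z,
    Len Zero \<^bold>= Zero,
    \<^bold>\<not> x \<^bold>= Zero \<^bold>\<longrightarrow> Len (Two \<^bold>* x) \<^bold>= Succ (Len x) \<^bold>\<and> Len (Succ (Two \<^bold>* x)) \<^bold>= Succ (Len x),
    Len One \<^bold>= One,
    x \<^bold>\<le> y \<^bold>\<longrightarrow> Len x \<^bold>\<le> Len y,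
    Len (x \<^bold># y) \<^bold>= Succ (Len x \<^bold>* Len y),
    Zero \<^bold># y \<^bold>= One,
    \<^bold>\<not> x \<^bold>= Zero \<^bold>\<longrightarrow> One \<^bold># (Two \<^bold>* x) \<^bold>= Two \<^bold>* (One \<^bold># x) \<^bold>\<and> One \<^bold># Succ (Two \<^bold>* x) \<^bold>= Two \<^bold>* (One \<^bold># x),
    x \<^bold># y \<^bold>= y \<^bold># x,
    Len x \<^bold>= Len y \<^bold>\<longrightarrow> x \<^bold># z \<^bold>= y \<^bold># z,
    Len x \<^bold>= Len u \<^bold>+ Len v \<^bold>\<longrightarrow> x \<^bold># y \<^bold>= (u \<^bold># y) \<^bold>* (v \<^bold># y),
    x \<^bold>\<le> x \<^bold>+ y,
    x \<^bold>\<le> y \<^bold>\<and> \<^bold>\<not> x \<^bold>= y \<^bold>\<longrightarrow> Succ (Two \<^bold>* x) \<^bold>\<le> Two \<^bold>* y \<^bold>\<and> \<^bold>\<not> Succ (Two \<^bold>* x) \<^bold>= Two \<^bold>* y,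
    x \<^bold>+ y \<^bold>= y \<^bold>+ x,
    x \<^bold>+ Zero \<^bold>= x,
    x \<^bold>+ Succ y \<^bold>= Succ (x \<^bold>+ y),
    (x \<^bold>+ y) \<^bold>+ z \<^bold>= x \<^bold>+ (y \<^bold>+ z),
    x \<^bold>+ y \<^bold>\<le> x \<^bold>+ z \<^bold>\<longleftrightarrow> y \<^bold>\<le> z,
    x \<^bold>* Zero \<^bold>= Zero,
    x \<^bold>* Succ y \<^bold>= x \<^bold>* y \<^bold>+ x,
    x \<^bold>* y \<^bold>= y \<^bold>* x,
    x \<^bold>* (y \<^bold>+ z) \<^bold>= x \<^bold>* y \<^bold>+ x \<^bold>* z,
    One \<^bold>\<le> x \<^bold>\<longrightarrow> (x \<^bold>* y \<^bold>\<le> x \<^bold>* z \<^bold>\<longleftrightarrow> y \<^bold>\<le> z),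
    \<^bold>\<not> x \<^bold>= Zero \<^bold>\<longrightarrow> Len x \<^bold>= Succ (Len (Half x)),
    x \<^bold>= Half y \<^bold>\<longleftrightarrow> (Two \<^bold>* x \<^bold>= y \<^bold>\<or> Succ (Two \<^bold>* x) \<^bold>= y)})"

definition BForall :: "tm \<Rightarrow> fm \<Rightarrow> fm" where
  "BForall t A = Forall (Var 0 \<^bold>\<le> tlift t \<^bold>\<longrightarrow> A)"

definition BExists :: "tm \<Rightarrow> fm \<Rightarrow> fm" where
  "BExists t A = Exists (Var 0 \<^bold>\<le> tlift t \<^bold>\<and> A)"

inductive sharply_bounded :: "fm \<Rightarrow> bool" where
  "sharply_bounded (t \<^bold>= u)"
| "sharply_bounded (t \<^bold>\<le> u)"
| "sharply_bounded A \<Longrightarrow> sharply_bounded (\<^bold>\<not> A)"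
| "sharply_bounded A \<Longrightarrow> sharply_bounded B \<Longrightarrow> sharply_bounded (A \<^bold>\<and> B)"
| "sharply_bounded A \<Longrightarrow> sharply_bounded B \<Longrightarrow> sharply_bounded (A \<^bold>\<or> B)"
| "sharply_bounded A \<Longrightarrow> sharply_bounded B \<Longrightarrow> sharply_bounded (A \<^bold>\<longrightarrow> B)"
| "sharply_bounded A \<Longrightarrow> sharply_bounded (BForall (Len t) A)"
| "sharply_bounded A \<Longrightarrow> sharply_bounded (BExists (Len t) A)"

inductive Sigma_b :: "nat \<Rightarrow> fm \<Rightarrow> bool" and Pi_b :: "nat \<Rightarrow> fm \<Rightarrow> bool" where
  "sharply_bounded A \<Longrightarrow> Sigma_b 0 A"
| "sharply_bounded A \<Longrightarrow> Pi_b 0 A"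
| "Pi_b k A \<Longrightarrow> Sigma_b (Suc k) A"
| "Sigma_b (Suc k) A \<Longrightarrow> Sigma_b (Suc k) (BExists t A)"
| "Sigma_b (Suc k) A \<Longrightarrow> Sigma_b (Suc k) (BForall (Len t) A)"
| "Sigma_b (Suc k) A \<Longrightarrow> Sigma_b (Suc k) B \<Longrightarrow> Sigma_b (Suc k) (A \<^bold>\<and> B)"
| "Sigma_b (Suc k) A \<Longrightarrow> Sigma_b (Suc k) B \<Longrightarrow> Sigma_b (Suc k) (A \<^bold>\<or> B)"
| "Pi_b (Suc k) A \<Longrightarrow> Sigma_b (Suc k) (\<^bold>\<not> A)"
| "Pi_b (Suc k) A \<Longrightarrow> Sigma_b (Suc k) B \<Longrightarrow> Sigma_b (Suc k) (A \<^bold>\<longrightarrow> B)"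
| "Sigma_b k A \<Longrightarrow> Pi_b (Suc k) A"
| "Pi_b (Suc k) A \<Longrightarrow> Pi_b (Suc k) (BForall t A)"
| "Pi_b (Suc k) A \<Longrightarrow> Pi_b (Suc k) (BExists (Len t) A)"
| "Pi_b (Suc k) A \<Longrightarrow> Pi_b (Suc k) B \<Longrightarrow> Pi_b (Suc k) (A \<^bold>\<and> B)"
| "Pi_b (Suc k) A \<Longrightarrow> Pi_b (Suc k) B \<Longrightarrow> Pi_b (Suc k) (A \<^bold>\<or> B)"
| "Sigma_b (Suc k) A \<Longrightarrow> Pi_b (Suc k) (\<^bold>\<not> A)"
| "Sigma_b (Suc k) A \<Longrightarrow> Pi_b (Suc k) B \<Longrightarrow> Pi_b (Suc k) (A \<^bold>\<longrightarrow> B)"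

definition PIND :: "fm \<Rightarrow> fm" where
  "PIND A = (inst Zero A \<^bold>\<and> Forall (fsub (case_nat (Half (Var 0)) (\<lambda>n. Var (Suc n))) A \<^bold>\<longrightarrow> A)
             \<^bold>\<longrightarrow> Forall A)"

definition S2 :: "nat \<Rightarrow> fm set" where
  "S2 i = BASIC \<union> {PIND A |A. Sigma_b i A}"


section \<open>The equational theory PV without induction\<close>

text \<open>
  Function symbols are Cobham-style derivations. The constant \<open>Eps\<close> is the initial symbol of arity
  \<open>0\<close>, so that recursion without parameters is possible. As the axioms do not refer to the growth
  rate, recursion on notation carries no bounding function. The relation \<open>\<approx>\<close> of derivable equations
  is the reference for the arithmetization below; its defining equations are stated for the
  variables \<open>PVar 1, \<dots>, PVar n\<close> and the recursion variable \<open>PVar 0\<close>.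
\<close>

datatype fsym =
    Eps | Succ0 | Succ1 | Const nat | Proj nat nat
  | Comp fsym "fsym list" | Rec fsym fsym fsym

inductive arity :: "fsym \<Rightarrow> nat \<Rightarrow> bool" where
  "arity Eps 0"
| "arity Succ0 1"
| "arity Succ1 1"
| "1 \<le> n \<Longrightarrow> arity (Const n) n"
| "1 \<le> i \<Longrightarrow> i \<le> n \<Longrightarrow> arity (Proj i n) n"
| "hs \<noteq> [] \<Longrightarrow> arity g (length hs) \<Longrightarrow> \<forall>h \<in> set hs. arity h n \<Longrightarrow> arity (Comp g hs) n"
| "arity ge n \<Longrightarrow> arity g0 (n + 2) \<Longrightarrow> arity g1 (n + 2) \<Longrightarrow> arity (Rec ge g0 g1) (n + 1)"

datatype pvtm = PVar nat | App fsym "pvtm list"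

inductive wf_tm :: "pvtm \<Rightarrow> bool" where
  "wf_tm (PVar i)"
| "arity f (length ts) \<Longrightarrow> \<forall>t \<in> set ts. wf_tm t \<Longrightarrow> wf_tm (App f ts)"

primrec pvsub :: "nat \<Rightarrow> pvtm \<Rightarrow> pvtm \<Rightarrow> pvtm" where
  "pvsub i r (PVar j) = (if j = i then r else PVar j)"
| "pvsub i r (App f ts) = App f (map (pvsub i r) ts)"

definition pvars :: "nat \<Rightarrow> pvtm list" where
  "pvars n = map PVar [1..<Suc n]"

inductive PVm :: "pvtm \<Rightarrow> pvtm \<Rightarrow> bool"  (infix "\<approx>" 50) where
  "arity (Const n) n \<Longrightarrow> App (Const n) (pvars n) \<approx> App Eps []"
| "arity (Proj i n) n \<Longrightarrow> App (Proj i n) (pvars n) \<approx> PVar i"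
| "arity (Comp g hs) n \<Longrightarrow> App (Comp g hs) (pvars n) \<approx> App g (map (\<lambda>h. App h (pvars n)) hs)"
| "arity (Rec ge g0 g1) (n + 1) \<Longrightarrow> App (Rec ge g0 g1) (App Eps [] # pvars n) \<approx> App ge (pvars n)"
| "arity (Rec ge g0 g1) (n + 1) \<Longrightarrow> App (Rec ge g0 g1) (App Succ0 [PVar 0] # pvars n)
     \<approx> App g0 (PVar 0 # App (Rec ge g0 g1) (PVar 0 # pvars n) # pvars n)"
| "arity (Rec ge g0 g1) (n + 1) \<Longrightarrow> App (Rec ge g0 g1) (App Succ1 [PVar 0] # pvars n)
     \<approx> App g1 (PVar 0 # App (Rec ge g0 g1) (PVar 0 # pvars n) # pvars n)"
| "wf_tm t \<Longrightarrow> t \<approx> t"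
| "u \<approx> t \<Longrightarrow> t \<approx> u"
| "t \<approx> u \<Longrightarrow> u \<approx> r \<Longrightarrow> t \<approx> r"
| "arity f (length ts) \<Longrightarrow> list_all2 (\<approx>) ts us \<Longrightarrow> App f ts \<approx> App f us"
| "t \<approx> u \<Longrightarrow> wf_tm r \<Longrightarrow> pvsub i r t \<approx> pvsub i r u"


section \<open>Arithmetization\<close>

text \<open>
  Every number is a word over the alphabet of natural numbers: the letter \<open>k\<close> is the number
  \<open>2 ^ k\<close>, that is, \<open>1\<close> followed by \<open>k\<close> zeros, the empty word is \<open>0\<close>, and the concatenation of
  \<open>x\<close> and \<open>y\<close> is \<open>x * 2 ^ |y| + y\<close>, where \<open>2 ^ |y| = 1 # y\<close>. Since the binary numeral of a
  positive number starts with \<open>1\<close>, this makes the numbers the free monoid over the letters, and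
  the length of a numeral is linear in the number of symbols of the word.
\<close>

abbreviation (input) MARK :: nat where "MARK \<equiv> 0"
abbreviation (input) SEP :: nat where "SEP \<equiv> 1"
abbreviation (input) COMMA :: nat where "COMMA \<equiv> 2"
abbreviation (input) END :: nat where "END \<equiv> 3"
abbreviation (input) EPS :: nat where "EPS \<equiv> 4"
abbreviation (input) SUC0 :: nat where "SUC0 \<equiv> 5"
abbreviation (input) SUC1 :: nat where "SUC1 \<equiv> 6"
abbreviation (input) CNST :: nat where "CNST \<equiv> 7"
abbreviation (input) PROJ :: nat where "PROJ \<equiv> 8"
abbreviation (input) COMP :: nat where "COMP \<equiv> 9"
abbreviation (input) REC :: nat where "REC \<equiv> 10"
abbreviation (input) AX :: nat where "AX \<equiv> 11"
abbreviation (input) REFL :: nat where "REFL \<equiv> 12"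
abbreviation (input) SYM :: nat where "SYM \<equiv> 13"
abbreviation (input) TRANS :: nat where "TRANS \<equiv> 14"
abbreviation (input) CONG :: nat where "CONG \<equiv> 15"
abbreviation (input) SUBST :: nat where "SUBST \<equiv> 16"
abbreviation (input) FUN :: nat where "FUN \<equiv> 17"
abbreviation (input) FUNS :: nat where "FUNS \<equiv> 18"
abbreviation (input) TRM :: nat where "TRM \<equiv> 19"
abbreviation (input) TRMS :: nat where "TRMS \<equiv> 20"
abbreviation (input) VARS :: nat where "VARS \<equiv> 21"
abbreviation (input) APPS :: nat where "APPS \<equiv> 22"
abbreviation (input) SUB :: nat where "SUB \<equiv> 23"
abbreviation (input) SUBS :: nat where "SUBS \<equiv> 24"
abbreviation (input) PRF :: nat where "PRF \<equiv> 25"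
abbreviation (input) PRFS :: nat where "PRFS \<equiv> 26"
abbreviation (input) VAR :: nat where "VAR \<equiv> 27"

text \<open>
  The words for function symbols and terms, as lists of letters. The variable \<open>PVar i\<close> is the
  single letter \<open>VAR + i\<close>, arities are in unary, argument lists are closed by \<open>END\<close>.
\<close>

primrec fcode :: "fsym \<Rightarrow> nat list" where
  "fcode Eps = [EPS]"
| "fcode Succ0 = [SUC0]"
| "fcode Succ1 = [SUC1]"
| "fcode (Const n) = CNST # replicate n MARK @ [END]"
| "fcode (Proj i n) = PROJ # replicate i MARK @ [END] @ replicate n MARK @ [END]"
| "fcode (Comp g hs) = COMP # fcode g @ concat (map fcode hs) @ [END]"
| "fcode (Rec ge g0 g1) = REC # fcode ge @ fcode g0 @ fcode g1"

primrec tcode :: "pvtm \<Rightarrow> nat list" where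
  "tcode (PVar i) = [VAR + i]"
| "tcode (App f ts) = fcode f @ concat (map tcode ts) @ [END]"

text \<open>
  Arithmetical terms and formulas are written as functions of the number \<open>d\<close> of enclosing
  quantifiers. A quantifier at depth \<open>d\<close> binds the variable whose de Bruijn index at depth
  \<open>d' > d\<close> is \<open>d' - d - 1\<close>; with this the object-level variables can be bound by \<open>\<lambda>\<close>.
\<close>

type_synonym htm = "nat \<Rightarrow> tm"
type_synonym hfm = "nat \<Rightarrow> fm"

definition hvar :: "nat \<Rightarrow> htm" where "hvar d = (\<lambda>d'. Var (d' - Suc d))"

definition hEx :: "(htm \<Rightarrow> hfm) \<Rightarrow> hfm" where
  "hEx P = (\<lambda>d. Exists (P (hvar d) (Suc d)))"
definition bex :: "htm \<Rightarrow> (htm \<Rightarrow> hfm) \<Rightarrow> hfm" where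
  "bex b P = (\<lambda>d. BExists (b d) (P (hvar d) (Suc d)))"
definition ball :: "htm \<Rightarrow> (htm \<Rightarrow> hfm) \<Rightarrow> hfm" where
  "ball b P = (\<lambda>d. BForall (b d) (P (hvar d) (Suc d)))"

abbreviation "bex2 b P \<equiv> bex b (\<lambda>x. bex b (P x))"
abbreviation "bex3 b P \<equiv> bex b (\<lambda>x. bex2 b (P x))"
abbreviation "bex4 b P \<equiv> bex b (\<lambda>x. bex3 b (P x))"
abbreviation "bex5 b P \<equiv> bex b (\<lambda>x. bex4 b (P x))"
abbreviation "bex6 b P \<equiv> bex b (\<lambda>x. bex5 b (P x))"
abbreviation "bex7 b P \<equiv> bex b (\<lambda>x. bex6 b (P x))"
abbreviation "ball3 b P \<equiv> ball b (\<lambda>x. ball b (\<lambda>y. ball b (P x y)))"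

definition hEq :: "htm \<Rightarrow> htm \<Rightarrow> hfm"  (infix "\<doteq>" 50) where "(x \<doteq> y) = (\<lambda>d. x d \<^bold>= y d)"
definition hLeq :: "htm \<Rightarrow> htm \<Rightarrow> hfm"  (infix "\<preceq>" 50) where "(x \<preceq> y) = (\<lambda>d. x d \<^bold>\<le> y d)"
definition hNeg :: "hfm \<Rightarrow> hfm"  ("\<not>\<^sub>h _" [40] 40) where "(\<not>\<^sub>h F) = (\<lambda>d. \<^bold>\<not> F d)"
definition hAnd :: "hfm \<Rightarrow> hfm \<Rightarrow> hfm"  (infixr "\<and>\<^sub>h" 35) where "(F \<and>\<^sub>h G) = (\<lambda>d. F d \<^bold>\<and> G d)"
definition hOr :: "hfm \<Rightarrow> hfm \<Rightarrow> hfm"  (infixr "\<or>\<^sub>h" 30) where "(F \<or>\<^sub>h G) = (\<lambda>d. F d \<^bold>\<or> G d)"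
definition hImp :: "hfm \<Rightarrow> hfm \<Rightarrow> hfm"  (infixr "\<longrightarrow>\<^sub>h" 25) where "(F \<longrightarrow>\<^sub>h G) = (\<lambda>d. F d \<^bold>\<longrightarrow> G d)"

primrec letter :: "nat \<Rightarrow> tm" where
  "letter 0 = One"
| "letter (Suc k) = Two \<^bold>* letter k"

definition hletter :: "nat \<Rightarrow> htm"  ("\<langle>_\<rangle>") where "\<langle>k\<rangle> = (\<lambda>d. letter k)"
definition nil :: htm where "nil = (\<lambda>d. Zero)"
definition cat :: "htm \<Rightarrow> htm \<Rightarrow> htm"  (infixl "\<frown>" 65) where
  "x \<frown> y = (\<lambda>d. x d \<^bold>* (One \<^bold># y d) \<^bold>+ y d)"

text \<open>
  \<open>is_var x\<close>: \<open>x\<close> is one of the letters \<open>2 ^ (VAR + i)\<close>; note that \<open>1 # \<lfloor>x/2\<rfloor>\<close> is the largest power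
  of two below a positive \<open>x\<close>. \<open>unary N\<close>: \<open>N = 2 ^ n - 1\<close> is the word \<open>MARK \<dots> MARK\<close> of length
  \<open>n = |N|\<close>, which represents the number \<open>n\<close>. \<open>var I\<close> is the word of \<open>PVar i\<close> if \<open>I\<close> represents \<open>i\<close>.
\<close>

definition is_var :: "htm \<Rightarrow> hfm" where
  "is_var x = (x \<doteq> (\<lambda>d. One \<^bold># Half (x d)) \<and>\<^sub>h \<langle>VAR\<rangle> \<preceq> x)"
definition unary :: "htm \<Rightarrow> hfm" where
  "unary N = ((\<lambda>d. Succ (N d)) \<doteq> (\<lambda>d. One \<^bold># N d))"
definition var :: "htm \<Rightarrow> htm" where
  "var I = (\<lambda>d. letter VAR \<^bold>* (One \<^bold># I d))"

definition app :: "htm \<Rightarrow> htm \<Rightarrow> htm" where "app f T = f \<frown> T \<frown> \<langle>END\<rangle>"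
definition cConst :: "htm \<Rightarrow> htm" where "cConst N = \<langle>CNST\<rangle> \<frown> N \<frown> \<langle>END\<rangle>"
definition cProj :: "htm \<Rightarrow> htm \<Rightarrow> htm" where "cProj I N = \<langle>PROJ\<rangle> \<frown> I \<frown> \<langle>END\<rangle> \<frown> N \<frown> \<langle>END\<rangle>"
definition cComp :: "htm \<Rightarrow> htm \<Rightarrow> htm" where "cComp g H = \<langle>COMP\<rangle> \<frown> g \<frown> H \<frown> \<langle>END\<rangle>"
definition cRec :: "htm \<Rightarrow> htm \<Rightarrow> htm \<Rightarrow> htm" where "cRec ge g0 g1 = \<langle>REC\<rangle> \<frown> ge \<frown> g0 \<frown> g1"

text \<open>
  A derivation is coded as a tree: a node is its rule, the two sides of its conclusion and the
  codes of the derivations of the premises, in Polish notation. The syntactic notions are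
  arithmetized by formation sequences: a word \<open>SEP e SEP e \<dots> SEP\<close> whose entries are judgements,
  each of which follows from earlier ones. The judgements are, for words \<open>f, t, \<dots>\<close> and unary
  \<open>M, N\<close>:
  \<^item> \<open>FUN, f, N\<close>: \<open>f\<close> is a function symbol of arity \<open>N\<close>;
  \<^item> \<open>FUNS, H, M, N\<close>: \<open>H\<close> is a list of \<open>M\<close> function symbols of arity \<open>N\<close>;
  \<^item> \<open>TRM, t\<close>: \<open>t\<close> is a term; \<open>TRMS, T, N\<close>: \<open>T\<close> is a list of \<open>N\<close> terms;
  \<^item> \<open>VARS, X, N\<close>: \<open>X\<close> is the list of the variables with indices \<open>1, \<dots>, N\<close>;
  \<^item> \<open>APPS, H, X, A\<close>: \<open>A\<close> is the list of the terms \<open>h(X)\<close> for \<open>h\<close> in \<open>H\<close>;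
  \<^item> \<open>SUB, t, x, r, t'\<close>: \<open>t'\<close> is the result of replacing \<open>x\<close> by \<open>r\<close> in \<open>t\<close>; likewise \<open>SUBS\<close> for lists;
  \<^item> \<open>PRF, p, t, u\<close>: \<open>p\<close> is a derivation of \<open>t = u\<close>;
  \<^item> \<open>PRFS, P, T, U, N\<close>: \<open>P\<close> is a list of \<open>N\<close> derivations of the equations between \<open>T\<close> and \<open>U\<close>.
\<close>

definition judge :: "nat \<Rightarrow> htm list \<Rightarrow> htm" where
  "judge k ws = foldl (\<lambda>a w. a \<frown> \<langle>COMMA\<rangle> \<frown> w) \<langle>k\<rangle> ws"

definition no_sep :: "htm \<Rightarrow> hfm" where
  "no_sep e = (\<not>\<^sub>h bex2 e (\<lambda>a b. e \<doteq> a \<frown> \<langle>SEP\<rangle> \<frown> b))"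

definition entry :: "htm \<Rightarrow> htm \<Rightarrow> hfm" where
  "entry w e = (bex2 w (\<lambda>a b. w \<doteq> a \<frown> \<langle>SEP\<rangle> \<frown> e \<frown> \<langle>SEP\<rangle> \<frown> b) \<and>\<^sub>h no_sep e)"

definition step_fun :: "htm \<Rightarrow> htm \<Rightarrow> htm \<Rightarrow> hfm" where
  "step_fun b v e =
    (e \<doteq> judge FUN [\<langle>EPS\<rangle>, nil]
   \<or>\<^sub>h e \<doteq> judge FUN [\<langle>SUC0\<rangle>, \<langle>MARK\<rangle>]
   \<or>\<^sub>h e \<doteq> judge FUN [\<langle>SUC1\<rangle>, \<langle>MARK\<rangle>]
   \<or>\<^sub>h bex b (\<lambda>N. e \<doteq> judge FUN [cConst N, N] \<and>\<^sub>h unary N \<and>\<^sub>h \<langle>MARK\<rangle> \<preceq> N)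
   \<or>\<^sub>h bex2 b (\<lambda>I N. e \<doteq> judge FUN [cProj I N, N] \<and>\<^sub>h unary I \<and>\<^sub>h unary N \<and>\<^sub>h \<langle>MARK\<rangle> \<preceq> I \<and>\<^sub>h I \<preceq> N)
   \<or>\<^sub>h bex4 b (\<lambda>g H M N. e \<doteq> judge FUN [cComp g H, N] \<and>\<^sub>h \<langle>MARK\<rangle> \<preceq> M
        \<and>\<^sub>h entry v (judge FUN [g, M]) \<and>\<^sub>h entry v (judge FUNS [H, M, N]))
   \<or>\<^sub>h bex4 b (\<lambda>ge g0 g1 N. e \<doteq> judge FUN [cRec ge g0 g1, N \<frown> \<langle>MARK\<rangle>]
        \<and>\<^sub>h entry v (judge FUN [ge, N])
        \<and>\<^sub>h entry v (judge FUN [g0, N \<frown> \<langle>MARK\<rangle> \<frown> \<langle>MARK\<rangle>])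
        \<and>\<^sub>h entry v (judge FUN [g1, N \<frown> \<langle>MARK\<rangle> \<frown> \<langle>MARK\<rangle>]))
   \<or>\<^sub>h bex b (\<lambda>N. e \<doteq> judge FUNS [nil, nil, N] \<and>\<^sub>h unary N)
   \<or>\<^sub>h bex4 b (\<lambda>H M N h. e \<doteq> judge FUNS [H \<frown> h, M \<frown> \<langle>MARK\<rangle>, N]
        \<and>\<^sub>h entry v (judge FUNS [H, M, N]) \<and>\<^sub>h entry v (judge FUN [h, N])))"

definition step_term :: "htm \<Rightarrow> htm \<Rightarrow> htm \<Rightarrow> hfm" where
  "step_term b v e =
    (bex b (\<lambda>x. e \<doteq> judge TRM [x] \<and>\<^sub>h is_var x)
   \<or>\<^sub>h bex3 b (\<lambda>f T N. e \<doteq> judge TRM [app f T]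
        \<and>\<^sub>h entry v (judge FUN [f, N]) \<and>\<^sub>h entry v (judge TRMS [T, N]))
   \<or>\<^sub>h e \<doteq> judge TRMS [nil, nil]
   \<or>\<^sub>h bex3 b (\<lambda>T N t. e \<doteq> judge TRMS [T \<frown> t, N \<frown> \<langle>MARK\<rangle>]
        \<and>\<^sub>h entry v (judge TRMS [T, N]) \<and>\<^sub>h entry v (judge TRM [t]))
   \<or>\<^sub>h e \<doteq> judge VARS [nil, nil]
   \<or>\<^sub>h bex2 b (\<lambda>X N. e \<doteq> judge VARS [X \<frown> var (N \<frown> \<langle>MARK\<rangle>), N \<frown> \<langle>MARK\<rangle>]
        \<and>\<^sub>h entry v (judge VARS [X, N]))
   \<or>\<^sub>h bex2 b (\<lambda>X N. e \<doteq> judge APPS [nil, X, nil] \<and>\<^sub>h entry v (judge VARS [X, N]))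
   \<or>\<^sub>h bex5 b (\<lambda>H X A h N. e \<doteq> judge APPS [H \<frown> h, X, A \<frown> app h X]
        \<and>\<^sub>h entry v (judge APPS [H, X, A]) \<and>\<^sub>h entry v (judge FUN [h, N])))"

definition step_sub :: "htm \<Rightarrow> htm \<Rightarrow> htm \<Rightarrow> hfm" where
  "step_sub b v e =
    (bex2 b (\<lambda>x r. e \<doteq> judge SUB [x, x, r, r] \<and>\<^sub>h is_var x \<and>\<^sub>h entry v (judge TRM [r]))
   \<or>\<^sub>h bex3 b (\<lambda>y x r. e \<doteq> judge SUB [y, x, r, y] \<and>\<^sub>h is_var y \<and>\<^sub>h is_var x \<and>\<^sub>h (\<not>\<^sub>h y \<doteq> x)
        \<and>\<^sub>h entry v (judge TRM [r]))
   \<or>\<^sub>h bex6 b (\<lambda>f N T x r T'. e \<doteq> judge SUB [app f T, x, r, app f T']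
        \<and>\<^sub>h entry v (judge FUN [f, N]) \<and>\<^sub>h entry v (judge SUBS [T, x, r, T']))
   \<or>\<^sub>h bex2 b (\<lambda>x r. e \<doteq> judge SUBS [nil, x, r, nil] \<and>\<^sub>h is_var x \<and>\<^sub>h entry v (judge TRM [r]))
   \<or>\<^sub>h bex6 b (\<lambda>T x r T' t t'. e \<doteq> judge SUBS [T \<frown> t, x, r, T' \<frown> t']
        \<and>\<^sub>h entry v (judge SUBS [T, x, r, T']) \<and>\<^sub>h entry v (judge SUB [t, x, r, t'])))"

definition def_eq :: "htm \<Rightarrow> htm \<Rightarrow> htm \<Rightarrow> htm \<Rightarrow> hfm" where
  "def_eq b v t u =
    (bex2 b (\<lambda>N X. t \<doteq> app (cConst N) X \<and>\<^sub>h u \<doteq> app \<langle>EPS\<rangle> nil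
        \<and>\<^sub>h entry v (judge FUN [cConst N, N]) \<and>\<^sub>h entry v (judge VARS [X, N]))
   \<or>\<^sub>h bex3 b (\<lambda>I N X. t \<doteq> app (cProj I N) X \<and>\<^sub>h u \<doteq> var I \<and>\<^sub>h unary I
        \<and>\<^sub>h entry v (judge FUN [cProj I N, N]) \<and>\<^sub>h entry v (judge VARS [X, N]))
   \<or>\<^sub>h bex6 b (\<lambda>g H M N X A. t \<doteq> app (cComp g H) X \<and>\<^sub>h u \<doteq> app g A \<and>\<^sub>h \<langle>MARK\<rangle> \<preceq> M
        \<and>\<^sub>h entry v (judge FUN [g, M]) \<and>\<^sub>h entry v (judge FUNS [H, M, N])
        \<and>\<^sub>h entry v (judge VARS [X, N]) \<and>\<^sub>h entry v (judge APPS [H, X, A]))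
   \<or>\<^sub>h bex5 b (\<lambda>ge g0 g1 N X.
        ( (t \<doteq> app (cRec ge g0 g1) (app \<langle>EPS\<rangle> nil \<frown> X) \<and>\<^sub>h u \<doteq> app ge X)
        \<or>\<^sub>h (t \<doteq> app (cRec ge g0 g1) (app \<langle>SUC0\<rangle> (var nil) \<frown> X)
             \<and>\<^sub>h u \<doteq> app g0 (var nil \<frown> app (cRec ge g0 g1) (var nil \<frown> X) \<frown> X))
        \<or>\<^sub>h (t \<doteq> app (cRec ge g0 g1) (app \<langle>SUC1\<rangle> (var nil) \<frown> X)
             \<and>\<^sub>h u \<doteq> app g1 (var nil \<frown> app (cRec ge g0 g1) (var nil \<frown> X) \<frown> X)))
        \<and>\<^sub>h entry v (judge FUN [ge, N])
        \<and>\<^sub>h entry v (judge FUN [g0, N \<frown> \<langle>MARK\<rangle> \<frown> \<langle>MARK\<rangle>])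
        \<and>\<^sub>h entry v (judge FUN [g1, N \<frown> \<langle>MARK\<rangle> \<frown> \<langle>MARK\<rangle>])
        \<and>\<^sub>h entry v (judge VARS [X, N])))"

definition node :: "nat \<Rightarrow> htm \<Rightarrow> htm \<Rightarrow> htm \<Rightarrow> htm" where
  "node k t u P = \<langle>k\<rangle> \<frown> t \<frown> u \<frown> P"

definition step_prf :: "htm \<Rightarrow> htm \<Rightarrow> htm \<Rightarrow> hfm" where
  "step_prf b v e =
    (bex2 b (\<lambda>t u. e \<doteq> judge PRF [node AX t u nil, t, u] \<and>\<^sub>h def_eq b v t u)
   \<or>\<^sub>h bex b (\<lambda>t. e \<doteq> judge PRF [node REFL t t nil, t, t] \<and>\<^sub>h entry v (judge TRM [t]))
   \<or>\<^sub>h bex3 b (\<lambda>p t u. e \<doteq> judge PRF [node SYM t u p, t, u] \<and>\<^sub>h entry v (judge PRF [p, u, t]))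
   \<or>\<^sub>h bex5 b (\<lambda>p q t u r. e \<doteq> judge PRF [node TRANS t r (p \<frown> q), t, r]
        \<and>\<^sub>h entry v (judge PRF [p, t, u]) \<and>\<^sub>h entry v (judge PRF [q, u, r]))
   \<or>\<^sub>h bex5 b (\<lambda>P f N T U. e \<doteq> judge PRF [node CONG (app f T) (app f U) P, app f T, app f U]
        \<and>\<^sub>h entry v (judge FUN [f, N]) \<and>\<^sub>h entry v (judge PRFS [P, T, U, N]))
   \<or>\<^sub>h bex7 b (\<lambda>p t u x r t' u'. e \<doteq> judge PRF [node SUBST t' u' p, t', u']
        \<and>\<^sub>h entry v (judge PRF [p, t, u])
        \<and>\<^sub>h entry v (judge SUB [t, x, r, t']) \<and>\<^sub>h entry v (judge SUB [u, x, r, u']))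
   \<or>\<^sub>h e \<doteq> judge PRFS [nil, nil, nil, nil]
   \<or>\<^sub>h bex7 b (\<lambda>P T U N p t u. e \<doteq> judge PRFS [P \<frown> p, T \<frown> t, U \<frown> u, N \<frown> \<langle>MARK\<rangle>]
        \<and>\<^sub>h entry v (judge PRFS [P, T, U, N]) \<and>\<^sub>h entry v (judge PRF [p, t, u])))"

definition formation_seq :: "htm \<Rightarrow> hfm" where
  "formation_seq w = ball3 w (\<lambda>a e b.
     w \<doteq> a \<frown> \<langle>SEP\<rangle> \<frown> e \<frown> \<langle>SEP\<rangle> \<frown> b \<and>\<^sub>h no_sep e \<longrightarrow>\<^sub>h
     step_fun w (a \<frown> \<langle>SEP\<rangle>) e \<or>\<^sub>h step_term w (a \<frown> \<langle>SEP\<rangle>) e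
     \<or>\<^sub>h step_sub w (a \<frown> \<langle>SEP\<rangle>) e \<or>\<^sub>h step_prf w (a \<frown> \<langle>SEP\<rangle>) e)"

definition derivation :: "htm \<Rightarrow> htm \<Rightarrow> htm \<Rightarrow> hfm" where
  "derivation p t u = hEx (\<lambda>w. formation_seq w \<and>\<^sub>h entry w (judge PRF [p, t, u]))"

definition gnum :: "pvtm \<Rightarrow> htm" where
  "gnum t = foldl (\<lambda>a k. a \<frown> \<langle>k\<rangle>) nil (tcode t)"

definition Con_PVm :: fm where
  "Con_PVm = (\<not>\<^sub>h hEx (\<lambda>p. derivation p (gnum (App Eps [])) (gnum (App Succ1 [App Eps []])))) 0"

end

theory Submission
  imports Defs "HOL-Library.Countable_Set"
begin

text \<open>
  By completeness it suffices to prove the consistency statement in every model of \<open>S2 2\<close>; all arguments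
  inside the model are inductions on lengths for \<open>\<Pi>\<^sub>2\<close> predicates. Evaluations of the terms in a formation
  sequence \<open>W\<close> are recorded in tables. A value is a word over the letters of \<open>s\<^sub>0\<close>, \<open>s\<^sub>1\<close> and \<open>\<epsilon>\<close>; an entry only
  claims that a word is a prefix of the value, so that the empty word means that nothing is known. A call of
  a defined function is justified by an evaluation of the right hand side of its defining equation. A table
  is good if each entry is justified by other entries and calls with compatible arguments have compatible
  results. If \<open>p\<close> derives \<open>t = u\<close>, then a good table that evaluates \<open>t\<close> to \<open>w\<close> can be enlarged, by a number of
  entries linear in the length of \<open>p\<close> for fixed \<open>W\<close>, to a good table that evaluates \<open>u\<close> to \<open>w\<close>, and vice
  versa. For the substitution rule the variable \<open>x\<close> is assigned the longest value of \<open>r\<close> in the table, which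
  exists because coherence makes all of them comparable. As \<open>\<epsilon>\<close> evaluates to the word \<open>\<epsilon>\<close> and \<open>s\<^sub>1 \<epsilon>\<close> never does,
  \<open>\<epsilon> = s\<^sub>1 \<epsilon>\<close> has no derivation.
\<close>

section \<open>Henkin completeness of the natural-deduction calculus\<close>

section \<open>Completeness of the calculus\<close>

subsection \<open>Substitution\<close>

text \<open>Soundness cannot be argued by evaluating every term. The recursions carry no growth
  bounds, so bounded arithmetic cannot be expected to prove that each term has a value. A derivation
  is asked only to carry over evaluations that some table already contains, and a known prefix is
  enough for this because a defining equation by recursion inspects only the first letter of its
  recursion argument, unless that argument is empty. Justification inside a table is local and need
  not be well-founded: entries may support one another. What an induction along the stages of a
  computation would provide is imposed instead as the coherence of calls, and every added call has
  to be shown to respect it. Being a good table is a \<Sigma>1 condition, so "every good table has a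
  good enlargement" is \<Pi>2, which is exactly the complexity the induction permits. Derivations
  are coded as trees, so the lengths of the premises of a rule add up to less than the length of its
  code, and the numbers of added entries add up with them. This keeps all tables within one bound
  fixed in advance, polynomial in the length of the formation sequence.\<close>

lemma tsub_tsub: "tsub \<sigma> (tsub \<tau> t) = tsub (%n. tsub \<sigma> (\<tau> n)) t"
  by (induction t) auto

lemma tsub_Var [simp]: "tsub Var t = t"
  by (induction t) auto

lemma up_simps [simp]: "up \<sigma> 0 = Var 0" "up \<sigma> (Suc n) = tlift (\<sigma> n)"
  by (auto simp: up_def)

lemma up_comp: "(%n. tsub (up \<sigma>) (up \<tau> n)) = up (%n. tsub \<sigma> (\<tau> n))"
proof
  fix n show "tsub (up \<sigma>) (up \<tau> n) = up (%n. tsub \<sigma> (\<tau> n)) n"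
    by (cases n) (auto simp: tlift_def tsub_tsub)
qed

lemma fsub_fsub: "fsub \<sigma> (fsub \<tau> A) = fsub (%n. tsub \<sigma> (\<tau> n)) A"
  by (induction A arbitrary: \<sigma> \<tau>) (auto simp: tsub_tsub up_comp)

lemma up_Var [simp]: "up Var = Var"
proof
  fix n show "up Var n = Var n" by (cases n) (auto simp: tlift_def)
qed

lemma fsub_Var [simp]: "fsub Var A = A"
  by (induction A) auto

lemma inst_fsub_up: "inst t (fsub (up \<sigma>) A) = fsub (case_nat t \<sigma>) A"
proof -
  have "(%n. tsub (case_nat t Var) (up \<sigma> n)) = case_nat t \<sigma>"
  proof
    fix n show "tsub (case_nat t Var) (up \<sigma> n) = case_nat t \<sigma> n"
      by (cases n) (auto simp: tlift_def tsub_tsub)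
  qed
  then show ?thesis by (simp add: inst_def fsub_fsub)
qed

lemma fsub_inst: "fsub \<sigma> (inst t A) = inst (tsub \<sigma> t) (fsub (up \<sigma>) A)"
proof -
  have "(%n. tsub \<sigma> (case_nat t Var n)) = case_nat (tsub \<sigma> t) \<sigma>"
  proof
    fix n show "tsub \<sigma> (case_nat t Var n) = case_nat (tsub \<sigma> t) \<sigma> n"
      by (cases n) auto
  qed
  then show ?thesis by (simp add: inst_fsub_up) (simp add: inst_def fsub_fsub)
qed

lemma fsub_up_flift: "fsub (up \<sigma>) (flift A) = flift (fsub \<sigma> A)"
  by (simp add: flift_def fsub_fsub tlift_def)

primrec tbd :: "tm => nat" where
  "tbd (Var n) = Suc n"
| "tbd Zero = 0"
| "tbd (Succ t) = tbd t"
| "tbd (t \<^bold>+ u) = max (tbd t) (tbd u)"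
| "tbd (t \<^bold>* u) = max (tbd t) (tbd u)"
| "tbd (t \<^bold># u) = max (tbd t) (tbd u)"
| "tbd (Len t) = tbd t"
| "tbd (Half t) = tbd t"

primrec fbd :: "fm => nat" where
  "fbd (t \<^bold>= u) = max (tbd t) (tbd u)"
| "fbd (t \<^bold>\<le> u) = max (tbd t) (tbd u)"
| "fbd (\<^bold>\<not> A) = fbd A"
| "fbd (A \<^bold>\<and> B) = max (fbd A) (fbd B)"
| "fbd (A \<^bold>\<or> B) = max (fbd A) (fbd B)"
| "fbd (A \<^bold>\<longrightarrow> B) = max (fbd A) (fbd B)"
| "fbd (Forall A) = fbd A - 1"
| "fbd (Exists A) = fbd A - 1"

lemma tsub_cong: "(\<And>n. n < tbd t ==> \<sigma> n = \<tau> n) ==> tsub \<sigma> t = tsub \<tau> t"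
  by (induction t) auto

lemma fsub_cong: "(\<And>n. n < fbd A ==> \<sigma> n = \<tau> n) ==> fsub \<sigma> A = fsub \<tau> A"
proof (induction A arbitrary: \<sigma> \<tau>)
  case (Forall A)
  have "fsub (up \<sigma>) A = fsub (up \<tau>) A"
  proof (rule Forall.IH)
    fix n assume "n < fbd A" then show "up \<sigma> n = up \<tau> n"
      by (cases n) (auto simp: Forall.prems)
  qed
  then show ?case by simp
next
  case (Exists A)
  have "fsub (up \<sigma>) A = fsub (up \<tau>) A"
  proof (rule Exists.IH)
    fix n assume "n < fbd A" then show "up \<sigma> n = up \<tau> n"
      by (cases n) (auto simp: Exists.prems)
  qed
  then show ?case by simp
next
  case (Eq t u)
  then have "tsub \<sigma> t = tsub \<tau> t" "tsub \<sigma> u = tsub \<tau> u" by (auto intro!: tsub_cong)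
  then show ?case by simp
next
  case (Leq t u)
  then have "tsub \<sigma> t = tsub \<tau> t" "tsub \<sigma> u = tsub \<tau> u" by (auto intro!: tsub_cong)
  then show ?case by simp
next
  case (Neg A)
  have "fsub \<sigma> A = fsub \<tau> A" by (rule Neg.IH) (rule Neg.prems, simp)
  then show ?case by simp
next
  case (And A B)
  have "fsub \<sigma> A = fsub \<tau> A" "fsub \<sigma> B = fsub \<tau> B" by (rule And.IH; rule And.prems; simp)+
  then show ?case by simp
next
  case (Or A B)
  have "fsub \<sigma> A = fsub \<tau> A" "fsub \<sigma> B = fsub \<tau> B" by (rule Or.IH; rule Or.prems; simp)+
  then show ?case by simp
next
  case (Imp A B)
  have "fsub \<sigma> A = fsub \<tau> A" "fsub \<sigma> B = fsub \<tau> B" by (rule Imp.IH; rule Imp.prems; simp)+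
  then show ?case by simp
qed

text \<open>A formula provable in every context can be generalized, since lifting the context does
  no harm. Quantifying \<open>fbd A\<close> times gives a sentence, on which substitutions do
  nothing; the quantifiers are then instantiated one by one.\<close>

lemma axiom_instance:
  assumes "\<And>\<Gamma>. prov T \<Gamma> A"
  shows "prov T \<Gamma> (fsub \<sigma> A)"
  using assms
proof (induction "fbd A" arbitrary: A \<Gamma> \<sigma>)
  case 0
  then have "fsub \<sigma> A = fsub Var A" by (intro fsub_cong) auto
  then show ?case using 0 by simp
next
  case (Suc n)
  have "prov T \<Gamma> (fsub (%n. \<sigma> (Suc n)) (Forall A))"
    using Suc.hyps(2) by (intro Suc.hyps(1) ForallI Suc.prems) auto
  then have "prov T \<Gamma> (inst (\<sigma> 0) (fsub (up (%n. \<sigma> (Suc n))) A))"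
    by (auto intro: ForallE)
  moreover have "case_nat (\<sigma> 0) (%n. \<sigma> (Suc n)) = \<sigma>" by (auto split: nat.split)
  ultimately show ?case by (simp add: inst_fsub_up)
qed

lemma prov_fsub: "prov T \<Gamma> A ==> prov T (map (fsub \<sigma>) \<Gamma>) (fsub \<sigma> A)"
proof (induction arbitrary: \<sigma> rule: prov.induct)
  case (Axiom A \<Gamma>)
  then show ?case by (intro axiom_instance prov.Axiom)
next
  case (ForallI \<Gamma> A)
  have "prov T (map (fsub (up \<sigma>)) (map flift \<Gamma>)) (fsub (up \<sigma>) A)" by (rule ForallI.IH)
  then show ?case by (auto intro!: prov.ForallI simp: fsub_up_flift comp_def)
next
  case (ForallE \<Gamma> A t)
  then show ?case using prov.ForallE[of T "map (fsub \<sigma>) \<Gamma>" "fsub (up \<sigma>) A" "tsub \<sigma> t"]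
    by (simp add: fsub_inst)
next
  case (ExistsI \<Gamma> t A)
  then show ?case using prov.ExistsI[of T "map (fsub \<sigma>) \<Gamma>" "tsub \<sigma> t" "fsub (up \<sigma>) A"]
    by (simp add: fsub_inst)
next
  case (ExistsE \<Gamma> A B)
  have "prov T (map (fsub (up \<sigma>)) (A # map flift \<Gamma>)) (fsub (up \<sigma>) (flift B))"
    by (rule ExistsE.IH)
  then have "prov T (fsub (up \<sigma>) A # map flift (map (fsub \<sigma>) \<Gamma>)) (flift (fsub \<sigma> B))"
    by (simp add: fsub_up_flift comp_def)
  then show ?case using ExistsE.IH(1)[of \<sigma>] by (auto intro: prov.ExistsE)
next
  case (EqSub \<Gamma> t u A)
  then show ?case using prov.EqSub[of T "map (fsub \<sigma>) \<Gamma>" "tsub \<sigma> t" "tsub \<sigma> u" "fsub (up \<sigma>) A"]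
    by (simp add: fsub_inst)
next
  case (OrE \<Gamma> A B C)
  then show ?case
    using prov.OrE[of T "map (fsub \<sigma>) \<Gamma>" "fsub \<sigma> A" "fsub \<sigma> B" "fsub \<sigma> C"] by simp
next
  case (NegI A \<Gamma> B)
  then show ?case using prov.NegI[of T "fsub \<sigma> A" "map (fsub \<sigma>) \<Gamma>" "fsub \<sigma> B"] by simp
next
  case (Contr A \<Gamma> B)
  then show ?case using prov.Contr[of T "fsub \<sigma> A" "map (fsub \<sigma>) \<Gamma>" "fsub \<sigma> B"] by simp
qed (auto intro: prov.intros)

lemma prov_weaken: "prov T \<Gamma> A ==> set \<Gamma> \<subseteq> set \<Delta> ==> prov T \<Delta> A"
proof (induction arbitrary: \<Delta> rule: prov.induct)
  case (OrE \<Gamma> A B C)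
  have "prov T (A # \<Delta>) C" "prov T (B # \<Delta>) C" by (rule OrE.IH; use OrE.prems in auto)+
  then show ?case using OrE.IH(1)[OF OrE.prems] by (rule_tac prov.OrE)
next
  case (ImpI A \<Gamma> B)
  then show ?case by (auto intro!: prov.ImpI ImpI.IH)
next
  case (NegI A \<Gamma> B)
  have "prov T (A # \<Delta>) B" "prov T (A # \<Delta>) (\<^bold>\<not> B)" by (rule NegI.IH; use NegI.prems in auto)+
  then show ?case by (rule prov.NegI)
next
  case (Contr A \<Gamma> B)
  have "prov T ((\<^bold>\<not> A) # \<Delta>) B" "prov T ((\<^bold>\<not> A) # \<Delta>) (\<^bold>\<not> B)"
    by (rule Contr.IH; use Contr.prems in auto)+
  then show ?case by (rule prov.Contr)
next
  case (ExistsE \<Gamma> A B)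
  have "prov T (A # map flift \<Delta>) (flift B)" by (rule ExistsE.IH) (use ExistsE.prems in auto)
  then show ?case using ExistsE.IH(1)[OF ExistsE.prems] by (rule_tac prov.ExistsE)
next
  case (ForallI \<Gamma> A)
  have "prov T (map flift \<Delta>) A" by (rule ForallI.IH) (use ForallI.prems in auto)
  then show ?case by (rule prov.ForallI)
next
  case (EqSub \<Gamma> t u A)
  then show ?case by (meson prov.EqSub)
qed (auto intro: prov.intros)

section \<open>Consistent extensions with witnesses for existential formulas\<close>

subsection \<open>Maximal consistent sets\<close>

instance tm :: countable by countable_datatype
instance fm :: countable by countable_datatype

definition incons :: "fm set => fm list => bool" where
  "incons T \<Gamma> \<longleftrightarrow> (\<exists>A. prov T \<Gamma> A \<and> prov T \<Gamma> (\<^bold>\<not> A))"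

lemma incons_prov: "incons T \<Gamma> ==> prov T \<Gamma> B"
  unfolding incons_def by (meson Contr prov_weaken set_subset_Cons)

lemma incons_hyps: "A \<in> set \<Gamma> ==> (\<^bold>\<not> A) \<in> set \<Gamma> ==> prov T \<Gamma> B"
  using incons_prov Assm unfolding incons_def by blast

lemma incons_weaken: "incons T \<Gamma> ==> set \<Gamma> \<subseteq> set \<Delta> ==> incons T \<Delta>"
  unfolding incons_def using prov_weaken by blast

lemma prov_cut: "prov T (A # \<Gamma>) B ==> prov T \<Gamma> A ==> prov T \<Gamma> B"
  by (blast intro: ImpI ImpE)

text \<open>Renaming the fresh variable \<open>k\<close> to 0 and shifting all others turns the
  witnessed instance into \<open>C\<close> and the context into its lifting, which is the premise of
  \<open>ExistsE\<close>. Closed conclusions are unaffected by the renaming, and the closed formula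
  \<open>Zero = Zero\<close> with its negation already shows inconsistency.\<close>

lemma incons_witness:
  assumes "incons T (inst (Var k) C # \<Gamma>)" "Exists C \<in> set \<Gamma>" "fbd C \<le> Suc k" "\<And>A. A \<in> set \<Gamma> ==> fbd A \<le> k"
  shows "incons T \<Gamma>"
proof -
  define \<sigma> where "\<sigma> = (%n. if n = k then Var 0 else Var (Suc n))"
  have C: "fsub \<sigma> (inst (Var k) C) = C"
  proof -
    have "fsub (%n. tsub \<sigma> (case_nat (Var k) Var n)) C = fsub Var C"
    proof (rule fsub_cong)
      fix n assume "n < fbd C" then show "tsub \<sigma> (case_nat (Var k) Var n) = Var n"
        using assms(3) by (cases n) (auto simp: \<sigma>_def)
    qed
    then show ?thesis by (simp add: inst_def fsub_fsub)
  qed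
  have G: "fsub \<sigma> A = flift A" if "A \<in> set \<Gamma>" for A
    unfolding flift_def by (rule fsub_cong) (use assms(4)[OF that] in \<open>auto simp: \<sigma>_def\<close>)
  have "prov T (C # map flift \<Gamma>) (flift B)" if "fbd B = 0" for B
  proof -
    have "prov T (map (fsub \<sigma>) (inst (Var k) C # \<Gamma>)) (fsub \<sigma> B)"
      by (intro prov_fsub incons_prov assms(1))
    moreover have "fsub \<sigma> B = flift B" unfolding flift_def by (rule fsub_cong) (use that in auto)
    ultimately show ?thesis using C G by (simp cong: map_cong)
  qed
  from ExistsE[OF Assm[OF assms(2)] this] have "prov T \<Gamma> B" if "fbd B = 0" for B
    using that by blast
  then show ?thesis unfolding incons_def by (metis fbd.simps(1,3) max.idem tbd.simps(2))
qed

definition fresh :: "fm list => nat" where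
  "fresh \<Gamma> = Max (insert 0 (fbd ` set \<Gamma>)) + 1"

lemma fresh: "A \<in> set \<Gamma> ==> fbd A < fresh \<Gamma>"
  unfolding fresh_def by (simp add: less_Suc_eq_le)

text \<open>The witness enters together with its existential formula. Stages are finite lists, so a
  variable outside the whole context always exists.\<close>

definition henkin_step :: "fm set => fm list => fm => fm list" where
  "henkin_step T \<Gamma> A = (if incons T (A # \<Gamma>) then \<Gamma> else
     (case A of Exists C => inst (Var (fresh (A # \<Gamma>))) C # A # \<Gamma> | _ => A # \<Gamma>))"

primrec henkin :: "fm set => fm list => nat => fm list" where
  "henkin T \<Gamma> 0 = \<Gamma>"
| "henkin T \<Gamma> (Suc n) = henkin_step T (henkin T \<Gamma> n) (from_nat n)"

lemma henkin_step_consistent: "\<not> incons T \<Gamma> ==> \<not> incons T (henkin_step T \<Gamma> A)"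
proof (cases A)
  case (Exists C)
  assume "\<not> incons T \<Gamma>"
  have "incons T (A # \<Gamma>)" if "incons T (inst (Var (fresh (A # \<Gamma>))) C # A # \<Gamma>)"
  proof (rule incons_witness[OF that])
    show "fbd C \<le> Suc (fresh (A # \<Gamma>))" using fresh[of A "A # \<Gamma>"] Exists by auto
    show "fbd B \<le> fresh (A # \<Gamma>)" if "B \<in> set (A # \<Gamma>)" for B using fresh[OF that] by simp
  qed (use Exists in simp)
  then show ?thesis using \<open>\<not> incons T \<Gamma>\<close> Exists by (auto simp: henkin_step_def)
qed (auto simp: henkin_step_def)

lemma henkin_step_mono: "set \<Gamma> \<subseteq> set (henkin_step T \<Gamma> A)"
  by (auto simp: henkin_step_def split: fm.splits)

lemma henkin_consistent: "\<not> incons T \<Gamma> ==> \<not> incons T (henkin T \<Gamma> n)"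
  by (induction n) (auto simp: henkin_step_consistent)

lemma henkin_mono: "m \<le> n ==> set (henkin T \<Gamma> m) \<subseteq> set (henkin T \<Gamma> n)"
  by (rule lift_Suc_mono_le[of "%n. set (henkin T \<Gamma> n)"]) (auto simp: henkin_step_mono subsetD)

locale maximal_consistent =
  fixes T :: "fm set" and \<Gamma>0 :: "fm list" and S :: "fm set"
  assumes consistent: "\<not> incons T \<Gamma>0"
  defines "S \<equiv> \<Union>n. set (henkin T \<Gamma>0 n)"
begin

lemma finite_subset_S: "set \<Gamma> \<subseteq> S ==> \<exists>n. set \<Gamma> \<subseteq> set (henkin T \<Gamma>0 n)"
proof (induction \<Gamma>)
  case (Cons A \<Gamma>)
  then obtain n m where "set \<Gamma> \<subseteq> set (henkin T \<Gamma>0 n)" "A \<in> set (henkin T \<Gamma>0 m)"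
    by (auto simp: S_def)
  then have "set (A # \<Gamma>) \<subseteq> set (henkin T \<Gamma>0 (max n m))"
    using henkin_mono[of n "max n m" T \<Gamma>0] henkin_mono[of m "max n m" T \<Gamma>0] by auto
  then show ?case by blast
qed simp

lemma S_consistent: "set \<Gamma> \<subseteq> S ==> \<not> incons T \<Gamma>"
  using finite_subset_S henkin_consistent[OF consistent] incons_weaken by blast

text \<open>Each formula has its turn in the enumeration. It can have been rejected only because it
  was inconsistent with the stage reached by then, and that stage is contained in
  \<open>S\<close>.\<close>

lemma S_add: "A \<notin> S ==> \<exists>\<Gamma>. set \<Gamma> \<subseteq> S \<and> incons T (A # \<Gamma>)"
proof -
  assume "A \<notin> S"
  then have "A \<notin> set (henkin T \<Gamma>0 (Suc (to_nat A)))" unfolding S_def by blast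
  then have "incons T (A # henkin T \<Gamma>0 (to_nat A))"
    by (auto simp: henkin_step_def split: if_splits fm.splits)
  then show ?thesis unfolding S_def by blast
qed

lemma S_closed: "prov T \<Gamma> A ==> set \<Gamma> \<subseteq> S ==> A \<in> S"
proof (rule ccontr)
  assume *: "prov T \<Gamma> A" "set \<Gamma> \<subseteq> S" "A \<notin> S"
  then obtain \<Delta> where \<Delta>: "set \<Delta> \<subseteq> S" "incons T (A # \<Delta>)" using S_add by blast
  have "prov T (\<Gamma> @ \<Delta>) A" using *(1) by (rule prov_weaken) simp
  moreover have "incons T (A # \<Gamma> @ \<Delta>)" using \<Delta>(2) by (rule incons_weaken) auto
  ultimately have "incons T (\<Gamma> @ \<Delta>)" unfolding incons_def using prov_cut by blast
  then show False using S_consistent[of "\<Gamma> @ \<Delta>"] * \<Delta> by simp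
qed

lemma S_axiom: "A \<in> T ==> fsub \<sigma> A \<in> S"
  by (rule S_closed[of "[]"]) (auto intro: axiom_instance Axiom)

lemma S_Neg: "(\<^bold>\<not> A) \<in> S \<longleftrightarrow> A \<notin> S"
proof
  assume "(\<^bold>\<not> A) \<in> S"
  moreover have "incons T [A, \<^bold>\<not> A]" unfolding incons_def by (rule exI[of _ A]) (simp add: Assm)
  ultimately show "A \<notin> S" using S_consistent[of "[A, \<^bold>\<not> A]"] by auto
next
  assume "A \<notin> S"
  then obtain \<Delta> where "set \<Delta> \<subseteq> S" "incons T (A # \<Delta>)" using S_add by blast
  then show "(\<^bold>\<not> A) \<in> S" using S_closed NegI unfolding incons_def by blast
qed

lemma S_And: "(A \<^bold>\<and> B) \<in> S \<longleftrightarrow> A \<in> S \<and> B \<in> S"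
proof
  assume *: "(A \<^bold>\<and> B) \<in> S"
  have "prov T [A \<^bold>\<and> B] (A \<^bold>\<and> B)" by (rule Assm) simp
  from AndE1[OF this] AndE2[OF this] show "A \<in> S \<and> B \<in> S"
    using S_closed[of "[A \<^bold>\<and> B]"] * by (metis empty_iff empty_set set_ConsD subsetI)
next
  assume *: "A \<in> S \<and> B \<in> S"
  show "(A \<^bold>\<and> B) \<in> S"
    by (rule S_closed[OF AndI[OF Assm Assm], of _ "[A, B]"]) (use * in auto)
qed

lemma S_Or: "(A \<^bold>\<or> B) \<in> S \<longleftrightarrow> A \<in> S \<or> B \<in> S"
proof -
  have "prov T [A] (A \<^bold>\<or> B)" "prov T [B] (A \<^bold>\<or> B)" by (rule OrI1[OF Assm] OrI2[OF Assm]; simp)+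
  moreover have "prov T [A \<^bold>\<or> B, \<^bold>\<not> A] B"
  proof (rule OrE[of _ _ A B])
    show "prov T [A, A \<^bold>\<or> B, \<^bold>\<not> A] B" by (rule incons_hyps[of A]) auto
  qed (auto intro: Assm)
  ultimately show ?thesis using S_closed[of "[A]"] S_closed[of "[B]"] S_closed[of "[A \<^bold>\<or> B, \<^bold>\<not> A]"]
    by (auto simp: S_Neg)
qed

lemma S_Imp: "(A \<^bold>\<longrightarrow> B) \<in> S \<longleftrightarrow> (A \<in> S --> B \<in> S)"
proof -
  have "prov T [B] (A \<^bold>\<longrightarrow> B)" by (rule ImpI) (simp add: Assm)
  moreover have "prov T [\<^bold>\<not> A] (A \<^bold>\<longrightarrow> B)"
    by (rule ImpI, rule incons_hyps[of A]) auto
  moreover have "prov T [A \<^bold>\<longrightarrow> B, A] B" by (rule ImpE[of _ _ A]) (simp_all add: Assm)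
  ultimately show ?thesis using S_closed[of "[B]"] S_closed[of "[\<^bold>\<not> A]"] S_closed[of "[A \<^bold>\<longrightarrow> B, A]"]
    by (auto simp: S_Neg)
qed

lemma S_Exists: "Exists A \<in> S \<longleftrightarrow> (\<exists>t. inst t A \<in> S)"
proof
  assume "Exists A \<in> S"
  then obtain m where "Exists A \<in> set (henkin T \<Gamma>0 m)" unfolding S_def by blast
  define n where "n = to_nat (Exists A)"
  have "\<not> incons T (Exists A # henkin T \<Gamma>0 n)"
    using S_consistent[of "Exists A # henkin T \<Gamma>0 n"] \<open>Exists A \<in> S\<close> by (auto simp: S_def)
  then have "inst (Var (fresh (Exists A # henkin T \<Gamma>0 n))) A \<in> set (henkin T \<Gamma>0 (Suc n))"
    by (simp add: henkin_step_def n_def)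
  then show "\<exists>t. inst t A \<in> S" unfolding S_def by blast
next
  assume "\<exists>t. inst t A \<in> S"
  then obtain t where "inst t A \<in> S" by blast
  moreover have "prov T [inst t A] (Exists A)" by (rule ExistsI[OF Assm]) simp
  ultimately show "Exists A \<in> S" using S_closed[of "[inst t A]"] by simp
qed

lemma inst_Var0_lift: "inst (Var 0) (fsub (up (%n. Var (Suc n))) A) = A"
proof -
  have "case_nat (Var 0) (%n. Var (Suc n)) = Var" by (auto split: nat.split)
  then show ?thesis by (simp add: inst_fsub_up)
qed

lemma prov_not_Forall: "prov T [\<^bold>\<not> Forall A] (Exists (\<^bold>\<not> A))"
proof (rule Contr)
  let ?\<Gamma> = "[\<^bold>\<not> Exists (\<^bold>\<not> A), \<^bold>\<not> Forall A]"
  show "prov T ?\<Gamma> (Forall A)"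
  proof (rule ForallI, rule Contr)
    let ?\<Delta> = "(\<^bold>\<not> A) # map flift ?\<Gamma>"
    have "prov T ?\<Delta> (Exists (fsub (up (%n. Var (Suc n))) (\<^bold>\<not> A)))"
      using inst_Var0_lift[of "\<^bold>\<not> A"] by (intro ExistsI[of _ _ "Var 0"]) (simp add: Assm)
    then show "prov T ?\<Delta> (flift (Exists (\<^bold>\<not> A)))" by (simp add: flift_def)
    show "prov T ?\<Delta> (\<^bold>\<not> flift (Exists (\<^bold>\<not> A)))" by (rule Assm) (simp add: flift_def)
  qed
  show "prov T ?\<Gamma> (\<^bold>\<not> Forall A)" by (rule Assm) simp
qed

lemma S_Forall: "Forall A \<in> S \<longleftrightarrow> (\<forall>t. inst t A \<in> S)"
proof
  assume "Forall A \<in> S"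
  then show "\<forall>t. inst t A \<in> S" using S_closed[OF ForallE[OF Assm[of "Forall A" "[Forall A]"]]] by simp
next
  assume *: "\<forall>t. inst t A \<in> S"
  show "Forall A \<in> S"
  proof (rule ccontr)
    assume "Forall A \<notin> S"
    then have "Exists (\<^bold>\<not> A) \<in> S" using S_closed[OF prov_not_Forall[of A]] S_Neg by simp
    then obtain t where "inst t (\<^bold>\<not> A) \<in> S" using S_Exists by blast
    then show False using * S_Neg[of "inst t A"] by (simp add: inst_def)
  qed
qed

definition teq :: "tm => tm => bool" where "teq t u \<longleftrightarrow> (t \<^bold>= u) \<in> S"

lemma teq_refl: "teq t t"
  using S_closed[of "[]"] EqRefl by (simp add: teq_def)

lemma teq_replace: "teq t u ==> inst t A \<in> S ==> inst u A \<in> S"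
  using S_closed[of "[t \<^bold>= u, inst t A]"] EqSub[of T "[t \<^bold>= u, inst t A]" t u A]
  by (simp add: teq_def Assm)

lemma inst_tlift [simp]: "tsub (case_nat t Var) (tlift u) = u"
  by (simp add: tlift_def tsub_tsub)

lemma teq_sym: "teq t u ==> teq u t"
  using teq_replace[of t u "Var 0 \<^bold>= tlift t"] teq_refl[of t] by (simp add: inst_def teq_def)

lemma teq_trans: "teq t u ==> teq u r ==> teq t r"
  using teq_replace[of u r "tlift t \<^bold>= Var 0"] by (simp add: inst_def teq_def)

lemma teq_cong1:
  assumes "\<And>\<sigma> x. tsub \<sigma> (f x) = f (tsub \<sigma> x)" "teq t u"
  shows "teq (f t) (f u)"
  using teq_replace[of t u "tlift (f t) \<^bold>= f (Var 0)"] assms teq_refl[of "f t"]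
  by (simp add: inst_def teq_def del: inst_tlift) (simp add: tlift_def tsub_tsub)

lemma teq_cong2:
  assumes "\<And>\<sigma> x y. tsub \<sigma> (f x y) = f (tsub \<sigma> x) (tsub \<sigma> y)" "teq t t'" "teq u u'"
  shows "teq (f t u) (f t' u')"
proof -
  have "teq (f t u) (f t' u)"
    using teq_replace[of t t' "tlift (f t u) \<^bold>= f (Var 0) (tlift u)"] assms teq_refl[of "f t u"]
    by (simp add: inst_def teq_def del: inst_tlift) (simp add: tlift_def tsub_tsub)
  moreover have "teq (f t' u) (f t' u')"
    using teq_replace[of u u' "tlift (f t' u) \<^bold>= f (tlift t') (Var 0)"] assms teq_refl[of "f t' u"]
    by (simp add: inst_def teq_def del: inst_tlift) (simp add: tlift_def tsub_tsub)
  ultimately show ?thesis by (rule teq_trans)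
qed

lemma teq_Leq: "teq t t' ==> teq u u' ==> (t \<^bold>\<le> u) \<in> S ==> (t' \<^bold>\<le> u') \<in> S"
  using teq_replace[of t t' "Var 0 \<^bold>\<le> tlift u"] teq_replace[of u u' "tlift t' \<^bold>\<le> Var 0"]
  by (simp add: inst_def)

end

section \<open>Term models with the natural numbers as carrier\<close>

subsection \<open>Structures\<close>

record 'a struc =
  zr :: 'a
  sc :: "'a => 'a"
  ad :: "'a => 'a => 'a"
  mu :: "'a => 'a => 'a"
  sm :: "'a => 'a => 'a"
  ln :: "'a => 'a"
  hf :: "'a => 'a"
  lq :: "'a => 'a => bool"

primrec tval :: "'a struc => (nat => 'a) => tm => 'a" where
  "tval K s (Var n) = s n"
| "tval K s Zero = zr K"
| "tval K s (Succ t) = sc K (tval K s t)"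
| "tval K s (t \<^bold>+ u) = ad K (tval K s t) (tval K s u)"
| "tval K s (t \<^bold>* u) = mu K (tval K s t) (tval K s u)"
| "tval K s (t \<^bold># u) = sm K (tval K s t) (tval K s u)"
| "tval K s (Len t) = ln K (tval K s t)"
| "tval K s (Half t) = hf K (tval K s t)"

primrec holds :: "'a struc => (nat => 'a) => fm => bool" where
  "holds K s (t \<^bold>= u) \<longleftrightarrow> tval K s t = tval K s u"
| "holds K s (t \<^bold>\<le> u) \<longleftrightarrow> lq K (tval K s t) (tval K s u)"
| "holds K s (\<^bold>\<not> A) \<longleftrightarrow> \<not> holds K s A"
| "holds K s (A \<^bold>\<and> B) \<longleftrightarrow> holds K s A \<and> holds K s B"
| "holds K s (A \<^bold>\<or> B) \<longleftrightarrow> holds K s A \<or> holds K s B"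
| "holds K s (A \<^bold>\<longrightarrow> B) \<longleftrightarrow> (holds K s A --> holds K s B)"
| "holds K s (Forall A) \<longleftrightarrow> (\<forall>x. holds K (case_nat x s) A)"
| "holds K s (Exists A) \<longleftrightarrow> (\<exists>x. holds K (case_nat x s) A)"

definition model :: "fm set => 'a struc => bool" where
  "model T K \<longleftrightarrow> (\<forall>A \<in> T. \<forall>s. holds K s A)"

context maximal_consistent
begin

text \<open>The carrier is to be all of \<open>nat\<close>, so there must be infinitely many classes
  of provably equal terms. The order axioms of BASIC already separate the numerals.\<close>

lemma numerals_distinct:
  assumes "BASIC \<subseteq> T" "m < n"
  shows "\<not> teq ((Succ ^^ m) Zero) ((Succ ^^ n) Zero)"
proof -
  let ?L = "%t u. (t \<^bold>\<le> u) \<in> S"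
  have inst: "fsub \<sigma> A \<in> S" if "A \<in> BASIC" for A \<sigma> using S_axiom assms(1) that by blast
  have le_Succ: "?L t u ==> ?L t (Succ u)" for t u
    using inst[of "Var 1 \<^bold>\<le> Var 0 \<^bold>\<longrightarrow> Var 1 \<^bold>\<le> Succ (Var 0)" "case_nat u (%_. t)"]
    by (simp add: BASIC_def Let_def S_Imp)
  have refl: "?L t t" for t
    using inst[of "Var 1 \<^bold>\<le> Var 0 \<^bold>\<or> Var 0 \<^bold>\<le> Var 1" "%_. t"] by (simp add: BASIC_def Let_def S_Or)
  have Succ_le: "?L (Succ t) u ==> \<not> teq t u" for t u
    using inst[of "(Var 0 \<^bold>\<le> Var 1 \<^bold>\<and> \<^bold>\<not> Var 0 \<^bold>= Var 1) \<^bold>\<longleftrightarrow> Succ (Var 0) \<^bold>\<le> Var 1" "case_nat t (%_. u)"]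
    by (simp add: BASIC_def Let_def S_And S_Imp S_Neg teq_def)
  have "?L ((Succ ^^ Suc m) Zero) ((Succ ^^ (Suc m + k)) Zero)" for k
    by (induction k) (auto simp: refl intro: le_Succ)
  then have "?L ((Succ ^^ Suc m) Zero) ((Succ ^^ n) Zero)"
    using assms(2) by (metis Suc_leI le_add_diff_inverse)
  then show ?thesis using Succ_le by simp
qed

text \<open>Countably many terms fall into infinitely many classes, so the classes are in bijection
  with \<open>nat\<close>. This is why completeness can be stated for structures over one fixed
  type.\<close>

lemma term_naming:
  assumes "BASIC \<subseteq> T"
  obtains h :: "tm => nat" where "surj h" "\<And>t u. h t = h u \<longleftrightarrow> teq t u"
proof -
  define c where "c t = Collect (teq t)" for t
  have c: "c t = c u \<longleftrightarrow> teq t u" for t u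
    unfolding c_def using teq_refl teq_sym teq_trans by blast
  have "inj (%n. c ((Succ ^^ n) Zero))"
    using numerals_distinct[OF assms] teq_sym by (metis (lifting) c injI linorder_neqE_nat)
  then have "infinite (range c)"
    by (metis finite_subset image_subset_iff infinite_UNIV_nat range_inj_infinite rangeI)
  then have "bij_betw (to_nat_on (range c)) (range c) UNIV"
    by (intro to_nat_on_infinite countable_image) auto
  then have "surj (%t. to_nat_on (range c) (c t))" "inj_on (to_nat_on (range c)) (range c)"
    by (auto simp: bij_betw_def image_image)
  then show ?thesis using that[of "%t. to_nat_on (range c) (c t)"] c
    by (metis (no_types, lifting) inj_on_eq_iff rangeI)
qed

lemma term_model:
  assumes "BASIC \<subseteq> T"
  obtains K :: "nat struc" and s where "model T K" "\<And>A. A \<in> S ==> holds K s A"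
proof -
  obtain h :: "tm => nat" where h: "surj h" "\<And>t u. h t = h u \<longleftrightarrow> teq t u"
    using term_naming[OF assms] by blast
  \<comment> \<open>Representatives of the classes. The operations are defined through them and do
    not depend on the choice because \<open>teq\<close> is a congruence.\<close>
  define g where "g x = (SOME t. h t = x)" for x
  have hg [simp]: "h (g x) = x" for x
    unfolding g_def by (rule someI_ex) (metis h(1) surjD)
  have gh: "teq (g (h t)) t" for t by (simp flip: h(2))
  define K where "K = \<lparr>zr = h Zero, sc = (%x. h (Succ (g x))), ad = (%x y. h (g x \<^bold>+ g y)),
    mu = (%x y. h (g x \<^bold>* g y)), sm = (%x y. h (g x \<^bold># g y)), ln = (%x. h (Len (g x))),
    hf = (%x. h (Half (g x))), lq = (%x y. (g x \<^bold>\<le> g y) \<in> S)\<rparr>"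
  have tval: "tval K (%n. h (\<sigma> n)) t = h (tsub \<sigma> t)" for \<sigma> t
  proof (induction t)
    case (Succ t) then show ?case by (simp add: K_def h(2) teq_cong1[of Succ] gh)
  next
    case (Len t) then show ?case by (simp add: K_def h(2) teq_cong1[of Len] gh)
  next
    case (Half t) then show ?case by (simp add: K_def h(2) teq_cong1[of Half] gh)
  next
    case (Add t u) then show ?case by (simp add: K_def h(2) teq_cong2[of Add] gh)
  next
    case (Mult t u) then show ?case by (simp add: K_def h(2) teq_cong2[of Mult] gh)
  next
    case (Smash t u) then show ?case by (simp add: K_def h(2) teq_cong2[of Smash] gh)
  qed (simp_all add: K_def)
  have case_h: "case_nat (h t) (%n. h (\<sigma> n)) = (%n. h (case_nat t \<sigma> n))" for t \<sigma>
    by (auto split: nat.split)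
  have holds: "holds K (%n. h (\<sigma> n)) A \<longleftrightarrow> fsub \<sigma> A \<in> S" for \<sigma> A
  proof (induction A arbitrary: \<sigma>)
    case (Eq t u) show ?case by (simp add: tval h(2) teq_def)
  next
    case (Leq t u)
    have "(g (h t) \<^bold>\<le> g (h u)) \<in> S \<longleftrightarrow> (t \<^bold>\<le> u) \<in> S" for t u
      using teq_Leq[OF gh gh] teq_Leq[OF gh[THEN teq_sym] gh[THEN teq_sym]] by blast
    then show ?case by (simp add: tval) (simp add: K_def)
  next
    case (Forall A)
    have "(\<forall>x. holds K (case_nat x (%n. h (\<sigma> n))) A) \<longleftrightarrow> (\<forall>t. fsub (case_nat t \<sigma>) A \<in> S)"
    proof -
      have "holds K (case_nat (h t) (%n. h (\<sigma> n))) A \<longleftrightarrow> fsub (case_nat t \<sigma>) A \<in> S" for t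
        using Forall.IH[of "case_nat t \<sigma>"] by (simp add: case_h)
      then show ?thesis using hg by metis
    qed
    then show ?case by (simp add: S_Forall inst_fsub_up)
  next
    case (Exists A)
    have "(\<exists>x. holds K (case_nat x (%n. h (\<sigma> n))) A) \<longleftrightarrow> (\<exists>t. fsub (case_nat t \<sigma>) A \<in> S)"
    proof -
      have "holds K (case_nat (h t) (%n. h (\<sigma> n))) A \<longleftrightarrow> fsub (case_nat t \<sigma>) A \<in> S" for t
        using Exists.IH[of "case_nat t \<sigma>"] by (simp add: case_h)
      then show ?thesis using hg by metis
    qed
    then show ?case by (simp add: S_Exists inst_fsub_up)
  qed (auto simp: S_Neg S_And S_Or S_Imp)
  have "model T K"
    unfolding model_def
  proof (intro ballI allI)
    fix A s assume "A \<in> T"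
    then show "holds K s A" using holds[of "%n. g (s n)" A] S_axiom by simp
  qed
  moreover have "holds K (%n. h (Var n)) A" if "A \<in> S" for A using holds[of Var A] that by simp
  ultimately show ?thesis using that by blast
qed

end

theorem completeness:
  assumes "BASIC \<subseteq> T" "\<And>(K :: nat struc) s. model T K ==> holds K s B"
  shows "T \<turnstile> B"
proof (rule ccontr)
  assume "\<not> T \<turnstile> B"
  then have "\<not> incons T [\<^bold>\<not> B]" by (auto simp: provable_def incons_def intro: Contr)
  then interpret maximal_consistent T "[\<^bold>\<not> B]" "\<Union>n. set (henkin T [\<^bold>\<not> B] n)"
    by unfold_locales auto
  obtain K :: "nat struc" and s where K: "model T K" "\<And>A. A \<in> (\<Union>n. set (henkin T [\<^bold>\<not> B] n)) ==> holds K s A"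
    using term_model[OF assms(1)] by blast
  have "(\<^bold>\<not> B) \<in> (\<Union>n. set (henkin T [\<^bold>\<not> B] n))" using henkin.simps(1)[of T "[\<^bold>\<not> B]"] by (metis UN_I UNIV_I list.set_intros(1))
  then show False using K assms(2)[of K s] by fastforce
qed

section \<open>From an arbitrary model of the theory to a single type\<close>

section \<open>A model of bounded arithmetic as a type\<close>

subsection \<open>The standard model\<close>

lemma tval_tsub: "tval K s (tsub \<sigma> t) = tval K (%n. tval K s (\<sigma> n)) t"
  by (induction t) auto

lemma tval_tlift [simp]: "tval K (case_nat x s) (tlift t) = tval K s t"
  by (simp add: tlift_def tval_tsub)

lemma tval_up: "(%n. tval K (case_nat x s) (up \<sigma> n)) = case_nat x (%n. tval K s (\<sigma> n))"
proof
  fix n show "tval K (case_nat x s) (up \<sigma> n) = case_nat x (%n. tval K s (\<sigma> n)) n"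
    by (cases n) auto
qed

lemma holds_fsub: "holds K s (fsub \<sigma> A) = holds K (%n. tval K s (\<sigma> n)) A"
  by (induction A arbitrary: s \<sigma>) (auto simp: tval_tsub tval_up)

lemma holds_PIND: "holds K s (PIND A) \<longleftrightarrow>
  (holds K (case_nat (zr K) s) A \<and> (\<forall>x. holds K (case_nat (hf K x) s) A --> holds K (case_nat x s) A)
    --> (\<forall>x. holds K (case_nat x s) A))"
proof -
  have "(%n. tval K (case_nat x s) (case_nat (Half (Var 0)) (%n. Var (Suc n)) n)) = case_nat (hf K x) s" for x
    by (auto split: nat.split)
  moreover have "(%n. tval K s (case_nat Zero Var n)) = case_nat (zr K) s"
    by (auto split: nat.split)
  ultimately show ?thesis by (simp add: PIND_def inst_def holds_fsub)
qed

fun bits :: "nat => nat" where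
  "bits n = (if n = 0 then 0 else Suc (bits (n div 2)))"

declare bits.simps [simp del]

lemma bits_0 [simp]: "bits 0 = 0" by (simp add: bits.simps)
lemma bits_pos: "n > 0 ==> bits n = Suc (bits (n div 2))" by (subst bits.simps) simp
lemma bits_1 [simp]: "bits (Suc 0) = Suc 0" by (simp add: bits_pos)

lemma bits_mono: "m \<le> n ==> bits m \<le> bits n"
proof (induction m arbitrary: n rule: less_induct)
  case (less m)
  show ?case
  proof (cases "m = 0")
    case False
    then have "bits (m div 2) \<le> bits (n div 2)" using less by (intro less.IH) (auto intro: div_le_mono)
    then show ?thesis using False less.prems by (simp add: bits_pos)
  qed simp
qed

lemma bits_power [simp]: "bits (2 ^ k) = Suc k"
  by (induction k) (simp_all add: bits_pos)

definition std :: "nat struc" where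
  "std = \<lparr>zr = 0, sc = Suc, ad = (+), mu = (*), sm = (%x y. 2 ^ (bits x * bits y)), ln = bits,
    hf = (%x. x div 2), lq = (\<le>)\<rparr>"

lemma model_std: "model (S2 i) std"
  unfolding model_def
proof (intro ballI allI)
  fix A and s :: "nat => nat"
  assume "A \<in> S2 i"
  then consider "A \<in> BASIC" | B where "A = PIND B" by (auto simp: S2_def)
  then show "holds std s A"
  proof cases
    case 1
    have b2: "bits (2 * x) = Suc (bits x)" "bits (Suc (2 * x)) = Suc (bits x)" if "x > 0" for x
      using that by (simp_all add: bits_pos)
    have b3: "bits (x + x) = Suc (bits x)" "bits (Suc (x + x)) = Suc (bits x)" if "x > 0" for x
      using b2[OF that] by (simp_all add: mult_2)
    have half: "(x = y div 2) = (x + x = y \<or> Suc (x + x) = y)" for x y :: nat by auto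
    show ?thesis using 1
      unfolding BASIC_def Let_def
      by (elim insertE emptyE)
        (auto simp: std_def b2 b3 bits_mono bits_pos half power_add algebra_simps)
  next
    case (2 B)
    have "holds std (case_nat x s) B" if "holds std (case_nat 0 s) B"
      "\<forall>x. holds std (case_nat (x div 2) s) B --> holds std (case_nat x s) B" for x
    proof (induction x rule: less_induct)
      case (less x)
      show ?case
      proof (cases "x = 0")
        case False
        then have "holds std (case_nat (x div 2) s) B" by (intro less) simp
        then show ?thesis using that(2) by blast
      next
        case True
        show ?thesis unfolding True by (rule that(1))
      qed
    qed
    moreover have "zr std = 0" "hf std = (%x. x div 2)" by (simp_all add: std_def)
    ultimately show ?thesis unfolding 2 holds_PIND by metis
  qed
qed

subsection \<open>The type of numbers\<close>

text \<open>
  The type \<open>mm\<close> is a model of \<open>S2 2\<close> that refutes the consistency statement if there is such a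
  model at all; the standard model only serves to make this definition total.
\<close>

definition choice :: "nat struc" where
  "choice = (SOME K. model (S2 2) K \<and>
     ((\<exists>K' :: nat struc. model (S2 2) K' \<and> (\<exists>s. \<not> holds K' s Con_PVm)) --> (\<exists>s. \<not> holds K s Con_PVm)))"

lemma choice: "model (S2 2) choice"
  "\<exists>K' :: nat struc. model (S2 2) K' \<and> (\<exists>s. \<not> holds K' s Con_PVm) ==> \<exists>s. \<not> holds choice s Con_PVm"
proof -
  have "\<exists>K :: nat struc. model (S2 2) K \<and>
     ((\<exists>K' :: nat struc. model (S2 2) K' \<and> (\<exists>s. \<not> holds K' s Con_PVm)) --> (\<exists>s. \<not> holds K s Con_PVm))"
    using model_std by blast
  from someI_ex[OF this] show "model (S2 2) choice"
    "\<exists>K' :: nat struc. model (S2 2) K' \<and> (\<exists>s. \<not> holds K' s Con_PVm) ==> \<exists>s. \<not> holds choice s Con_PVm"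
    by (simp_all add: choice_def)
qed

text \<open>A copy of \<open>nat\<close> without its arithmetic, so that the usual symbols can
  denote the operations of the chosen model and the algebraic type classes can be instantiated for
  them.\<close>

typedef mm = "UNIV :: nat set" by simp

definition MM :: "mm struc" where
  "MM = \<lparr>zr = Abs_mm (zr choice), sc = (%x. Abs_mm (sc choice (Rep_mm x))),
    ad = (%x y. Abs_mm (ad choice (Rep_mm x) (Rep_mm y))),
    mu = (%x y. Abs_mm (mu choice (Rep_mm x) (Rep_mm y))),
    sm = (%x y. Abs_mm (sm choice (Rep_mm x) (Rep_mm y))),
    ln = (%x. Abs_mm (ln choice (Rep_mm x))), hf = (%x. Abs_mm (hf choice (Rep_mm x))),
    lq = (%x y. lq choice (Rep_mm x) (Rep_mm y))\<rparr>"

lemma Rep_Abs_mm [simp]: "Rep_mm (Abs_mm x) = x" by (simp add: Abs_mm_inverse)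

lemma tval_MM: "Rep_mm (tval MM s t) = tval choice (%n. Rep_mm (s n)) t"
  by (induction t) (auto simp: MM_def)

lemma holds_MM: "holds MM s A = holds choice (%n. Rep_mm (s n)) A"
proof (induction A arbitrary: s)
  case (Eq t u) show ?case by (simp add: Rep_mm_inject flip: tval_MM)
next
  case (Leq t u) show ?case by (simp add: MM_def flip: tval_MM)
next
  case (Forall A)
  have *: "(%n. Rep_mm (case_nat x s n)) = case_nat (Rep_mm x) (%n. Rep_mm (s n))" for x
    by (auto split: nat.split)
  show ?case by (simp add: Forall.IH *) (metis Rep_Abs_mm)
next
  case (Exists A)
  have *: "(%n. Rep_mm (case_nat x s n)) = case_nat (Rep_mm x) (%n. Rep_mm (s n))" for x
    by (auto split: nat.split)
  show ?case by (simp add: Exists.IH *) (metis Rep_Abs_mm)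
qed auto

lemma model_MM: "model (S2 2) MM"
  using choice(1) by (simp add: model_def holds_MM)

text \<open>By the choice of the structure, it refutes the statement if any model does. Truth in
  this one model is therefore truth in all of them, and completeness turns it into a proof.\<close>

lemma Con_if_MM:
  assumes "\<And>s. holds MM s Con_PVm"
  shows "S2 2 \<turnstile> Con_PVm"
proof (rule completeness)
  show "BASIC \<subseteq> S2 2" by (simp add: S2_def)
next
  fix K :: "nat struc" and s assume "model (S2 2) K"
  moreover have "holds choice s Con_PVm" for s
    using assms[of "%n. Abs_mm (s n)"] by (simp add: holds_MM)
  ultimately show "holds K s Con_PVm" using choice(2) by blast
qed

instantiation mm :: "{zero, one, plus, times, ord}"
begin
definition "0 = zr MM"
definition "1 = sc MM (zr MM)"
definition "x + y = ad MM x y"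
definition "x * y = mu MM x y"
definition "x \<le> y \<longleftrightarrow> lq MM x y"
definition "x < y \<longleftrightarrow> lq MM x y \<and> x \<noteq> (y :: mm)"
instance ..
end

definition smash :: "mm => mm => mm" where "smash = sm MM"
definition len :: "mm => mm" where "len = ln MM"
definition half :: "mm => mm" where "half = hf MM"
definition suc :: "mm => mm" where "suc = sc MM"

lemmas MM_simps = zero_mm_def[symmetric] plus_mm_def[symmetric] times_mm_def[symmetric]
  less_eq_mm_def[symmetric] smash_def[symmetric] len_def[symmetric] half_def[symmetric] suc_def[symmetric]

section \<open>The BASIC axioms as facts about the type \<open>mm\<close>\<close>

definition env4 :: "mm => mm => mm => mm => nat => mm" where
  "env4 x y z v n = (if n = 0 then x else if n = 1 then y else if n = 2 then z else v)"

lemma env4_simps: "env4 x y z v 0 = x" "env4 x y z v (Suc 0) = y" "env4 x y z v 2 = z" "env4 x y z v 3 = v"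
  by (auto simp: env4_def)

lemma basic: "A \<in> BASIC ==> holds MM s A"
  using model_MM by (auto simp: model_def S2_def)

context
  fixes x y z v :: mm
begin

lemma b_le_suc: "y \<le> x ==> y \<le> suc x"
proof -
  have "(Var 1 \<^bold>\<le> Var 0 \<^bold>\<longrightarrow> Var 1 \<^bold>\<le> Succ (Var 0)) \<in> BASIC" by (simp add: BASIC_def Let_def)
  from basic[OF this, of "env4 x y z v", unfolded holds.simps tval.simps One_nat_def env4_simps MM_simps]
  show "y \<le> x ==> y \<le> suc x" by blast
qed

lemma b_suc_neq: "x \<noteq> suc x"
proof -
  have "(\<^bold>\<not> Var 0 \<^bold>= Succ (Var 0)) \<in> BASIC" by (simp add: BASIC_def Let_def)
  from basic[OF this, of "env4 x y z v", unfolded holds.simps tval.simps One_nat_def env4_simps MM_simps]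
  show "x \<noteq> suc x" by blast
qed

lemma b_zero_le: "0 \<le> x"
proof -
  have "(Zero \<^bold>\<le> Var 0) \<in> BASIC" by (simp add: BASIC_def Let_def)
  from basic[OF this, of "env4 x y z v", unfolded holds.simps tval.simps One_nat_def env4_simps MM_simps]
  show "0 \<le> x" by blast
qed

lemma b_suc_le_iff: "suc x \<le> y \<longleftrightarrow> x \<le> y \<and> x \<noteq> y"
proof -
  have "((Var 0 \<^bold>\<le> Var 1 \<^bold>\<and> \<^bold>\<not> Var 0 \<^bold>= Var 1) \<^bold>\<longleftrightarrow> Succ (Var 0) \<^bold>\<le> Var 1) \<in> BASIC" by (simp add: BASIC_def Let_def)
  from basic[OF this, of "env4 x y z v", unfolded holds.simps tval.simps One_nat_def env4_simps MM_simps]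
  show "suc x \<le> y \<longleftrightarrow> x \<le> y \<and> x \<noteq> y" by argo
qed

lemma b_linear: "y \<le> x \<or> x \<le> y"
proof -
  have "(Var 1 \<^bold>\<le> Var 0 \<^bold>\<or> Var 0 \<^bold>\<le> Var 1) \<in> BASIC" by (simp add: BASIC_def Let_def)
  from basic[OF this, of "env4 x y z v", unfolded holds.simps tval.simps One_nat_def env4_simps MM_simps]
  show "y \<le> x \<or> x \<le> y" by blast
qed

lemma b_antisym: "x \<le> y ==> y \<le> x ==> x = y"
proof -
  have "(Var 0 \<^bold>\<le> Var 1 \<^bold>\<and> Var 1 \<^bold>\<le> Var 0 \<^bold>\<longrightarrow> Var 0 \<^bold>= Var 1) \<in> BASIC" by (simp add: BASIC_def Let_def)
  from basic[OF this, of "env4 x y z v", unfolded holds.simps tval.simps One_nat_def env4_simps MM_simps]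
  show "x \<le> y ==> y \<le> x ==> x = y" by blast
qed

lemma b_trans: "x \<le> y ==> y \<le> z ==> x \<le> z"
proof -
  have "(Var 0 \<^bold>\<le> Var 1 \<^bold>\<and> Var 1 \<^bold>\<le> Var 2 \<^bold>\<longrightarrow> Var 0 \<^bold>\<le> Var 2) \<in> BASIC" by (simp add: BASIC_def Let_def)
  from basic[OF this, of "env4 x y z v", unfolded holds.simps tval.simps One_nat_def env4_simps MM_simps]
  show "x \<le> y ==> y \<le> z ==> x \<le> z" by blast
qed

lemma b_len_0: "len 0 = 0"
proof -
  have "(Len Zero \<^bold>= Zero) \<in> BASIC" by (simp add: BASIC_def Let_def)
  from basic[OF this, of "env4 x y z v", unfolded holds.simps tval.simps One_nat_def env4_simps MM_simps]
  show "len 0 = 0" by blast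
qed

lemma b_len_1: "len (suc 0) = suc 0"
proof -
  have "(Len One \<^bold>= One) \<in> BASIC" by (simp add: BASIC_def Let_def)
  from basic[OF this, of "env4 x y z v", unfolded holds.simps tval.simps One_nat_def env4_simps MM_simps]
  show "len (suc 0) = suc 0" by blast
qed

lemma b_len_mono: "x \<le> y ==> len x \<le> len y"
proof -
  have "(Var 0 \<^bold>\<le> Var 1 \<^bold>\<longrightarrow> Len (Var 0) \<^bold>\<le> Len (Var 1)) \<in> BASIC" by (simp add: BASIC_def Let_def)
  from basic[OF this, of "env4 x y z v", unfolded holds.simps tval.simps One_nat_def env4_simps MM_simps]
  show "x \<le> y ==> len x \<le> len y" by blast
qed

lemma b_len_smash: "len (smash x y) = suc (len x * len y)"
proof -
  have "(Len (Var 0 \<^bold># Var 1) \<^bold>= Succ (Len (Var 0) \<^bold>* Len (Var 1))) \<in> BASIC" by (simp add: BASIC_def Let_def)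
  from basic[OF this, of "env4 x y z v", unfolded holds.simps tval.simps One_nat_def env4_simps MM_simps]
  show "len (smash x y) = suc (len x * len y)" by blast
qed

lemma b_smash_0: "smash 0 y = suc 0"
proof -
  have "(Zero \<^bold># Var 1 \<^bold>= One) \<in> BASIC" by (simp add: BASIC_def Let_def)
  from basic[OF this, of "env4 x y z v", unfolded holds.simps tval.simps One_nat_def env4_simps MM_simps]
  show "smash 0 y = suc 0" by blast
qed

lemma b_smash_1: "x \<noteq> 0 ==> smash (suc 0) (suc (suc 0) * x) = suc (suc 0) * smash (suc 0) x \<and> smash (suc 0) (suc (suc (suc 0) * x)) = suc (suc 0) * smash (suc 0) x"
proof -
  have "(\<^bold>\<not> Var 0 \<^bold>= Zero \<^bold>\<longrightarrow> One \<^bold># (Two \<^bold>* Var 0) \<^bold>= Two \<^bold>* (One \<^bold># Var 0) \<^bold>\<and> One \<^bold># Succ (Two \<^bold>* Var 0) \<^bold>= Two \<^bold>* (One \<^bold># Var 0)) \<in> BASIC" by (simp add: BASIC_def Let_def)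
  from basic[OF this, of "env4 x y z v", unfolded holds.simps tval.simps One_nat_def env4_simps MM_simps]
  show "x \<noteq> 0 ==> smash (suc 0) (suc (suc 0) * x) = suc (suc 0) * smash (suc 0) x \<and> smash (suc 0) (suc (suc (suc 0) * x)) = suc (suc 0) * smash (suc 0) x" by blast
qed

lemma b_smash_commute: "smash x y = smash y x"
proof -
  have "(Var 0 \<^bold># Var 1 \<^bold>= Var 1 \<^bold># Var 0) \<in> BASIC" by (simp add: BASIC_def Let_def)
  from basic[OF this, of "env4 x y z v", unfolded holds.simps tval.simps One_nat_def env4_simps MM_simps]
  show "smash x y = smash y x" by blast
qed

lemma b_smash_cong: "len x = len y ==> smash x z = smash y z"
proof -
  have "(Len (Var 0) \<^bold>= Len (Var 1) \<^bold>\<longrightarrow> Var 0 \<^bold># Var 2 \<^bold>= Var 1 \<^bold># Var 2) \<in> BASIC" by (simp add: BASIC_def Let_def)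
  from basic[OF this, of "env4 x y z v", unfolded holds.simps tval.simps One_nat_def env4_simps MM_simps]
  show "len x = len y ==> smash x z = smash y z" by blast
qed

lemma b_smash_add: "len x = len z + len v ==> smash x y = smash z y * smash v y"
proof -
  have "(Len (Var 0) \<^bold>= Len (Var 2) \<^bold>+ Len (Var 3) \<^bold>\<longrightarrow> Var 0 \<^bold># Var 1 \<^bold>= (Var 2 \<^bold># Var 1) \<^bold>* (Var 3 \<^bold># Var 1)) \<in> BASIC" by (simp add: BASIC_def Let_def)
  from basic[OF this, of "env4 x y z v", unfolded holds.simps tval.simps One_nat_def env4_simps MM_simps]
  show "len x = len z + len v ==> smash x y = smash z y * smash v y" by blast
qed

lemma b_le_add: "x \<le> x + y"
proof -
  have "(Var 0 \<^bold>\<le> Var 0 \<^bold>+ Var 1) \<in> BASIC" by (simp add: BASIC_def Let_def)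
  from basic[OF this, of "env4 x y z v", unfolded holds.simps tval.simps One_nat_def env4_simps MM_simps]
  show "x \<le> x + y" by blast
qed

lemma b_add_commute: "x + y = y + x"
proof -
  have "(Var 0 \<^bold>+ Var 1 \<^bold>= Var 1 \<^bold>+ Var 0) \<in> BASIC" by (simp add: BASIC_def Let_def)
  from basic[OF this, of "env4 x y z v", unfolded holds.simps tval.simps One_nat_def env4_simps MM_simps]
  show "x + y = y + x" by blast
qed

lemma b_add_0: "x + 0 = x"
proof -
  have "(Var 0 \<^bold>+ Zero \<^bold>= Var 0) \<in> BASIC" by (simp add: BASIC_def Let_def)
  from basic[OF this, of "env4 x y z v", unfolded holds.simps tval.simps One_nat_def env4_simps MM_simps]
  show "x + 0 = x" by blast
qed

lemma b_add_suc: "x + suc y = suc (x + y)"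
proof -
  have "(Var 0 \<^bold>+ Succ (Var 1) \<^bold>= Succ (Var 0 \<^bold>+ Var 1)) \<in> BASIC" by (simp add: BASIC_def Let_def)
  from basic[OF this, of "env4 x y z v", unfolded holds.simps tval.simps One_nat_def env4_simps MM_simps]
  show "x + suc y = suc (x + y)" by blast
qed

lemma b_add_assoc: "(x + y) + z = x + (y + z)"
proof -
  have "((Var 0 \<^bold>+ Var 1) \<^bold>+ Var 2 \<^bold>= Var 0 \<^bold>+ (Var 1 \<^bold>+ Var 2)) \<in> BASIC" by (simp add: BASIC_def Let_def)
  from basic[OF this, of "env4 x y z v", unfolded holds.simps tval.simps One_nat_def env4_simps MM_simps]
  show "(x + y) + z = x + (y + z)" by blast
qed

lemma b_add_le: "x + y \<le> x + z \<longleftrightarrow> y \<le> z"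
proof -
  have "(Var 0 \<^bold>+ Var 1 \<^bold>\<le> Var 0 \<^bold>+ Var 2 \<^bold>\<longleftrightarrow> Var 1 \<^bold>\<le> Var 2) \<in> BASIC" by (simp add: BASIC_def Let_def)
  from basic[OF this, of "env4 x y z v", unfolded holds.simps tval.simps One_nat_def env4_simps MM_simps]
  show "x + y \<le> x + z \<longleftrightarrow> y \<le> z" by blast
qed

lemma b_mult_0: "x * 0 = 0"
proof -
  have "(Var 0 \<^bold>* Zero \<^bold>= Zero) \<in> BASIC" by (simp add: BASIC_def Let_def)
  from basic[OF this, of "env4 x y z v", unfolded holds.simps tval.simps One_nat_def env4_simps MM_simps]
  show "x * 0 = 0" by blast
qed

lemma b_mult_suc: "x * suc y = x * y + x"
proof -
  have "(Var 0 \<^bold>* Succ (Var 1) \<^bold>= Var 0 \<^bold>* Var 1 \<^bold>+ Var 0) \<in> BASIC" by (simp add: BASIC_def Let_def)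
  from basic[OF this, of "env4 x y z v", unfolded holds.simps tval.simps One_nat_def env4_simps MM_simps]
  show "x * suc y = x * y + x" by blast
qed

lemma b_mult_commute: "x * y = y * x"
proof -
  have "(Var 0 \<^bold>* Var 1 \<^bold>= Var 1 \<^bold>* Var 0) \<in> BASIC" by (simp add: BASIC_def Let_def)
  from basic[OF this, of "env4 x y z v", unfolded holds.simps tval.simps One_nat_def env4_simps MM_simps]
  show "x * y = y * x" by blast
qed

lemma b_distrib: "x * (y + z) = x * y + x * z"
proof -
  have "(Var 0 \<^bold>* (Var 1 \<^bold>+ Var 2) \<^bold>= Var 0 \<^bold>* Var 1 \<^bold>+ Var 0 \<^bold>* Var 2) \<in> BASIC" by (simp add: BASIC_def Let_def)
  from basic[OF this, of "env4 x y z v", unfolded holds.simps tval.simps One_nat_def env4_simps MM_simps]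
  show "x * (y + z) = x * y + x * z" by blast
qed

lemma b_mult_le: "suc 0 \<le> x ==> x * y \<le> x * z \<longleftrightarrow> y \<le> z"
proof -
  have "(One \<^bold>\<le> Var 0 \<^bold>\<longrightarrow> (Var 0 \<^bold>* Var 1 \<^bold>\<le> Var 0 \<^bold>* Var 2 \<^bold>\<longleftrightarrow> Var 1 \<^bold>\<le> Var 2)) \<in> BASIC" by (simp add: BASIC_def Let_def)
  from basic[OF this, of "env4 x y z v", unfolded holds.simps tval.simps One_nat_def env4_simps MM_simps]
  show "suc 0 \<le> x ==> x * y \<le> x * z \<longleftrightarrow> y \<le> z" by blast
qed

lemma b_len_half: "x \<noteq> 0 ==> len x = suc (len (half x))"
proof -
  have "(\<^bold>\<not> Var 0 \<^bold>= Zero \<^bold>\<longrightarrow> Len (Var 0) \<^bold>= Succ (Len (Half (Var 0)))) \<in> BASIC" by (simp add: BASIC_def Let_def)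
  from basic[OF this, of "env4 x y z v", unfolded holds.simps tval.simps One_nat_def env4_simps MM_simps]
  show "x \<noteq> 0 ==> len x = suc (len (half x))" by blast
qed

lemma b_half_iff: "x = half y \<longleftrightarrow> suc (suc 0) * x = y \<or> suc (suc (suc 0) * x) = y"
proof -
  have "(Var 0 \<^bold>= Half (Var 1) \<^bold>\<longleftrightarrow> (Two \<^bold>* Var 0 \<^bold>= Var 1 \<^bold>\<or> Succ (Two \<^bold>* Var 0) \<^bold>= Var 1)) \<in> BASIC" by (simp add: BASIC_def Let_def)
  from basic[OF this, of "env4 x y z v", unfolded holds.simps tval.simps One_nat_def env4_simps MM_simps]
  show "x = half y \<longleftrightarrow> suc (suc 0) * x = y \<or> suc (suc (suc 0) * x) = y" by blast
qed

end

section \<open>Predicates definable with parameters in the bounded hierarchy\<close>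

section \<open>Definable predicates\<close>

lemma fsub_BExists: "fsub \<sigma> (BExists t A) = BExists (tsub \<sigma> t) (fsub (up \<sigma>) A)"
  and fsub_BForall: "fsub \<sigma> (BForall t A) = BForall (tsub \<sigma> t) (fsub (up \<sigma>) A)"
  by (simp_all add: BExists_def BForall_def tlift_def tsub_tsub)

lemma sharply_bounded_fsub: "sharply_bounded A ==> sharply_bounded (fsub \<sigma> A)"
  by (induction arbitrary: \<sigma> rule: sharply_bounded.induct)
    (auto simp: fsub_BExists fsub_BForall intro: sharply_bounded.intros)

lemma Sigma_Pi_fsub:
  "Sigma_b k A ==> Sigma_b k (fsub \<sigma> A)" "Pi_b k B ==> Pi_b k (fsub \<sigma> B)"
  by (induction arbitrary: \<sigma> and \<sigma> rule: Sigma_b_Pi_b.inducts)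
    (auto simp: fsub_BExists fsub_BForall intro: Sigma_b_Pi_b.intros sharply_bounded_fsub)

lemma Sigma_Pi_mono: "Sigma_b k A ==> Sigma_b (Suc k) A" "Pi_b k B ==> Pi_b (Suc k) B"
  by (induction rule: Sigma_b_Pi_b.inducts) (auto intro: Sigma_b_Pi_b.intros)

text \<open>
  A predicate on environments is definable if it is given by a formula whose free variables are
  components of the environment or parameters from the model.
\<close>

type_synonym env = "nat => mm"

definition sel :: "(env => env) => bool" where
  "sel f \<longleftrightarrow> (\<forall>n. (\<exists>i. \<forall>s. f s n = s i) \<or> (\<exists>c. \<forall>s. f s n = c))"

definition Tm :: "(env => mm) => bool" where
  "Tm g \<longleftrightarrow> (\<exists>t f. sel f \<and> (\<forall>s. g s = tval MM (f s) t))"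

definition Sg :: "nat => (env => bool) => bool" where
  "Sg k P \<longleftrightarrow> (\<exists>A f. Sigma_b k A \<and> sel f \<and> (\<forall>s. P s = holds MM (f s) A))"

definition Pg :: "nat => (env => bool) => bool" where
  "Pg k P \<longleftrightarrow> (\<exists>A f. Pi_b k A \<and> sel f \<and> (\<forall>s. P s = holds MM (f s) A))"

text \<open>Two formulas with their own environments are combined by interleaving: the variables of
  one become even, those of the other odd. Parameters never have to be matched.\<close>

definition mix :: "(env => env) => (env => env) => env => env" where
  "mix f g s n = (if even n then f s (n div 2) else g s (n div 2))"

lemma sel_mix: "sel f ==> sel g ==> sel (mix f g)"
  unfolding sel_def mix_def by (metis (full_types))

lemma mix_simps [simp]: "mix f g s (2 * n) = f s n" "mix f g s (Suc (2 * n)) = g s n"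
  by (simp_all add: mix_def)

lemma tval_mix:
  "tval MM (mix f g s) (tsub (%n. Var (2 * n)) t) = tval MM (f s) t"
  "tval MM (mix f g s) (tsub (%n. Var (Suc (2 * n))) t) = tval MM (g s) t"
  by (simp_all add: tval_tsub)

lemma holds_mix:
  "holds MM (mix f g s) (fsub (%n. Var (2 * n)) A) = holds MM (f s) A"
  "holds MM (mix f g s) (fsub (%n. Var (Suc (2 * n))) A) = holds MM (g s) A"
  by (simp_all add: holds_fsub)

lemma sel_id: "sel (%s. s)" by (auto simp: sel_def)
lemma sel_const: "sel (%s n. c)" by (auto simp: sel_def)
lemma sel_reindex: "sel f ==> sel (%s. f (%n. s (r n)))"
  unfolding sel_def by metis

lemma Tm_var: "Tm (%s. s i)"
  unfolding Tm_def by (rule exI[of _ "Var i"]) (use sel_id in auto)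

lemma Tm_const: "Tm (%s. c)"
  unfolding Tm_def by (rule exI[of _ "Var 0"]) (use sel_const[of c] in auto)

lemma Tm_unary:
  assumes "Tm g" "\<And>s t. tval MM s (F t) = f (tval MM s t)"
  shows "Tm (%s. f (g s))"
  using assms unfolding Tm_def by metis

lemma Tm_binary:
  assumes "Tm g" "Tm h" "\<And>s t u. tval MM s (F t u) = f (tval MM s t) (tval MM s u)"
  shows "Tm (%s. f (g s) (h s))"
proof -
  from assms obtain t u a b where *: "sel a" "sel b" "\<And>s. g s = tval MM (a s) t" "\<And>s. h s = tval MM (b s) u"
    unfolding Tm_def by metis
  show ?thesis unfolding Tm_def
    by (rule exI[of _ "F (tsub (%n. Var (2 * n)) t) (tsub (%n. Var (Suc (2 * n))) u)"], rule exI[of _ "mix a b"])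
      (simp add: assms(3) tval_mix * sel_mix)
qed

lemma Tm_len: "Tm g ==> Tm (%s. len (g s))" by (rule Tm_unary[of _ Len]) (simp_all add: MM_simps)
lemma Tm_half: "Tm g ==> Tm (%s. half (g s))" by (rule Tm_unary[of _ Half]) (simp_all add: MM_simps)
lemma Tm_plus: "Tm g ==> Tm h ==> Tm (%s. g s + h s)"
  by (rule Tm_binary[of _ _ Add]) (simp_all add: MM_simps)
lemma Tm_times: "Tm g ==> Tm h ==> Tm (%s. g s * h s)"
  by (rule Tm_binary[of _ _ Mult]) (simp_all add: MM_simps)
lemma Tm_smash: "Tm g ==> Tm h ==> Tm (%s. smash (g s) (h s))"
  by (rule Tm_binary[of _ _ Smash]) (simp_all add: MM_simps)

lemma Tm_reindex: "Tm g ==> Tm (%s. g (%n. s (r n)))"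
  unfolding Tm_def using sel_reindex by metis

lemma Sg_reindex: "Sg k P ==> Sg k (%s. P (%n. s (r n)))"
  unfolding Sg_def using sel_reindex by metis

lemma Pg_iff: "Pg (Suc k) P \<longleftrightarrow> Sg (Suc k) (%s. \<not> P s)"
proof
  assume "Pg (Suc k) P"
  then show "Sg (Suc k) (%s. \<not> P s)"
    unfolding Sg_def Pg_def using Sigma_b_Pi_b.intros(8) holds.simps(3) by metis
next
  assume "Sg (Suc k) (%s. \<not> P s)"
  then show "Pg (Suc k) P"
    unfolding Sg_def Pg_def using Sigma_b_Pi_b.intros(15) holds.simps(3) by metis
qed

lemma Sg_atom:
  assumes "Tm g" "Tm h" "\<And>t u. sharply_bounded (F t u)" "\<And>s t u. holds MM s (F t u) = R (tval MM s t) (tval MM s u)"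
  shows "Sg 0 (%s. R (g s) (h s))" "Pg 0 (%s. R (g s) (h s))"
proof -
  from assms obtain t u a b where *: "sel a" "sel b" "\<And>s. g s = tval MM (a s) t" "\<And>s. h s = tval MM (b s) u"
    unfolding Tm_def by metis
  have "holds MM (mix a b s) (F (tsub (%n. Var (2 * n)) t) (tsub (%n. Var (Suc (2 * n))) u)) = R (g s) (h s)" for s
    by (simp add: assms(4) tval_mix *)
  then show "Sg 0 (%s. R (g s) (h s))" "Pg 0 (%s. R (g s) (h s))"
    unfolding Sg_def Pg_def using sel_mix[OF *(1,2)] Sigma_b_Pi_b.intros(1,2) assms(3) by metis+
qed

lemma Sg_up: "Sg k P ==> Sg (Suc k) P"
  unfolding Sg_def using Sigma_Pi_mono by metis
lemma Sg_Pg: "Sg k P ==> Pg (Suc k) P"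
  unfolding Sg_def Pg_def using Sigma_b_Pi_b.intros(10) by metis
lemma Pg_Sg: "Pg k P ==> Sg (Suc k) P"
  unfolding Sg_def Pg_def using Sigma_b_Pi_b.intros(3) by metis

lemma Sg_eq0: "Tm g ==> Tm h ==> Sg (Suc k) (%s. g s = h s)"
  and Pg_eq0: "Tm g ==> Tm h ==> Pg (Suc k) (%s. g s = h s)"
  and Sg_le0: "Tm g ==> Tm h ==> Sg (Suc k) (%s. g s \<le> h s)"
  and Pg_le0: "Tm g ==> Tm h ==> Pg (Suc k) (%s. g s \<le> h s)"
proof -
  assume *: "Tm g" "Tm h"
  have "Sg 0 (%s. g s = h s)" "Pg 0 (%s. g s = h s)"
    using Sg_atom[OF *, of Eq "(=)"] by (auto intro: sharply_bounded.intros)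
  moreover have "Sg 0 (%s. g s \<le> h s)" "Pg 0 (%s. g s \<le> h s)"
    using Sg_atom[OF *, of Leq "(\<le>)"] by (auto intro: sharply_bounded.intros simp: MM_simps)
  moreover have "Sg 0 P ==> Pg 0 P ==> Sg (Suc k) P \<and> Pg (Suc k) P" for P k
    by (induction k) (auto intro: Sg_up Sg_Pg Pg_Sg)
  ultimately show "Sg (Suc k) (%s. g s = h s)" "Pg (Suc k) (%s. g s = h s)"
    "Sg (Suc k) (%s. g s \<le> h s)" "Pg (Suc k) (%s. g s \<le> h s)" by blast+
qed

lemma
  assumes "Sg (Suc k) P" "Sg (Suc k) Q"
  shows Sg_conj: "Sg (Suc k) (%s. P s \<and> Q s)"
    and Sg_disj: "Sg (Suc k) (%s. P s \<or> Q s)"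
proof -
  from assms obtain A B a b where *: "Sigma_b (Suc k) A" "Sigma_b (Suc k) B" "sel a" "sel b"
    "\<And>s. P s = holds MM (a s) A" "\<And>s. Q s = holds MM (b s) B" unfolding Sg_def by metis
  let ?A = "fsub (%n. Var (2 * n)) A" and ?B = "fsub (%n. Var (Suc (2 * n))) B"
  have "Sigma_b (Suc k) (?A \<^bold>\<and> ?B)" "Sigma_b (Suc k) (?A \<^bold>\<or> ?B)"
    by (intro Sigma_b_Pi_b.intros Sigma_Pi_fsub *)+
  moreover have "holds MM (mix a b s) ?A = P s" "holds MM (mix a b s) ?B = Q s" for s
    by (simp_all add: holds_mix *)
  ultimately show "Sg (Suc k) (%s. P s \<and> Q s)" "Sg (Suc k) (%s. P s \<or> Q s)"
    unfolding Sg_def using sel_mix[OF *(3,4)] holds.simps(4,5) by metis+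
qed

definition tl_env :: "env => env" where "tl_env s = (%n. s (Suc n))"

lemma quantifier_env:
  assumes f: "sel f" and h: "sel h"
  obtains F \<sigma> \<tau> where "sel F" "\<And>x s A. holds MM (case_nat x (F s)) (fsub \<sigma> A) = holds MM (f (case_nat x s)) A"
    "\<And>s t. tval MM (F s) (tsub \<tau> t) = tval MM (h s) t"
proof -
  define g where "g s = f (case_nat 0 s)" for s
  define \<sigma> where "\<sigma> n = (if \<forall>s. f s n = s 0 then Var 0 else Var (Suc (2 * n)))" for n
  have "(\<exists>i. \<forall>s. g s n = s i) \<or> (\<exists>c. \<forall>s. g s n = c)" for n
  proof -
    consider i where "\<And>s. f s n = s i" | c where "\<And>s. f s n = c" using f unfolding sel_def by metis
    then show ?thesis
    proof cases
      case (1 i) then show ?thesis by (cases i) (auto simp: g_def)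
    qed (auto simp: g_def)
  qed
  then have "sel g" unfolding sel_def by blast
  then have "sel (mix g h)" using h by (rule sel_mix)
  moreover have "holds MM (case_nat x (mix g h s)) (fsub \<sigma> A) = holds MM (f (case_nat x s)) A" for x s A
  proof -
    have "tval MM (case_nat x (mix g h s)) (\<sigma> n) = f (case_nat x s) n" for n
    proof (cases "\<forall>s. f s n = s 0")
      case False
      then have "f (case_nat x s) n = f (case_nat 0 s) n"
      proof -
        consider i where "\<And>s. f s n = s (Suc i)" | c where "\<And>s. f s n = c"
          using f False unfolding sel_def by (metis not0_implies_Suc)
        then show ?thesis by cases auto
      qed
      moreover have "\<sigma> n = Var (Suc (2 * n))" unfolding \<sigma>_def using False by (rule if_not_P)
      ultimately show ?thesis by (simp add: g_def)
    next
      case True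
      have "\<sigma> n = Var 0" unfolding \<sigma>_def using True by (rule if_P)
      then show ?thesis using True[rule_format, of "case_nat x s"] by simp
    qed
    then show ?thesis by (simp add: holds_fsub)
  qed
  ultimately show ?thesis
    using that[of "mix g h" \<sigma> "%n. Var (Suc (2 * n))"] by (simp add: tval_mix)
qed

text \<open>The premise follows the de Bruijn convention: the bound number is component 0 and the
  outer environment is shifted. With all quantifier rules in this form, definability is proved by
  plain resolution along the shape of a predicate.\<close>

lemma Sg_bex0:
  assumes "Tm g" "Sg (Suc k) (%s. P (s 0) (%n. s (Suc n)))"
  shows "Sg (Suc k) (%s. \<exists>x\<le>g s. P x s)"
proof -
  from assms obtain t h A f where *: "sel h" "sel f" "Sigma_b (Suc k) A" "\<And>s. g s = tval MM (h s) t"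
    "\<And>s. P (s 0) (%n. s (Suc n)) = holds MM (f s) A" unfolding Sg_def Tm_def by metis
  obtain F \<sigma> \<tau> where F: "sel F" "\<And>x s A. holds MM (case_nat x (F s)) (fsub \<sigma> A) = holds MM (f (case_nat x s)) A"
    "\<And>s t. tval MM (F s) (tsub \<tau> t) = tval MM (h s) t" using quantifier_env[OF *(2,1)] by blast
  have "holds MM (F s) (BExists (tsub \<tau> t) (fsub \<sigma> A)) = (\<exists>x\<le>g s. P x s)" for s
    using *(5)[of "case_nat _ s"] by (simp add: BExists_def F MM_simps *(4))
  moreover have "Sigma_b (Suc k) (BExists (tsub \<tau> t) (fsub \<sigma> A))"
    by (intro Sigma_b_Pi_b.intros Sigma_Pi_fsub *)
  ultimately show ?thesis unfolding Sg_def using F(1) by metis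
qed

lemma Sg_sball0:
  assumes "Tm g" "Sg (Suc k) (%s. P (s 0) (%n. s (Suc n)))"
  shows "Sg (Suc k) (%s. \<forall>x\<le>len (g s). P x s)"
proof -
  from assms obtain t h A f where *: "sel h" "sel f" "Sigma_b (Suc k) A" "\<And>s. g s = tval MM (h s) t"
    "\<And>s. P (s 0) (%n. s (Suc n)) = holds MM (f s) A" unfolding Sg_def Tm_def by metis
  obtain F \<sigma> \<tau> where F: "sel F" "\<And>x s A. holds MM (case_nat x (F s)) (fsub \<sigma> A) = holds MM (f (case_nat x s)) A"
    "\<And>s t. tval MM (F s) (tsub \<tau> t) = tval MM (h s) t" using quantifier_env[OF *(2,1)] by blast
  have "holds MM (F s) (BForall (Len (tsub \<tau> t)) (fsub \<sigma> A)) = (\<forall>x\<le>len (g s). P x s)" for s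
  proof -
    have "tlift (Len u) = Len (tlift u)" for u by (simp add: tlift_def)
    then show ?thesis using *(5)[of "case_nat _ s"] by (simp add: BForall_def F MM_simps *(4))
  qed
  moreover have "Sigma_b (Suc k) (BForall (Len (tsub \<tau> t)) (fsub \<sigma> A))"
    by (intro Sigma_b_Pi_b.intros Sigma_Pi_fsub *)
  ultimately show ?thesis unfolding Sg_def using F(1) by metis
qed

lemma Sg_cong: "Sg k P ==> (\<And>s. P s = Q s) ==> Sg k Q"
  by (simp add: Sg_def)

lemma Pg_reindex: "Pg k P ==> Pg k (%s. P (%n. s (r n)))"
  unfolding Pg_def using sel_reindex by metis

lemma Sg_neg: "Pg (Suc k) P ==> Sg (Suc k) (%s. \<not> P s)" by (simp add: Pg_iff)
lemma Pg_neg: "Sg (Suc k) P ==> Pg (Suc k) (%s. \<not> P s)" by (simp add: Pg_iff)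
lemma Pg_conj: "Pg (Suc k) P ==> Pg (Suc k) Q ==> Pg (Suc k) (%s. P s \<and> Q s)"
  unfolding Pg_iff by (rule Sg_cong[OF Sg_disj[of k "%s. \<not> P s" "%s. \<not> Q s"]]) auto
lemma Pg_disj: "Pg (Suc k) P ==> Pg (Suc k) Q ==> Pg (Suc k) (%s. P s \<or> Q s)"
  unfolding Pg_iff by (rule Sg_cong[OF Sg_conj[of k "%s. \<not> P s" "%s. \<not> Q s"]]) auto
lemma Sg_imp: "Pg (Suc k) P ==> Sg (Suc k) Q ==> Sg (Suc k) (%s. P s --> Q s)"
  by (rule Sg_cong[OF Sg_disj[OF Sg_neg]]) auto
lemma Pg_imp: "Sg (Suc k) P ==> Pg (Suc k) Q ==> Pg (Suc k) (%s. P s --> Q s)"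
  unfolding Pg_iff by (rule Sg_cong[OF Sg_conj]) auto
lemma Pg_ball0: "Tm g ==> Pg (Suc k) (%s. P (s 0) (%n. s (Suc n))) ==> Pg (Suc k) (%s. \<forall>x\<le>g s. P x s)"
  unfolding Pg_iff by (rule Sg_cong[OF Sg_bex0[of _ _ "%x s. \<not> P x s"]]) auto

section \<open>\<Pi>2 induction from \<Sigma>2 induction on notation\<close>

subsection \<open>Induction\<close>

lemma PIND_Sg:
  assumes "Sg 2 (%s. Q (s 0))" "Q 0" "\<And>x. Q (half x) ==> Q x"
  shows "Q x"
proof -
  from assms(1) obtain A f where *: "Sigma_b 2 A" "sel f" "\<And>s. Q (s 0) = holds MM (f s) A"
    unfolding Sg_def by blast
  \<comment> \<open>The description of \<open>Q\<close> is valid for every environment, in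
    particular for constant ones. All components that vary may therefore be identified with the
    induction variable, and the others remain parameters.\<close>
  define \<sigma> where "\<sigma> n = (if \<exists>i. \<forall>s. f s n = s i then Var 0 else Var (Suc n))" for n
  define e where "e = f (%_. 0)"
  have Q: "holds MM (case_nat x e) (fsub \<sigma> A) = Q x" for x
  proof -
    have "tval MM (case_nat x e) (\<sigma> n) = f (%_. x) n" for n
    proof (cases "\<exists>i. \<forall>s. f s n = s i")
      case False
      then have "f (%_. 0) n = f (%_. x) n" using *(2) unfolding sel_def by metis
      moreover have "\<sigma> n = Var (Suc n)" unfolding \<sigma>_def using False by (rule if_not_P)
      ultimately show ?thesis by (simp add: e_def)
    qed (auto simp: \<sigma>_def)
    then show ?thesis using *(3)[of "%_. x"] by (simp add: holds_fsub)
  qed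
  have "holds MM e (PIND (fsub \<sigma> A))"
    using model_MM Sigma_Pi_fsub(1)[OF *(1)] unfolding model_def S2_def by blast
  from this[unfolded holds_PIND MM_simps Q] show ?thesis using assms(2,3) by blast
qed

lemma b_refl: "x \<le> (x :: mm)" using b_linear[of x x] by simp

lemma b_le_0: "x \<le> 0 ==> x = (0 :: mm)" using b_antisym b_zero_le by blast

lemma b_le_suc_iff: "x \<le> suc y \<longleftrightarrow> x \<le> y \<or> x = suc y"
  by (metis b_antisym b_le_suc b_linear b_refl b_suc_le_iff)

lemma b_double: "suc (suc 0) * x = x + x"
  by (metis b_add_0 b_add_commute b_mult_0 b_mult_commute b_mult_suc)

lemma b_half_cases: "x = half x + half x \<or> x = suc (half x + half x)"
  using b_half_iff[of "half x" x] b_double[of "half x"] by metis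

lemma b_half_le: "half x \<le> x"
  using b_half_cases[of x] by (metis b_le_add b_le_suc)

lemma b_half_0: "half 0 = 0"
  using b_half_iff[of 0 0] by (simp add: b_mult_0)

lemma b_len_eq_0: "len x \<le> 0 ==> x = 0"
  by (metis b_le_0 b_len_half b_suc_le_iff b_suc_neq)

text \<open>The induction is run backwards from a counterexample \<open>a\<close>. The \<Sigma>2
  predicate \<open>C u\<close> asks for a counterexample \<open>x\<close> with
  \<open>len x + len u \<le> len a\<close>. Going from \<open>half u\<close> to \<open>u\<close> is
  paid for by halving \<open>x\<close>, which stays a counterexample by the contrapositive of the
  step. At \<open>u = a\<close> only \<open>x = 0\<close> is left.\<close>

lemma PIND_Pg:
  assumes "Pg (Suc (Suc 0)) (%s. Q (s 0))" "Q 0" "\<And>x. Q (half x) ==> Q x"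
  shows "Q a"
proof (rule ccontr)
  assume "\<not> Q a"
  define C where "C u \<longleftrightarrow> (\<exists>x\<le>a. \<not> Q x \<and> len x + len u \<le> len a)" for u
  have "C a"
  proof (rule PIND_Sg[of C])
    show "Sg 2 (%s. C (s 0))"
      unfolding C_def numeral_2_eq_2
      by (intro Sg_bex0 Tm_const Sg_conj Sg_neg assms(1) Sg_le0 Tm_plus Tm_len Tm_var)
    show "C 0" unfolding C_def using \<open>\<not> Q a\<close> b_refl[of a] b_refl[of "len a"] by (auto simp: b_len_0 b_add_0 intro!: exI[of _ a])
    show "C u" if "C (half u)" for u
    proof (cases "u = 0")
      case False
      obtain x where x: "x \<le> a" "\<not> Q x" "len x + len (half u) \<le> len a" using \<open>C (half u)\<close> C_def by blast
      then have "x \<noteq> 0" "\<not> Q (half x)" using assms(2,3) by blast+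
      moreover have "len (half x) + len u = len x + len (half u)"
        using b_len_half[OF False] b_len_half[OF \<open>x \<noteq> 0\<close>] by (metis b_add_commute b_add_suc)
      ultimately show ?thesis unfolding C_def using x b_half_le b_trans by metis
    qed (use that b_half_0 in simp)
  qed
  then obtain x where x: "\<not> Q x" "len x + len a \<le> len a" unfolding C_def by blast
  then have "len x \<le> 0" by (metis b_add_0 b_add_commute b_add_le)
  then show False using x(1) assms(2) b_len_eq_0 by blast
qed

text \<open>Substitution is simulated by a bounded quantifier over a number equal to the
  term.\<close>

lemma Sg_sub0:
  assumes "Tm g" "Sg (Suc k) (%s. P (s 0) (%n. s (Suc n)))"
  shows "Sg (Suc k) (%s. P (g s) s)"
proof -
  have "Sg (Suc k) (%s. \<exists>x\<le>g s. x = g s \<and> P x s)"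
    by (intro Sg_bex0 assms Sg_conj Sg_eq0 Tm_var) (rule Tm_reindex[OF assms(1)])
  then show ?thesis by (rule Sg_cong) (use b_refl in auto)
qed

lemma Pg_sub0:
  assumes "Tm g" "Pg (Suc k) (%s. P (s 0) (%n. s (Suc n)))"
  shows "Pg (Suc k) (%s. P (g s) s)"
  using Sg_sub0[of g k "%x s. \<not> P x s"] assms by (simp add: Pg_iff)

text \<open>The doubling argument: \<open>B u\<close> allows jumps of length \<open>u\<close>, and
  such a jump consists of two jumps of length \<open>half u\<close> and at most one single step.
  \<open>R\<close> stands on both sides of the implication in \<open>B\<close>, hence the two
  definability hypotheses.\<close>

lemma IND_suc:
  assumes "Sg (Suc (Suc 0)) (%s. R (s 0))" "Pg (Suc (Suc 0)) (%s. R (s 0))"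
    "R 0" "\<And>x. R x ==> R (suc x)"
  shows "R a"
proof -
  define B where "B u \<longleftrightarrow> (\<forall>x\<le>a. R x \<and> x + u \<le> a --> R (x + u))" for u
  have "B a"
  proof (rule PIND_Pg[of B])
    show "Pg (Suc (Suc 0)) (%s. B (s 0))"
      unfolding B_def
      by (intro Pg_ball0 Tm_const Pg_imp Sg_conj assms(1) Sg_le0 Tm_plus Tm_var)
        (rule Pg_sub0[where P = "%x s. R x", OF Tm_plus[OF Tm_var Tm_var] assms(2)])
    show "B 0" by (simp add: B_def b_add_0)
    show "B u" if B: "B (half u)" for u
      unfolding B_def
    proof (intro allI impI, elim conjE)
      fix x assume x: "x \<le> a" "R x" "x + u \<le> a"
      have "x + half u \<le> x + u" by (simp add: b_add_le b_half_le)
      then have 1: "x + half u \<le> a" using x(3) b_trans by blast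
      then have 2: "R (x + half u)" using B x unfolding B_def by blast
      have "half u + half u \<le> u" using b_half_cases[of u] by (metis b_le_suc b_refl)
      then have "x + (half u + half u) \<le> a" using b_add_le b_trans x(3) by blast
      then have "R (x + (half u + half u))" using B 1 2 unfolding B_def by (metis b_add_assoc)
      then show "R (x + u)" using b_half_cases[of u] assms(4) b_add_suc by metis
    qed
  qed
  then have "R (0 + a)" using assms(3) b_zero_le b_refl unfolding B_def by (metis b_add_0 b_add_commute)
  then show ?thesis by (metis b_add_0 b_add_commute)
qed

section \<open>The model as an ordered semiring with truncated subtraction\<close>

section \<open>Arithmetic in the model\<close>

lemma b_mult_assoc: "x * y * z = x * (y * (z :: mm))"
  by (rule IND_suc[of "%z. x * y * z = x * (y * z)"])
    (simp_all add: Sg_eq0 Pg_eq0 Tm_times Tm_const Tm_var b_mult_0 b_mult_suc b_distrib)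

text \<open>BASIC has the order as a primitive relation. Differences are obtained by induction, and
  subtraction, the type class instance and the ring of differences all rest on them.\<close>

lemma b_sub: "y \<le> x ==> \<exists>z. y + z = (x :: mm)"
proof -
  have "y \<le> x --> (\<exists>z\<le>x. y + z = x)"
  proof (rule IND_suc[of "%x. y \<le> x --> (\<exists>z\<le>x. y + z = x)"])
    have 1: "Sg (Suc 0) (%s. y \<le> s 0 --> (\<exists>z\<le>s 0. y + z = s 0))"
      by (intro Sg_imp Pg_le0 Sg_bex0 Sg_eq0 Tm_plus Tm_const Tm_var)
    show "Sg (Suc (Suc 0)) (%s. y \<le> s 0 --> (\<exists>z\<le>s 0. y + z = s 0))" using 1 by (rule Sg_up)
    show "Pg (Suc (Suc 0)) (%s. y \<le> s 0 --> (\<exists>z\<le>s 0. y + z = s 0))" using 1 by (rule Sg_Pg)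
    show "y \<le> 0 --> (\<exists>z\<le>0. y + z = 0)" using b_le_0 b_refl b_add_0 by metis
    show "y \<le> suc x --> (\<exists>z\<le>suc x. y + z = suc x)" if "y \<le> x --> (\<exists>z\<le>x. y + z = x)" for x
      using that by (metis b_add_0 b_add_suc b_le_suc_iff b_suc_le_iff b_zero_le b_linear)
  qed
  then show "y \<le> x ==> ?thesis" by blast
qed

instantiation mm :: minus
begin
definition "x - y = (if y \<le> x then THE z. y + z = x else (0 :: mm))"
instance ..
end

lemma b_add_cancel: "x + y = x + z ==> y = (z :: mm)"
  by (metis b_add_le b_antisym b_refl)

lemma b_diff: "y + z = x ==> x - y = (z :: mm)"
  unfolding minus_mm_def using b_le_add b_add_cancel by (auto intro!: the_equality)

lemma b_diff_le: "\<not> y \<le> x ==> x - y = (0 :: mm)"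
  by (simp add: minus_mm_def)

lemma b_diff_diff: "a - b - c = a - (b + (c :: mm))"
proof (cases "b + c \<le> a")
  case True
  then obtain d where "b + c + d = a" using b_sub by blast
  then show ?thesis by (metis b_add_assoc b_diff)
next
  case F: False
  show ?thesis
  proof (cases "b \<le> a")
    case True
    then obtain d where d: "b + d = a" using b_sub by blast
    then have "\<not> c \<le> d" using F b_add_le by blast
    then show ?thesis using F d b_diff b_diff_le by metis
  next
    case False
    then show ?thesis using F by (metis b_add_0 b_diff b_diff_le b_le_0)
  qed
qed

lemma b_mult_diff: "a * (b - c) = a * b - a * (c :: mm)"
proof (cases "c \<le> b")
  case True
  then obtain d where "c + d = b" using b_sub by blast
  then show ?thesis by (metis b_diff b_distrib)
next
  case F: False
  show ?thesis
  proof (cases "a = 0")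
    case True
    then show ?thesis by (metis b_add_0 b_diff b_mult_0 b_mult_commute)
  next
    case False
    then have "suc 0 \<le> a" using b_suc_le_iff b_zero_le by metis
    then have "\<not> a * c \<le> a * b" using F b_mult_le by blast
    then show ?thesis using F b_diff_le b_mult_0 by metis
  qed
qed

lemma b_one: "1 = suc 0" by (simp add: one_mm_def MM_simps)

lemma b_less: "x < y \<longleftrightarrow> x \<le> y \<and> x \<noteq> (y :: mm)" by (simp add: less_mm_def less_eq_mm_def)

lemma b_pos: "0 < x ==> suc 0 \<le> x" using b_less b_suc_le_iff by metis

instance mm :: linordered_semidom
proof
  fix a b c :: mm
  show "a + b + c = a + (b + c)" by (rule b_add_assoc)
  show "a + b = b + a" by (rule b_add_commute)
  show "0 + a = a" by (metis b_add_0 b_add_commute)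
  show "a + b - a = b" by (simp add: b_diff)
  show "a - b - c = a - (b + c)" by (rule b_diff_diff)
  show "0 * a = 0" "a * 0 = 0" by (metis b_mult_0 b_mult_commute)+
  show "a * b * c = a * (b * c)" by (rule b_mult_assoc)
  show "a * b = b * a" by (rule b_mult_commute)
  show "1 * a = a" by (metis b_one b_mult_commute b_mult_suc b_mult_0 b_add_0 b_add_commute)
  show "(a + b) * c = a * c + b * c" by (metis b_distrib b_mult_commute)
  show "a * (b + c) = a * b + a * c" by (rule b_distrib)
  show "0 \<noteq> (1 :: mm)" using b_one b_suc_neq by metis
  show "a * (b - c) = a * b - a * c" by (rule b_mult_diff)
  show "a \<noteq> 0 ==> b \<noteq> 0 ==> a * b \<noteq> 0"
    by (metis b_le_0 b_mult_0 b_mult_le b_refl b_suc_le_iff b_zero_le)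
  show "(a < b) = (a \<le> b \<and> \<not> b \<le> a)" using b_less b_antisym b_refl by metis
  show "a \<le> a" by (rule b_refl)
  show "a \<le> b ==> b \<le> c ==> a \<le> c" by (rule b_trans)
  show "a \<le> b ==> b \<le> a ==> a = b" by (rule b_antisym)
  show "a \<le> b \<or> b \<le> a" using b_linear by blast
  show "a \<le> b ==> c + a \<le> c + b" by (simp add: b_add_le)
  show "a < b ==> 0 < c ==> c * a < c * b" using b_pos b_less b_mult_le by (metis b_antisym)
  show "0 < (1 :: mm)" using b_one b_less b_zero_le b_suc_neq by metis
  show "b \<le> a ==> a - b + b = a" using b_sub b_diff b_add_commute by metis
qed

subsection \<open>The ordered ring generated by the model\<close>

text \<open>Its only purpose is to make linear arithmetic available for the type \<open>mm\<close>.\<close>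

definition mz_rel :: "mm \<times> mm => mm \<times> mm => bool" where
  "mz_rel = (%(x, y) (u, v). x + v = u + y)"

lemma mz_rel_simp [simp]: "mz_rel (x, y) (u, v) \<longleftrightarrow> x + v = u + y"
  by (simp add: mz_rel_def)

quotient_type mz = "mm \<times> mm" / mz_rel
  morphisms Rep_mz Abs_mz
proof (rule equivpI)
  show "reflp mz_rel" by (auto simp: reflp_def)
  show "symp mz_rel" by (auto simp: symp_def)
  show "transp mz_rel"
  proof (rule transpI, clarsimp)
    fix a b c d e f :: mm
    assume "a + d = c + b" "c + f = e + d"
    then have "(a + d) + (c + f) = (c + b) + (e + d)" by simp
    then have "(a + f) + (c + d) = (e + b) + (c + d)" by (simp add: ac_simps)
    then show "a + f = e + b" by simp
  qed
qed

lemma mz_flip: "a + d = c + b ==> b + c = d + (a :: mm)"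
  using add.commute[of a d] add.commute[of c b] by argo

lemma Abs_mz_cases: obtains x y where "a = Abs_mz (x, y)"
proof -
  have "\<exists>p. a = Abs_mz p" by (induction a rule: mz.abs_induct) blast
  then show thesis using that by (metis surj_pair)
qed

lemma mz_times_respects:
  fixes s t u v w x y z :: mm
  assumes "s + v = u + t" "w + z = y + x"
  shows "s * w + t * x + (u * z + v * y) = u * y + v * z + (s * x + t * w)"
proof -
  have 1: "s * w + v * w = u * w + t * w" "u * x + t * x = s * x + v * x"
    using assms(1) by (metis distrib_right)+
  have 2: "u * w + u * z = u * y + u * x" "v * y + v * x = v * w + v * z"
    using assms(2) by (metis distrib_left)+
  have "(s * w + v * w) + (u * x + t * x) + (u * w + u * z) + (v * y + v * x)
      = (u * w + t * w) + (s * x + v * x) + (u * y + u * x) + (v * w + v * z)"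
    using 1 2 by simp
  then have "(s * w + t * x + (u * z + v * y)) + (v * w + u * x + u * w + v * x)
      = (u * y + v * z + (s * x + t * w)) + (v * w + u * x + u * w + v * x)"
    by (simp add: ac_simps)
  then show ?thesis by simp
qed

lemma mz_le_respects:
  fixes s t u v w x y z :: mm
  assumes "s + v = u + t" "w + z = y + x"
  shows "s + x \<le> w + t \<longleftrightarrow> u + z \<le> y + v"
proof -
  have "s + x \<le> w + t \<longleftrightarrow> (s + x) + (v + z) \<le> (w + t) + (v + z)" by simp
  also have "(s + x) + (v + z) = (u + z) + (t + x)" using arg_cong[OF assms(1), of "%a. a + (x + z)"] by (simp add: ac_simps)
  also have "(w + t) + (v + z) = (y + v) + (t + x)" using arg_cong[OF assms(2), of "%a. a + (t + v)"] by (simp add: ac_simps)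
  finally show ?thesis by simp
qed

instantiation mz :: linordered_idom
begin

lift_definition zero_mz :: mz is "(0, 0)" .
lift_definition one_mz :: mz is "(1, 0)" .
lift_definition plus_mz :: "mz => mz => mz" is "%(x, y) (u, v). (x + u, y + v)"
proof clarify
  fix a b c d e f g h :: mm
  assume "mz_rel (a, b) (c, d)" "mz_rel (e, f) (g, h)"
  then have "(a + d) + (e + h) = (c + b) + (g + f)" unfolding mz_rel_simp by (rule arg_cong2)
  then show "mz_rel (a + e, b + f) (c + g, d + h)" unfolding mz_rel_simp by (simp add: ac_simps)
qed
lift_definition uminus_mz :: "mz => mz" is "%(x, y). (y, x)"
proof clarify
  fix a b c d :: mm
  assume "mz_rel (a, b) (c, d)"
  then have "b + c = d + a" unfolding mz_rel_simp by (rule mz_flip)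
  then show "mz_rel (b, a) (d, c)" unfolding mz_rel_simp .
qed
lift_definition times_mz :: "mz => mz => mz" is "%(x, y) (u, v). (x * u + y * v, x * v + y * u)"
proof clarify
  fix s t u v w x y z :: mm
  assume "mz_rel (s, t) (u, v)" "mz_rel (w, x) (y, z)"
  then show "mz_rel (s * w + t * x, s * x + t * w) (u * y + v * z, u * z + v * y)"
    unfolding mz_rel_simp by (rule mz_times_respects)
qed
lift_definition less_eq_mz :: "mz => mz => bool" is "%(x, y) (u, v). x + v \<le> u + y"
proof clarify
  fix s t u v w x y z :: mm
  assume "mz_rel (s, t) (u, v)" "mz_rel (w, x) (y, z)"
  then show "s + x \<le> w + t \<longleftrightarrow> u + z \<le> y + v"
    unfolding mz_rel_simp by (rule mz_le_respects)
qed
definition minus_mz_def: "x - y = x + - (y :: mz)"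
definition less_mz_def: "x < y \<longleftrightarrow> x \<le> y \<and> \<not> y \<le> (x :: mz)"
definition abs_mz_def: "\<bar>x :: mz\<bar> = (if x < 0 then - x else x)"
definition sgn_mz_def: "sgn (x :: mz) = (if x = 0 then 0 else if 0 < x then 1 else - 1)"

instance
proof
  fix a b c :: mz
  show "a * b * c = a * (b * c)" by (transfer, clarsimp simp: algebra_simps)
  show "a * b = b * a" by (transfer, clarsimp simp: algebra_simps)
  show "1 * a = a" by (transfer, clarsimp simp: algebra_simps)
  show "a + b + c = a + (b + c)" by (transfer, clarsimp simp: algebra_simps)
  show "a + b = b + a" by (transfer, clarsimp simp: algebra_simps)
  show "0 + a = a" by (transfer, clarsimp simp: algebra_simps)
  show "- a + a = 0" by (transfer, clarsimp simp: algebra_simps)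
  show "(a + b) * c = a * c + b * c" by (transfer, clarsimp simp: algebra_simps)
  show "(0 :: mz) \<noteq> 1" by (transfer, clarsimp simp: algebra_simps)
  show "a - b = a + - b" by (rule minus_mz_def)
  show "a + b - a = b" unfolding minus_mz_def by (transfer, clarsimp simp: algebra_simps)
  show "a - b - c = a - (b + c)" unfolding minus_mz_def by (transfer, clarsimp simp: algebra_simps)
  show "0 * a = 0" by (transfer, clarsimp simp: algebra_simps)
  show "a * 0 = 0" by (transfer, clarsimp simp: algebra_simps)
  show "(a < b) = (a \<le> b \<and> \<not> b \<le> a)" by (rule less_mz_def)
  show "a \<le> a" by transfer auto
  show "a \<le> b \<or> b \<le> a" by transfer auto
  show "a \<le> b ==> b \<le> a ==> a = b" by transfer auto
  show "a \<le> b ==> b \<le> c ==> a \<le> c"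
  proof (transfer, clarsimp)
    fix x y u v w z :: mm
    assume "x + v \<le> u + y" "u + z \<le> w + v"
    then have "(x + v) + (u + z) \<le> (u + y) + (w + v)" by (rule add_mono)
    then have "(x + z) + (u + v) \<le> (w + y) + (u + v)" by (simp add: ac_simps)
    then show "x + z \<le> w + y" by simp
  qed
  show "a \<le> b ==> c + a \<le> c + b"
  proof (transfer, clarsimp)
    fix x y u v w z :: mm
    assume "x + v \<le> u + y"
    then have "(x + v) + (w + z) \<le> (u + y) + (w + z)" by simp
    then show "w + x + (z + v) \<le> w + u + (z + y)" by (simp add: ac_simps)
  qed
  show "\<bar>a\<bar> = (if a < 0 then - a else a)" by (rule abs_mz_def)
  show "sgn a = (if a = 0 then 0 else if 0 < a then 1 else - 1)" by (rule sgn_mz_def)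
  \<comment> \<open>A positive difference is represented by a pair with second component 0, so
    multiplication by it reduces to multiplication by an element of \<open>mm\<close>.\<close>
  have pos: "0 < x ==> \<exists>d. x = Abs_mz (d, 0) \<and> d \<noteq> 0" for x :: mz
  proof -
    assume "0 < x"
    obtain u v where x: "x = Abs_mz (u, v)" by (rule Abs_mz_cases)
    have "\<not> u \<le> v" using \<open>0 < x\<close> unfolding x less_mz_def by (simp add: zero_mz.abs_eq less_eq_mz.abs_eq mz.abs_eq_iff)
    then obtain d where "u = v + d" using b_sub[of v u] linear[of u v] by metis
    then have "x = Abs_mz (d, 0)" "d \<noteq> 0" using x \<open>\<not> u \<le> v\<close> by (auto simp: mz.abs_eq_iff ac_simps)
    then show "\<exists>d. x = Abs_mz (d, 0) \<and> d \<noteq> 0" by blast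
  qed
  show "a < b ==> 0 < c ==> c * a < c * b"
  proof -
    assume "a < b" "0 < c"
    obtain d where d: "c = Abs_mz (d, 0)" "d \<noteq> 0" using pos[OF \<open>0 < c\<close>] by blast
    obtain x y where a: "a = Abs_mz (x, y)" by (rule Abs_mz_cases)
    obtain u v where b: "b = Abs_mz (u, v)" by (rule Abs_mz_cases)
    note ab = a b
    have "x + v < u + y" using \<open>a < b\<close> unfolding ab less_mz_def by (simp add: less_eq_mz.abs_eq not_le)
    then have "d * (x + v) < d * (u + y)" using d(2) by (intro mult_strict_left_mono) (auto simp: order_less_le b_zero_le)
    then show ?thesis unfolding ab d(1) less_mz_def
      by (simp add: times_mz.abs_eq less_eq_mz.abs_eq distrib_left not_le[symmetric] ac_simps)
  qed
qed

end

lift_definition zz :: "mm => mz" is "%x. (x, 0)" .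

lemma zz_add: "zz (x + y) = zz x + zz y" by transfer simp
lemma zz_mult: "zz (x * y) = zz x * zz y" by transfer simp
lemma zz_0: "zz 0 = 0" by transfer simp
lemma zz_1: "zz 1 = 1" by transfer simp
lemma zz_numeral: "zz (numeral k) = numeral k"
  by (induction k) (simp_all only: numeral.simps zz_add zz_1)
lemma zz_le: "x \<le> y \<longleftrightarrow> zz x \<le> zz y" by transfer simp
lemma zz_less: "x < y \<longleftrightarrow> zz x < zz y" by (simp add: not_le[symmetric] zz_le)
lemma zz_eq: "x = y \<longleftrightarrow> zz x = zz y" by transfer simp
lemma zz_nonneg: "0 \<le> zz x" using zz_le[of 0 x] by (simp add: b_zero_le zz_0)

lemmas zify = zz_le zz_less zz_eq zz_add zz_mult zz_0 zz_1 zz_numeral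

section \<open>The cut of lengths and the powers of two\<close>

subsection \<open>Lengths and powers of two\<close>

lemma suc_eq: "suc x = x + 1"
  by (metis add.right_neutral b_add_suc b_one)

lemma mm_nonneg [simp]: "0 \<le> (x :: mm)" by (rule b_zero_le)

lemma mm_not_neg [simp]: "\<not> x < (0 :: mm)" by (simp add: not_less)

lemma mm_le_0 [simp]: "x \<le> 0 \<longleftrightarrow> x = (0 :: mm)"
  by (auto intro: b_le_0)

lemma mm_pos: "0 < x \<longleftrightarrow> x \<noteq> (0 :: mm)"
  by (simp add: order_less_le)

lemma mm_add_eq_0 [simp]: "x + y = 0 \<longleftrightarrow> x = 0 \<and> y = (0 :: mm)"
  by (simp add: add_nonneg_eq_0_iff)

lemma mm_mult_cancel: "a \<noteq> 0 ==> a * x = a * y \<longleftrightarrow> x = (y :: mm)"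
  unfolding zify by simp

lemma less_iff: "x < y \<longleftrightarrow> x + 1 \<le> (y :: mm)"
  by (metis b_less b_suc_le_iff suc_eq)

lemma le_iff: "x \<le> y \<longleftrightarrow> x < y + (1 :: mm)"
  by (simp add: less_iff)

lemma one_le: "1 \<le> x \<longleftrightarrow> x \<noteq> (0 :: mm)"
  using less_iff[of 0 x] by (simp add: mm_pos)

lemma le_ex: "x \<le> y ==> \<exists>z. y = x + (z :: mm)"
  by (metis b_sub)

lemma half_cases: "x = 2 * half x \<or> x = 2 * half x + 1"
  using b_half_cases[of x] by (simp add: suc_eq mult_2)

lemma half_double [simp]: "half (2 * x) = x" "half (2 * x + 1) = x"
  using b_half_iff[of x "2 * x"] b_half_iff[of x "2 * x + 1"] by (simp_all add: suc_eq)

lemma half_0 [simp]: "half 0 = 0" by (rule b_half_0)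
lemma half_1 [simp]: "half 1 = 0" using half_double(2)[of 0] by simp

lemma len_0 [simp]: "len 0 = 0" by (rule b_len_0)
lemma len_1 [simp]: "len 1 = 1" using b_len_1 by (simp add: suc_eq)
lemma len_pos: "x \<noteq> 0 ==> len x = len (half x) + 1" using b_len_half by (simp add: suc_eq)
lemma len_mono: "x \<le> y ==> len x \<le> len y" by (rule b_len_mono)
lemma len_eq_0 [simp]: "len x = 0 \<longleftrightarrow> x = 0" by (metis b_len_eq_0 len_0 order_refl)
lemma len_smash: "len (smash x y) = len x * len y + 1" using b_len_smash by (simp add: suc_eq)
lemma len_double: "x \<noteq> 0 ==> len (2 * x) = len x + 1"
  using len_pos[of "2 * x"] by simp

lemma PIND_mm_Sg:
  assumes "Sg (Suc (Suc 0)) (%s. Q (s 0))" "Q 0" "\<And>x. Q (half x) ==> x \<noteq> 0 ==> Q x"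
  shows "Q x"
  by (rule PIND_Sg[of Q]) (use assms in \<open>auto simp: numeral_2_eq_2\<close>)

text \<open>Exponentiation is partial in the model: powers of two are available for exponents in the
  initial segment of lengths. Smash closes this cut under products, so sizes polynomial in the
  length of a word remain usable exponents.\<close>

definition Log :: "mm => bool" where "Log i \<longleftrightarrow> (\<exists>x. i \<le> len x)"

lemma Log_len [simp, intro]: "Log (len x)" by (auto simp: Log_def)

lemma Log_down: "Log j ==> i \<le> j ==> Log i"
  unfolding Log_def by (meson order_trans)

lemma len_surj_below: "i \<le> len x ==> \<exists>y\<le>x. len y = i"
proof -
  have "\<forall>i\<le>len x. \<exists>y\<le>x. len y = i"
  proof (rule PIND_mm_Sg[of "%x. \<forall>i\<le>len x. \<exists>y\<le>x. len y = i"])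
    show "Sg (Suc (Suc 0)) (%s. \<forall>i\<le>len (s 0). \<exists>y\<le>s 0. len y = i)"
      by (intro Sg_sball0 Sg_bex0 Sg_eq0 Tm_len Tm_var)
    show "\<forall>i\<le>len x. \<exists>y\<le>x. len y = i" if *: "\<forall>i\<le>len (half x). \<exists>y\<le>half x. len y = i" "x \<noteq> 0" for x
    proof (intro allI impI)
      fix i assume "i \<le> len x"
      then have "i = len x \<or> i \<le> len (half x)"
        using less_iff[of i "len x"] len_pos[OF *(2)] unfolding zify by linarith
      then consider "i = len x" | "i \<le> len (half x)" by blast
      then show "\<exists>y\<le>x. len y = i"
        by cases (use * b_half_le[of x] in \<open>auto intro: order_trans\<close>)
    qed
  qed auto
  then show "i \<le> len x ==> ?thesis" by blast
qed

lemma Log_iff: "Log i \<longleftrightarrow> (\<exists>x. i = len x)"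
  using len_surj_below Log_def by (metis order_refl)

lemma Log_0 [simp]: "Log 0" using Log_len[of 0] by simp

lemma Log_Suc: "Log i ==> Log (i + 1)"
proof -
  assume "Log i"
  then obtain x where "i = len x" using Log_iff by blast
  then show ?thesis using Log_len[of 1] len_double[of x] Log_len[of "2 * x"] by (cases "x = 0") auto
qed

lemma Log_times: "Log i ==> Log j ==> Log (i * j)"
proof -
  assume "Log i" "Log j"
  then obtain x y where "i = len x" "j = len y" using Log_iff by blast
  then have "i * j \<le> len (smash x y)" by (simp add: len_smash)
  then show ?thesis using Log_def by blast
qed

lemma Log_add: "Log i ==> Log j ==> Log (i + j)"
proof (rule Log_down)
  assume "Log i" "Log j"
  then show "Log ((i + 1) * (j + 1))" by (intro Log_times Log_Suc)
  have "(i + 1) * (j + 1) = i + j + (i * j + 1)" by (simp add: algebra_simps)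
  then show "i + j \<le> (i + 1) * (j + 1)" by simp
qed

lemma Log_1 [simp]: "Log 1" using Log_len[of 1] by simp

lemma Log_numeral [simp]: "Log (numeral k)"
proof (induction k)
  case One then show ?case using Log_1 by (simp only: numeral.simps)
next
  case (Bit0 k) then show ?case unfolding numeral.simps by (intro Log_add)
next
  case (Bit1 k) then show ?case unfolding numeral.simps by (intro Log_add Log_1)
qed

text \<open>The choice is immaterial on \<open>Log\<close>, because smash depends only on the
  lengths of its arguments. Outside \<open>Log\<close> the value is arbitrary, which explains the
  recurring hypothesis.\<close>

definition ex :: "mm => mm" where "ex i = smash 1 (SOME y. len y = i)"

lemma ex_len: "ex (len x) = smash 1 x"
proof -
  have "len (SOME y. len y = len x) = len x" by (rule someI[of _ x]) simp
  then show ?thesis unfolding ex_def using b_smash_cong b_smash_commute by metis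
qed

lemma ex_0 [simp]: "ex 0 = 1"
  using ex_len[of 0] b_smash_0[of 1] b_smash_commute[of 1 0] by (simp add: suc_eq)

lemma ex_add: "Log i ==> Log j ==> ex (i + j) = ex i * ex j"
proof -
  assume *: "Log i" "Log j"
  then obtain x y z where "i = len x" "j = len y" "i + j = len z"
    using Log_add[OF *] Log_iff by metis
  then show ?thesis using b_smash_add[of z x y 1] ex_len b_smash_commute by metis
qed

lemma len_ex: "Log i ==> len (ex i) = i + 1"
  using Log_iff ex_len by (auto simp: len_smash)

lemma ex_nonzero [simp]: "Log i ==> ex i \<noteq> 0"
  using len_ex[of i] by auto

lemma ex_pos [simp]: "Log i ==> 0 < ex i"
  by (simp add: mm_pos)

text \<open>The axiom on \<open>1 # (2 * x)\<close> speaks of nonzero \<open>x\<close> only. Thus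
  \<open>ex 2\<close> is computed in two ways, as \<open>ex 1 * ex 1\<close> and as
  \<open>2 * ex 1\<close>, and one factor is cancelled.\<close>

lemma ex_1 [simp]: "ex 1 = 2"
proof -
  have "ex (1 + 1) = ex 1 * ex 1" by (rule ex_add) simp_all
  moreover have "ex (1 + 1) = 2 * ex 1"
    using b_smash_1[of 1] ex_len[of 1] ex_len[of 2] len_double[of 1] by (simp add: suc_eq)
  ultimately have "ex 1 * ex 1 = ex 1 * 2" by (simp add: mult.commute)
  then show ?thesis using ex_nonzero[of 1] mm_mult_cancel by auto
qed

lemma ex_Suc: "Log i ==> ex (i + 1) = 2 * ex i"
  by (simp add: ex_add mult.commute)

lemma ex_mono: "i \<le> j ==> Log j ==> ex i \<le> ex j"
proof -
  assume *: "i \<le> j" "Log j"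
  then obtain k where k: "j = i + k" using le_ex by blast
  then have "Log i" "Log k" using * Log_down by (auto intro: Log_down[of j])
  then have "ex i * 1 \<le> ex i * ex k" by (intro mult_left_mono) (simp_all add: one_le)
  then show ?thesis using k \<open>Log i\<close> \<open>Log k\<close> by (simp add: ex_add)
qed

lemma ex_bounds: "x < ex (len x) \<and> (x \<noteq> 0 --> ex (len x) \<le> 2 * x)"
  unfolding ex_len
proof (rule PIND_mm_Sg[of "%x. x < smash 1 x \<and> (x \<noteq> 0 --> smash 1 x \<le> 2 * x)"])
  show "Sg (Suc (Suc 0)) (%s. s 0 < smash 1 (s 0) \<and> (s 0 \<noteq> 0 --> smash 1 (s 0) \<le> 2 * s 0))"
    unfolding less_iff by (intro Sg_conj Sg_imp Pg_neg Sg_eq0 Sg_le0 Tm_plus Tm_smash Tm_times Tm_var Tm_const)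
  show "(0::mm) < smash 1 0 \<and> ((0::mm) \<noteq> 0 --> smash 1 0 \<le> 2 * 0)" using ex_len[of 0] by simp
next
  fix x assume *: "half x < smash 1 (half x) \<and> (half x \<noteq> 0 --> smash 1 (half x) \<le> 2 * half x)" "x \<noteq> 0"
  show "x < smash 1 x \<and> (x \<noteq> 0 --> smash 1 x \<le> 2 * x)"
  proof (cases "half x = 0")
    case True
    then have "x = 1" using half_cases[of x] *(2) by auto
    then show ?thesis using ex_len[of 1] by (simp add: less_iff)
  next
    case False
    have 1: "smash 1 x = 2 * smash 1 (half x)"
      using len_pos[OF *(2)] ex_Suc[of "len (half x)"] by (simp flip: ex_len)
    have "half x + 1 \<le> smash 1 (half x)" "smash 1 (half x) \<le> 2 * half x" using * False by (auto simp: less_iff)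
    then show ?thesis using half_cases[of x] 1 unfolding zify by linarith
  qed
qed

lemma len_le_iff: "Log i ==> len x \<le> i \<longleftrightarrow> x < ex i"
proof
  assume "Log i" "len x \<le> i"
  then show "x < ex i" using ex_bounds[of x] ex_mono[of "len x" i] by auto
next
  assume *: "Log i" "x < ex i"
  show "len x \<le> i"
  proof (rule ccontr)
    assume "\<not> len x \<le> i"
    then have "i + 1 \<le> len x" by (simp add: not_le less_iff)
    then have "ex (i + 1) \<le> ex (len x)" by (intro ex_mono) auto
    moreover have "x \<noteq> 0" using \<open>\<not> len x \<le> i\<close> by auto
    ultimately have "2 * ex i \<le> 2 * x" using ex_bounds[of x] ex_Suc[OF *(1)] by auto
    then show False using *(2) unfolding zify by linarith
  qed
qed

definition is_pow :: "mm => bool" where "is_pow c \<longleftrightarrow> c = smash 1 (half c)"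

lemma is_pow_ex: "Log i ==> is_pow (ex i)"
proof (cases "i = 0")
  case False
  assume "Log i"
  obtain j where j: "i = j + 1" using False b_sub[of 1 i] one_le[of i] by (metis add.commute)
  then have "Log j" using \<open>Log i\<close> Log_down[of i j] by simp
  then have "half (ex i) = ex j" "len (ex j) = i" by (simp_all add: ex_Suc len_ex j)
  then show ?thesis unfolding is_pow_def by (metis ex_len)
next
  case True
  then show ?thesis using ex_len[of 0] by (simp add: is_pow_def)
qed

lemma is_pow_iff: "is_pow c \<longleftrightarrow> (\<exists>i. Log i \<and> c = ex i)"
  using is_pow_ex unfolding is_pow_def by (metis Log_len ex_len)

lemma is_pow_len: "is_pow c ==> len c = i + 1 \<longleftrightarrow> Log i \<and> c = ex i"
proof -
  assume "is_pow c"
  then obtain j where "Log j" "c = ex j" using is_pow_iff by blast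
  then show ?thesis using len_ex by (metis add_right_cancel)
qed

text \<open>BASIC fixes only the length of \<open>x # y\<close>. That it is a power follows by
  induction on the notation of \<open>x\<close>, since each further digit multiplies the result by
  \<open>ex (len y)\<close>; its exact value is then determined by its length.\<close>

lemma is_pow_smash: "is_pow (smash x y)"
  unfolding is_pow_def
proof (rule PIND_mm_Sg[of "%x. smash x y = smash 1 (half (smash x y))"])
  show "Sg (Suc (Suc 0)) (%s. smash (s 0) y = smash 1 (half (smash (s 0) y)))"
    by (intro Sg_eq0 Tm_smash Tm_half Tm_var Tm_const)
  show "smash 0 y = smash 1 (half (smash 0 y))"
    using is_pow_ex[of 0] b_smash_0[of y] by (simp add: is_pow_def suc_eq)
  fix x assume *: "smash (half x) y = smash 1 (half (smash (half x) y))" "x \<noteq> 0"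
  then have "is_pow (smash (half x) y)" by (simp add: is_pow_def)
  then obtain i where i: "Log i" "smash (half x) y = ex i" using is_pow_iff by blast
  have "smash x y = ex i * ex (len y)"
    using b_smash_add[of x "half x" 1 y] len_pos[OF *(2)] i by (simp add: ex_len)
  then have "smash x y = ex (i + len y)" using i by (simp add: ex_add)
  then show "smash x y = smash 1 (half (smash x y))" using is_pow_ex[of "i + len y"] i
    by (simp add: is_pow_def Log_add)
qed

lemma smash_eq: "smash x y = ex (len x * len y)"
  using is_pow_len[OF is_pow_smash, of x y "len x * len y"] len_smash by blast

lemma smash_mono: "x \<le> x' ==> y \<le> y' ==> smash x y \<le> smash x' y'"
  unfolding smash_eq by (intro ex_mono mult_mono len_mono Log_times) auto

lemma half_mono: "x \<le> y ==> half x \<le> half y"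
proof (rule ccontr)
  assume "x \<le> y" "\<not> half x \<le> half y"
  then have "half y + 1 \<le> half x" by (simp add: less_iff not_le)
  then show False using \<open>x \<le> y\<close> half_cases[of x] half_cases[of y] unfolding zify by linarith
qed

section \<open>Functions with a \<Sigma>1 graph in the place of terms\<close>

subsection \<open>Definable functions\<close>

text \<open>Total functions that are bounded by a term and have a \<open>\<Sigma>\<^sub>1\<close> graph; they may be used like terms.\<close>

definition T1 :: "(env => mm) => bool" where
  "T1 f \<longleftrightarrow> (\<exists>g. Tm g \<and> (\<forall>s. f s \<le> g s)) \<and> Sg (Suc 0) (%s. s 0 = f (%n. s (Suc n)))"

lemma T1_bound: "T1 f ==> \<exists>g. Tm g \<and> (\<forall>s. f s \<le> g s)"
  and T1_graph: "T1 f ==> Sg (Suc 0) (%s. s 0 = f (%n. s (Suc n)))"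
  by (simp_all add: T1_def)

lemma Sg_lift: "Sg (Suc 0) P ==> Sg (Suc k) P"
  by (induction k) (auto intro: Sg_up)

lemma Sg_sub:
  assumes "T1 f" "Sg (Suc k) (%s. P (s 0) (%n. s (Suc n)))"
  shows "Sg (Suc k) (%s. P (f s) s)"
proof -
  obtain g where g: "Tm g" "\<forall>s. f s \<le> g s" using T1_bound[OF assms(1)] by auto
  have "Sg (Suc k) (%s. \<exists>x\<le>g s. x = f s \<and> P x s)"
    by (intro Sg_bex0 Sg_conj g(1) assms(2)) (rule Sg_lift[OF T1_graph[OF assms(1)]])
  then show ?thesis by (rule Sg_cong) (use g(2) in auto)
qed

lemma Pg_sub:
  assumes "T1 f" "Pg (Suc k) (%s. P (s 0) (%n. s (Suc n)))"
  shows "Pg (Suc k) (%s. P (f s) s)"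
  using Sg_sub[of f k "%x s. \<not> P x s"] assms by (simp add: Pg_iff)

lemma T1_tm: "Tm f ==> T1 f"
  unfolding T1_def by (auto intro!: Sg_eq0 Tm_var Tm_reindex[of f Suc])

lemma T1_reindex: "T1 f ==> T1 (%s. f (%n. s (r n)))"
proof -
  assume "T1 f"
  obtain g where g: "Tm g" "\<forall>s. f s \<le> g s" using T1_bound[OF \<open>T1 f\<close>] by auto
  have "Sg (Suc 0) (%s. s 0 = f (%n. s (Suc (r n))))"
    using Sg_reindex[OF T1_graph[OF \<open>T1 f\<close>], of "case_nat 0 (%n. Suc (r n))"] by simp
  moreover have "\<exists>g. Tm g \<and> (\<forall>s. f (%n. s (r n)) \<le> g s)"
    by (rule exI[of _ "%s. g (%n. s (r n))"]) (use g(2) Tm_reindex[OF g(1), of r] in simp)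
  ultimately show ?thesis unfolding T1_def by simp
qed

lemma T1_op2:
  assumes "T1 f" "T1 g" "\<And>a b. Tm a ==> Tm b ==> Tm (%s. F (a s) (b s))"
    "\<And>x y x' y'. x \<le> x' ==> y \<le> y' ==> F x y \<le> F x' y'"
  shows "T1 (%s. F (f s) (g s))"
  unfolding T1_def
proof
  obtain a where a: "Tm a" "\<forall>s. f s \<le> a s" using T1_bound[OF assms(1)] by auto
  obtain b where b: "Tm b" "\<forall>s. g s \<le> b s" using T1_bound[OF assms(2)] by auto
  show "\<exists>h. Tm h \<and> (\<forall>s. F (f s) (g s) \<le> h s)"
    by (rule exI[of _ "%s. F (a s) (b s)"]) (use assms(3)[OF a(1) b(1)] assms(4)[OF a(2)[rule_format] b(2)[rule_format]] in simp)
  have "Sg (Suc 0) (%s. s (Suc (Suc 0)) = F (s (Suc 0)) (s 0))" by (intro Sg_eq0 assms(3) Tm_var)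
  from Sg_sub[OF T1_reindex[OF assms(2), of "%n. Suc (Suc n)"], where P = "%x s. s (Suc 0) = F (s 0) x", OF this]
  have "Sg (Suc 0) (%s. s (Suc 0) = F (s 0) (g (%n. s (Suc (Suc n)))))" .
  from Sg_sub[OF T1_reindex[OF assms(1), of "%n. Suc n"], where P = "%x s. s 0 = F x (g (%n. s (Suc n)))", OF this]
  show "Sg (Suc 0) (%s. s 0 = F (f (%n. s (Suc n))) (g (%n. s (Suc n))))" .
qed

text \<open>For functions such as \<open>hi\<close> and \<open>lo\<close> that are given by a graph
  rather than a term: the bound by the first argument replaces monotonicity.\<close>

lemma T1_fun2:
  assumes "T1 f" "T1 g" "Sg (Suc 0) (%s. s 0 = F (s (Suc 0)) (s (Suc (Suc 0))))" "\<And>x y. F x y \<le> x"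
  shows "T1 (%s. F (f s) (g s))"
  unfolding T1_def
proof
  obtain a where a: "Tm a" "\<forall>s. f s \<le> a s" using T1_bound[OF assms(1)] by auto
  show "\<exists>h. Tm h \<and> (\<forall>s. F (f s) (g s) \<le> h s)"
    by (rule exI[of _ a]) (use a(1) order_trans[OF assms(4) a(2)[rule_format]] in simp)
  have "Sg (Suc 0) (%s. s (Suc (Suc 0)) = F (s (Suc 0)) (s 0))"
    using Sg_reindex[OF assms(3), of "%n. 2 - n"] by (simp add: numeral_2_eq_2)
  from Sg_sub[OF T1_reindex[OF assms(2), of "%n. Suc (Suc n)"], where P = "%x s. s (Suc 0) = F (s 0) x", OF this]
  have "Sg (Suc 0) (%s. s (Suc 0) = F (s 0) (g (%n. s (Suc (Suc n)))))" .
  from Sg_sub[OF T1_reindex[OF assms(1), of "%n. Suc n"], where P = "%x s. s 0 = F x (g (%n. s (Suc n)))", OF this]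
  show "Sg (Suc 0) (%s. s 0 = F (f (%n. s (Suc n))) (g (%n. s (Suc n))))" .
qed

named_theorems def_intros

lemma T1_var [def_intros]: "T1 (%s. s i)" by (rule T1_tm[OF Tm_var])
lemma T1_const [def_intros]: "T1 (%s. c)" by (rule T1_tm[OF Tm_const])
lemma T1_plus [def_intros]: "T1 f ==> T1 g ==> T1 (%s. f s + g s)"
  by (rule T1_op2) (auto intro: Tm_plus add_mono)
lemma T1_times [def_intros]: "T1 f ==> T1 g ==> T1 (%s. f s * g s)"
  by (rule T1_op2) (auto intro: Tm_times mult_mono)
lemma T1_smash [def_intros]: "T1 f ==> T1 g ==> T1 (%s. smash (f s) (g s))"
  by (rule T1_op2) (auto intro: Tm_smash smash_mono)
lemma T1_len [def_intros]: "T1 f ==> T1 (%s. len (f s))"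
  by (rule T1_op2[of f f "%x y. len x"]) (auto intro: Tm_len len_mono)
lemma T1_half [def_intros]: "T1 f ==> T1 (%s. half (f s))"
  by (rule T1_op2[of f f "%x y. half x"]) (auto intro: Tm_half half_mono)

lemma Sg_eq [def_intros]: "T1 f ==> T1 g ==> Sg (Suc k) (%s. f s = g s)"
  by (rule Sg_sub[of f k "%x s. x = g s"]) (auto simp: T1_def intro: Sg_lift)

lemma Pg_eq [def_intros]: "T1 f ==> T1 g ==> Pg (Suc k) (%s. f s = g s)"
proof -
  assume *: "T1 f" "T1 g"
  have "Pg (Suc k) (%s. s (Suc 0) = s 0)" by (intro Pg_eq0 Tm_var)
  from Pg_sub[OF T1_reindex[OF *(2), of Suc], where P = "%x s. s 0 = x", OF this]
  have "Pg (Suc k) (%s. s 0 = g (%n. s (Suc n)))" .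
  from Pg_sub[OF *(1), where P = "%x s. x = g s", OF this] show ?thesis .
qed

lemma Sg_le [def_intros]: "T1 f ==> T1 g ==> Sg (Suc k) (%s. f s \<le> g s)"
  and Pg_le [def_intros]: "T1 f ==> T1 g ==> Pg (Suc k) (%s. f s \<le> g s)"
proof -
  assume *: "T1 f" "T1 g"
  have "Sg (Suc k) (%s. s (Suc 0) \<le> s 0)" "Pg (Suc k) (%s. s (Suc 0) \<le> s 0)"
    by (intro Sg_le0 Pg_le0 Tm_var)+
  from Sg_sub[OF T1_reindex[OF *(2), of Suc], where P = "%x s. s 0 \<le> x", OF this(1)]
    Pg_sub[OF T1_reindex[OF *(2), of Suc], where P = "%x s. s 0 \<le> x", OF this(2)]
  have "Sg (Suc k) (%s. s 0 \<le> g (%n. s (Suc n)))" "Pg (Suc k) (%s. s 0 \<le> g (%n. s (Suc n)))" .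
  from Sg_sub[OF *(1), where P = "%x s. x \<le> g s", OF this(1)] Pg_sub[OF *(1), where P = "%x s. x \<le> g s", OF this(2)]
  show "Sg (Suc k) (%s. f s \<le> g s)" "Pg (Suc k) (%s. f s \<le> g s)" .
qed

lemma Sg_less [def_intros]: "T1 f ==> T1 g ==> Sg (Suc k) (%s. f s < g s)"
  unfolding less_iff by (intro def_intros)
lemma Pg_less [def_intros]: "T1 f ==> T1 g ==> Pg (Suc k) (%s. f s < g s)"
  unfolding less_iff by (intro def_intros)

lemmas [def_intros] = Sg_conj Sg_disj Sg_neg Sg_imp Pg_conj Pg_disj Pg_neg Pg_imp

lemma Sg_bex [def_intros]:
  assumes "T1 g" "Sg (Suc k) (%s. P (s 0) (%n. s (Suc n)))"
  shows "Sg (Suc k) (%s. \<exists>x\<le>g s. P x s)"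
proof -
  obtain b where b: "Tm b" "\<forall>s. g s \<le> b s" using T1_bound[OF assms(1)] by auto
  have "Sg (Suc k) (%s. \<exists>x\<le>b s. x \<le> g s \<and> P x s)"
    by (intro Sg_bex0 b(1) Sg_conj Sg_le T1_var assms(2)) (rule T1_reindex[OF assms(1)])
  then show ?thesis by (rule Sg_cong) (use b(2) order_trans in \<open>metis (full_types)\<close>)
qed

lemma Sg_sball [def_intros]:
  assumes "T1 g" "Sg (Suc k) (%s. P (s 0) (%n. s (Suc n)))"
  shows "Sg (Suc k) (%s. \<forall>x\<le>len (g s). P x s)"
proof -
  obtain b where b: "Tm b" "\<forall>s. g s \<le> b s" using T1_bound[OF assms(1)] by auto
  have "Sg (Suc k) (%s. \<forall>x\<le>len (b s). x \<le> len (g s) --> P x s)"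
    by (intro Sg_sball0 b(1) Sg_imp Pg_le T1_var T1_len assms(2)) (rule T1_reindex[OF assms(1)])
  then show ?thesis by (rule Sg_cong) (use b(2) order_trans len_mono in metis)
qed

lemma Pg_ball [def_intros]:
  assumes "T1 g" "Pg (Suc k) (%s. P (s 0) (%n. s (Suc n)))"
  shows "Pg (Suc k) (%s. \<forall>x\<le>g s. P x s)"
  using Sg_bex[of g k "%x s. \<not> P x s"] assms by (simp add: Pg_iff)

lemma Pg_sbex [def_intros]:
  assumes "T1 g" "Pg (Suc k) (%s. P (s 0) (%n. s (Suc n)))"
  shows "Pg (Suc k) (%s. \<exists>x\<le>len (g s). P x s)"
  using Sg_sball[of g k "%x s. \<not> P x s"] assms by (simp add: Pg_iff)

lemma Sg_bool: "Sg (Suc k) (%s. b)"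
proof (cases b)
  case True
  have "Sg (Suc k) (%s. s 0 = s 0)" by (intro def_intros)
  then show ?thesis using True by simp
next
  case False
  have "Sg (Suc k) (%s. \<not> s 0 = s 0)" by (intro def_intros)
  then show ?thesis using False by simp
qed

subsection \<open>Induction principles\<close>

text \<open>A \<Sigma>1 predicate is both \<Sigma>2 and \<Pi>2, as the doubling argument
  demands.\<close>

lemma IND:
  assumes "Sg (Suc 0) (%s. R (s 0))" "R 0" "\<And>x. R x ==> R (x + 1)"
  shows "R a"
  by (rule IND_suc[of R]) (auto intro: assms Sg_up Sg_Pg simp: suc_eq)

text \<open>Halving a number lowers its length by one, so induction on notation for
  \<open>Q (len x)\<close> is induction along lengths.\<close>

lemma LIND:
  assumes "Pg (Suc (Suc 0)) (%s. Q (s 0))" "Q 0" "\<And>i. Log i ==> Q i ==> Q (i + 1)" "Log i"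
  shows "Q i"
proof -
  have "Q (len x)" for x
  proof (rule PIND_Pg[of "%x. Q (len x)"])
    show "Pg (Suc (Suc 0)) (%s. Q (len (s 0)))"
      by (rule Pg_sub[where P = "%x s. Q x", OF T1_len[OF T1_var]]) (rule assms(1))
    show "Q (len x)" if "Q (len (half x))" for x
      using that assms(3)[of "len (half x)"] len_pos[of x] by (cases "x = 0") auto
  qed (use assms(2) in simp)
  moreover obtain x where "i = len x" using assms(4) Log_iff by auto
  ultimately show ?thesis by simp
qed

lemma LIND_Sg:
  assumes "Sg (Suc (Suc 0)) (%s. Q (s 0))" "Q 0" "\<And>i. Log i ==> Q i ==> Q (i + 1)" "Log i"
  shows "Q i"
proof -
  have "Q (len x)" for x
  proof (rule PIND_mm_Sg[of "%x. Q (len x)"])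
    show "Sg (Suc (Suc 0)) (%s. Q (len (s 0)))"
      by (rule Sg_sub[where P = "%x s. Q x", OF T1_len[OF T1_var]]) (rule assms(1))
    show "Q (len x)" if "Q (len (half x))" for x
      using that assms(3)[of "len (half x)"] len_pos[of x] by (cases "x = 0") auto
  qed (use assms(2) in simp)
  moreover obtain x where "i = len x" using assms(4) Log_iff by auto
  ultimately show ?thesis by simp
qed

text \<open>The bound \<open>a\<close> keeps the quantifier over shorter words bounded, so the
  course-of-values hypothesis is still \<Pi>2. Most later inductions on words, terms and derivations
  are instances with \<open>a = W\<close>.\<close>

lemma len_induct:
  assumes "Pg (Suc (Suc 0)) (%s. Q (s 0))" "x \<le> a"
    "\<And>x. x \<le> a ==> (\<And>y. y \<le> a ==> len y < len x ==> Q y) ==> Q x"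
  shows "Q x"
proof -
  have "\<forall>x\<le>a. len x \<le> i --> Q x" if "Log i" for i
  proof (rule LIND[of "%i. \<forall>x\<le>a. len x \<le> i --> Q x", OF _ _ _ that])
    show "Pg (Suc (Suc 0)) (%s. \<forall>x\<le>a. len x \<le> s 0 --> Q x)"
      by (intro def_intros assms(1))
    show "\<forall>x\<le>a. len x \<le> 0 --> Q x" by (intro allI impI, rule assms(3)) auto
    show "\<forall>x\<le>a. len x \<le> i + 1 --> Q x" if IH: "\<forall>x\<le>a. len x \<le> i --> Q x" for i
    proof (intro allI impI)
      fix x assume x: "x \<le> a" "len x \<le> i + 1"
      show "Q x"
      proof (rule assms(3)[OF x(1)])
        fix y assume "y \<le> a" "len y < len x"
        then have "len y \<le> i" using order_less_le_trans[OF _ x(2)] le_iff by auto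
        then show "Q y" using IH \<open>y \<le> a\<close> by simp
      qed
    qed
  qed
  then show ?thesis using assms(2) by (meson Log_len order_refl)
qed

text \<open>Without a longest witness, \<Sigma>2 induction would find witnesses of length at least
  \<open>i\<close> for every \<open>i\<close> in \<open>Log\<close>, including
  \<open>len a + 1\<close>, although all of them are below \<open>a\<close>.\<close>

lemma longest:
  assumes "Sg (Suc (Suc 0)) (%s. P (s 0))" "P v" "\<And>v. P v ==> v \<le> a"
  shows "\<exists>v. P v \<and> (\<forall>u. P u --> len u \<le> len v)"
proof (rule ccontr)
  assume no: "\<nexists>v. P v \<and> (\<forall>u. P u --> len u \<le> len v)"
  have "\<exists>v\<le>a. P v \<and> i \<le> len v" if "Log i" for i
  proof (rule LIND_Sg[of "%i. \<exists>v\<le>a. P v \<and> i \<le> len v", OF _ _ _ that])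
    show "Sg (Suc (Suc 0)) (%s. \<exists>v\<le>a. P v \<and> s 0 \<le> len v)" by (intro def_intros assms(1))
    show "\<exists>v\<le>a. P v \<and> 0 \<le> len v" using assms(2,3) by auto
    show "\<exists>v\<le>a. P v \<and> i + 1 \<le> len v" if IH: "\<exists>v\<le>a. P v \<and> i \<le> len v" for i
    proof -
      obtain v where v: "P v" "i \<le> len v" using IH by auto
      then obtain u where "P u" "len v < len u" using no by (meson not_le)
      then show ?thesis using v(2) assms(3) less_iff[of i "len u"] by (auto intro!: exI[of _ u])
    qed
  qed
  from this[of "len a + 1"] obtain v where "v \<le> a" "len a + 1 \<le> len v" by (auto simp: Log_Suc)
  then show False using len_mono[of v a] by (simp flip: less_iff)
qed

subsection \<open>Splitting numbers\<close>

lemma div_ex: "d \<noteq> 0 ==> \<exists>q r. x = q * d + r \<and> r < (d :: mm)"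
proof -
  assume "d \<noteq> 0"
  have "\<exists>q\<le>x. \<exists>r\<le>x. x = q * d + r \<and> r < d"
  proof (rule IND[of "%x. \<exists>q\<le>x. \<exists>r\<le>x. x = q * d + r \<and> r < d"])
    show "Sg (Suc 0) (%s. \<exists>q\<le>s 0. \<exists>r\<le>s 0. s 0 = q * d + r \<and> r < d)" by (intro def_intros)
    show "\<exists>q\<le>0. \<exists>r\<le>0. 0 = q * d + r \<and> r < d" using \<open>d \<noteq> 0\<close> by (simp add: mm_pos)
    fix x assume "\<exists>q\<le>x. \<exists>r\<le>x. x = q * d + r \<and> r < d"
    then obtain q r where qr: "q \<le> x" "r \<le> x" "x = q * d + r" "r < d" by blast
    show "\<exists>q\<le>x + 1. \<exists>r\<le>x + 1. x + 1 = q * d + r \<and> r < d"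
    proof (cases "r + 1 = d")
      case True
      then have "x + 1 = q * d + d" using qr(3) by (simp add: add.assoc)
      then have "x + 1 = (q + 1) * d + 0" by (simp add: distrib_right)
      moreover have "q + 1 \<le> x + 1" "0 \<le> x + 1" "0 < d" using qr \<open>d \<noteq> 0\<close> by (auto simp: mm_pos)
      ultimately show ?thesis by blast
    next
      case False
      then have "r + 1 < d" using qr(4) less_iff[of r d] by (simp add: order_less_le)
      moreover have "q \<le> x + 1" "r + 1 \<le> x + 1" using qr(1,2) by (simp_all add: add_increasing2)
      moreover have "x + 1 = q * d + (r + 1)" using qr(3) by (simp add: add.assoc)
      ultimately show ?thesis by blast
    qed
  qed
  then show ?thesis by blast
qed

lemma div_unique:
  fixes d :: mm
  assumes "q * d + r = q' * d + r'" "r < d" "r' < d"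
  shows "q = q' \<and> r = r'"
proof -
  have *: "\<not> q < q'" if "q * d + r = q' * d + r'" "r < d" for q q' r r'
  proof
    assume "q < q'"
    then have "(q + 1) * d \<le> q' * d" by (intro mult_right_mono) (auto simp: less_iff)
    then have "q * d + d \<le> q * d + r" using that(1) by (simp add: distrib_right) (metis add_increasing2 mm_nonneg)
    then show False using that(2) by simp
  qed
  have "q = q'" using *[OF assms(1,2)] *[OF assms(1)[symmetric] assms(3)] by simp
  then show ?thesis using assms(1) by simp
qed

text \<open>Quotient and remainder modulo \<open>2 ^ i\<close>. The default values for
  \<open>i \<ge> len x\<close> are the correct ones when \<open>2 ^ i\<close> exists, and they keep
  both functions total and bounded by \<open>x\<close> when it does not.\<close>

definition hi :: "mm => mm => mm" where
  "hi x i = (if i < len x then THE q. \<exists>r. x = q * ex i + r \<and> r < ex i else 0)"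
definition lo :: "mm => mm => mm" where
  "lo x i = (if i < len x then THE r. \<exists>q. x = q * ex i + r \<and> r < ex i else x)"

lemma hilo_unique:
  assumes "Log i" "x = q * ex i + r" "r < ex i"
  shows "hi x i = q" "lo x i = r"
proof -
  have "hi x i = q \<and> lo x i = r"
  proof (cases "i < len x")
    case True
    have u: "\<And>q' r'. x = q' * ex i + r' \<and> r' < ex i ==> q' = q \<and> r' = r"
      using div_unique[of _ "ex i"] assms(2,3) by metis
    have "(THE q. \<exists>r. x = q * ex i + r \<and> r < ex i) = q"
      by (rule the_equality) (use assms u in blast)+
    moreover have "(THE r. \<exists>q. x = q * ex i + r \<and> r < ex i) = r"
      by (rule the_equality) (use assms u in blast)+
    ultimately show ?thesis using True by (simp add: hi_def lo_def)
  next
    case False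
    then have "x < ex i" using len_le_iff[OF assms(1)] by (simp add: not_less)
    then have "q = 0 \<and> r = x" using div_unique[of q "ex i" r 0 x] assms by simp
    then show ?thesis using False by (simp add: hi_def lo_def)
  qed
  then show "hi x i = q" "lo x i = r" by auto
qed

lemma hilo: "Log i ==> x = hi x i * ex i + lo x i" "Log i ==> lo x i < ex i"
  using div_ex[of "ex i" x] hilo_unique[of i x] by auto

lemma hi_le: "hi x i \<le> x" and lo_le: "lo x i \<le> x"
proof -
  have "hi x i \<le> x \<and> lo x i \<le> x"
  proof (cases "i < len x")
    case True
    then have "Log i" using Log_down[of "len x" i] by auto
    then have "hi x i * 1 \<le> hi x i * ex i" by (intro mult_left_mono) (simp_all add: one_le)
    then show ?thesis using hilo(1)[OF \<open>Log i\<close>, of x] zz_nonneg[of "hi x i * ex i"] zz_nonneg[of "lo x i"] unfolding zify by auto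
  qed (simp add: hi_def lo_def)
  then show "hi x i \<le> x" "lo x i \<le> x" by auto
qed

text \<open>The case distinction keeps the witnesses bounded: only for \<open>i < len x\<close> does
  the power \<open>2 ^ i\<close> lie below \<open>x\<close>.\<close>

lemma hi_graph: "y = hi x i \<longleftrightarrow> (len x \<le> i \<and> y = 0) \<or> (i < len x \<and>
    (\<exists>c\<le>x. \<exists>r\<le>x. is_pow c \<and> len c = i + 1 \<and> x = y * c + r \<and> r < c))"
  and lo_graph: "y = lo x i \<longleftrightarrow> (len x \<le> i \<and> y = x) \<or> (i < len x \<and>
    (\<exists>c\<le>x. \<exists>q\<le>x. is_pow c \<and> len c = i + 1 \<and> x = q * c + y \<and> y < c))"
proof -
  have "(y = hi x i \<longleftrightarrow> (\<exists>c\<le>x. \<exists>r\<le>x. is_pow c \<and> len c = i + 1 \<and> x = y * c + r \<and> r < c)) \<and>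
      (y = lo x i \<longleftrightarrow> (\<exists>c\<le>x. \<exists>q\<le>x. is_pow c \<and> len c = i + 1 \<and> x = q * c + y \<and> y < c))" if "i < len x"
  proof -
    have L: "Log i" using that Log_down[of "len x" i] by auto
    have "ex i \<le> x" using that len_le_iff[OF L, of x] by (meson not_le)
    moreover have "is_pow (ex i)" "len (ex i) = i + 1" using L by (simp_all add: is_pow_ex len_ex)
    ultimately show ?thesis
      using hilo[OF L, of x] hi_le[of x i] lo_le[of x i] hilo_unique[OF L] is_pow_len by metis
  qed
  then show "y = hi x i \<longleftrightarrow> (len x \<le> i \<and> y = 0) \<or> (i < len x \<and>
    (\<exists>c\<le>x. \<exists>r\<le>x. is_pow c \<and> len c = i + 1 \<and> x = y * c + r \<and> r < c))"
  "y = lo x i \<longleftrightarrow> (len x \<le> i \<and> y = x) \<or> (i < len x \<and>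
    (\<exists>c\<le>x. \<exists>q\<le>x. is_pow c \<and> len c = i + 1 \<and> x = q * c + y \<and> y < c))"
    by (cases "i < len x"; auto simp: hi_def lo_def)+
qed

lemma Sg_is_pow [def_intros]: "T1 f ==> Sg (Suc k) (%s. is_pow (f s))"
  and Pg_is_pow [def_intros]: "T1 f ==> Pg (Suc k) (%s. is_pow (f s))"
  unfolding is_pow_def by (intro def_intros; assumption)+

lemma T1_hi [def_intros]: "T1 f ==> T1 g ==> T1 (%s. hi (f s) (g s))"
  by (rule T1_fun2, assumption, assumption, subst hi_graph, intro def_intros, rule hi_le)

lemma T1_lo [def_intros]: "T1 f ==> T1 g ==> T1 (%s. lo (f s) (g s))"
  by (rule T1_fun2, assumption, assumption, subst lo_graph, intro def_intros, rule lo_le)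

section \<open>The free monoid on the powers of two\<close>

section \<open>Words\<close>

lemma ex_le_iff: "Log i ==> ex i \<le> x \<longleftrightarrow> i < len x"
  by (metis len_le_iff not_less)

definition wc :: "mm => mm => mm"  (infixl "@@" 66) where
  "x @@ y = x * smash 1 y + y"

lemma wc_eq: "x @@ y = x * ex (len y) + y"
  by (simp add: wc_def ex_len)

lemma wc_0 [simp]: "0 @@ x = x" "x @@ 0 = x"
  by (simp_all add: wc_eq)

lemma T1_wc [def_intros]: "T1 f ==> T1 g ==> T1 (%s. f s @@ g s)"
  unfolding wc_def by (intro def_intros)

lemma len_wc [simp]: "len (x @@ y) = len x + len y"
proof (cases "x = 0")
  case False
  define i where "i = len (half x)"
  have i: "len x = i + 1" "Log i" using len_pos[OF False] by (simp_all add: i_def)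
  let ?E = "ex (len y)"
  have "x + 1 \<le> ex (len x)" using ex_bounds[of x] by (simp add: less_iff)
  then have "(x + 1) * ?E \<le> ex (len x) * ?E" by (rule mult_right_mono) simp
  moreover have "y < ?E" using ex_bounds[of y] by blast
  ultimately have "x @@ y < ex (len x + len y)"
    by (simp add: ex_add wc_eq distrib_right) (metis add_strict_left_mono order_less_le_trans)
  then have 1: "len (x @@ y) \<le> len x + len y" by (simp add: len_le_iff Log_add)
  have "ex i \<le> x" using ex_le_iff[OF i(2)] i(1) by simp
  then have "ex i * ?E \<le> x * ?E" by (rule mult_right_mono) simp
  then have "ex (i + len y) \<le> x @@ y" using i(2) by (simp add: ex_add wc_eq add_increasing2)
  then have "\<not> len (x @@ y) \<le> i + len y" using i(2) by (simp add: len_le_iff Log_add not_less)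
  then have "len x + len y \<le> len (x @@ y)" using i(1) less_iff[of "i + len y" "len (x @@ y)"]
    by (simp add: not_le ac_simps)
  then show ?thesis using 1 by simp
qed simp

lemma wc_assoc [simp]: "x @@ (y @@ z) = x @@ y @@ z"
proof -
  have "x @@ (y @@ z) = x * ex (len y + len z) + y @@ z" unfolding wc_eq[of x] by simp
  also have "\<dots> = x * (ex (len y) * ex (len z)) + (y * ex (len z) + z)" unfolding wc_eq[of y z] by (simp add: ex_add)
  finally show ?thesis by (simp add: wc_eq algebra_simps)
qed

lemma wc_eq_0 [simp]: "x @@ y = 0 \<longleftrightarrow> x = 0 \<and> y = 0"
  using len_eq_0[of "x @@ y"] by simp

lemma wc_split: "x @@ y = x' @@ y' ==> len y = len y' ==> x = x' \<and> y = y'"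
  unfolding wc_eq using div_unique[of x "ex (len y)" y x' y'] ex_bounds by metis

lemma wc_cancel_right [simp]: "x @@ y = x' @@ y \<longleftrightarrow> x = x'"
  using wc_split by blast

lemma wc_cancel_left [simp]: "x @@ y = x @@ y' \<longleftrightarrow> y = y'"
  by (metis add_left_cancel len_wc wc_split)

lemma wc_cancel_left_0 [simp]: "x @@ y = x \<longleftrightarrow> y = 0"
  by (metis wc_0(2) wc_cancel_left)

lemma hi_wc: "hi (x @@ y) (len y) = x" and lo_wc: "lo (x @@ y) (len y) = y"
  using hilo_unique[of "len y" "x @@ y" x y] ex_bounds[of y] by (auto simp: wc_eq)

lemma wc_hilo: "len (lo x i) = i ==> x = hi x i @@ lo x i"
  using hilo(1)[of i x] Log_len[of "lo x i"] by (simp add: wc_eq)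

text \<open>Levi's lemma: the longer right factor is cut at the length of the shorter one, and
  uniqueness of division by \<open>ex (len y)\<close> compares the pieces.\<close>

lemma levi:
  assumes "x @@ y = x' @@ y'" "len y \<le> len y'"
  shows "\<exists>z. y' = z @@ y \<and> x = x' @@ z"
proof -
  let ?E = "ex (len y)"
  obtain k where k: "len y' = len y + k" using assms(2) le_ex by blast
  have "Log k" using Log_down[OF Log_len[of y'], of k] k by simp
  define q r where "q = hi y' (len y)" and "r = lo y' (len y)"
  have y': "y' = q * ?E + r" "r < ?E" using hilo[of "len y" y'] by (simp_all add: q_def r_def)
  have "x' @@ y' = x' * (ex k * ?E) + y'" using \<open>Log k\<close> by (simp add: wc_eq k ex_add mult.commute)
  also have "\<dots> = (x' * ex k + q) * ?E + r" by (subst y'(1)) (simp add: algebra_simps)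
  finally have "x' @@ y' = (x' * ex k + q) * ?E + r" .
  then have "x = x' * ex k + q \<and> y = r"
    using div_unique[of x ?E y "x' * ex k + q" r] assms(1) y'(2) ex_bounds[of y] by (simp add: wc_eq)
  moreover from this have "y' = q @@ y" using y'(1) by (simp add: wc_eq)
  moreover from this have "len q = k" using k by (simp add: add.commute)
  ultimately show ?thesis by (auto simp: wc_eq)
qed

lemma levi_cases:
  assumes "x @@ y = x' @@ y'"
  obtains z where "y' = z @@ y" "x = x' @@ z" | z where "y = z @@ y'" "x' = x @@ z" "z \<noteq> 0"
proof (cases "len y \<le> len y'")
  case True then show ?thesis using levi[OF assms] that(1) by blast
next
  case False
  then obtain z where z: "y = z @@ y'" "x' = x @@ z" using levi[OF assms[symmetric]] by (meson linear)
  then have "z \<noteq> 0" using False by auto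
  then show ?thesis using z that(2) by blast
qed

subsection \<open>Letters\<close>

definition L :: "nat => mm" where "L k = 2 ^ k"

lemma L_ex: "\<exists>i. Log i \<and> L k = ex i \<and> i = of_nat k"
proof (induction k)
  case (Suc k)
  then obtain i where "Log i" "L k = ex i" "i = of_nat k" by blast
  then show ?case using ex_Suc[of i] Log_Suc[of i] by (auto simp: L_def add.commute)
qed (simp add: L_def)

lemma is_pow_L [simp]: "is_pow (L k)"
  using L_ex is_pow_iff by metis

lemma len_L: "len (L k) = of_nat k + 1"
  using L_ex len_ex by metis

lemma L_inj [simp]: "L j = L k \<longleftrightarrow> j = k"
  using len_L[of j] len_L[of k] by (metis add_right_cancel of_nat_eq_iff)

lemma is_pow_nonzero: "is_pow c ==> c \<noteq> 0"
  using is_pow_iff by auto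

lemma L_nonzero [simp]: "L k \<noteq> 0" by (simp add: is_pow_nonzero)

text \<open>If both factors are nonempty, the product exceeds the least number of its length, since
  the leading digit of \<open>y\<close> adds to \<open>x * 2 ^ |y|\<close>. A power of two is that
  least number and so is indecomposable.\<close>

lemma pow_atom:
  assumes "is_pow c" "x @@ y = c"
  shows "x = 0 \<or> y = 0"
proof (rule ccontr)
  assume *: "\<not> (x = 0 \<or> y = 0)"
  define i where "i = len (half x)"
  have i: "len x = i + 1" "Log i" using len_pos[of x] * by (simp_all add: i_def)
  obtain k where k: "Log k" "c = ex k" using assms(1) is_pow_iff by blast
  have "k + 1 = i + 1 + len y" using len_ex[OF k(1)] assms(2) k(2) i(1) len_wc[of x y] by simp
  then have "k = i + len y" by (simp add: ac_simps)
  then have "c = ex i * ex (len y)" using k i by (simp add: ex_add)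
  moreover have "ex i \<le> x" using ex_le_iff[OF i(2)] i(1) by simp
  then have "ex i * ex (len y) \<le> x * ex (len y)" by (rule mult_right_mono) simp
  ultimately have "c < x @@ y" using * by (simp add: wc_eq mm_pos order_le_less_trans)
  then show False using assms(2) by simp
qed

lemma pow_cons:
  assumes "is_pow c" "is_pow c'" "c @@ x = c' @@ x'"
  shows "c = c' \<and> x = x'"
  using assms(3)
proof (cases rule: levi_cases)
  case (1 z) then show ?thesis using pow_atom[OF assms(1)] is_pow_nonzero[OF assms(2)] by fastforce
next
  case (2 z) then show ?thesis using pow_atom[OF assms(2)] is_pow_nonzero[OF assms(1)] by fastforce
qed

lemma L_cons [simp]: "L j @@ x = L k @@ y \<longleftrightarrow> j = k \<and> x = y"
  using pow_cons[OF is_pow_L is_pow_L] by auto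

lemma L_cons_single [simp]: "L j = L k @@ y \<longleftrightarrow> j = k \<and> y = 0" "L k @@ y = L j \<longleftrightarrow> j = k \<and> y = 0"
  using L_cons[of j 0 k y] L_cons[of k y j 0] by auto

subsection \<open>Subwords and prefixes\<close>

definition sub :: "mm => mm => bool" where "sub m w \<longleftrightarrow> (\<exists>a b. w = a @@ m @@ b)"
definition pre :: "mm => mm => bool"  (infix "\<sqsubseteq>" 50) where "x \<sqsubseteq> y \<longleftrightarrow> (\<exists>z. y = x @@ z)"

text \<open>A subword is located by two lengths, over which quantification is sharply bounded. This
  makes the relation available on both sides, as \<Sigma>1 and as \<Pi>1. The test
  \<open>len (lo w j) = j\<close> ensures that the cut loses no leading zeros.\<close>

lemma sub_iff: "sub m w \<longleftrightarrow> (\<exists>j\<le>len w. \<exists>i\<le>len w. len (lo w j) = j \<and> lo (hi w j) i = m \<and> len m = i)"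
proof
  assume "sub m w"
  then obtain a b where "w = a @@ m @@ b" unfolding sub_def by blast
  then show "\<exists>j\<le>len w. \<exists>i\<le>len w. len (lo w j) = j \<and> lo (hi w j) i = m \<and> len m = i"
    using hi_wc[of "a @@ m" b] lo_wc[of "a @@ m" b] lo_wc[of a m]
    by (intro exI[of _ "len b"] conjI exI[of _ "len m"]) (auto simp: add_increasing add_increasing2)
next
  assume "\<exists>j\<le>len w. \<exists>i\<le>len w. len (lo w j) = j \<and> lo (hi w j) i = m \<and> len m = i"
  then obtain i j where "len (lo w j) = j" "lo (hi w j) i = m" "len m = i" by blast
  then have "w = hi w j @@ lo w j" "hi w j = hi (hi w j) i @@ m"
    using wc_hilo[of w j] wc_hilo[of "hi w j" i] by auto
  then show "sub m w" unfolding sub_def by metis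
qed

lemma pre_iff: "x \<sqsubseteq> y \<longleftrightarrow> (\<exists>j\<le>len y. len (lo y j) = j \<and> hi y j = x)"
proof
  assume "x \<sqsubseteq> y"
  then obtain z where "y = x @@ z" unfolding pre_def by blast
  then show "\<exists>j\<le>len y. len (lo y j) = j \<and> hi y j = x"
    by (intro exI[of _ "len z"]) (auto simp: hi_wc lo_wc add_increasing)
next
  assume "\<exists>j\<le>len y. len (lo y j) = j \<and> hi y j = x"
  then show "x \<sqsubseteq> y" unfolding pre_def using wc_hilo by metis
qed

lemma Sg_sub_word [def_intros]: "T1 f ==> T1 g ==> Sg (Suc k) (%s. sub (f s) (g s))"
  and Pg_sub_word [def_intros]: "T1 f ==> T1 g ==> Pg (Suc k) (%s. sub (f s) (g s))"
proof -
  have "Sg (Suc k) (%s. sub (s (Suc 0)) (s 0))" "Pg (Suc k) (%s. sub (s (Suc 0)) (s 0))"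
    unfolding sub_iff
    by (rule Sg_bex[OF T1_len[OF T1_var]] Pg_sbex[OF T1_var], intro def_intros)+
  note * = this
  assume f: "T1 f" and g: "T1 g"
  from Sg_sub[OF T1_reindex[OF g, of Suc], where P = "%x s. sub (s 0) x", OF *(1)]
  have "Sg (Suc k) (%s. sub (s 0) (g (%n. s (Suc n))))" .
  from Sg_sub[OF f, where P = "%x s. sub x (g s)", OF this] show "Sg (Suc k) (%s. sub (f s) (g s))" .
  from Pg_sub[OF T1_reindex[OF g, of Suc], where P = "%x s. sub (s 0) x", OF *(2)]
  have "Pg (Suc k) (%s. sub (s 0) (g (%n. s (Suc n))))" .
  from Pg_sub[OF f, where P = "%x s. sub x (g s)", OF this] show "Pg (Suc k) (%s. sub (f s) (g s))" .
qed

lemma Sg_pre [def_intros]: "T1 f ==> T1 g ==> Sg (Suc k) (%s. f s \<sqsubseteq> g s)"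
  and Pg_pre [def_intros]: "T1 f ==> T1 g ==> Pg (Suc k) (%s. f s \<sqsubseteq> g s)"
proof -
  have "Sg (Suc k) (%s. s (Suc 0) \<sqsubseteq> s 0)" "Pg (Suc k) (%s. s (Suc 0) \<sqsubseteq> s 0)"
    unfolding pre_iff
    by (rule Sg_bex[OF T1_len[OF T1_var]] Pg_sbex[OF T1_var], intro def_intros)+
  note * = this
  assume f: "T1 f" and g: "T1 g"
  from Sg_sub[OF T1_reindex[OF g, of Suc], where P = "%x s. s 0 \<sqsubseteq> x", OF *(1)]
  have "Sg (Suc k) (%s. s 0 \<sqsubseteq> (g (%n. s (Suc n))))" .
  from Sg_sub[OF f, where P = "%x s. x \<sqsubseteq> g s", OF this] show "Sg (Suc k) (%s. f s \<sqsubseteq> g s)" .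
  from Pg_sub[OF T1_reindex[OF g, of Suc], where P = "%x s. s 0 \<sqsubseteq> x", OF *(2)]
  have "Pg (Suc k) (%s. s 0 \<sqsubseteq> (g (%n. s (Suc n))))" .
  from Pg_sub[OF f, where P = "%x s. x \<sqsubseteq> g s", OF this] show "Pg (Suc k) (%s. f s \<sqsubseteq> g s)" .
qed

lemma wc_le: "x \<le> x @@ y" "y \<le> x @@ y"
proof -
  have "x * 1 \<le> x * ex (len y)" by (intro mult_left_mono) (simp_all add: one_le)
  then show "x \<le> x @@ y" "y \<le> x @@ y" by (simp_all add: wc_eq add_increasing2)
qed

lemma sub_le: "sub m w ==> m \<le> w"
  unfolding sub_def by (metis order_trans wc_le)

lemma pre_le: "x \<sqsubseteq> y ==> x \<le> y"
  unfolding pre_def using wc_le by auto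

lemma pre_len: "x \<sqsubseteq> y ==> len x \<le> len y"
  unfolding pre_def by auto

lemma pre_refl [simp]: "x \<sqsubseteq> x" unfolding pre_def by (metis wc_0(2))
lemma pre_0 [simp]: "0 \<sqsubseteq> x" unfolding pre_def by (metis wc_0(1))
lemma pre_0_iff [simp]: "x \<sqsubseteq> 0 \<longleftrightarrow> x = 0" using pre_le[of x 0] by auto
lemma pre_trans: "x \<sqsubseteq> y ==> y \<sqsubseteq> z ==> x \<sqsubseteq> z" unfolding pre_def by (metis wc_assoc)
lemma pre_wc [simp]: "x \<sqsubseteq> x @@ y" unfolding pre_def by blast
lemma pre_wc_iff [simp]: "x @@ y \<sqsubseteq> x @@ z \<longleftrightarrow> y \<sqsubseteq> z"
  unfolding pre_def by (metis wc_assoc wc_cancel_left)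

lemma pre_linear: "x \<sqsubseteq> z ==> y \<sqsubseteq> z ==> x \<sqsubseteq> y \<or> y \<sqsubseteq> x"
  unfolding pre_def by (metis levi_cases)

lemma pre_len_antisym: "x \<sqsubseteq> y ==> len y \<le> len x ==> x = y"
  unfolding pre_def by auto

lemma sub_refl [simp]: "sub x x" unfolding sub_def by (metis wc_0)
lemma sub_trans: "sub x y ==> sub y z ==> sub x z"
  unfolding sub_def by (metis wc_assoc)
lemma sub_left: "sub x (x @@ y)" and sub_right: "sub y (x @@ y)"
  unfolding sub_def by (metis wc_0)+
lemma sub_wcI1: "sub c x ==> sub c (x @@ y)" and sub_wcI2: "sub c y ==> sub c (x @@ y)"
  using sub_trans sub_left sub_right by blast+

text \<open>A letter is an atom, so an occurrence cannot straddle the boundary of two words.\<close>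

lemma sub_pow_wc: "is_pow c ==> sub c (x @@ y) \<longleftrightarrow> sub c x \<or> sub c y"
proof
  assume c: "is_pow c" and "sub c (x @@ y)"
  then obtain a b where "a @@ (c @@ b) = x @@ y" unfolding sub_def by auto
  then show "sub c x \<or> sub c y"
  proof (cases rule: levi_cases)
    case (1 z)
    then show ?thesis unfolding sub_def by auto
  next
    case (2 z)
    have sub: "sub c x" if "z = c @@ u" for u
      using 2(2) that unfolding sub_def by (metis wc_assoc)
    from 2(1) show ?thesis
    proof (cases rule: levi_cases)
      case (1 u)
      then have "z = 0 \<or> u = 0" using pow_atom[OF c, of z u] by simp
      then have "z = c" using 1 \<open>z \<noteq> 0\<close> by auto
      then show ?thesis using \<open>x = a @@ z\<close> sub_right by blast
    next
      case (2 u)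
      then show ?thesis using sub by blast
    qed
  qed
qed (use sub_wcI1 sub_wcI2 in blast)

lemma sub_pow_pow: "is_pow c ==> is_pow d ==> sub c d \<longleftrightarrow> c = d"
proof
  assume c: "is_pow c" "is_pow d" and "sub c d"
  then obtain a b where d: "d = a @@ c @@ b" unfolding sub_def by blast
  then have "a @@ c = 0 \<or> b = 0" using pow_atom[OF c(2)] by metis
  then have "b = 0" using is_pow_nonzero[OF c(1)] by simp
  then show "c = d" using pow_atom[OF c(2), of a c] d is_pow_nonzero[OF c(1)] by auto
qed simp

lemma sub_0 [simp]: "is_pow c ==> \<not> sub c 0"
  using sub_le[of c 0] is_pow_nonzero by auto

section \<open>Reading the arithmetized syntax as predicates on the model\<close>

section \<open>Meaning of the arithmetization\<close>

subsection \<open>Semantic counterparts of the formulas\<close>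

definition s_is_var :: "mm => bool" where "s_is_var x \<longleftrightarrow> is_pow x \<and> L VAR \<le> x"
definition s_unary :: "mm => bool" where "s_unary N \<longleftrightarrow> N + 1 = smash 1 N"
definition s_var :: "mm => mm" where "s_var I = L VAR * smash 1 I"
definition s_app :: "mm => mm => mm" where "s_app f T = f @@ T @@ L END"
definition s_cConst :: "mm => mm" where "s_cConst N = L CNST @@ N @@ L END"
definition s_cProj :: "mm => mm => mm" where "s_cProj I N = L PROJ @@ I @@ L END @@ N @@ L END"
definition s_cComp :: "mm => mm => mm" where "s_cComp g H = L COMP @@ g @@ H @@ L END"
definition s_cRec :: "mm => mm => mm => mm" where "s_cRec ge g0 g1 = L REC @@ ge @@ g0 @@ g1"

definition s_judge :: "nat => mm list => mm" where
  "s_judge k ws = foldl (%a w. a @@ L COMMA @@ w) (L k) ws"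

definition s_entry :: "mm => mm => bool" where
  "s_entry w e \<longleftrightarrow> sub (L SEP @@ e @@ L SEP) w \<and> \<not> sub (L SEP) e"

definition s_step_fun :: "mm => mm => mm => bool" where
  "s_step_fun b v e =
    (e = s_judge FUN [L EPS, 0]
   \<or> e = s_judge FUN [L SUC0, L MARK]
   \<or> e = s_judge FUN [L SUC1, L MARK]
   \<or> (\<exists>N\<le>b. e = s_judge FUN [s_cConst N, N] \<and> s_unary N \<and> L MARK \<le> N)
   \<or> (\<exists>I\<le>b. \<exists>N\<le>b. e = s_judge FUN [s_cProj I N, N] \<and> s_unary I \<and> s_unary N \<and> L MARK \<le> I \<and> I \<le> N)
   \<or> (\<exists>g\<le>b. \<exists>H\<le>b. \<exists>M\<le>b. \<exists>N\<le>b. e = s_judge FUN [s_cComp g H, N] \<and> L MARK \<le> M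
        \<and> s_entry v (s_judge FUN [g, M]) \<and> s_entry v (s_judge FUNS [H, M, N]))
   \<or> (\<exists>ge\<le>b. \<exists>g0\<le>b. \<exists>g1\<le>b. \<exists>N\<le>b. e = s_judge FUN [s_cRec ge g0 g1, N @@ L MARK]
        \<and> s_entry v (s_judge FUN [ge, N])
        \<and> s_entry v (s_judge FUN [g0, N @@ L MARK @@ L MARK])
        \<and> s_entry v (s_judge FUN [g1, N @@ L MARK @@ L MARK]))
   \<or> (\<exists>N\<le>b. e = s_judge FUNS [0, 0, N] \<and> s_unary N)
   \<or> (\<exists>H\<le>b. \<exists>M\<le>b. \<exists>N\<le>b. \<exists>h\<le>b. e = s_judge FUNS [H @@ h, M @@ L MARK, N]
        \<and> s_entry v (s_judge FUNS [H, M, N]) \<and> s_entry v (s_judge FUN [h, N])))"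

definition s_step_term :: "mm => mm => mm => bool" where
  "s_step_term b v e =
    ((\<exists>x\<le>b. e = s_judge TRM [x] \<and> s_is_var x)
   \<or> (\<exists>f\<le>b. \<exists>T\<le>b. \<exists>N\<le>b. e = s_judge TRM [s_app f T]
        \<and> s_entry v (s_judge FUN [f, N]) \<and> s_entry v (s_judge TRMS [T, N]))
   \<or> e = s_judge TRMS [0, 0]
   \<or> (\<exists>T\<le>b. \<exists>N\<le>b. \<exists>t\<le>b. e = s_judge TRMS [T @@ t, N @@ L MARK]
        \<and> s_entry v (s_judge TRMS [T, N]) \<and> s_entry v (s_judge TRM [t]))
   \<or> e = s_judge VARS [0, 0]
   \<or> (\<exists>X\<le>b. \<exists>N\<le>b. e = s_judge VARS [X @@ s_var (N @@ L MARK), N @@ L MARK]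
        \<and> s_entry v (s_judge VARS [X, N]))
   \<or> (\<exists>X\<le>b. \<exists>N\<le>b. e = s_judge APPS [0, X, 0] \<and> s_entry v (s_judge VARS [X, N]))
   \<or> (\<exists>H\<le>b. \<exists>X\<le>b. \<exists>A\<le>b. \<exists>h\<le>b. \<exists>N\<le>b. e = s_judge APPS [H @@ h, X, A @@ s_app h X]
        \<and> s_entry v (s_judge APPS [H, X, A]) \<and> s_entry v (s_judge FUN [h, N])))"

definition s_step_sub :: "mm => mm => mm => bool" where
  "s_step_sub b v e =
    ((\<exists>x\<le>b. \<exists>r\<le>b. e = s_judge SUB [x, x, r, r] \<and> s_is_var x \<and> s_entry v (s_judge TRM [r]))
   \<or> (\<exists>y\<le>b. \<exists>x\<le>b. \<exists>r\<le>b. e = s_judge SUB [y, x, r, y] \<and> s_is_var y \<and> s_is_var x \<and> y \<noteq> x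
        \<and> s_entry v (s_judge TRM [r]))
   \<or> (\<exists>f\<le>b. \<exists>N\<le>b. \<exists>T\<le>b. \<exists>x\<le>b. \<exists>r\<le>b. \<exists>T'\<le>b. e = s_judge SUB [s_app f T, x, r, s_app f T']
        \<and> s_entry v (s_judge FUN [f, N]) \<and> s_entry v (s_judge SUBS [T, x, r, T']))
   \<or> (\<exists>x\<le>b. \<exists>r\<le>b. e = s_judge SUBS [0, x, r, 0] \<and> s_is_var x \<and> s_entry v (s_judge TRM [r]))
   \<or> (\<exists>T\<le>b. \<exists>x\<le>b. \<exists>r\<le>b. \<exists>T'\<le>b. \<exists>t\<le>b. \<exists>t'\<le>b. e = s_judge SUBS [T @@ t, x, r, T' @@ t']
        \<and> s_entry v (s_judge SUBS [T, x, r, T']) \<and> s_entry v (s_judge SUB [t, x, r, t'])))"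

definition s_def_eq :: "mm => mm => mm => mm => bool" where
  "s_def_eq b v t u =
    ((\<exists>N\<le>b. \<exists>X\<le>b. t = s_app (s_cConst N) X \<and> u = s_app (L EPS) 0
        \<and> s_entry v (s_judge FUN [s_cConst N, N]) \<and> s_entry v (s_judge VARS [X, N]))
   \<or> (\<exists>I\<le>b. \<exists>N\<le>b. \<exists>X\<le>b. t = s_app (s_cProj I N) X \<and> u = s_var I \<and> s_unary I
        \<and> s_entry v (s_judge FUN [s_cProj I N, N]) \<and> s_entry v (s_judge VARS [X, N]))
   \<or> (\<exists>g\<le>b. \<exists>H\<le>b. \<exists>M\<le>b. \<exists>N\<le>b. \<exists>X\<le>b. \<exists>A\<le>b. t = s_app (s_cComp g H) X \<and> u = s_app g A \<and> L MARK \<le> M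
        \<and> s_entry v (s_judge FUN [g, M]) \<and> s_entry v (s_judge FUNS [H, M, N])
        \<and> s_entry v (s_judge VARS [X, N]) \<and> s_entry v (s_judge APPS [H, X, A]))
   \<or> (\<exists>ge\<le>b. \<exists>g0\<le>b. \<exists>g1\<le>b. \<exists>N\<le>b. \<exists>X\<le>b.         ( (t = s_app (s_cRec ge g0 g1) (s_app (L EPS) 0 @@ X) \<and> u = s_app ge X)
        \<or> (t = s_app (s_cRec ge g0 g1) (s_app (L SUC0) (s_var 0) @@ X)
             \<and> u = s_app g0 (s_var 0 @@ s_app (s_cRec ge g0 g1) (s_var 0 @@ X) @@ X))
        \<or> (t = s_app (s_cRec ge g0 g1) (s_app (L SUC1) (s_var 0) @@ X)
             \<and> u = s_app g1 (s_var 0 @@ s_app (s_cRec ge g0 g1) (s_var 0 @@ X) @@ X)))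
        \<and> s_entry v (s_judge FUN [ge, N])
        \<and> s_entry v (s_judge FUN [g0, N @@ L MARK @@ L MARK])
        \<and> s_entry v (s_judge FUN [g1, N @@ L MARK @@ L MARK])
        \<and> s_entry v (s_judge VARS [X, N])))"

definition s_node :: "nat => mm => mm => mm => mm" where
  "s_node k t u P = L k @@ t @@ u @@ P"

definition s_step_prf :: "mm => mm => mm => bool" where
  "s_step_prf b v e =
    ((\<exists>t\<le>b. \<exists>u\<le>b. e = s_judge PRF [s_node AX t u 0, t, u] \<and> s_def_eq b v t u)
   \<or> (\<exists>t\<le>b. e = s_judge PRF [s_node REFL t t 0, t, t] \<and> s_entry v (s_judge TRM [t]))
   \<or> (\<exists>p\<le>b. \<exists>t\<le>b. \<exists>u\<le>b. e = s_judge PRF [s_node SYM t u p, t, u] \<and> s_entry v (s_judge PRF [p, u, t]))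
   \<or> (\<exists>p\<le>b. \<exists>q\<le>b. \<exists>t\<le>b. \<exists>u\<le>b. \<exists>r\<le>b. e = s_judge PRF [s_node TRANS t r (p @@ q), t, r]
        \<and> s_entry v (s_judge PRF [p, t, u]) \<and> s_entry v (s_judge PRF [q, u, r]))
   \<or> (\<exists>P\<le>b. \<exists>f\<le>b. \<exists>N\<le>b. \<exists>T\<le>b. \<exists>U\<le>b. e = s_judge PRF [s_node CONG (s_app f T) (s_app f U) P, s_app f T, s_app f U]
        \<and> s_entry v (s_judge FUN [f, N]) \<and> s_entry v (s_judge PRFS [P, T, U, N]))
   \<or> (\<exists>p\<le>b. \<exists>t\<le>b. \<exists>u\<le>b. \<exists>x\<le>b. \<exists>r\<le>b. \<exists>t'\<le>b. \<exists>u'\<le>b. e = s_judge PRF [s_node SUBST t' u' p, t', u']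
        \<and> s_entry v (s_judge PRF [p, t, u])
        \<and> s_entry v (s_judge SUB [t, x, r, t']) \<and> s_entry v (s_judge SUB [u, x, r, u']))
   \<or> e = s_judge PRFS [0, 0, 0, 0]
   \<or> (\<exists>P\<le>b. \<exists>T\<le>b. \<exists>U\<le>b. \<exists>N\<le>b. \<exists>p\<le>b. \<exists>t\<le>b. \<exists>u\<le>b. e = s_judge PRFS [P @@ p, T @@ t, U @@ u, N @@ L MARK]
        \<and> s_entry v (s_judge PRFS [P, T, U, N]) \<and> s_entry v (s_judge PRF [p, t, u])))"

definition s_step :: "mm => mm => mm => bool" where
  "s_step w v e \<longleftrightarrow> s_step_fun w v e \<or> s_step_term w v e \<or> s_step_sub w v e \<or> s_step_prf w v e"

definition s_formation_seq :: "mm => bool" where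
  "s_formation_seq w \<longleftrightarrow> (\<forall>a e b. w = a @@ L SEP @@ e @@ L SEP @@ b \<and> \<not> sub (L SEP) e --> s_step w (a @@ L SEP) e)"

subsection \<open>Denotation\<close>

text \<open>A term in this notation is a family indexed by the quantifier depth. The quantification
  over \<open>ys\<close> evaluates it at every greater depth, which makes denotations survive the
  entry into further quantifiers.\<close>

definition den :: "nat => env => htm => mm => bool" where
  "den d s x a \<longleftrightarrow> (\<forall>ys. tval MM (foldr case_nat ys s) (x (d + length ys)) = a)"

definition means :: "nat => env => hfm => bool => bool" where
  "means d s F R \<longleftrightarrow> holds MM s (F d) = R"

lemma den_up: "den d s x a ==> den (Suc d) (case_nat y s) x a"
  unfolding den_def
proof
  fix ys assume "\<forall>ys. tval MM (foldr case_nat ys s) (x (d + length ys)) = a"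
  from this[rule_format, of "ys @ [y]"]
  show "tval MM (foldr case_nat ys (case_nat y s)) (x (Suc d + length ys)) = a" by simp
qed

lemma den_hvar: "den (Suc d) (case_nat y s) (hvar d) y"
proof -
  have "foldr case_nat ys (case_nat y s) (length ys) = y" for ys
    by (induction ys) auto
  then show ?thesis by (simp add: den_def hvar_def)
qed

lemma den_D: "den d s x a ==> tval MM s (x d) = a"
  unfolding den_def by (metis add.right_neutral foldr_Nil id_apply list.size(3))

lemma tval_letter: "tval MM s (letter k) = L k"
  by (induction k) (simp_all add: L_def MM_simps suc_eq)

lemma den_letter: "den d s \<langle>k\<rangle> (L k)"
  by (simp add: den_def hletter_def tval_letter)

lemma den_nil: "den d s nil 0"
  by (simp add: den_def nil_def MM_simps)

lemma den_cat: "den d s x a ==> den d s y b ==> den d s (x \<frown> y) (a @@ b)"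
  by (simp add: den_def cat_def wc_def MM_simps suc_eq)

lemma den_var: "den d s x a ==> den d s (var x) (s_var a)"
  by (simp add: den_def var_def s_var_def tval_letter MM_simps suc_eq)

lemmas den_base = den_hvar den_letter den_nil den_cat den_var den_up

lemma den_app: "den d s f a ==> den d s T b ==> den d s (app f T) (s_app a b)"
  unfolding app_def s_app_def by (intro den_base)
lemma den_cConst: "den d s f a ==> den d s (cConst f) (s_cConst a)"
  unfolding cConst_def s_cConst_def by (intro den_base)
lemma den_cProj: "den d s f a ==> den d s T b ==> den d s (cProj f T) (s_cProj a b)"
  unfolding cProj_def s_cProj_def by (intro den_base)
lemma den_cComp: "den d s f a ==> den d s T b ==> den d s (cComp f T) (s_cComp a b)"
  unfolding cComp_def s_cComp_def by (intro den_base)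
lemma den_cRec: "den d s f a ==> den d s g b ==> den d s h c ==> den d s (cRec f g h) (s_cRec a b c)"
  unfolding cRec_def s_cRec_def by (intro den_base)
lemma den_node: "den d s f a ==> den d s g b ==> den d s h c ==> den d s (node k f g h) (s_node k a b c)"
  unfolding node_def s_node_def by (intro den_base)

lemma den_foldl: "den d s x a ==> list_all2 (den d s) ws vs ==>
  den d s (foldl (%a w. a \<frown> \<langle>COMMA\<rangle> \<frown> w) x ws) (foldl (%a w. a @@ L COMMA @@ w) a vs)"
proof (induction ws arbitrary: x a vs)
  case (Cons w ws)
  then obtain v vs' where v: "vs = v # vs'" "den d s w v" "list_all2 (den d s) ws vs'"
    by (auto simp: list_all2_Cons1)
  show ?case unfolding v(1) foldl.simps
    by (intro Cons.IH v den_cat den_letter Cons.prems)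
qed simp

lemma den_judge: "list_all2 (den d s) ws vs ==> den d s (judge k ws) (s_judge k vs)"
  unfolding judge_def s_judge_def by (intro den_foldl den_letter)

lemma den_list: "list_all2 (den d s) [] []"
  "den d s x a ==> list_all2 (den d s) xs as ==> list_all2 (den d s) (x # xs) (a # as)"
  by auto

lemma means_eq: "den d s x a ==> den d s y b ==> means d s (x \<doteq> y) (a = b)"
  by (simp add: means_def hEq_def den_D)
lemma means_le: "den d s x a ==> den d s y b ==> means d s (x \<preceq> y) (a \<le> b)"
  by (simp add: means_def hLeq_def den_D MM_simps)
lemma means_neg: "means d s F P ==> means d s (\<not>\<^sub>h F) (\<not> P)"
  by (simp add: means_def hNeg_def)
lemma means_conj: "means d s F P ==> means d s G Q ==> means d s (F \<and>\<^sub>h G) (P \<and> Q)"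
  by (simp add: means_def hAnd_def)
lemma means_disj: "means d s F P ==> means d s G Q ==> means d s (F \<or>\<^sub>h G) (P \<or> Q)"
  by (simp add: means_def hOr_def)
lemma means_imp: "means d s F P ==> means d s G Q ==> means d s (F \<longrightarrow>\<^sub>h G) (P --> Q)"
  by (simp add: means_def hImp_def)
lemma means_bex: "den d s b B ==> (\<And>x. means (Suc d) (case_nat x s) (P (hvar d)) (R x)) ==>
    means d s (bex b P) (\<exists>x\<le>B. R x)"
  by (simp add: means_def bex_def BExists_def den_D MM_simps)
lemma means_ball: "den d s b B ==> (\<And>x. means (Suc d) (case_nat x s) (P (hvar d)) (R x)) ==>
    means d s (ball b P) (\<forall>x\<le>B. R x)"
  by (simp add: means_def ball_def BForall_def den_D MM_simps)
lemma means_hEx: "(\<And>x. means (Suc d) (case_nat x s) (P (hvar d)) (R x)) ==> means d s (hEx P) (\<exists>x. R x)"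
  by (simp add: means_def hEx_def)

lemma means_is_var: "den d s x a ==> means d s (is_var x) (s_is_var a)"
  unfolding is_var_def s_is_var_def is_pow_def
  by (simp add: means_def hAnd_def hEq_def hLeq_def hletter_def tval_letter den_D MM_simps suc_eq)

lemma means_unary: "den d s x a ==> means d s (unary x) (s_unary a)"
  unfolding unary_def s_unary_def by (simp add: means_def hEq_def den_D MM_simps suc_eq)

lemma means_cong: "means d s F P ==> P = Q ==> means d s F Q" by simp

lemma means_no_sep: "den d s e E ==> means d s (no_sep e) (\<not> sub (L SEP) E)"
proof (rule means_cong)
  assume "den d s e E"
  then show "means d s (no_sep e) (\<not> (\<exists>a\<le>E. \<exists>b\<le>E. E = a @@ L SEP @@ b))"
    unfolding no_sep_def by (intro means_neg means_bex means_eq den_base)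
  show "(\<not> (\<exists>a\<le>E. \<exists>b\<le>E. E = a @@ L SEP @@ b)) = (\<not> sub (L SEP) E)"
    unfolding sub_def by (metis order_trans wc_le)
qed

lemma means_entry: "den d s w W ==> den d s e E ==> means d s (entry w e) (s_entry W E)"
proof (rule means_cong)
  assume "den d s w W" "den d s e E"
  then show "means d s (entry w e) ((\<exists>a\<le>W. \<exists>b\<le>W. W = a @@ L SEP @@ E @@ L SEP @@ b) \<and> \<not> sub (L SEP) E)"
    unfolding entry_def by (intro means_conj means_no_sep means_bex means_eq den_base)
  have "(\<exists>a\<le>W. \<exists>b\<le>W. W = a @@ L SEP @@ E @@ L SEP @@ b) \<longleftrightarrow> (\<exists>a b. W = a @@ L SEP @@ E @@ L SEP @@ b)"
    by (metis order_trans wc_le)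
  then show "((\<exists>a\<le>W. \<exists>b\<le>W. W = a @@ L SEP @@ E @@ L SEP @@ b) \<and> \<not> sub (L SEP) E) = s_entry W E"
    unfolding s_entry_def sub_def by simp
qed

lemmas means_intros = means_eq means_le means_neg means_conj means_disj means_bex means_is_var means_unary
  means_entry den_hvar den_letter den_nil den_cat den_var den_app den_cConst den_cProj den_cComp den_cRec
  den_node den_judge den_list den_up

lemma means_step_fun: "den d s b B ==> den d s v V ==> den d s e E ==>
  means d s (step_fun b v e) (s_step_fun B V E)"
  unfolding step_fun_def s_step_fun_def by (intro means_intros)

lemma means_step_term: "den d s b B ==> den d s v V ==> den d s e E ==>
  means d s (step_term b v e) (s_step_term B V E)"
  unfolding step_term_def s_step_term_def by (intro means_intros)

lemma means_step_sub: "den d s b B ==> den d s v V ==> den d s e E ==>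
  means d s (step_sub b v e) (s_step_sub B V E)"
  unfolding step_sub_def s_step_sub_def by (intro means_intros)

lemma means_def_eq: "den d s b B ==> den d s v V ==> den d s t E ==> den d s u F ==>
  means d s (def_eq b v t u) (s_def_eq B V E F)"
  unfolding def_eq_def s_def_eq_def by (intro means_intros)

lemma means_step_prf: "den d s b B ==> den d s v V ==> den d s e E ==>
  means d s (step_prf b v e) (s_step_prf B V E)"
  unfolding step_prf_def s_step_prf_def by (intro means_def_eq means_intros)

lemma means_formation_seq: "den d s w W ==> means d s (formation_seq w) (s_formation_seq W)"
proof (rule means_cong)
  assume "den d s w W"
  then show "means d s (formation_seq w) (\<forall>a\<le>W. \<forall>e\<le>W. \<forall>b\<le>W. W = a @@ L SEP @@ e @@ L SEP @@ b \<and> \<not> sub (L SEP) e -->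
      s_step_fun W (a @@ L SEP) e \<or> s_step_term W (a @@ L SEP) e \<or> s_step_sub W (a @@ L SEP) e \<or> s_step_prf W (a @@ L SEP) e)"
    unfolding formation_seq_def
    by (intro means_ball means_imp means_no_sep means_step_fun means_step_term means_step_sub means_step_prf
        means_intros)
  have "W = a @@ L SEP @@ e @@ L SEP @@ b ==> a \<le> W \<and> e \<le> W \<and> b \<le> W" for a e b
    using sub_le[of a W] sub_le[of e W] sub_le[of b W]
    by (auto intro!: sub_wcI1 sub_right) (auto intro!: sub_wcI1 sub_left)
  then show "(\<forall>a\<le>W. \<forall>e\<le>W. \<forall>b\<le>W. W = a @@ L SEP @@ e @@ L SEP @@ b \<and> \<not> sub (L SEP) e -->
      s_step_fun W (a @@ L SEP) e \<or> s_step_term W (a @@ L SEP) e \<or> s_step_sub W (a @@ L SEP) e \<or> s_step_prf W (a @@ L SEP) e)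
    = s_formation_seq W"
    unfolding s_formation_seq_def s_step_def by (metis (no_types, lifting))
qed

definition eps_code :: mm where "eps_code = s_app (L EPS) 0"
definition s1_eps_code :: mm where "s1_eps_code = s_app (L SUC1) eps_code"

lemma means_Con: "holds MM s Con_PVm \<longleftrightarrow>
  \<not> (\<exists>p w. s_formation_seq w \<and> s_entry w (s_judge PRF [p, eps_code, s1_eps_code]))"
proof -
  have 1: "den d s (gnum (App Eps [])) eps_code" for d s
  proof -
    have "gnum (App Eps []) = nil \<frown> \<langle>EPS\<rangle> \<frown> \<langle>END\<rangle>" by (simp add: gnum_def)
    moreover have "eps_code = 0 @@ L EPS @@ L END" by (simp add: eps_code_def s_app_def)
    ultimately show ?thesis by (metis den_cat den_letter den_nil)
  qed
  have 2: "den d s (gnum (App Succ1 [App Eps []])) s1_eps_code" for d s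
  proof -
    have "gnum (App Succ1 [App Eps []]) = nil \<frown> \<langle>SUC1\<rangle> \<frown> \<langle>EPS\<rangle> \<frown> \<langle>END\<rangle> \<frown> \<langle>END\<rangle>" by (simp add: gnum_def)
    moreover have "s1_eps_code = 0 @@ L SUC1 @@ L EPS @@ L END @@ L END"
      by (simp add: s1_eps_code_def eps_code_def s_app_def)
    ultimately show ?thesis by (metis den_cat den_letter den_nil)
  qed
  have "means 0 s (\<not>\<^sub>h hEx (%p. derivation p (gnum (App Eps [])) (gnum (App Succ1 [App Eps []]))))
     (\<not> (\<exists>p w. s_formation_seq w \<and> s_entry w (s_judge PRF [p, eps_code, s1_eps_code])))"
    unfolding derivation_def
    by (intro means_neg means_hEx means_conj means_formation_seq means_entry den_judge den_list 1 2 den_hvar den_up)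
  then show ?thesis by (simp add: means_def Con_PVm_def)
qed

section \<open>Inversion of judgements in a formation sequence\<close>

section \<open>Formation sequences\<close>

lemma T1_codes [def_intros]:
  "T1 f ==> T1 (%s. s_var (f s))"
  "T1 f ==> T1 g ==> T1 (%s. s_app (f s) (g s))"
  "T1 f ==> T1 (%s. s_cConst (f s))"
  "T1 f ==> T1 g ==> T1 (%s. s_cProj (f s) (g s))"
  "T1 f ==> T1 g ==> T1 (%s. s_cComp (f s) (g s))"
  "T1 f ==> T1 g ==> T1 h ==> T1 (%s. s_cRec (f s) (g s) (h s))"
  "T1 f ==> T1 g ==> T1 h ==> T1 (%s. s_node k (f s) (g s) (h s))"
  unfolding s_var_def s_app_def s_cConst_def s_cProj_def s_cComp_def s_cRec_def s_node_def
  by (intro def_intros; assumption)+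

lemma T1_judge [def_intros]:
  "T1 f ==> T1 (%s. s_judge k [f s])"
  "T1 f ==> T1 g ==> T1 (%s. s_judge k [f s, g s])"
  "T1 f ==> T1 g ==> T1 h ==> T1 (%s. s_judge k [f s, g s, h s])"
  "T1 f ==> T1 g ==> T1 h ==> T1 h' ==> T1 (%s. s_judge k [f s, g s, h s, h' s])"
  unfolding s_judge_def foldl.simps by (intro def_intros; assumption)+

lemma Sg_syntax [def_intros]:
  "T1 f ==> T1 g ==> Sg (Suc k) (%s. s_entry (f s) (g s))"
  "T1 f ==> Sg (Suc k) (%s. s_is_var (f s))"
  "T1 f ==> Sg (Suc k) (%s. s_unary (f s))"
  unfolding s_entry_def s_is_var_def s_unary_def by (intro def_intros; assumption)+

lemma Pg_syntax [def_intros]: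
  "T1 f ==> T1 g ==> Pg (Suc k) (%s. s_entry (f s) (g s))"
  "T1 f ==> Pg (Suc k) (%s. s_is_var (f s))"
  "T1 f ==> Pg (Suc k) (%s. s_unary (f s))"
  unfolding s_entry_def s_is_var_def s_unary_def by (intro def_intros; assumption)+

subsection \<open>Judgements are uniquely decomposable\<close>

text \<open>Judgements are read by cutting at \<open>COMMA\<close>, so their components must avoid
  it. Formation sequences do not demand this outright; it is derived for all relevant entries in
  \<open>entry_clean\<close>.\<close>

definition clean :: "mm => bool" where "clean x \<longleftrightarrow> \<not> sub (L COMMA) x"

lemma Sg_clean [def_intros]: "T1 f ==> Sg (Suc k) (%s. clean (f s))"
  and Pg_clean [def_intros]: "T1 f ==> Pg (Suc k) (%s. clean (f s))"
  unfolding clean_def by (intro def_intros; assumption)+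

lemma clean_wc [simp]: "clean (x @@ y) \<longleftrightarrow> clean x \<and> clean y"
  by (simp add: clean_def sub_pow_wc)
lemma clean_L [simp]: "clean (L k) \<longleftrightarrow> k \<noteq> COMMA"
  by (auto simp: clean_def sub_pow_pow)
lemma clean_0 [simp]: "clean 0" by (simp add: clean_def)

lemma clean_pow: "is_pow c ==> c \<noteq> L COMMA ==> clean c"
  by (auto simp: clean_def sub_pow_pow)

fun join :: "mm list => mm" where
  "join [] = 0"
| "join [w] = w"
| "join (w # v # ws) = w @@ L COMMA @@ join (v # ws)"

lemma judge_join: "foldl (%a w. a @@ L COMMA @@ w) a (w # ws) = a @@ L COMMA @@ join (w # ws)"
proof (induction ws arbitrary: a w)
  case (Cons v ws)
  have "foldl (%a w. a @@ L COMMA @@ w) a (w # v # ws)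
      = foldl (%a w. a @@ L COMMA @@ w) (a @@ L COMMA @@ w) (v # ws)" by simp
  also have "\<dots> = a @@ L COMMA @@ w @@ L COMMA @@ join (v # ws)" by (rule Cons.IH)
  finally show ?case by simp
qed simp

lemma s_judge_kind: "s_judge k ws = s_judge k' ws' ==> k = k'"
proof -
  have "\<exists>r. s_judge k ws = L k @@ r" for k ws
  proof (cases ws)
    case Nil
    then have "s_judge k ws = L k @@ 0" by (simp add: s_judge_def)
    then show ?thesis by blast
  next
    case (Cons w vs)
    then have "s_judge k ws = L k @@ (L COMMA @@ join ws)" unfolding s_judge_def using judge_join by simp
    then show ?thesis by blast
  qed
  then show "s_judge k ws = s_judge k' ws' ==> k = k'" by (metis L_cons)
qed

lemma comma_split:
  assumes "x @@ L COMMA @@ y = x' @@ L COMMA @@ y'" "clean x'"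
  shows "x = x' \<and> y = y' \<or> (\<exists>u. x = x' @@ L COMMA @@ u \<and> y' = u @@ L COMMA @@ y)"
proof -
  have "x @@ (L COMMA @@ y) = x' @@ (L COMMA @@ y')" using assms(1) by simp
  then show ?thesis
  proof (cases rule: levi_cases)
    case (1 z)
    show ?thesis
    proof (cases "z = 0")
      case False
      from 1(1) show ?thesis
      proof (cases rule: levi_cases)
        case (1 u)
        have "L COMMA = z @@ u" by fact
        then have "z = 0 \<or> u = 0" using pow_atom[OF is_pow_L] by metis
        then have "u = 0" using False by simp
        then show ?thesis using 1 \<open>x = x' @@ z\<close> by (auto intro!: exI[of _ 0])
      next
        case (2 u)
        then show ?thesis using 1(2) by auto
      qed
    qed (use 1 in simp)
  next
    case (2 z)
    have "sub (L COMMA) z"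
      using 2(1)
    proof (cases rule: levi_cases)
      case (1 u)
      have "L COMMA = z @@ u" by fact
      then have "z = 0 \<or> u = 0" using pow_atom[OF is_pow_L] by metis
      then show ?thesis using \<open>z \<noteq> 0\<close> \<open>L COMMA = z @@ u\<close> by auto
    next
      case (2 u)
      then show ?thesis using sub_left by metis
    qed
    then show ?thesis using assms(2) 2(2) unfolding clean_def using sub_wcI2 by blast
  qed
qed

text \<open>The cut into \<open>ws'\<close> is the finest one, as its words contain no commas. A
  word of \<open>ws\<close> with commas merely merges pieces, so \<open>ws\<close> cannot be longer,
  and equal lengths force equality. Cleanness is thus required on one side only, that of the entry
  being inverted.\<close>

lemma join_unique:
  assumes "join ws = join ws'" "ws \<noteq> []" "ws' \<noteq> []" "\<forall>w \<in> set ws'. clean w"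
  shows "length ws \<le> length ws' \<and> (length ws = length ws' --> ws = ws')"
  using assms
proof (induction ws' arbitrary: ws)
  case (Cons w' ws')
  show ?case
  proof (cases ws')
    case Nil
    then have "ws = [w']" using Cons.prems by (cases ws rule: join.cases) auto
    then show ?thesis using Nil by simp
  next
    case (Cons v' vs')
    note ws' = this
    show ?thesis
    proof (cases ws rule: join.cases)
      case 1 then show ?thesis using Cons.prems by simp
    next
      case (2 w) then show ?thesis using ws' by simp
    next
      case (3 w v vs)
      have "w @@ L COMMA @@ join (v # vs) = w' @@ L COMMA @@ join ws'" using Cons.prems(1) 3 ws' by simp
      moreover have "clean w'" using Cons.prems(4) by simp
      ultimately consider "w = w'" "join (v # vs) = join ws'"
        | u where "join ws' = u @@ L COMMA @@ join (v # vs)" using comma_split by blast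
      then show ?thesis
      proof cases
        case 1
        then have "length (v # vs) \<le> length ws' \<and> (length (v # vs) = length ws' --> v # vs = ws')"
          using Cons.prems ws' by (intro Cons.IH) auto
        then show ?thesis using 3 1 by auto
      next
        case (2 u)
        then have "length (u # v # vs) \<le> length ws' \<and> (length (u # v # vs) = length ws' --> u # v # vs = ws')"
          using Cons.prems ws' by (intro Cons.IH) auto
        then show ?thesis using 3 by simp
      qed
    qed
  qed
qed simp

lemma s_judge_inj:
  assumes "s_judge k ws = s_judge k ws'" "\<forall>w \<in> set ws'. clean w" "length ws = length ws'"
  shows "ws = ws'"
proof (cases ws)
  case (Cons w vs)
  then obtain w' vs' where "ws' = w' # vs'" using assms(3) by (cases ws') auto
  then have "L k @@ L COMMA @@ join ws = L k @@ L COMMA @@ join ws'"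
    using assms(1) Cons unfolding s_judge_def by (simp only: judge_join)
  then have "join ws = join ws'" by simp
  then show ?thesis using join_unique[of ws ws'] assms Cons \<open>ws' = w' # vs'\<close> by simp
qed (use assms(3) in simp)

lemma s_judge_eq:
  assumes "\<forall>w \<in> set ws. clean w" "length ws = length ws'"
  shows "s_judge k ws = s_judge k ws' \<longleftrightarrow> ws = ws'"
  using s_judge_inj[of k ws' ws] assms by auto

definition kinds :: "(nat \<times> nat) list" where
  "kinds = [(FUN, 2), (FUNS, 3), (TRM, 1), (TRMS, 2), (VARS, 2), (APPS, 3), (SUB, 4), (SUBS, 4), (PRF, 3), (PRFS, 4)]"

text \<open>The recursion is on a standard number, so each instance unfolds to a fixed \<Sigma>1
  formula, which the induction for \<open>entry_clean\<close> needs.\<close>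

fun judge_like :: "nat => mm => mm => bool" where
  "judge_like 0 a e \<longleftrightarrow> e = a"
| "judge_like (Suc n) a e \<longleftrightarrow> (\<exists>w\<le>e. clean w \<and> judge_like n (a @@ L COMMA @@ w) e)"

lemma judge_like_foldl: "judge_like (length ws) a (foldl (%a w. a @@ L COMMA @@ w) a ws) \<longleftrightarrow> True"
  if "\<forall>w \<in> set ws. clean w"
  using that
proof (induction ws arbitrary: a)
  case (Cons w ws)
  have "w \<le> foldl (%a w. a @@ L COMMA @@ w) a (w # ws)"
    unfolding judge_join by (cases ws) (auto, metis wc_le(2), metis order_trans wc_assoc wc_le)
  then show ?case using Cons by auto
qed simp

lemma judge_like_D: "judge_like n a e ==> \<exists>ws. length ws = n \<and> (\<forall>w \<in> set ws. clean w) \<and> e = foldl (%a w. a @@ L COMMA @@ w) a ws"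
proof (induction n arbitrary: a)
  case (Suc n)
  then obtain w where "clean w" "judge_like n (a @@ L COMMA @@ w) e" by auto
  then obtain ws where "length ws = n" "\<forall>w \<in> set ws. clean w" "e = foldl (%a w. a @@ L COMMA @@ w) (a @@ L COMMA @@ w) ws"
    using Suc.IH by blast
  then show ?case using \<open>clean w\<close> by (intro exI[of _ "w # ws"]) auto
qed simp

lemma Sg_judge_like: "T1 f ==> T1 g ==> Sg (Suc 0) (%s. judge_like n (f s) (g s))"
proof (induction n arbitrary: f g)
  case 0 then show ?case by (simp add: Sg_eq)
next
  case (Suc n)
  show ?case unfolding judge_like.simps
    by (intro def_intros Suc.prems Suc.IH T1_reindex[OF Suc.prems(1)] T1_reindex[OF Suc.prems(2)])
qed

definition good_judge :: "mm => bool" where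
  "good_judge e \<longleftrightarrow> (\<exists>(k, n) \<in> set kinds. judge_like n (L k) e)"

lemma Sg_good_judge: "Sg (Suc 0) (%s. good_judge (s 0))"
  unfolding good_judge_def kinds_def
  by simp (intro Sg_disj Sg_judge_like T1_var T1_const Sg_conj Sg_bex Sg_clean T1_wc Sg_eq)

lemma good_judgeI: "(k, length ws) \<in> set kinds ==> \<forall>w \<in> set ws. clean w ==> good_judge (s_judge k ws)"
  unfolding good_judge_def s_judge_def using judge_like_foldl by fastforce

lemma good_judge_clean:
  assumes "good_judge (s_judge k ws)" "(k, length ws) \<in> set kinds"
  shows "\<forall>w \<in> set ws. clean w"
proof -
  obtain k' n where k': "(k', n) \<in> set kinds" "judge_like n (L k') (s_judge k ws)"
    using assms(1) unfolding good_judge_def by blast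
  then obtain ws' where ws': "length ws' = n" "\<forall>w \<in> set ws'. clean w" "s_judge k ws = s_judge k' ws'"
    using judge_like_D unfolding s_judge_def by metis
  then have "k = k'" using s_judge_kind by blast
  then have "length ws = n" using k'(1) assms(2) unfolding kinds_def by auto
  then show ?thesis using s_judge_inj[of k ws ws'] ws' \<open>k = k'\<close> by simp
qed

subsection \<open>Unary words and variables\<close>

lemma unary_iff: "s_unary N \<longleftrightarrow> N + 1 = ex (len N)"
  by (simp add: s_unary_def ex_len)

text \<open>All binary digits of \<open>2 ^ n - 1\<close> are 1. If \<open>x\<close> were smaller
  than \<open>2 ^ |x| - 1\<close>, then \<open>x @@ y\<close> would miss the required value by at
  least a block of \<open>2 ^ |y|\<close>.\<close>

lemma unary_wc:
  assumes "s_unary (x @@ y)"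
  shows "s_unary x \<and> s_unary y"
proof -
  let ?X = "ex (len x)" and ?Y = "ex (len y)"
  have b: "x + 1 \<le> ?X" "y + 1 \<le> ?Y" using ex_bounds[of x] ex_bounds[of y] by (simp_all add: less_iff)
  have e: "x * ?Y + y + 1 = ?X * ?Y" using assms by (simp add: unary_iff wc_eq[of x y] ex_add len_wc[of x y, unfolded wc_eq])
  have "x + 1 = ?X"
  proof (rule ccontr)
    assume "x + 1 \<noteq> ?X"
    then have "x + 1 + 1 \<le> ?X" using b(1) by (metis less_iff order_le_neq_trans)
    then have "(x + 1 + 1) * ?Y \<le> ?X * ?Y" by (rule mult_right_mono) simp
    then have "x * ?Y + ?Y + ?Y \<le> x * ?Y + y + 1" using e by (simp add: distrib_right)
    then have "?Y + ?Y \<le> y + 1" by (simp add: add.assoc)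
    moreover have "0 < ?Y" by simp
    ultimately show False using b(2) unfolding zify by linarith
  qed
  moreover have "?X * ?Y = x * ?Y + ?Y" using calculation by (metis distrib_right mult_1)
  then have "y + 1 = ?Y" using e by (simp add: add.assoc)
  ultimately show ?thesis by (simp add: unary_iff)
qed

lemma unary_sub: "s_unary N ==> is_pow c ==> sub c N ==> c = 1"
proof -
  assume "s_unary N" "is_pow c" "sub c N"
  then have "s_unary c" using unary_wc unfolding sub_def by blast
  obtain i where i: "Log i" "c = ex i" using \<open>is_pow c\<close> is_pow_iff by blast
  then have "c + 1 = 2 * c" using \<open>s_unary c\<close> by (simp add: unary_iff len_ex ex_Suc)
  then show "c = 1" by (simp add: mult_2)
qed

lemma L_0: "L 0 = 1" by (simp add: L_def)

lemma unary_no_letter: "s_unary N ==> k \<noteq> 0 ==> \<not> sub (L k) N"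
  using unary_sub[of N "L k"] L_inj[of k 0] by (auto simp: L_0)

lemma unary_clean: "s_unary N ==> clean N"
  by (simp add: clean_def unary_no_letter)

text \<open>Both sides are cut at the first occurrence of the letter. Applied to \<open>END\<close>
  after a unary block, this makes arities readable.\<close>

lemma letter_prefix:
  assumes "N @@ L k @@ x = N' @@ L k @@ y" "\<not> sub (L k) N" "\<not> sub (L k) N'"
  shows "N = N' \<and> x = y"
proof -
  have *: "z = 0" if "L k @@ x = z @@ y" "\<not> sub (L k) z" for z x y
    using that(1)
  proof (cases rule: levi_cases)
    case (1 u)
    then show ?thesis using pow_atom[OF is_pow_L, of z u k] that(2) by auto
  next
    case (2 u)
    then show ?thesis using that(2) sub_left by blast
  qed
  have "N @@ (L k @@ x) = N' @@ (L k @@ y)" using assms(1) by simp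
  then show ?thesis
  proof (cases rule: levi_cases)
    case (1 z)
    then have "z = 0" using *[of y z "L k @@ x"] assms(2) sub_wcI2 by metis
    then show ?thesis using 1 by simp
  next
    case (2 z)
    then have "z = 0" using *[of x z "L k @@ y"] assms(3) sub_wcI2 by metis
    then show ?thesis using 2 by simp
  qed
qed

lemma is_var_pow: "s_is_var x ==> is_pow x" by (simp add: s_is_var_def)

lemma L_mono: "j \<le> k ==> L j \<le> L k"
  unfolding L_def by (rule power_increasing) simp_all

lemma L_less: "j < k ==> L j < L k"
  using L_mono[of j k] L_inj[of j k] by (simp add: order_less_le)

lemma is_var_not_L: "s_is_var x ==> k < VAR ==> x \<noteq> L k"
  using L_less[of k VAR] by (auto simp: s_is_var_def)

lemma is_var_clean: "s_is_var x ==> clean x"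
  by (rule clean_pow) (auto simp: is_var_pow dest: is_var_not_L[of _ COMMA])

lemma s_var_ex: "\<exists>i. Log i \<and> s_var I = ex i \<and> i = 27 + len I"
proof -
  obtain i where "Log i" "L VAR = ex i" "i = 27" using L_ex[of VAR] by auto
  then show ?thesis by (intro exI[of _ "i + len I"]) (simp add: s_var_def Log_add ex_add flip: ex_len)
qed

lemma len_s_var: "len (s_var I) = 28 + len I"
proof -
  have "len (s_var I) = 27 + len I + 1" using s_var_ex[of I] len_ex by metis
  then show ?thesis unfolding zify by linarith
qed

lemma s_var_is_var: "s_is_var (s_var I)"
proof -
  have "L VAR * 1 \<le> L VAR * smash 1 I" by (intro mult_left_mono) (simp_all add: one_le flip: ex_len)
  then show ?thesis using s_var_ex[of I] is_pow_ex by (auto simp: s_is_var_def s_var_def)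
qed

lemma is_var_len_inj: "s_is_var x ==> s_is_var y ==> len x = len y ==> x = y"
  using is_pow_iff len_ex by (metis add_right_cancel is_var_pow)

lemma s_var_clean: "clean (s_var I)" by (simp add: is_var_clean s_var_is_var)

lemma clean_codes [simp]:
  "clean (s_app f T) \<longleftrightarrow> clean f \<and> clean T"
  "clean (s_cConst N) \<longleftrightarrow> clean N"
  "clean (s_cProj I N) \<longleftrightarrow> clean I \<and> clean N"
  "clean (s_cComp g H) \<longleftrightarrow> clean g \<and> clean H"
  "clean (s_cRec ge g0 g1) \<longleftrightarrow> clean ge \<and> clean g0 \<and> clean g1"
  "k \<noteq> COMMA ==> clean (s_node k t u P) \<longleftrightarrow> clean t \<and> clean u \<and> clean P"
  by (auto simp: s_app_def s_cConst_def s_cProj_def s_cComp_def s_cRec_def s_node_def)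

subsection \<open>Induction along a formation sequence\<close>

lemma s_judge_sub: "w \<in> set ws ==> sub w (s_judge k ws)"
proof -
  assume "w \<in> set ws"
  then obtain v vs where ws: "ws = v # vs" by (cases ws) auto
  have "w \<in> set (v # vs) ==> sub w (join (v # vs))" for v vs
  proof (induction vs arbitrary: v)
    case (Cons u vs)
    then show ?case by (auto intro: sub_wcI1 sub_wcI2 sub_left)
  qed simp
  then have "sub w (join ws)" using ws \<open>w \<in> set ws\<close> by blast
  then show ?thesis unfolding s_judge_def ws judge_join by (simp add: sub_wcI2)
qed

text \<open>Entries of the sequence occur only positively in the rules.\<close>

lemma step_mono:
  assumes "\<And>e'. s_entry v e' ==> s_entry v' e'"
  shows "s_step b v e --> s_step b v' e"
proof -
  have m: "s_entry v e' --> s_entry v' e'" for e' using assms by blast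
  show ?thesis
    unfolding s_step_def s_step_fun_def s_step_term_def s_step_sub_def s_step_prf_def s_def_eq_def
    by ((rule disj_mono Set.ex_mono conj_mono m imp_refl)+)
qed

locale deriv =
  fixes W :: mm
  assumes W: "s_formation_seq W"
begin

text \<open>The induction is on the length of the part of \<open>W\<close> that precedes an entry.
  Any entry available to its rule starts strictly earlier, and its neighbours in \<open>W\<close>
  again exhibit it as an entry of \<open>W\<close>.\<close>

lemma formation_induct:
  assumes "Pg (Suc (Suc 0)) (%s. Q (s 0))"
    "\<And>v e. (\<And>e'. s_entry v e' ==> s_entry W e' \<and> Q e') ==> s_step W v e ==> Q e"
    "s_entry W e"
  shows "Q e"
proof -
  define R where "R a \<longleftrightarrow> (\<forall>e\<le>W. \<forall>b\<le>W. W = a @@ L SEP @@ e @@ L SEP @@ b \<and> \<not> sub (L SEP) e --> Q e)" for a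
  have bound: "a \<le> W \<and> e \<le> W \<and> b \<le> W" if "W = a @@ L SEP @@ e @@ L SEP @@ b" for a e b
    using that sub_le[of a W] sub_le[of e W] sub_le[of b W]
    by (auto intro!: sub_wcI1 sub_right) (auto intro!: sub_wcI1 sub_left)
  have R: "R a" if "a \<le> W" for a
  proof (rule len_induct[of R, OF _ that])
    have "Pg (Suc (Suc 0)) (%s. Q (s (Suc 0)))" using Pg_reindex[OF assms(1), of Suc] by simp
    then show "Pg (Suc (Suc 0)) (%s. R (s 0))"
      unfolding R_def by (intro def_intros)
    fix a assume IH: "\<And>y. y \<le> W ==> len y < len a ==> R y"
    show "R a" unfolding R_def
    proof (intro allI impI, elim conjE)
      fix e b assume We: "W = a @@ L SEP @@ e @@ L SEP @@ b" "\<not> sub (L SEP) e"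
      show "Q e"
      proof (rule assms(2))
        show "s_step W (a @@ L SEP) e" using W We unfolding s_formation_seq_def by blast
        fix e' assume e': "s_entry (a @@ L SEP) e'"
        then obtain a' b' where ab: "a @@ L SEP = a' @@ L SEP @@ e' @@ L SEP @@ b'" and ns: "\<not> sub (L SEP) e'"
          unfolding s_entry_def sub_def by auto
        then have W': "W = a' @@ L SEP @@ e' @@ L SEP @@ (b' @@ e @@ L SEP @@ b)" using We(1) by simp
        have "len a + len (L SEP) = len a' + len (L SEP) + len e' + len (L SEP) + len b'"
          using arg_cong[OF ab, of len] by simp
        moreover have "len (L SEP) \<noteq> 0" by simp
        ultimately have "len a' < len a" using one_le[of "len (L SEP)"] zz_nonneg[of "len e'"] zz_nonneg[of "len b'"]
          unfolding zify by auto
        then have "R a'" using IH bound[OF W'] by blast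
        then have "Q e'" using bound[OF W'] W' ns unfolding R_def by blast
        moreover have "s_entry W e'"
        proof -
          have "W = a' @@ (L SEP @@ e' @@ L SEP) @@ (b' @@ e @@ L SEP @@ b)" by (subst W') simp
          then show ?thesis unfolding s_entry_def using ns unfolding sub_def by blast
        qed
        ultimately show "s_entry W e' \<and> Q e'" by blast
      qed
    qed
  qed
  obtain a b where "W = a @@ L SEP @@ e @@ L SEP @@ b" "\<not> sub (L SEP) e"
    using assms(3) unfolding s_entry_def sub_def by auto
  then show ?thesis using R[of a] bound unfolding R_def by blast
qed

text \<open>The order of the entries is forgotten here: premises may be sought anywhere in
  \<open>W\<close>. Later inductions run on the lengths of words instead.\<close>

lemma entry_step: "s_entry W e ==> s_step W W e"
proof -
  assume e: "s_entry W e"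
  then obtain a b where ab: "W = a @@ L SEP @@ e @@ L SEP @@ b" "\<not> sub (L SEP) e"
    unfolding s_entry_def sub_def by auto
  then have "s_step W (a @@ L SEP) e" using W unfolding s_formation_seq_def by blast
  moreover have "sub (a @@ L SEP) W" by (subst ab(1)) (intro sub_wcI1 sub_refl)
  then have "s_entry W e'" if "s_entry (a @@ L SEP) e'" for e'
    using that sub_trans unfolding s_entry_def by blast
  ultimately show ?thesis using step_mono by blast
qed

text \<open>Unique reading of judgements needs clean components, yet inverting a rule would already
  use unique reading. The circle is avoided by building judgements up with
  \<open>formation_induct\<close>: clean premises give clean conclusions, whichever rule
  applies.\<close>

lemma entry_clean:
  assumes "s_entry W (s_judge k ws)" "(k, length ws) \<in> set kinds"
  shows "\<forall>w \<in> set ws. clean w"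
proof (rule good_judge_clean[OF _ assms(2)], rule formation_induct[OF _ _ assms(1)])
  show "Pg (Suc (Suc 0)) (%s. good_judge (s 0))" by (rule Sg_Pg[OF Sg_good_judge])
  fix v e assume v: "\<And>e'. s_entry v e' ==> s_entry W e' \<and> good_judge e'" and step: "s_step W v e"
  have c: "s_entry v (s_judge k ws) ==> (k, length ws) \<in> set kinds ==> \<forall>w \<in> set ws. clean w" for k ws
    using v good_judge_clean by blast
  have cl: "s_entry v (s_judge FUN [x, y]) ==> clean x \<and> clean y"
    "s_entry v (s_judge FUNS [x, y, z]) ==> clean x \<and> clean y \<and> clean z"
    "s_entry v (s_judge TRM [x]) ==> clean x"
    "s_entry v (s_judge TRMS [x, y]) ==> clean x \<and> clean y"
    "s_entry v (s_judge VARS [x, y]) ==> clean x \<and> clean y"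
    "s_entry v (s_judge APPS [x, y, z]) ==> clean x \<and> clean y \<and> clean z"
    "s_entry v (s_judge SUB [x, y, z, u]) ==> clean x \<and> clean y \<and> clean z \<and> clean u"
    "s_entry v (s_judge SUBS [x, y, z, u]) ==> clean x \<and> clean y \<and> clean z \<and> clean u"
    "s_entry v (s_judge PRF [x, y, z]) ==> clean x \<and> clean y \<and> clean z"
    "s_entry v (s_judge PRFS [x, y, z, u]) ==> clean x \<and> clean y \<and> clean z \<and> clean u" for x y z u
    by (drule c; simp add: kinds_def)+
  have df: "clean t \<and> clean u" if "s_def_eq W v t u" for t u
    using that unfolding s_def_eq_def
    by (elim disjE exE conjE; (auto dest!: cl simp: s_var_clean))
  from step consider "s_step_fun W v e" | "s_step_term W v e" | "s_step_sub W v e" | "s_step_prf W v e"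
    unfolding s_step_def by blast
  then show "good_judge e"
  proof cases
    case 1
    then show ?thesis unfolding s_step_fun_def
      by (elim disjE exE conjE) (auto dest!: cl df unary_clean is_var_clean intro!: good_judgeI simp: kinds_def s_var_clean)
  next
    case 2
    then show ?thesis unfolding s_step_term_def
      by (elim disjE exE conjE) (auto dest!: cl df unary_clean is_var_clean intro!: good_judgeI simp: kinds_def s_var_clean)
  next
    case 3
    then show ?thesis unfolding s_step_sub_def
      by (elim disjE exE conjE) (auto dest!: cl df unary_clean is_var_clean intro!: good_judgeI simp: kinds_def s_var_clean)
  next
    case 4
    then show ?thesis unfolding s_step_prf_def
      by (elim disjE exE conjE) (auto dest!: cl df unary_clean is_var_clean intro!: good_judgeI simp: kinds_def s_var_clean)
  qed
qed

end

context deriv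
begin

subsection \<open>The judgements of a formation sequence\<close>

definition isFUN :: "mm => mm =>  bool" where
  "isFUN f N \<longleftrightarrow> s_entry W (s_judge FUN [f, N])"
definition isFUNS :: "mm => mm => mm =>  bool" where
  "isFUNS H M N \<longleftrightarrow> s_entry W (s_judge FUNS [H, M, N])"
definition isTRM :: "mm =>  bool" where
  "isTRM t \<longleftrightarrow> s_entry W (s_judge TRM [t])"
definition isTRMS :: "mm => mm =>  bool" where
  "isTRMS T N \<longleftrightarrow> s_entry W (s_judge TRMS [T, N])"
definition isVARS :: "mm => mm =>  bool" where
  "isVARS X N \<longleftrightarrow> s_entry W (s_judge VARS [X, N])"
definition isAPPS :: "mm => mm => mm =>  bool" where
  "isAPPS H X A \<longleftrightarrow> s_entry W (s_judge APPS [H, X, A])"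
definition isSUB :: "mm => mm => mm => mm =>  bool" where
  "isSUB t x r t' \<longleftrightarrow> s_entry W (s_judge SUB [t, x, r, t'])"
definition isSUBS :: "mm => mm => mm => mm =>  bool" where
  "isSUBS T x r T' \<longleftrightarrow> s_entry W (s_judge SUBS [T, x, r, T'])"
definition isPRF :: "mm => mm => mm =>  bool" where
  "isPRF p t u \<longleftrightarrow> s_entry W (s_judge PRF [p, t, u])"
definition isPRFS :: "mm => mm => mm => mm =>  bool" where
  "isPRFS P T U N \<longleftrightarrow> s_entry W (s_judge PRFS [P, T, U, N])"

lemmas is_defs = isFUN_def isFUNS_def isTRM_def isTRMS_def isVARS_def isAPPS_def isSUB_def isSUBS_def isPRF_def isPRFS_def

lemma Sg_judgements [def_intros]:
  "T1 f1 ==> T1 f2 ==> Sg (Suc k) (%s. isFUN (f1 s) (f2 s))"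
  "T1 f1 ==> T1 f2 ==> T1 f3 ==> Sg (Suc k) (%s. isFUNS (f1 s) (f2 s) (f3 s))"
  "T1 f1 ==> Sg (Suc k) (%s. isTRM (f1 s))"
  "T1 f1 ==> T1 f2 ==> Sg (Suc k) (%s. isTRMS (f1 s) (f2 s))"
  "T1 f1 ==> T1 f2 ==> Sg (Suc k) (%s. isVARS (f1 s) (f2 s))"
  "T1 f1 ==> T1 f2 ==> T1 f3 ==> Sg (Suc k) (%s. isAPPS (f1 s) (f2 s) (f3 s))"
  "T1 f1 ==> T1 f2 ==> T1 f3 ==> T1 f4 ==> Sg (Suc k) (%s. isSUB (f1 s) (f2 s) (f3 s) (f4 s))"
  "T1 f1 ==> T1 f2 ==> T1 f3 ==> T1 f4 ==> Sg (Suc k) (%s. isSUBS (f1 s) (f2 s) (f3 s) (f4 s))"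
  "T1 f1 ==> T1 f2 ==> T1 f3 ==> Sg (Suc k) (%s. isPRF (f1 s) (f2 s) (f3 s))"
  "T1 f1 ==> T1 f2 ==> T1 f3 ==> T1 f4 ==> Sg (Suc k) (%s. isPRFS (f1 s) (f2 s) (f3 s) (f4 s))"
  unfolding is_defs by (intro def_intros; assumption)+

lemma Pg_judgements [def_intros]:
  "T1 f1 ==> T1 f2 ==> Pg (Suc k) (%s. isFUN (f1 s) (f2 s))"
  "T1 f1 ==> T1 f2 ==> T1 f3 ==> Pg (Suc k) (%s. isFUNS (f1 s) (f2 s) (f3 s))"
  "T1 f1 ==> Pg (Suc k) (%s. isTRM (f1 s))"
  "T1 f1 ==> T1 f2 ==> Pg (Suc k) (%s. isTRMS (f1 s) (f2 s))"
  "T1 f1 ==> T1 f2 ==> Pg (Suc k) (%s. isVARS (f1 s) (f2 s))"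
  "T1 f1 ==> T1 f2 ==> T1 f3 ==> Pg (Suc k) (%s. isAPPS (f1 s) (f2 s) (f3 s))"
  "T1 f1 ==> T1 f2 ==> T1 f3 ==> T1 f4 ==> Pg (Suc k) (%s. isSUB (f1 s) (f2 s) (f3 s) (f4 s))"
  "T1 f1 ==> T1 f2 ==> T1 f3 ==> T1 f4 ==> Pg (Suc k) (%s. isSUBS (f1 s) (f2 s) (f3 s) (f4 s))"
  "T1 f1 ==> T1 f2 ==> T1 f3 ==> Pg (Suc k) (%s. isPRF (f1 s) (f2 s) (f3 s))"
  "T1 f1 ==> T1 f2 ==> T1 f3 ==> T1 f4 ==> Pg (Suc k) (%s. isPRFS (f1 s) (f2 s) (f3 s) (f4 s))"
  unfolding is_defs by (intro def_intros; assumption)+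

lemma judge_sub: "s_entry W (s_judge k ws) ==> w \<in> set ws ==> sub w W"
  unfolding s_entry_def by (meson s_judge_sub sub_trans sub_left sub_right)

lemma isFUN_sub: "isFUN f N ==> sub f W \<and> sub N W"
  unfolding isFUN_def using judge_sub by auto
lemma isFUN_clean: "isFUN f N ==> clean f \<and> clean N"
  unfolding isFUN_def by (drule entry_clean) (auto simp: kinds_def)
lemma isFUNS_sub: "isFUNS H M N ==> sub H W \<and> sub M W \<and> sub N W"
  unfolding isFUNS_def using judge_sub by auto
lemma isFUNS_clean: "isFUNS H M N ==> clean H \<and> clean M \<and> clean N"
  unfolding isFUNS_def by (drule entry_clean) (auto simp: kinds_def)
lemma isTRM_sub: "isTRM t ==> sub t W"
  unfolding isTRM_def using judge_sub by auto
lemma isTRM_clean: "isTRM t ==> clean t"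
  unfolding isTRM_def by (drule entry_clean) (auto simp: kinds_def)
lemma isTRMS_sub: "isTRMS T N ==> sub T W \<and> sub N W"
  unfolding isTRMS_def using judge_sub by auto
lemma isTRMS_clean: "isTRMS T N ==> clean T \<and> clean N"
  unfolding isTRMS_def by (drule entry_clean) (auto simp: kinds_def)
lemma isVARS_sub: "isVARS X N ==> sub X W \<and> sub N W"
  unfolding isVARS_def using judge_sub by auto
lemma isVARS_clean: "isVARS X N ==> clean X \<and> clean N"
  unfolding isVARS_def by (drule entry_clean) (auto simp: kinds_def)
lemma isAPPS_sub: "isAPPS H X A ==> sub H W \<and> sub X W \<and> sub A W"
  unfolding isAPPS_def using judge_sub by auto
lemma isAPPS_clean: "isAPPS H X A ==> clean H \<and> clean X \<and> clean A"
  unfolding isAPPS_def by (drule entry_clean) (auto simp: kinds_def)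
lemma isSUB_sub: "isSUB t x r t' ==> sub t W \<and> sub x W \<and> sub r W \<and> sub t' W"
  unfolding isSUB_def using judge_sub by auto
lemma isSUB_clean: "isSUB t x r t' ==> clean t \<and> clean x \<and> clean r \<and> clean t'"
  unfolding isSUB_def by (drule entry_clean) (auto simp: kinds_def)
lemma isSUBS_sub: "isSUBS T x r T' ==> sub T W \<and> sub x W \<and> sub r W \<and> sub T' W"
  unfolding isSUBS_def using judge_sub by auto
lemma isSUBS_clean: "isSUBS T x r T' ==> clean T \<and> clean x \<and> clean r \<and> clean T'"
  unfolding isSUBS_def by (drule entry_clean) (auto simp: kinds_def)
lemma isPRF_sub: "isPRF p t u ==> sub p W \<and> sub t W \<and> sub u W"
  unfolding isPRF_def using judge_sub by auto
lemma isPRF_clean: "isPRF p t u ==> clean p \<and> clean t \<and> clean u"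
  unfolding isPRF_def by (drule entry_clean) (auto simp: kinds_def)
lemma isPRFS_sub: "isPRFS P T U N ==> sub P W \<and> sub T W \<and> sub U W \<and> sub N W"
  unfolding isPRFS_def using judge_sub by auto
lemma isPRFS_clean: "isPRFS P T U N ==> clean P \<and> clean T \<and> clean U \<and> clean N"
  unfolding isPRFS_def by (drule entry_clean) (auto simp: kinds_def)

lemma s_judge_neq: "k \<noteq> k' ==> (s_judge k ws = s_judge k' ws') = False"
  using s_judge_kind by blast

lemma isFUN_cases:
  assumes "isFUN f N"
  shows "f = L EPS \<or> f = L SUC0 \<or> f = L SUC1 \<or> (\<exists>N. f = s_cConst N \<and> s_unary N)
    \<or> (\<exists>I N. f = s_cProj I N \<and> s_unary I \<and> s_unary N)
    \<or> (\<exists>g H M N. f = s_cComp g H \<and> isFUN g M \<and> isFUNS H M N)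
    \<or> (\<exists>ge g0 g1 N M. f = s_cRec ge g0 g1 \<and> isFUN ge N \<and> isFUN g0 M \<and> isFUN g1 M)"
proof -
  have "s_step W W (s_judge FUN [f, N])" using assms entry_step by (simp add: isFUN_def)
  then have "s_step_fun W W (s_judge FUN [f, N])"
    unfolding s_step_def s_step_fun_def s_step_term_def s_step_sub_def s_step_prf_def by (simp add: s_judge_neq)
  then show ?thesis
    using isFUN_clean[OF assms] unfolding s_step_fun_def
    by (simp add: s_judge_neq s_judge_eq flip: is_defs) blast
qed

lemma isFUNS_cases:
  assumes "isFUNS H M N"
  shows "H = 0 \<or> (\<exists>H' h M' N'. H = H' @@ h \<and> isFUNS H' M' N' \<and> isFUN h N')"
proof -
  have "s_step W W (s_judge FUNS [H, M, N])" using assms entry_step by (simp add: isFUNS_def)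
  then have "s_step_fun W W (s_judge FUNS [H, M, N])"
    unfolding s_step_def s_step_fun_def s_step_term_def s_step_sub_def s_step_prf_def by (simp add: s_judge_neq)
  then show ?thesis
    using isFUNS_clean[OF assms] unfolding s_step_fun_def
    by (simp add: s_judge_neq s_judge_eq flip: is_defs) blast
qed

lemma isTRM_cases:
  assumes "isTRM t"
  shows "s_is_var t \<or> (\<exists>f T N. t = s_app f T \<and> isFUN f N \<and> isTRMS T N)"
proof -
  have "s_step W W (s_judge TRM [t])" using assms entry_step by (simp add: isTRM_def)
  then have "s_step_term W W (s_judge TRM [t])"
    unfolding s_step_def s_step_fun_def s_step_term_def s_step_sub_def s_step_prf_def by (simp add: s_judge_neq)
  then show ?thesis
    using isTRM_clean[OF assms] unfolding s_step_term_def
    by (simp add: s_judge_neq s_judge_eq flip: is_defs) blast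
qed

lemma isTRMS_cases:
  assumes "isTRMS T N"
  shows "(T = 0 \<and> N = 0) \<or> (\<exists>T' t N'. T = T' @@ t \<and> N = N' @@ L MARK \<and> isTRMS T' N' \<and> isTRM t)"
proof -
  have "s_step W W (s_judge TRMS [T, N])" using assms entry_step by (simp add: isTRMS_def)
  then have "s_step_term W W (s_judge TRMS [T, N])"
    unfolding s_step_def s_step_fun_def s_step_term_def s_step_sub_def s_step_prf_def by (simp add: s_judge_neq)
  then show ?thesis
    using isTRMS_clean[OF assms] unfolding s_step_term_def
    by (simp add: s_judge_neq s_judge_eq flip: is_defs) blast
qed

lemma isVARS_cases:
  assumes "isVARS X N"
  shows "(X = 0 \<and> N = 0) \<or> (\<exists>X' N'. X = X' @@ s_var (N' @@ L MARK) \<and> N = N' @@ L MARK \<and> isVARS X' N')"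
proof -
  have "s_step W W (s_judge VARS [X, N])" using assms entry_step by (simp add: isVARS_def)
  then have "s_step_term W W (s_judge VARS [X, N])"
    unfolding s_step_def s_step_fun_def s_step_term_def s_step_sub_def s_step_prf_def by (simp add: s_judge_neq)
  then show ?thesis
    using isVARS_clean[OF assms] unfolding s_step_term_def
    by (simp add: s_judge_neq s_judge_eq flip: is_defs) blast
qed

lemma isAPPS_cases:
  assumes "isAPPS H X A"
  shows "(H = 0 \<and> A = 0 \<and> (\<exists>N. isVARS X N))
    \<or> (\<exists>H' A' h N. H = H' @@ h \<and> A = A' @@ s_app h X \<and> isAPPS H' X A' \<and> isFUN h N)"
proof -
  have "s_step W W (s_judge APPS [H, X, A])" using assms entry_step by (simp add: isAPPS_def)
  then have "s_step_term W W (s_judge APPS [H, X, A])"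
    unfolding s_step_def s_step_fun_def s_step_term_def s_step_sub_def s_step_prf_def by (simp add: s_judge_neq)
  then show ?thesis
    using isAPPS_clean[OF assms] unfolding s_step_term_def
    by (simp add: s_judge_neq s_judge_eq flip: is_defs) blast
qed

lemma isSUB_cases:
  assumes "isSUB t x r t'"
  shows "(t = x \<and> t' = r \<and> s_is_var x \<and> isTRM r) \<or> (t' = t \<and> s_is_var t \<and> s_is_var x \<and> t \<noteq> x \<and> isTRM r)
    \<or> (\<exists>f N T T'. t = s_app f T \<and> t' = s_app f T' \<and> isFUN f N \<and> isSUBS T x r T')"
proof -
  have "s_step W W (s_judge SUB [t, x, r, t'])" using assms entry_step by (simp add: isSUB_def)
  then have "s_step_sub W W (s_judge SUB [t, x, r, t'])"
    unfolding s_step_def s_step_fun_def s_step_term_def s_step_sub_def s_step_prf_def by (simp add: s_judge_neq)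
  then show ?thesis
    using isSUB_clean[OF assms] unfolding s_step_sub_def
    by (simp add: s_judge_neq s_judge_eq flip: is_defs) blast
qed

lemma isSUBS_cases:
  assumes "isSUBS T x r T'"
  shows "(T = 0 \<and> T' = 0 \<and> s_is_var x \<and> isTRM r)
    \<or> (\<exists>T1 T1' t t'. T = T1 @@ t \<and> T' = T1' @@ t' \<and> isSUBS T1 x r T1' \<and> isSUB t x r t')"
proof -
  have "s_step W W (s_judge SUBS [T, x, r, T'])" using assms entry_step by (simp add: isSUBS_def)
  then have "s_step_sub W W (s_judge SUBS [T, x, r, T'])"
    unfolding s_step_def s_step_fun_def s_step_term_def s_step_sub_def s_step_prf_def by (simp add: s_judge_neq)
  then show ?thesis
    using isSUBS_clean[OF assms] unfolding s_step_sub_def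
    by (simp add: s_judge_neq s_judge_eq flip: is_defs) blast
qed

lemma isPRF_cases:
  assumes "isPRF p t u"
  shows "(p = s_node AX t u 0 \<and> s_def_eq W W t u) \<or> (u = t \<and> p = s_node REFL t t 0 \<and> isTRM t)
    \<or> (\<exists>q. p = s_node SYM t u q \<and> isPRF q u t)
    \<or> (\<exists>q q' v. p = s_node TRANS t u (q @@ q') \<and> isPRF q t v \<and> isPRF q' v u)
    \<or> (\<exists>P f N T U. t = s_app f T \<and> u = s_app f U \<and> p = s_node CONG t u P \<and> isFUN f N \<and> isPRFS P T U N)
    \<or> (\<exists>q t0 u0 x r. p = s_node SUBST t u q \<and> isPRF q t0 u0 \<and> isSUB t0 x r t \<and> isSUB u0 x r u)"
proof -
  have "s_step W W (s_judge PRF [p, t, u])" using assms entry_step by (simp add: isPRF_def)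
  then have "s_step_prf W W (s_judge PRF [p, t, u])"
    unfolding s_step_def s_step_fun_def s_step_term_def s_step_sub_def s_step_prf_def by (simp add: s_judge_neq)
  then show ?thesis
    using isPRF_clean[OF assms] unfolding s_step_prf_def
    by (simp add: s_judge_neq s_judge_eq flip: is_defs) blast
qed

lemma isPRFS_cases:
  assumes "isPRFS P T U N"
  shows "(P = 0 \<and> T = 0 \<and> U = 0)
    \<or> (\<exists>P' T' U' N' q t u. P = P' @@ q \<and> T = T' @@ t \<and> U = U' @@ u \<and> isPRFS P' T' U' N' \<and> isPRF q t u)"
proof -
  have "s_step W W (s_judge PRFS [P, T, U, N])" using assms entry_step by (simp add: isPRFS_def)
  then have "s_step_prf W W (s_judge PRFS [P, T, U, N])"
    unfolding s_step_def s_step_fun_def s_step_term_def s_step_sub_def s_step_prf_def by (simp add: s_judge_neq)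
  then show ?thesis
    using isPRFS_clean[OF assms] unfolding s_step_prf_def
    by (simp add: s_judge_neq s_judge_eq flip: is_defs) blast
qed

end

section \<open>Prefix-freeness of function words and of lists\<close>

subsection \<open>Unique readability\<close>

lemma Sg_inst: "Sg (Suc 0) (%s. F (s 0)) ==> T1 f ==> Sg (Suc k) (%s. F (f s))"
  by (rule Sg_lift) (rule Sg_sub[where P = "%x s. F x"])

lemma pre_comparable: "x @@ a = y @@ b ==> x \<sqsubseteq> y \<or> y \<sqsubseteq> x"
  by (metis pre_linear pre_wc)

text \<open>
  The words of \<open>Li\<close> are concatenations of words of \<open>F\<close>, built by appending on the right. If \<open>F\<close> is
  prefix-free, then such a word that is a proper prefix of another one is followed by a word of \<open>F\<close>.
\<close>

locale word_lists =
  fixes F Li :: "mm => bool" and a n :: mm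
  assumes Sg_F: "Sg (Suc 0) (%s. F (s 0))"
    and Sg_Li: "Sg (Suc 0) (%s. Li (s 0))"
    and F_bound: "F h ==> h \<le> a"
    and F_nonzero: "F h ==> h \<noteq> 0"
    and Li_bound: "Li H ==> H \<le> a"
    and Li_cases: "Li H ==> H = 0 \<or> (\<exists>H1 h. H = H1 @@ h \<and> Li H1 \<and> F h)"
    and prefix_free: "F h ==> F h' ==> len h < n ==> h' \<sqsubseteq> h ==> h' = h"
begin

text \<open>Lists grow at the right end but are compared from the left. Removing the last item of
  \<open>H\<close> leaves two cases: either \<open>H'\<close> fits into the rest, or it reaches into
  that item, which prefix-freeness allows only if it covers the item. The bound \<open>n\<close>
  lets the lemma be used inside the induction that proves prefix-freeness, where it is known only
  for shorter items.\<close>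

lemma list_next:
  assumes "Li H" "len H < n" "Li H'" "H' \<sqsubseteq> H"
  shows "H' = H \<or> (\<exists>h. F h \<and> H' @@ h \<sqsubseteq> H)"
proof -
  define Q where "Q H \<longleftrightarrow> (\<forall>H'\<le>a. Li H \<and> len H < n \<and> Li H' \<and> H' \<sqsubseteq> H -->
      H' = H \<or> (\<exists>h\<le>a. F h \<and> H' @@ h \<sqsubseteq> H))" for H
  have "Q H"
  proof (rule len_induct[of Q, OF _ Li_bound[OF assms(1)]])
    show "Pg (Suc (Suc 0)) (%s. Q (s 0))" unfolding Q_def
      by (intro Pg_ball Pg_imp Pg_disj; (rule Sg_Pg)?; intro def_intros Sg_inst[OF Sg_F] Sg_inst[OF Sg_Li])
    fix H assume IH: "\<And>y. y \<le> a ==> len y < len H ==> Q y"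
    have "H' = H \<or> (\<exists>h. F h \<and> H' @@ h \<sqsubseteq> H)" if H: "Li H" "len H < n" "Li H'" "H' \<sqsubseteq> H" for H'
    proof (cases "H = 0")
      case False
      then obtain H1 h where h: "H = H1 @@ h" "Li H1" "F h" using Li_cases[OF H(1)] by blast
      have IH': "H'' = H2 \<or> (\<exists>h. F h \<and> H'' @@ h \<sqsubseteq> H2)"
        if "Li H2" "Li H''" "H'' \<sqsubseteq> H2" "len H2 < len H" for H2 H''
      proof -
        have "Q H2" "len H2 < n" using IH[OF Li_bound[OF that(1)] that(4)] that(4) H(2) by auto
        then show ?thesis using that Li_bound[OF that(2)] unfolding Q_def by blast
      qed
      have lens: "len H1 < len H" "len h < n"
        using h F_nonzero H(2) by (auto simp: mm_pos) (metis add_increasing le_less_trans mm_nonneg order_refl)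
      have "H1 \<sqsubseteq> H" using h(1) by simp
      then consider "H' \<sqsubseteq> H1" | "H1 \<sqsubseteq> H'" using pre_linear H(4) by blast
      then show ?thesis
      proof cases
        case 1
        then have "H' = H1 \<or> (\<exists>h. F h \<and> H' @@ h \<sqsubseteq> H1)" using IH' h(2) H(3) lens by blast
        then show ?thesis using h \<open>H1 \<sqsubseteq> H\<close> pre_trans by (metis pre_refl)
      next
        case 2
        show ?thesis
        proof (cases "len H' < len H")
          case True
          then have "H1 = H' \<or> (\<exists>h. F h \<and> H1 @@ h \<sqsubseteq> H')" using IH' H(3) h(2) 2 by blast
          then show ?thesis
          proof
            assume "\<exists>h. F h \<and> H1 @@ h \<sqsubseteq> H'"
            then obtain h'' where h'': "F h''" "H1 @@ h'' \<sqsubseteq> H'" by blast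
            then have "h'' \<sqsubseteq> h" using pre_trans[OF h''(2) H(4)] h(1) by simp
            then have "h'' = h" using prefix_free h(3) h''(1) lens(2) by blast
            then have "H \<sqsubseteq> H'" using h''(2) h(1) by simp
            then show ?thesis using True pre_len by (metis not_le)
          qed (use h in auto)
        next
          case False
          then show ?thesis using H(4) pre_len_antisym by (metis not_le)
        qed
      qed
    qed (use that in simp)
    then show "Q H" unfolding Q_def using F_bound by blast
  qed
  then show ?thesis unfolding Q_def using assms Li_bound by blast
qed

text \<open>If one list were a proper prefix of the other, an item would stand where the first has
  its terminator. The terminator is an atom and no item starts with it.\<close>

lemma list_end:
  assumes "Li H" "Li H'" "len H < n" "len H' < n" "H @@ c @@ x = H' @@ c @@ y" "is_pow c"
    "\<And>h. F h ==> \<not> c \<sqsubseteq> h"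
  shows "H = H' \<and> x = y"
proof -
  have main: "H = H'" if H: "Li H" "Li H'" "len H < n" "H @@ c @@ x = H' @@ c @@ y" "H' \<sqsubseteq> H" for H H' x y
  proof (rule ccontr)
    assume "H \<noteq> H'"
    then obtain h where h: "F h" "H' @@ h \<sqsubseteq> H" using list_next[OF H(1,3,2,5)] by blast
    then obtain z where "H = H' @@ h @@ z" unfolding pre_def by blast
    then have "H' @@ (h @@ (z @@ c @@ x)) = H' @@ (c @@ y)" using H(4) by simp
    then have "h @@ (z @@ c @@ x) = c @@ y" by (simp only: wc_cancel_left)
    then have "h \<sqsubseteq> c" using pre_comparable assms(7)[OF h(1)] by blast
    then have "h = c" unfolding pre_def using pow_atom[OF assms(6)] F_nonzero[OF h(1)] by (metis wc_0(2))
    then show False using assms(7)[OF h(1)] by simp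
  qed
  have "H @@ (c @@ x) = H' @@ (c @@ y)" using assms(5) by simp
  then have "H \<sqsubseteq> H' \<or> H' \<sqsubseteq> H" by (rule pre_comparable)
  then have "H = H'"
    using main[OF assms(1,2,3,5)] main[OF assms(2,1,4) assms(5)[symmetric]] by blast
  then show ?thesis using assms(5) by simp
qed

text \<open>If the list parts differed, \<open>list_next\<close> would place an item as a prefix of
  the last item of the shorter list; prefix-freeness makes them equal and leaves no room for the
  other last item.\<close>

lemma list_last:
  assumes "Li H" "Li H'" "F h" "F h'" "H @@ h = H' @@ h'" "len (H @@ h) < n"
  shows "H = H' \<and> h = h'"
proof -
  have main: "H = H'" if H: "Li H" "Li H'" "F h" "F h'" "H @@ h = H' @@ h'" "len (H @@ h) < n" "H \<sqsubseteq> H'" for H H' h h'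
  proof (rule ccontr)
    assume "H \<noteq> H'"
    have l: "len H' < n" "len h < n"
    proof -
      have "len H + len h < n" "len H + len h = len H' + len h'" using H(6) arg_cong[OF H(5), of len] by simp_all
      then show "len H' < n" "len h < n"
        using zz_nonneg[of "len h'"] zz_nonneg[of "len H"] unfolding zify by linarith+
    qed
    then obtain g where g: "F g" "H @@ g \<sqsubseteq> H'" using list_next[OF H(2) _ H(1,7)] \<open>H \<noteq> H'\<close> by blast
    then obtain z where z: "H' = H @@ g @@ z" unfolding pre_def by blast
    then have "H @@ h = H @@ (g @@ (z @@ h'))" using H(5) by simp
    then have h: "h = g @@ (z @@ h')" by (simp only: wc_cancel_left)
    then have "g = h" using prefix_free[OF H(3) g(1) l(2)] pre_wc by metis
    then have "g @@ (z @@ h') = g" using h by simp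
    then show False using F_nonzero[OF H(4)] by (simp only: wc_cancel_left_0) simp
  qed
  have "H \<sqsubseteq> H' \<or> H' \<sqsubseteq> H" using pre_comparable assms(5) by blast
  then have "H = H'"
    using main[OF assms(1-6)] main[OF assms(2,1,4,3) assms(5)[symmetric]] assms(5,6) by metis
  then show ?thesis using assms(5) by simp
qed

end

context deriv
begin

text \<open>Defining equations by composition and recursion require entries for the components but
  none for the compound symbol, and they mention the letters of initial symbols. \<open>F\<close>
  adds these to the judged symbols \<open>F0\<close>, so that all function words form one class with
  unique reading. \<open>LF\<close> likewise collects lists from two kinds of judgements.\<close>

definition F0 :: "mm => bool" where "F0 f \<longleftrightarrow> (\<exists>N\<le>W. isFUN f N)"
definition LF :: "mm => bool" where
  "LF H \<longleftrightarrow> H \<le> W \<and> ((\<exists>M\<le>W. \<exists>N\<le>W. isFUNS H M N) \<or> (\<exists>X\<le>W. \<exists>A\<le>W. isAPPS H X A))"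
definition F :: "mm => bool" where
  "F f \<longleftrightarrow> f \<le> W \<and> (f = L EPS \<or> f = L SUC0 \<or> f = L SUC1 \<or> F0 f \<or> (\<exists>g\<le>W. \<exists>H\<le>W. f = s_cComp g H \<and> F0 g \<and> LF H)
     \<or> (\<exists>ge\<le>W. \<exists>g0\<le>W. \<exists>g1\<le>W. f = s_cRec ge g0 g1 \<and> F0 ge \<and> F0 g0 \<and> F0 g1))"

lemma Sg_F0 [def_intros]: "T1 f ==> Sg (Suc k) (%s. F0 (f s))"
  by (rule Sg_inst[of F0]) (auto simp: F0_def intro!: def_intros)
lemma Sg_LF [def_intros]: "T1 f ==> Sg (Suc k) (%s. LF (f s))"
  by (rule Sg_inst[of LF]) (auto simp: LF_def intro!: def_intros)
lemma Sg_F [def_intros]: "T1 f ==> Sg (Suc k) (%s. F (f s))"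
  by (rule Sg_inst[of F]) (auto simp: F_def intro!: def_intros)

lemma isFUN_F0: "isFUN f N ==> F0 f"
  unfolding F0_def using isFUN_sub sub_le by blast

lemma F0_F: "F0 f ==> F f"
  unfolding F_def F0_def using isFUN_sub sub_le by blast

lemma isFUN_F: "isFUN f N ==> F f"
  using isFUN_F0 F0_F by blast

lemma isFUNS_LF: "isFUNS H M N ==> LF H"
  unfolding LF_def using isFUNS_sub sub_le by blast

lemma isAPPS_LF: "isAPPS H X A ==> LF H"
  unfolding LF_def using isAPPS_sub sub_le by blast

lemma F_cases:
  assumes "F f"
  shows "f = L EPS \<or> f = L SUC0 \<or> f = L SUC1 \<or> (\<exists>N. f = s_cConst N \<and> s_unary N)
    \<or> (\<exists>I N. f = s_cProj I N \<and> s_unary I \<and> s_unary N)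
    \<or> (\<exists>g H. f = s_cComp g H \<and> F g \<and> LF H)
    \<or> (\<exists>ge g0 g1. f = s_cRec ge g0 g1 \<and> F ge \<and> F g0 \<and> F g1)"
proof -
  consider (letter) "f = L EPS \<or> f = L SUC0 \<or> f = L SUC1" | (1) "F0 f" | (2) g H where "f = s_cComp g H" "F0 g" "LF H"
    | (3) ge g0 g1 where "f = s_cRec ge g0 g1" "F0 ge" "F0 g0" "F0 g1"
    using assms unfolding F_def by auto
  then show ?thesis
  proof cases
    case letter then show ?thesis by argo
  next
    case 1
    then obtain N where "isFUN f N" unfolding F0_def by blast
    moreover have "\<exists>g H. f = s_cComp g H \<and> F g \<and> LF H" if "\<exists>g H M N. f = s_cComp g H \<and> isFUN g M \<and> isFUNS H M N"
      using that isFUN_F isFUNS_LF by blast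
    moreover have "\<exists>ge g0 g1. f = s_cRec ge g0 g1 \<and> F ge \<and> F g0 \<and> F g1"
      if "\<exists>ge g0 g1 N M. f = s_cRec ge g0 g1 \<and> isFUN ge N \<and> isFUN g0 M \<and> isFUN g1 M"
      using that isFUN_F by blast
    ultimately show ?thesis using isFUN_cases[of f N] by argo
  next
    case (2 g H)
    then have "\<exists>g H. f = s_cComp g H \<and> F g \<and> LF H" using F0_F by blast
    then show ?thesis by argo
  next
    case (3 ge g0 g1)
    then have "\<exists>ge g0 g1. f = s_cRec ge g0 g1 \<and> F ge \<and> F g0 \<and> F g1" using F0_F by blast
    then show ?thesis by argo
  qed
qed

lemma LF_cases: "LF H ==> H = 0 \<or> (\<exists>H1 h. H = H1 @@ h \<and> LF H1 \<and> F h)"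
  unfolding LF_def[of H] using isFUNS_cases[of H] isAPPS_cases[of H] isFUN_F isFUNS_LF isAPPS_LF by metis

lemma F_bound: "F f ==> f \<le> W" by (simp add: F_def)
lemma LF_bound: "LF f ==> f \<le> W" by (simp add: LF_def)

lemmas code_defs = s_cConst_def s_cProj_def s_cComp_def s_cRec_def

definition fletters :: "nat set" where "fletters = {EPS, SUC0, SUC1, CNST, PROJ, COMP, REC}"

lemma code_cons:
  "s_cConst N = L CNST @@ (N @@ L END)" "s_cProj I N = L PROJ @@ (I @@ L END @@ N @@ L END)"
  "s_cComp g H = L COMP @@ (g @@ H @@ L END)" "s_cRec ge g0 g1 = L REC @@ (ge @@ g0 @@ g1)"
  by (simp_all add: code_defs)

lemma F_first: "F f ==> \<exists>k r. k \<in> fletters \<and> f = L k @@ r"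
proof -
  assume "F f"
  have 1: "?thesis" if "f = L k" "k \<in> fletters" for k
    using that by (intro exI[of _ k] exI[of _ 0]) simp
  have 2: "?thesis" if "f = L k @@ r" "k \<in> fletters" for k r
    using that by blast
  from F_cases[OF \<open>F f\<close>] show ?thesis unfolding code_cons
    by (elim disjE exE conjE) (erule 1 2, simp add: fletters_def)+
qed

lemma F_nonzero: "F f ==> f \<noteq> 0" using F_first by fastforce

lemma F_not_letter: "F f ==> k \<notin> fletters ==> \<not> L k \<sqsubseteq> f"
  using F_first[of f] unfolding pre_def by auto

text \<open>Polish notation is prefix-free: the first letter fixes the constructor, unary blocks
  stop at the first \<open>END\<close>, and component words are handled by the induction
  hypothesis.\<close>

lemma F_prefix:
  assumes "F f" "F f'" "f' \<sqsubseteq> f"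
  shows "f' = f"
proof -
  define Q where "Q f \<longleftrightarrow> (\<forall>f'\<le>W. F f \<and> F f' \<and> f' \<sqsubseteq> f --> f' = f)" for f
  have "Q f"
  proof (rule len_induct[of Q, OF _ F_bound[OF assms(1)]])
    show "Pg (Suc (Suc 0)) (%s. Q (s 0))" unfolding Q_def by (intro def_intros)
    fix f assume IH: "\<And>y. y \<le> W ==> len y < len f ==> Q y"
    have pf: "h' = h" if "F h" "F h'" "len h < len f" "h' \<sqsubseteq> h" for h h'
      using IH[OF F_bound[OF that(1)] that(3)] that F_bound unfolding Q_def by blast
    \<comment> \<open>Prefix-freeness is so far known only below the length of \<open>f\<close>;
      this is what the parameter of the locale expresses.\<close>
    interpret wl: word_lists F LF W "len f"
    proof
      show "Sg (Suc 0) (%s. F (s 0))" "Sg (Suc 0) (%s. LF (s 0))" by (intro def_intros)+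
    qed (fact F_bound F_nonzero LF_bound LF_cases pf)+
    have pf2: "g = g' \<and> x = y" if "F g" "F g'" "g @@ x = g' @@ y" "len g < len f" "len g' < len f" for g g' x y
      using pre_comparable[OF that(3)] pf that by (metis wc_cancel_left)
    have "f' = f" if f: "F f" "F f'" "f' \<sqsubseteq> f" for f'
    proof -
      obtain z where z: "f = f' @@ z" using f(3) unfolding pre_def by blast
      have un: "I = J \<and> x = y" if "s_unary I" "s_unary J" "I @@ L END @@ x = J @@ L END @@ y" for I J x y
        using letter_prefix[OF that(3)] unary_no_letter that by simp
      have lsub: "len y < len f" if "f' = L k @@ x @@ y @@ w" for k x y w
        using that z one_le[of "len (L k)"] zz_nonneg[of "len x"] zz_nonneg[of "len w"] zz_nonneg[of "len z"]
        by simp (unfold zify, simp)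
      have lsub': "len y < len f" if "f = L k @@ x @@ y @@ w" for k x y w
        using that one_le[of "len (L k)"] zz_nonneg[of "len x"] zz_nonneg[of "len w"]
        by simp (unfold zify, simp)
      note c = F_cases[OF f(1)] F_cases[OF f(2)]
      obtain k r k' r' where k: "f = L k @@ r" "f' = L k' @@ r'" using F_first f(1,2) by metis
      then have kk: "k = k'" using z by (metis L_cons wc_assoc)
      have first: "k = j ==> L j @@ x = f' ==> x = r'" "k = j ==> L j @@ x = f ==> x = r" for j x
        using k kk by auto
      have kd: "L j @@ x = f ==> k = j" "L j @@ x = f' ==> k = j" "L j = f ==> k = j" "L j = f' ==> k = j" for j x
        using k kk by auto
      from c(1) consider (leaf) j where "f = L j" | (const) N where "f = s_cConst N" "s_unary N"
        | (proj) I N where "f = s_cProj I N" "s_unary I" "s_unary N"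
        | (comp) g H where "f = s_cComp g H" "F g" "LF H"
        | (rec) ge g0 g1 where "f = s_cRec ge g0 g1" "F ge" "F g0" "F g1" by blast
      then show ?thesis
      proof cases
        case leaf
        then have "f' = 0 \<or> z = 0" using pow_atom[OF is_pow_L] z by metis
        then show ?thesis using z F_nonzero[OF f(2)] by auto
      next
        case (const N)
        then have "k = CNST" using k(1) unfolding code_defs by (metis L_cons wc_assoc)
        then obtain N' where N': "f' = s_cConst N'" "s_unary N'"
          using c(2) k(2) kk unfolding code_defs by (auto simp flip: wc_assoc simp del: wc_assoc)
        have "L CNST @@ (N @@ L END @@ 0) = L CNST @@ (N' @@ L END @@ z)"
          using z const(1) N'(1) unfolding code_defs by simp
        then have "N @@ L END @@ 0 = N' @@ L END @@ z" by (simp only: wc_cancel_left)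
        then have "N = N'" using un const(2) N'(2) by blast
        then show ?thesis using const N' by simp
      next
        case (proj I N)
        then have "k = PROJ" using k(1) unfolding code_defs by (metis L_cons wc_assoc)
        then obtain I' N' where N': "f' = s_cProj I' N'" "s_unary I'" "s_unary N'"
          using c(2) k(2) kk unfolding code_defs by (auto simp flip: wc_assoc simp del: wc_assoc)
        have "L PROJ @@ (I @@ L END @@ (N @@ L END @@ 0)) = L PROJ @@ (I' @@ L END @@ (N' @@ L END @@ z))"
          using z proj(1) N'(1) unfolding code_defs by simp
        then have "I @@ L END @@ (N @@ L END @@ 0) = I' @@ L END @@ (N' @@ L END @@ z)" by (simp only: wc_cancel_left)
        then have "I = I'" "N @@ L END @@ 0 = N' @@ L END @@ z" using un proj N' by blast+
        then have "N = N'" using un proj N' by blast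
        then show ?thesis using proj N' \<open>I = I'\<close> by simp
      next
        case (comp g H)
        then have "k = COMP" using k(1) unfolding code_defs by (metis L_cons wc_assoc)
        then obtain g' H' where N': "f' = s_cComp g' H'" "F g'" "LF H'"
          using c(2) k(2) kk unfolding code_defs by (auto simp flip: wc_assoc simp del: wc_assoc)
        have "L COMP @@ (g @@ (H @@ L END @@ 0)) = L COMP @@ (g' @@ (H' @@ L END @@ z))"
          using z comp(1) N'(1) unfolding code_defs by simp
        then have e: "g @@ (H @@ L END @@ 0) = g' @@ (H' @@ L END @@ z)" by (simp only: wc_cancel_left)
        have l: "len g < len f" "len H < len f" "len g' < len f" "len H' < len f"
          using lsub[of COMP 0 g' "H' @@ L END"] lsub[of COMP g' H' "L END"]
            lsub'[of COMP 0 g "H @@ L END"] lsub'[of COMP g H "L END"] comp(1) N'(1) unfolding code_defs by simp_all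
        have "g = g'" "H @@ L END @@ 0 = H' @@ L END @@ z" using pf2[OF comp(2) N'(2) e] l by auto
        moreover have "H = H'"
          using wl.list_end[OF comp(3) N'(3) _ _ calculation(2) is_pow_L] l F_not_letter[of _ END]
          by (auto simp: fletters_def)
        ultimately show ?thesis using comp N' by simp
      next
        case (rec ge g0 g1)
        then have "k = REC" using k(1) unfolding code_defs by (metis L_cons wc_assoc)
        then obtain ge' g0' g1' where N': "f' = s_cRec ge' g0' g1'" "F ge'" "F g0'" "F g1'"
          using c(2) k(2) kk unfolding code_defs by (auto simp flip: wc_assoc simp del: wc_assoc)
        have "L REC @@ (ge @@ (g0 @@ (g1 @@ 0))) = L REC @@ (ge' @@ (g0' @@ (g1' @@ z)))"
          using z rec(1) N'(1) unfolding code_defs by simp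
        then have e: "ge @@ (g0 @@ (g1 @@ 0)) = ge' @@ (g0' @@ (g1' @@ z))" by (simp only: wc_cancel_left)
        have l: "len ge < len f" "len g0 < len f" "len g1 < len f" "len ge' < len f" "len g0' < len f" "len g1' < len f"
          using lsub[of REC 0 ge' "g0' @@ g1'"] lsub[of REC ge' g0' g1'] lsub[of REC "ge' @@ g0'" g1' 0]
            lsub'[of REC 0 ge "g0 @@ g1"] lsub'[of REC ge g0 g1] lsub'[of REC "ge @@ g0" g1 0] rec(1) N'(1)
          unfolding code_defs by simp_all
        have 1: "ge = ge'" "g0 @@ (g1 @@ 0) = g0' @@ (g1' @@ z)" using pf2[OF rec(2) N'(2) e] l by auto
        then have 2: "g0 = g0'" "g1 @@ 0 = g1' @@ z" using pf2[OF rec(3) N'(3) 1(2)] l by auto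
        then have "g1 = g1'" using pf2[OF rec(4) N'(4) 2(2)] l by auto
        then show ?thesis using rec N' 1 2 by simp
      qed
    qed
    then show "Q f" unfolding Q_def by blast
  qed
  then show ?thesis using assms F_bound unfolding Q_def by blast
qed

end

section \<open>Arrays and pairing with linear bounds on lengths\<close>

section \<open>Tables\<close>

subsection \<open>Arrays and pairs\<close>

text \<open>Digit \<open>i\<close> of \<open>d\<close> in base \<open>2 ^ b\<close>. Arrays are
  numbers in such a base, with 0 beyond their end.\<close>

definition dig :: "mm => mm => mm => mm" where "dig b d i = lo (hi d (b * i)) b"

lemma T1_dig [def_intros]: "T1 f ==> T1 g ==> T1 h ==> T1 (%s. dig (f s) (g s) (h s))"
  unfolding dig_def by (intro def_intros)

lemma dig_unique:
  assumes "Log b" "Log i" "d = (A * ex b + v) * ex (b * i) + R" "v < ex b" "R < ex (b * i)"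
  shows "dig b d i = v"
proof -
  have "hi d (b * i) = A * ex b + v" using assms by (intro hilo_unique) (auto intro: Log_times)
  then show ?thesis unfolding dig_def using assms(1,4) hilo_unique(2) by simp
qed

lemma dig_split:
  assumes "Log b" "Log i"
  obtains A R where "d = (A * ex b + dig b d i) * ex (b * i) + R" "R < ex (b * i)" "dig b d i < ex b"
proof
  have L: "Log (b * i)" using assms by (rule Log_times)
  show "d = (hi (hi d (b * i)) b * ex b + dig b d i) * ex (b * i) + lo d (b * i)"
    unfolding dig_def using hilo(1)[OF assms(1), of "hi d (b * i)"] hilo(1)[OF L, of d] by simp
  show "lo d (b * i) < ex (b * i)" using hilo(2)[OF L] .
  show "dig b d i < ex b" unfolding dig_def using hilo(2)[OF assms(1)] .
qed

lemma dig_less: "Log b ==> dig b d i < ex b"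
  unfolding dig_def by (rule hilo(2))

lemma dig_len: "Log b ==> len (dig b d i) \<le> b"
  by (simp add: len_le_iff dig_less)

lemma dig_beyond: "len d \<le> b * i ==> dig b d i = 0"
  by (auto simp: dig_def hi_def lo_def not_less)

lemma dig_0 [simp]: "dig b 0 i = 0" by (rule dig_beyond) simp

lemma dig_first: "Log b ==> v < ex b ==> dig b v 0 = v"
  by (rule dig_unique[of _ _ _ 0 _ 0]) simp_all

lemma dig_low:
  assumes "Log b" "Log c" "b * i + b \<le> c"
  shows "dig b (x * ex c + V) i = dig b V i"
proof (cases "b = 0")
  case False
  obtain k where k: "c = b * i + b + k" using assms(3) le_ex by blast
  have "i \<le> b * i" using False mult_right_mono[of 1 b i] by (simp add: one_le)
  then have "i \<le> c" "b * i \<le> c" "k \<le> c"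
    using k zz_nonneg[of "b * i"] zz_nonneg[of b] zz_nonneg[of k] unfolding zify by linarith+
  then have L: "Log i" "Log (b * i)" "Log k" using assms(2) Log_down by blast+
  obtain A R where V: "V = (A * ex b + dig b V i) * ex (b * i) + R" "R < ex (b * i)" "dig b V i < ex b"
    using dig_split[OF assms(1) L(1)] by blast
  have "ex c = ex k * ex b * ex (b * i)" using k L assms(1) by (simp add: ex_add Log_add ac_simps)
  then have "x * ex c + V = ((x * ex k + A) * ex b + dig b V i) * ex (b * i) + R"
    by (subst V(1)) (simp add: algebra_simps)
  then show ?thesis using dig_unique[OF assms(1) L(1) _ V(3,2)] by blast
next
  case True
  have "lo x 0 = 0" for x using hilo(2)[of 0 x] by (simp add: less_iff)
  then show ?thesis using True by (simp add: dig_def)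
qed

lemma dig_high:
  assumes "Log b" "Log c" "Log i" "V < ex (b * c)"
  shows "dig b (x * ex (b * c) + V) (c + i) = dig b x i"
proof -
  have L: "Log (b * c)" "Log (b * i)" using assms by (simp_all add: Log_times)
  obtain A R where x: "x = (A * ex b + dig b x i) * ex (b * i) + R" "R < ex (b * i)" "dig b x i < ex b"
    using dig_split[OF assms(1,3)] by blast
  have e: "ex (b * (c + i)) = ex (b * c) * ex (b * i)" using L by (simp add: distrib_left ex_add)
  have "(R + 1) * ex (b * c) \<le> ex (b * i) * ex (b * c)" using x(2) by (intro mult_right_mono) (auto simp: less_iff)
  then have "R * ex (b * c) + V < ex (b * (c + i))"
    using assms(4) unfolding e zify by (simp add: algebra_simps)
  moreover have "x * ex (b * c) + V = (A * ex b + dig b x i) * ex (b * (c + i)) + (R * ex (b * c) + V)"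
    unfolding e by (subst x(1)) (simp add: algebra_simps)
  ultimately show ?thesis using dig_unique[OF assms(1) Log_add[OF assms(2,3)] _ x(3)] by blast
qed

lemma array_snoc:
  assumes "Log b" "Log N" "len V \<le> b * N" "v < ex b"
  shows "dig b (v * ex (b * N) + V) N = v" "i < N ==> dig b (v * ex (b * N) + V) i = dig b V i"
    "len (v * ex (b * N) + V) \<le> b * (N + 1)" "hi (v * ex (b * N) + V) (b * N) = v" "lo (v * ex (b * N) + V) (b * N) = V"
proof -
  have L: "Log (b * N)" using assms by (simp add: Log_times)
  have V: "V < ex (b * N)" using assms(3) L by (simp add: len_le_iff)
  show "dig b (v * ex (b * N) + V) N = v" using dig_high[OF assms(1,2) Log_0 V, of v] dig_first[OF assms(1,4)] by simp
  show "dig b (v * ex (b * N) + V) i = dig b V i" if "i < N"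
  proof (rule dig_low[OF assms(1) L])
    have "b * (i + 1) \<le> b * N" using that by (intro mult_left_mono) (auto simp: less_iff)
    then show "b * i + b \<le> b * N" by (simp add: distrib_left)
  qed
  show "hi (v * ex (b * N) + V) (b * N) = v" "lo (v * ex (b * N) + V) (b * N) = V"
    using hilo_unique[OF L _ V] by auto
  have "(v + 1) * ex (b * N) \<le> ex b * ex (b * N)" using assms(4) by (intro mult_right_mono) (auto simp: less_iff)
  moreover have "ex (b * (N + 1)) = ex b * ex (b * N)" using L assms(1) by (simp add: distrib_left ex_add mult.commute)
  ultimately have "v * ex (b * N) + V < ex (b * (N + 1))"
    using V unfolding zify by (simp add: algebra_simps)
  then show "len (v * ex (b * N) + V) \<le> b * (N + 1)" using assms by (simp add: len_le_iff Log_times Log_add)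
qed

lemma array_high_less:
  assumes "Log b" "Log c" "len d \<le> b * M" "c \<le> M" "Log M" "R < ex (b * c)"
  shows "len (hi d (b * c) * ex (b * c) + R) \<le> b * M"
proof -
  let ?A = "hi d (b * c)" and ?E = "ex (b * c)"
  have L: "Log (b * c)" using assms by (simp add: Log_times)
  obtain l where l: "M = c + l" using assms(4) le_ex by blast
  then have Ll: "Log l" "Log (b * l)" using assms Log_down[of M l] by (auto intro: Log_times)
  have e: "ex (b * M) = ex (b * l) * ?E" unfolding l distrib_left[of b c l] using L Ll by (simp add: ex_add mult.commute)
  have "d < ex (b * M)" using assms by (simp add: len_le_iff Log_times)
  moreover have "?A * ?E \<le> d" using hilo(1)[OF L, of d] by (metis le_add_same_cancel1 mm_nonneg)
  ultimately have "?A * ?E < ex (b * l) * ?E" using e by simp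
  then have "?A < ex (b * l)" by (metis mult_right_mono not_le mm_nonneg)
  then have "(?A + 1) * ?E \<le> ex (b * M)" unfolding e by (intro mult_right_mono) (auto simp: less_iff)
  then have "?A * ?E + R < ex (b * M)" using assms(6) unfolding zify by (simp add: algebra_simps)
  then show ?thesis using assms by (simp add: len_le_iff Log_times)
qed

lemma array_update:
  assumes "Log b" "Log j" "v < ex b" "len d \<le> b * M" "j + 1 \<le> M" "Log M"
  shows "\<exists>d'. dig b d' j = v \<and> (\<forall>i. i \<noteq> j --> dig b d' i = dig b d i) \<and> len d' \<le> b * M"
proof -
  define A R where "A = hi d (b * (j + 1))" and "R = lo d (b * j)"
  have L: "Log (b * j)" "Log (b * (j + 1))" using assms by (simp_all add: Log_times Log_add)
  have R: "R < ex (b * j)" "len R \<le> b * j" using hilo(2)[OF L(1), of d] L(1) by (simp_all add: R_def len_le_iff)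
  define d' where "d' = A * ex (b * (j + 1)) + (v * ex (b * j) + R)"
  note sn = array_snoc[OF assms(1,2) R(2) assms(3)]
  have mid: "v * ex (b * j) + R < ex (b * (j + 1))" using sn(3) L(2) by (simp add: len_le_iff)
  have le: "b * i + b \<le> b * k" if "i < k" for i k
  proof -
    have "b * (i + 1) \<le> b * k" using that by (intro mult_left_mono) (auto simp: less_iff)
    then show ?thesis by (simp add: distrib_left)
  qed
  have low: "dig b d' i = dig b (v * ex (b * j) + R) i" if "i \<le> j" for i
    unfolding d'_def by (rule dig_low[OF assms(1) L(2) le]) (use that in \<open>simp add: le_iff\<close>)
  have 1: "dig b d' j = v" using low[of j] sn(1) by simp
  have 2: "dig b d' i = dig b d i" if "i < j" for i
  proof -
    have "d = hi d (b * j) * ex (b * j) + R" using hilo(1)[OF L(1)] by (simp add: R_def)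
    then have "dig b d i = dig b R i" using dig_low[OF assms(1) L(1) le[OF that]] by metis
    then show ?thesis using low[of i] sn(2)[OF that] that by simp
  qed
  have 4: "len d' \<le> b * M"
    unfolding d'_def A_def by (rule array_high_less) (use assms mid in \<open>auto intro: Log_add\<close>)
  have 3: "dig b d' i = dig b d i" if "j < i" for i
  proof -
    have "j + 1 \<le> i" using that by (simp add: less_iff)
    then obtain k where k: "i = (j + 1) + k" using le_ex by blast
    show ?thesis
    proof (cases "Log k")
      case True
      have "dig b d' i = dig b A k" unfolding d'_def k
        by (rule dig_high) (use assms True mid in \<open>auto intro: Log_add\<close>)
      moreover have "dig b d i = dig b A k"
        using dig_high[OF assms(1) _ True, of "j + 1" "lo d (b * (j + 1))" A] hilo[OF L(2), of d] assms(2)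
        unfolding k A_def by (simp add: Log_add)
      ultimately show ?thesis by simp
    next
      case False
      \<comment> \<open>If the remaining index is not in \<open>Log\<close>, the position lies
        beyond \<open>M\<close>, which is. Both arrays have digit 0 there.\<close>
      have "M \<le> i" using False assms(6) k Log_down[of M k] by (metis add_increasing linear mm_nonneg order_trans)
      then have "b * M \<le> b * i" by (rule mult_left_mono) simp
      then show ?thesis using assms(4) 4 dig_beyond order_trans by metis
    qed
  qed
  have "dig b d' i = dig b d i" if "i \<noteq> j" for i using 2 3 that by (metis linorder_neqE)
  then show ?thesis using 1 4 by blast
qed

text \<open>A quadratic pairing without division: \<open>x \<le> x + y\<close> is smaller than the
  gap between consecutive squares, so the sum and then \<open>x\<close> can be recovered.\<close>

definition pair :: "mm => mm => mm" where "pair x y = (x + y) * (x + y) + x"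

lemma T1_pair [def_intros]: "T1 f ==> T1 g ==> T1 (%s. pair (f s) (g s))"
  unfolding pair_def by (intro def_intros)

lemma pair_inj [simp]: "pair x y = pair x' y' \<longleftrightarrow> x = x' \<and> y = y'"
proof
  have *: "\<not> x + y < x' + y'" if "pair x y = pair x' y'" for x y x' y'
  proof
    assume "x + y < x' + y'"
    define s t where "s = x + y" and "t = x' + y'"
    have "s + 1 \<le> t" using \<open>x + y < x' + y'\<close> by (simp add: less_iff s_def t_def)
    then have "(s + 1) * (s + 1) \<le> t * t" by (intro mult_mono) auto
    moreover have "x \<le> s" by (simp add: s_def)
    moreover have "s * s + x = t * t + x'" using that by (simp add: pair_def s_def t_def)
    ultimately show False using zz_nonneg[of x'] zz_nonneg[of s] unfolding zify by (simp add: algebra_simps)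
  qed
  assume p: "pair x y = pair x' y'"
  then have "x + y = x' + y'" using *[OF p] *[OF p[symmetric]] by simp
  then show "x = x' \<and> y = y'" using p by (simp add: pair_def)
qed simp

lemma pair_less: "Log i ==> x < ex i ==> y < ex i ==> pair x y < ex (2 * i + 3)"
proof -
  assume i: "Log i" "x < ex i" "y < ex i"
  have e: "ex (2 * i + 3) = 8 * (ex i * ex i)"
  proof -
    have "(3 :: mm) = 1 + 1 + 1" unfolding zify by simp
    then have "ex 3 = 8" using ex_Suc[of "1 + 1"] ex_Suc[of 1] by simp
    moreover have "2 * i + 3 = i + i + 3" by (simp add: mult_2)
    ultimately show ?thesis using i(1) by (simp add: ex_add Log_add mult.commute)
  qed
  define P q where "P = (x + y) * (x + y)" and "q = ex i * ex i"
  have "P \<le> (2 * ex i) * (2 * ex i)" unfolding P_def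
    using i by (intro mult_mono) (auto simp: mult_2 add_mono order_less_imp_le)
  then have "P \<le> 4 * q" by (simp add: q_def mult.assoc mult.left_commute)
  moreover have "ex i * 1 \<le> q" unfolding q_def using i(1) by (intro mult_left_mono) (simp_all add: one_le)
  ultimately show ?thesis using i(2) ex_pos[OF i(1)] unfolding e pair_def P_def[symmetric] q_def[symmetric] zify
    by simp
qed

text \<open>
  \<open>EV t \<sigma> w\<close>: the word \<open>w\<close> is a prefix of the value of \<open>t\<close> in the environment \<open>\<sigma>\<close>, an array indexed by the
  lengths of the variable words. \<open>EVS T N \<sigma> V\<close>: likewise for a list \<open>T\<close> of \<open>N\<close> terms and the array \<open>V\<close>.
  \<open>CALL f N V w\<close>: likewise for the function word \<open>f\<close> applied to the \<open>N\<close> values in \<open>V\<close>.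
\<close>

definition EV :: "mm => mm => mm => mm" where "EV t \<sigma> w = pair 1 (pair t (pair \<sigma> w))"
definition EVS :: "mm => mm => mm => mm => mm" where "EVS T N \<sigma> V = pair 2 (pair T (pair N (pair \<sigma> V)))"
definition CALL :: "mm => mm => mm => mm => mm" where "CALL f N V w = pair 3 (pair f (pair N (pair V w)))"

lemma T1_entries [def_intros]:
  "T1 f1 ==> T1 f2 ==> T1 f3 ==> T1 (%s. EV (f1 s) (f2 s) (f3 s))"
  "T1 f1 ==> T1 f2 ==> T1 f3 ==> T1 f4 ==> T1 (%s. EVS (f1 s) (f2 s) (f3 s) (f4 s))"
  "T1 f1 ==> T1 f2 ==> T1 f3 ==> T1 f4 ==> T1 (%s. CALL (f1 s) (f2 s) (f3 s) (f4 s))"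
  unfolding EV_def EVS_def CALL_def by (intro def_intros; assumption)+

lemma mm_numeral_neq: "(1 :: mm) \<noteq> 2" "(1 :: mm) \<noteq> 3" "(2 :: mm) \<noteq> 3" "(2 :: mm) \<noteq> 1" "(3 :: mm) \<noteq> 1" "(3 :: mm) \<noteq> 2"
  unfolding zify by simp_all

lemma entry_eq [simp]:
  "EV t \<sigma> w = EV t' \<sigma>' w' \<longleftrightarrow> t = t' \<and> \<sigma> = \<sigma>' \<and> w = w'"
  "EVS T N \<sigma> V = EVS T' N' \<sigma>' V' \<longleftrightarrow> T = T' \<and> N = N' \<and> \<sigma> = \<sigma>' \<and> V = V'"
  "CALL f N V w = CALL f' N' V' w' \<longleftrightarrow> f = f' \<and> N = N' \<and> V = V' \<and> w = w'"
  "EV t \<sigma> w \<noteq> EVS T' N' \<sigma>' V'" "EV t \<sigma> w \<noteq> CALL f' N' V' w'" "EVS T N \<sigma> V \<noteq> CALL f' N' V' w'"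
  "EVS T' N' \<sigma>' V' \<noteq> EV t \<sigma> w" "CALL f' N' V' w' \<noteq> EV t \<sigma> w" "CALL f' N' V' w' \<noteq> EVS T N \<sigma> V"
  by (simp_all add: EV_def EVS_def CALL_def mm_numeral_neq)

lemma pair_nonzero: "x \<noteq> 0 ==> pair x y \<noteq> 0" by (simp add: pair_def)

lemma entry_nonzero [simp]: "EV t \<sigma> w \<noteq> 0" "EVS T N \<sigma> V \<noteq> 0" "CALL f N V w \<noteq> 0"
  by (simp_all add: EV_def EVS_def CALL_def pair_nonzero)

text \<open>One pairing takes bit bound \<open>i\<close> to \<open>2 * i + 3\<close>; four of them
  give \<open>16 * i + 45\<close>, rounded up to a common bound. The condition
  \<open>2 \<le> i\<close> makes room for the tags 1, 2 and 3.\<close>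

lemma entries_less:
  assumes i: "Log i" "2 \<le> i" and "x < ex i" "y < ex i" "z < ex i" "u < ex i"
  shows "EV x y z < ex (16 * i + 64)" "EVS x y z u < ex (16 * i + 64)" "CALL x y z u < ex (16 * i + 64)"
proof -
  define i1 i2 i3 i4 where "i1 = 2 * i + 3" and "i2 = 2 * i1 + 3" and "i3 = 2 * i2 + 3" and "i4 = 2 * i3 + 3"
  have L: "Log i1" "Log i2" "Log i3" "Log i4" using i(1) by (simp_all add: i1_def i2_def i3_def i4_def Log_add Log_times)
  have dbl: "j \<le> 2 * j + 3" for j :: mm using zz_nonneg[of j] unfolding zify by linarith
  have o: "i \<le> i1" "i1 \<le> i2" "i2 \<le> i3" "i3 \<le> i4" unfolding i1_def i2_def i3_def i4_def by (rule dbl)+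
  have o5: "i4 \<le> 16 * i + 64" unfolding i1_def i2_def i3_def i4_def zify by (simp add: algebra_simps)
  have up: "a < ex k" if "a < ex j" "j \<le> k" "Log k" for a j k
    using that ex_mono by (meson order_less_le_trans)
  have "(4 :: mm) = ex 2"
  proof -
    have "(2 :: mm) = 1 + 1" by simp
    then show ?thesis using ex_Suc[of 1] by simp
  qed
  then have "(3 :: mm) < ex i" using ex_mono[OF i(2,1)] unfolding zify by simp
  then have n: "1 < ex i" "2 < ex i" "3 < ex i" unfolding zify by simp_all
  have p2: "pair y z < ex i1" "pair z u < ex i1" using pair_less i(1) assms(3-6) by (simp_all add: i1_def)
  have p3: "pair x (pair y z) < ex i2" "pair y (pair z u) < ex i2"
    unfolding i2_def by (rule pair_less[OF L(1)]; use p2 up[OF _ o(1) L(1)] assms in blast)+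
  have p4: "pair x (pair y (pair z u)) < ex i3"
    unfolding i3_def by (rule pair_less[OF L(2)]; use p3 up[OF up[OF _ o(1) L(1)] o(2) L(2)] assms in blast)
  have u2: "a < ex i ==> a < ex i2" for a using up[OF up[OF _ o(1) L(1)] o(2) L(2)] by blast
  have u3: "a < ex i ==> a < ex i3" for a using up[OF u2 o(3) L(3)] by blast
  have "EV x y z < ex i3" unfolding EV_def i3_def by (rule pair_less[OF L(2) u2[OF n(1)] p3(1)])
  then have "EV x y z < ex i4" using up o(4) L(4) by blast
  moreover have "EVS x y z u < ex i4" unfolding EVS_def i4_def by (rule pair_less[OF L(3) u3[OF n(2)] p4])
  moreover have "CALL x y z u < ex i4" unfolding CALL_def i4_def by (rule pair_less[OF L(3) u3[OF n(3)] p4])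
  moreover have "Log (16 * i + 64)" using i(1) by (simp add: Log_add Log_times)
  ultimately show "EV x y z < ex (16 * i + 64)" "EVS x y z u < ex (16 * i + 64)" "CALL x y z u < ex (16 * i + 64)"
    using up o5 by blast+
qed

lemma less_ex: "Log i ==> i < ex i"
proof -
  have "len x \<le> x" for x
  proof (rule PIND_mm_Sg[of "%x. len x \<le> x"])
    show "Sg (Suc (Suc 0)) (%s. len (s 0) \<le> s 0)" by (intro def_intros)
    fix x assume IH: "len (half x) \<le> half x" "x \<noteq> 0"
    show "len x \<le> x"
    proof (cases "half x = 0")
      case True
      then have "x = 1" using half_cases[of x] IH(2) by auto
      then show ?thesis by (simp add: len_1)
    next
      case False
      then have "1 \<le> half x" by (simp add: one_le)
      then show ?thesis using IH len_pos[OF IH(2)] half_cases[of x] unfolding zify by linarith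
    qed
  qed simp
  then show "Log i ==> i < ex i" using Log_iff ex_bounds by (metis le_less_trans)
qed

context deriv
begin

section \<open>Term words and their unique reading\<close>

subsection \<open>Terms\<close>

definition x0 :: mm where "x0 = s_var 0"

text \<open>The parts of argument lists that precede the variables \<open>x_1, x_2, ...\<close> in
  defining equations, together with their own initial parts needed when terms are split off from the
  right.\<close>

definition list_head :: "mm => bool" where
  "list_head T \<longleftrightarrow> T = 0 \<or> T = x0 \<or> T = s_app (L EPS) 0 \<or> T = s_app (L SUC0) x0 \<or> T = s_app (L SUC1) x0
     \<or> (\<exists>f\<le>W. \<exists>Y\<le>W. \<exists>M\<le>W. F f \<and> isVARS Y M \<and> T = x0 @@ s_app f (x0 @@ Y))"

text \<open>Defining equations write down terms that have no \<open>TRM\<close> entry, and argument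
  lists may be known only from \<open>SUBS\<close>, \<open>PRFS\<close> or \<open>APPS\<close>.
  Gathering all sources gives a class closed under removing the last term, on which evaluation can
  be defined uniformly.\<close>

definition TL :: "mm => bool" where
  "TL T \<longleftrightarrow> T \<le> W \<and> ((\<exists>N\<le>W. isTRMS T N) \<or> (\<exists>x\<le>W. \<exists>r\<le>W. \<exists>T'\<le>W. isSUBS T x r T' \<or> isSUBS T' x r T)
     \<or> (\<exists>P\<le>W. \<exists>U\<le>W. \<exists>N\<le>W. isPRFS P T U N \<or> isPRFS P U T N) \<or> (\<exists>H\<le>W. \<exists>X\<le>W. isAPPS H X T)
     \<or> (\<exists>T0\<le>W. \<exists>X\<le>W. \<exists>N\<le>W. list_head T0 \<and> isVARS X N \<and> T = T0 @@ X))"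

definition TM :: "mm => bool" where
  "TM t \<longleftrightarrow> t \<le> W \<and> (s_is_var t \<or> (\<exists>f\<le>W. \<exists>T\<le>W. F f \<and> TL T \<and> t = s_app f T))"

lemma Sg_list_head [def_intros]: "T1 f ==> Sg (Suc k) (%s. list_head (f s))"
  by (rule Sg_inst[of list_head], unfold list_head_def, intro def_intros)
lemma Sg_TL [def_intros]: "T1 f ==> Sg (Suc k) (%s. TL (f s))"
  by (rule Sg_inst[of TL], unfold TL_def, intro def_intros)
lemma Sg_TM [def_intros]: "T1 f ==> Sg (Suc k) (%s. TM (f s))"
  by (rule Sg_inst[of TM], unfold TM_def, intro def_intros)

lemma TL_bound: "TL T ==> T \<le> W" and TM_bound: "TM t ==> t \<le> W"
  by (simp_all add: TL_def TM_def)

lemma app_le: "s_app f T \<le> W ==> f \<le> W \<and> T \<le> W"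
  unfolding s_app_def by (meson order_trans wc_le)

lemma TM_var: "s_is_var x ==> x \<le> W ==> TM x" by (simp add: TM_def)
lemma TM_app: "F f ==> TL T ==> s_app f T \<le> W ==> TM (s_app f T)"
  unfolding TM_def using app_le by blast

lemma TM_cases: "TM t ==> s_is_var t \<or> (\<exists>f T. F f \<and> TL T \<and> t = s_app f T)"
  unfolding TM_def by blast

lemma s_app_nonzero [simp]: "s_app f T \<noteq> 0" by (simp add: s_app_def)
lemma var_nonzero: "s_is_var x ==> x \<noteq> 0" using is_var_pow is_pow_nonzero by blast
lemma TM_nonzero: "TM t ==> t \<noteq> 0" using TM_cases var_nonzero by force

lemma TL_trms: assumes "isTRMS T N" shows "TL T"
proof -
  have b: "T \<le> W" "N \<le> W" using isTRMS_sub[OF assms] sub_le by auto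
  then have "\<exists>N\<le>W. isTRMS T N" using assms by blast
  then show ?thesis unfolding TL_def using b by argo
qed

lemma TL_subs: assumes "isSUBS T x r T'" shows "TL T \<and> TL T'"
proof -
  have b: "T \<le> W" "x \<le> W" "r \<le> W" "T' \<le> W" using isSUBS_sub[OF assms] sub_le by auto
  then have "\<exists>x\<le>W. \<exists>r\<le>W. \<exists>T'\<le>W. isSUBS T x r T' \<or> isSUBS T' x r T" "\<exists>x\<le>W. \<exists>r\<le>W. \<exists>T\<le>W. isSUBS T' x r T \<or> isSUBS T x r T'"
    using assms by blast+
  then show ?thesis unfolding TL_def using b by argo
qed

lemma TL_prfs: assumes "isPRFS P T U N" shows "TL T \<and> TL U"
proof -
  have b: "P \<le> W" "T \<le> W" "U \<le> W" "N \<le> W" using isPRFS_sub[OF assms] sub_le by auto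
  then have "\<exists>P\<le>W. \<exists>U\<le>W. \<exists>N\<le>W. isPRFS P T U N \<or> isPRFS P U T N" "\<exists>P\<le>W. \<exists>T\<le>W. \<exists>N\<le>W. isPRFS P U T N \<or> isPRFS P T U N"
    using assms by blast+
  then show ?thesis unfolding TL_def using b by argo
qed

lemma TL_apps: assumes "isAPPS H X T" shows "TL T"
proof -
  have b: "H \<le> W" "X \<le> W" "T \<le> W" using isAPPS_sub[OF assms] sub_le by auto
  then have "\<exists>H\<le>W. \<exists>X\<le>W. isAPPS H X T" using assms by blast
  then show ?thesis unfolding TL_def using b by argo
qed

lemma TL_vars: assumes "list_head T0" "isVARS X N" "T0 @@ X \<le> W" shows "TL (T0 @@ X)"
proof -
  have "T0 \<le> W" "X \<le> W" "N \<le> W" using isVARS_sub[OF assms(2)] sub_le wc_le[of T0 X] assms(3) order_trans by blast+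
  then have "\<exists>T1\<le>W. \<exists>Y\<le>W. \<exists>N\<le>W. list_head T1 \<and> isVARS Y N \<and> T0 @@ X = T1 @@ Y" using assms by blast
  then show ?thesis unfolding TL_def using assms(3) by argo
qed

lemma list_heads [simp]: "list_head 0" "list_head x0" "list_head (s_app (L EPS) 0)"
  "list_head (s_app (L SUC0) x0)" "list_head (s_app (L SUC1) x0)"
  by (simp_all add: list_head_def)

lemma F_letters: "L EPS \<le> W ==> F (L EPS)" "L SUC0 \<le> W ==> F (L SUC0)" "L SUC1 \<le> W ==> F (L SUC1)"
  by (simp_all add: F_def)

lemma TRM_TM: "isTRM t ==> TM t"
  using isTRM_cases[of t] isTRM_sub[of t] sub_le[of t] isFUN_F TL_trms TM_var TM_app by blast

lemma SUB_TM: assumes "isSUB t x r t'" shows "TM t \<and> TM t'"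
proof -
  have b: "t \<le> W" "t' \<le> W" using isSUB_sub[OF assms] sub_le by auto
  from isSUB_cases[OF assms] consider "t = x" "t' = r" "s_is_var x" "isTRM r" | "t' = t" "s_is_var t"
    | f N T T' where "t = s_app f T" "t' = s_app f T'" "isFUN f N" "isSUBS T x r T'" by blast
  then show ?thesis
  proof cases
    case 1 then show ?thesis using TRM_TM TM_var b by simp
  next
    case 2 then show ?thesis using TM_var b by simp
  next
    case (3 f N T T') then show ?thesis using TM_app isFUN_F[OF 3(3)] TL_subs[OF 3(4)] b by simp
  qed
qed

lemma TL_app_arg: "isVARS X N ==> TL X"
  using TL_vars[of 0 X N] isVARS_sub[of X N] sub_le by simp

lemma len_mid: "x \<noteq> 0 ==> len y < len (x @@ a @@ y @@ b)"
  using one_le[of "len x"] zz_nonneg[of "len a"] zz_nonneg[of "len b"] by (simp, unfold zify, simp)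

lemma APPS_vars: assumes "isAPPS H X A" shows "\<exists>N. isVARS X N"
proof -
  have b: "H \<le> W \<and> X \<le> W \<and> A \<le> W" if "isAPPS H X A" for H X A using isAPPS_sub[OF that] sub_le by blast
  have Nb: "N \<le> W" if "isVARS X N" for N using isVARS_sub[OF that] sub_le by blast
  let ?Q = "%A. \<forall>H\<le>W. isAPPS H X A --> (\<exists>N\<le>W. isVARS X N)"
  have "?Q A"
  proof (rule len_induct[of ?Q A W])
    show "Pg (Suc (Suc 0)) (%s. ?Q (s 0))" by (intro Pg_ball Pg_imp; (rule Sg_Pg)?; intro def_intros)
    show "A \<le> W" using b[OF assms] by simp
    fix A assume IH: "\<And>y. y \<le> W ==> len y < len A ==> ?Q y"
    show "?Q A"
    proof (intro allI impI)
      fix H assume A: "isAPPS H X A"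
      from isAPPS_cases[OF A] show "\<exists>N\<le>W. isVARS X N"
      proof (elim disjE exE conjE)
        fix N assume "isVARS X N" then show ?thesis using Nb by blast
      next
        fix H' A' h N assume *: "A = A' @@ s_app h X" "isAPPS H' X A'"
        then have "len A' < len A" by (simp add: mm_pos)
        then show ?thesis using IH[of A'] b[OF *(2)] *(2) by blast
      qed
    qed
  qed
  then show ?thesis using assms b[OF assms] by blast
qed

text \<open>A variable list is built up from the empty one, so the latter has an entry too. It
  supplies \<open>TL 0\<close>, by which the empty argument list may occur in tables.\<close>

lemma vars_0: assumes that: "isVARS X N" shows "isVARS 0 0"
proof -
  have "\<forall>N\<le>W. isVARS X N --> isVARS 0 0"
  proof (rule len_induct[of "%X. \<forall>N\<le>W. isVARS X N --> isVARS 0 0" X W])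
    show "Pg (Suc (Suc 0)) (%s. \<forall>N\<le>W. isVARS (s 0) N --> isVARS 0 0)" by (intro def_intros)
    show "X \<le> W" using isVARS_sub[OF that] sub_le by blast
    fix X assume IH: "\<And>y. y \<le> W ==> len y < len X ==> \<forall>N\<le>W. isVARS y N --> isVARS 0 0"
    show "\<forall>N\<le>W. isVARS X N --> isVARS 0 0"
    proof (intro allI impI)
      fix N assume N: "isVARS X N"
      from isVARS_cases[OF N] show "isVARS 0 0"
      proof (elim disjE exE conjE)
        fix X' N' assume *: "X = X' @@ s_var (N' @@ L MARK)" "isVARS X' N'"
        then have "len X' < len X" using var_nonzero[OF s_var_is_var] by (simp add: mm_pos)
        then show ?thesis using IH[of X'] * isVARS_sub[OF *(2)] sub_le by blast
      qed (use N in simp)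
    qed
  qed
  then show ?thesis using that isVARS_sub[OF that] sub_le by blast
qed

lemma head_TM:
  assumes "list_head T0" "T0 \<le> W" "isVARS X N"
  shows "T0 = 0 \<or> (\<exists>T1 t. T0 = T1 @@ t \<and> TL T1 \<and> TM t)"
proof -
  have TL0: "TL 0" using TL_app_arg[OF vars_0[OF assms(3)]] .
  have one: "?thesis" if "TM T0" using that TL0 by (metis wc_0(1))
  have v: "s_is_var x0" using s_var_is_var by (simp add: x0_def)
  have x0: "TM x0 \<and> TL x0" if "x0 \<le> W"
    using that TM_var[OF v] TL_vars[OF list_heads(2) vars_0[OF assms(3)]] by simp
  consider "T0 = 0" | "T0 = x0" | "T0 = s_app (L EPS) 0" | "T0 = s_app (L SUC0) x0" | "T0 = s_app (L SUC1) x0"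
    | f Y M where "F f" "isVARS Y M" "T0 = x0 @@ s_app f (x0 @@ Y)"
    using assms(1) unfolding list_head_def by blast
  then show ?thesis
  proof cases
    case 2 then show ?thesis using one x0 assms(2) by simp
  next
    case 3
    then have "TM T0" using TM_app[of "L EPS" 0] TL0 F_letters(1) app_le[of "L EPS" 0] assms(2) by blast
    then show ?thesis by (rule one)
  next
    case 4
    then have "TM T0" using TM_app[of "L SUC0" x0] x0 F_letters(2) app_le[of "L SUC0" x0] assms(2) by blast
    then show ?thesis by (rule one)
  next
    case 5
    then have "TM T0" using TM_app[of "L SUC1" x0] x0 F_letters(3) app_le[of "L SUC1" x0] assms(2) by blast
    then show ?thesis by (rule one)
  next
    case (6 f Y M)
    have b: "x0 \<le> W" "s_app f (x0 @@ Y) \<le> W" using assms(2) 6(3) wc_le order_trans by blast+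
    then have "TL (x0 @@ Y)" using TL_vars[OF list_heads(2) 6(2)] app_le[of f "x0 @@ Y"] by blast
    then have "TM (s_app f (x0 @@ Y))" using TM_app 6(1) b by simp
    then show ?thesis using x0[OF b(1)] 6(3) by blast
  qed simp
qed

lemma F_comp: "isFUN g M ==> isFUNS H M N ==> s_cComp g H \<le> W ==> F (s_cComp g H)"
  using isFUN_F0[of g M] isFUNS_LF[of H M N] F0_F[of g] F_bound[of g] LF_bound[of H] unfolding F_def[of "s_cComp g H"] by blast

lemma F_rec: "isFUN ge N ==> isFUN g0 M ==> isFUN g1 M' ==> s_cRec ge g0 g1 \<le> W ==> F (s_cRec ge g0 g1)"
  using isFUN_F0[of ge N] isFUN_F0[of g0 M] isFUN_F0[of g1 M'] F0_F F_bound unfolding F_def[of "s_cRec ge g0 g1"] by blast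

lemma def_eq_cases:
  assumes "s_def_eq W W t u"
  obtains (const) N X where "t = s_app (s_cConst N) X" "u = s_app (L EPS) 0" "isFUN (s_cConst N) N" "isVARS X N"
    | (proj) I N X where "t = s_app (s_cProj I N) X" "u = s_var I" "s_unary I" "isFUN (s_cProj I N) N" "isVARS X N"
    | (comp) g H M N X A where "t = s_app (s_cComp g H) X" "u = s_app g A" "isFUN g M" "isFUNS H M N" "isVARS X N" "isAPPS H X A"
    | (rec) ge g0 g1 N X where "isFUN ge N" "isFUN g0 (N @@ L MARK @@ L MARK)" "isFUN g1 (N @@ L MARK @@ L MARK)" "isVARS X N"
        "t = s_app (s_cRec ge g0 g1) (s_app (L EPS) 0 @@ X) \<and> u = s_app ge X
        \<or> t = s_app (s_cRec ge g0 g1) (s_app (L SUC0) x0 @@ X) \<and> u = s_app g0 (x0 @@ s_app (s_cRec ge g0 g1) (x0 @@ X) @@ X)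
        \<or> t = s_app (s_cRec ge g0 g1) (s_app (L SUC1) x0 @@ X) \<and> u = s_app g1 (x0 @@ s_app (s_cRec ge g0 g1) (x0 @@ X) @@ X)"
proof -
  have entry: "isVARS X N \<longleftrightarrow> s_entry W (s_judge VARS [X, N])" "isAPPS H X A \<longleftrightarrow> s_entry W (s_judge APPS [H, X, A])"
    "isFUN f N \<longleftrightarrow> s_entry W (s_judge FUN [f, N])" "isFUNS H M N \<longleftrightarrow> s_entry W (s_judge FUNS [H, M, N])" for X N f H A M
    by (simp_all add: is_defs)
  from assms[unfolded s_def_eq_def, folded entry x0_def] show ?thesis
    by (elim disjE exE conjE) (erule (3) const | erule (4) proj | rule comp, assumption+ | rule rec, assumption+, simp)+
qed

lemma DEF_TM: assumes "s_def_eq W W t u" "t \<le> W" "u \<le> W" shows "TM t \<and> TM u"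
proof -
  have eps: "TM (s_app (L EPS) 0)" if "s_app (L EPS) 0 \<le> W" "isVARS X N" for X N
    using TM_app[of "L EPS" 0] vars_0[OF that(2)] F_letters(1) app_le[OF that(1)] TL_app_arg that(1) by blast
  from assms(1) show ?thesis
  proof (cases rule: def_eq_cases)
    case const
    then show ?thesis using TM_app isFUN_F TL_app_arg eps assms by blast
  next
    case proj
    then show ?thesis using TM_app isFUN_F TL_app_arg s_var_is_var TM_var assms by blast
  next
    case comp
    then show ?thesis using TM_app isFUN_F TL_app_arg TL_apps F_comp app_le assms by blast
  next
    case (rec ge g0 g1 N X)
    let ?f = "s_cRec ge g0 g1"
    have f: "F ?f" using rec(5) assms(2) F_rec[OF rec(1-3)] app_le by blast
    have g: "F ge" "F g0" "F g1" using rec isFUN_F by blast+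
    have t: "TM (s_app ?f (T0 @@ X))" if "s_app ?f (T0 @@ X) \<le> W" "list_head T0" for T0
      using TM_app[OF f] TL_vars[OF that(2) rec(4)] that(1) app_le by blast
    have u: "TM (s_app g (x0 @@ s_app ?f (x0 @@ X) @@ X))" if b: "s_app g (x0 @@ s_app ?f (x0 @@ X) @@ X) \<le> W" "F g" for g
    proof -
      have "list_head (x0 @@ s_app ?f (x0 @@ X))"
        unfolding list_head_def using f rec(4) F_bound isVARS_sub[OF rec(4)] sub_le by blast
      then show ?thesis using TM_app[OF b(2)] TL_vars[OF _ rec(4)] b(1) app_le by blast
    qed
    show ?thesis using rec(5) t[OF _ list_heads(3)] t[OF _ list_heads(4)] t[OF _ list_heads(5)]
        u[OF _ g(2)] u[OF _ g(3)] TM_app[OF g(1) TL_app_arg[OF rec(4)]] assms(2,3) by (elim disjE conjE) auto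
  qed
qed

text \<open>Symmetry and transitivity carry no judgements about terms, so an induction on
  derivations is required. It precedes \<open>TL_cases\<close>, where lists may come from
  \<open>PRFS\<close>.\<close>

lemma PRF_TM: assumes "isPRF p t u" shows "TM t \<and> TM u"
proof -
  let ?Q = "%p. \<forall>t\<le>W. \<forall>u\<le>W. isPRF p t u --> TM t \<and> TM u"
  have b: "p \<le> W \<and> t \<le> W \<and> u \<le> W" if "isPRF p t u" for p t u using isPRF_sub[OF that] sub_le by blast
  have "?Q p"
  proof (rule len_induct[of ?Q p W])
    show "Pg (Suc (Suc 0)) (%s. ?Q (s 0))" by (intro Pg_ball Pg_imp; (rule Sg_Pg)?; intro def_intros)
    show "p \<le> W" using b[OF assms] by simp
    fix p assume IH: "\<And>y. y \<le> W ==> len y < len p ==> ?Q y"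
    have IH': "TM t \<and> TM u" if "isPRF q t u" "len q < len p" for q t u
      using IH[of q] that b[OF that(1)] by blast
    show "?Q p"
    proof (intro allI impI)
      fix t u assume p: "isPRF p t u"
      have less: "len q < len (s_node k t u (q @@ q'))" "len q < len (s_node k t u (q' @@ q))" for k q q'
        using len_mid[OF L_nonzero, of q k "t @@ u" q'] len_mid[OF L_nonzero, of q k "t @@ u @@ q'" 0] by (simp_all add: s_node_def)
      from isPRF_cases[OF p] consider "s_def_eq W W t u" | "u = t" "isTRM t" | q where "p = s_node SYM t u q" "isPRF q u t"
        | q q' v where "p = s_node TRANS t u (q @@ q')" "isPRF q t v" "isPRF q' v u"
        | P f N T U where "t = s_app f T" "u = s_app f U" "isFUN f N" "isPRFS P T U N"
        | t0 u0 x r where "isSUB t0 x r t" "isSUB u0 x r u" by blast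
      then show "TM t \<and> TM u"
      proof cases
        case 1 then show ?thesis using DEF_TM b[OF p] by blast
      next
        case 2 then show ?thesis using TRM_TM by blast
      next
        case (3 q) then show ?thesis using IH'[OF 3(2)] less(1)[of q SYM 0] by simp
      next
        case (4 q q' v) then show ?thesis using IH'[OF 4(2)] IH'[OF 4(3)] less(1)[of q TRANS q'] less(2)[of q' TRANS q] by simp
      next
        case (5 P f N T U) then show ?thesis using TM_app isFUN_F[OF 5(3)] TL_prfs[OF 5(4)] b[OF p] by simp
      next
        case 6 then show ?thesis using SUB_TM by blast
      qed
    qed
  qed
  then show ?thesis using b[OF assms] assms by blast
qed

lemma TL_cases:
  assumes "TL T"
  shows "T = 0 \<or> (\<exists>T1 t. T = T1 @@ t \<and> TL T1 \<and> TM t)"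
proof -
  consider N where "isTRMS T N" | x r T' where "isSUBS T x r T'" | x r T' where "isSUBS T' x r T"
    | P U N where "isPRFS P T U N" | P U N where "isPRFS P U T N" | H X where "isAPPS H X T"
    | T0 X N where "list_head T0" "isVARS X N" "T = T0 @@ X"
    using assms unfolding TL_def by blast
  then show ?thesis
  proof cases
    case 1 then show ?thesis using isTRMS_cases[OF 1] TL_trms TRM_TM by blast
  next
    case 2 then show ?thesis using isSUBS_cases[OF 2] TL_subs SUB_TM by blast
  next
    case 3 then show ?thesis using isSUBS_cases[OF 3] TL_subs SUB_TM by blast
  next
    case 4 then show ?thesis using isPRFS_cases[OF 4] TL_prfs PRF_TM by blast
  next
    case 5 then show ?thesis using isPRFS_cases[OF 5] TL_prfs PRF_TM by blast
  next
    case (6 H X)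
    have "TM (s_app h X)" if "T = A' @@ s_app h X" "isAPPS H' X A'" "isFUN h N" for A' H' h N
    proof -
      have "s_app h X \<le> W" using wc_le(2)[of "s_app h X" A'] that(1) TL_bound[OF assms] by simp
      moreover have "\<exists>N. isVARS X N" using APPS_vars[OF 6] .
      ultimately show ?thesis using TM_app isFUN_F[OF that(3)] TL_app_arg by blast
    qed
    then show ?thesis using isAPPS_cases[OF 6] TL_apps by blast
  next
    case (7 T0 X N)
    have T0: "T0 \<le> W" using 7(3) TL_bound[OF assms] wc_le order_trans by blast
    from isVARS_cases[OF 7(2)] show ?thesis
    proof (elim disjE exE conjE)
      assume "X = 0"
      then show ?thesis using head_TM[OF 7(1) T0 7(2)] 7(3) by simp
    next
      fix X' N' assume X: "X = X' @@ s_var (N' @@ L MARK)" "isVARS X' N'"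
      then have T: "T = (T0 @@ X') @@ s_var (N' @@ L MARK)" using 7(3) by simp
      then have "T0 @@ X' \<le> W" "s_var (N' @@ L MARK) \<le> W" using TL_bound[OF assms] wc_le order_trans by blast+
      then show ?thesis using T TL_vars[OF 7(1) X(2)] TM_var[OF s_var_is_var] by blast
    qed
  qed
qed

text \<open>A variable is one atom, larger than every letter that starts a function word. Otherwise
  both words begin with function words, which coincide by \<open>F_prefix\<close>, and the argument
  lists are ended by \<open>END\<close>, with which no term begins.\<close>

lemma TM_prefix:
  assumes "TM t" "TM t'" "t' \<sqsubseteq> t"
  shows "t' = t"
proof -
  define Q where "Q t \<longleftrightarrow> (\<forall>t'\<le>W. TM t \<and> TM t' \<and> t' \<sqsubseteq> t --> t' = t)" for t
  have "Q t"
  proof (rule len_induct[of Q, OF _ TM_bound[OF assms(1)]])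
    show "Pg (Suc (Suc 0)) (%s. Q (s 0))" unfolding Q_def by (intro Pg_ball Pg_imp; (rule Sg_Pg)?; intro def_intros)
    fix t assume IH: "\<And>y. y \<le> W ==> len y < len t ==> Q y"
    have pf: "h' = h" if "TM h" "TM h'" "len h < len t" "h' \<sqsubseteq> h" for h h'
      using IH[OF TM_bound[OF that(1)] that(3)] that TM_bound unfolding Q_def by blast
    interpret wl: word_lists TM TL W "len t"
    proof
      show "Sg (Suc 0) (%s. TM (s 0))" "Sg (Suc 0) (%s. TL (s 0))" by (intro def_intros)+
    qed (fact TM_bound TM_nonzero TL_bound TL_cases pf)+
    have "t' = t" if t: "TM t" "TM t'" "t' \<sqsubseteq> t" for t'
    proof -
      obtain z where z: "t = t' @@ z" using t(3) unfolding pre_def by blast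
      consider "s_is_var t" | f T where "F f" "TL T" "t = s_app f T" using TM_cases[OF t(1)] by blast
      then show ?thesis
      proof cases
        case 1
        then have "t' = 0 \<or> z = 0" using pow_atom[OF is_var_pow] z by metis
        then show ?thesis using z TM_nonzero[OF t(2)] by auto
      next
        case (2 f T)
        consider "s_is_var t'" | f' T' where "F f'" "TL T'" "t' = s_app f' T'" using TM_cases[OF t(2)] by blast
        then show ?thesis
        proof cases
          case 1
          obtain k r where k: "k \<in> fletters" "f = L k @@ r" using F_first[OF 2(1)] by blast
          then have "L k @@ (r @@ T @@ L END) = t' @@ z" using z 2(3) by (simp add: s_app_def)
          then have "L k = t'" using pow_cons[OF is_pow_L is_var_pow[OF 1]] by blast
          moreover have "k < VAR" using k(1) by (auto simp: fletters_def)
          ultimately show ?thesis using is_var_not_L[OF 1] by blast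
        next
          case (2 f' T')
          note f = \<open>F f\<close> \<open>TL T\<close> \<open>t = s_app f T\<close>
          have e: "f @@ (T @@ L END) = f' @@ (T' @@ L END @@ z)" using z f(3) 2(3) by (simp add: s_app_def)
          then have ff: "f = f'" using pre_comparable[OF e] F_prefix f(1) 2(1) by blast
          then have "T @@ L END @@ 0 = T' @@ L END @@ z" using e by (simp only: wc_cancel_left wc_0)
          moreover have "len T < len t"
            using len_mid[OF F_nonzero[OF f(1)], of T 0 "L END"] unfolding f(3) s_app_def by simp
          moreover have "len T' < len t"
            using len_mid[OF F_nonzero[OF 2(1)], of T' 0 "L END @@ z"] unfolding z 2(3) s_app_def by simp
          moreover have "\<not> L END \<sqsubseteq> h" if "TM h" for h
          proof
            assume "L END \<sqsubseteq> h"
            then obtain y where y: "h = L END @@ y" unfolding pre_def by blast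
            from TM_cases[OF that] show False
            proof (elim disjE exE conjE)
              assume v: "s_is_var h"
              then have "L END = h" using pow_cons[OF is_pow_L is_var_pow[OF v], of END y 0] y by simp
              then show False using is_var_not_L[OF v, of END] by simp
            next
              fix f T assume "F f" "h = s_app f T"
              then show False using F_first[of f] y by (auto simp: s_app_def fletters_def simp flip: wc_assoc)
            qed
          qed
          ultimately have "T = T' \<and> 0 = z" using wl.list_end[OF f(2) 2(2)] is_pow_L by blast
          then show ?thesis using z by simp
        qed
      qed
    qed
    then show "Q t" unfolding Q_def by blast
  qed
  then show ?thesis unfolding Q_def using assms TM_bound by blast
qed

sublocale wt: word_lists TM TL W "len t" for t
proof
  show "Sg (Suc 0) (%s. TM (s 0))" "Sg (Suc 0) (%s. TL (s 0))" by (intro def_intros)+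
qed (fact TM_bound TM_nonzero TL_bound TL_cases | simp add: TM_prefix)+

lemma TL_last: "TL T ==> TL T' ==> TM t ==> TM t' ==> T @@ t = T' @@ t' ==> T = T' \<and> t = t'"
  using wt.list_last[of T T' t t' "T @@ t @@ 1"] by (simp add: less_iff)

lemma app_inj: "F f ==> F f' ==> s_app f T = s_app f' T' ==> f = f' \<and> T = T'"
proof -
  assume f: "F f" "F f'" and "s_app f T = s_app f' T'"
  then have e: "f @@ (T @@ L END) = f' @@ (T' @@ L END)" by (simp add: s_app_def)
  then have "f = f'" using pre_comparable[OF e] F_prefix f by blast
  then show ?thesis using e by (simp only: wc_cancel_left wc_cancel_right)
qed

lemma app_not_var: "F f ==> \<not> s_is_var (s_app f T)"
proof
  assume f: "F f" and v: "s_is_var (s_app f T)"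
  have "f @@ (T @@ L END) = s_app f T" by (simp add: s_app_def)
  then show False using pow_atom[OF is_var_pow[OF v]] F_nonzero[OF f] by fastforce
qed

end

section \<open>Simultaneous substitution of definable functions\<close>

lemma Sg_inst2:
  assumes "Sg (Suc k) (%s. P (s (Suc 0)) (s 0))" "T1 f1" "T1 f2"
  shows "Sg (Suc k) (%s. P (f1 s) (f2 s))"
proof -
  note assms(1)
  from Sg_sub[OF T1_reindex[OF assms(3), of "%n. (Suc n)"], where P = "%x s. P (s 0) x", OF this]
  have "Sg (Suc k) (%s. P (s 0) (f2 (%n. s (Suc n))))" .
  from Sg_sub[OF T1_reindex[OF assms(2), of "%n. n"], where P = "%x s. P x (f2 s)", OF this]
  show ?thesis .
qed

lemma Pg_inst2:
  assumes "Pg (Suc k) (%s. P (s (Suc 0)) (s 0))" "T1 f1" "T1 f2"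
  shows "Pg (Suc k) (%s. P (f1 s) (f2 s))"
proof -
  note assms(1)
  from Pg_sub[OF T1_reindex[OF assms(3), of "%n. (Suc n)"], where P = "%x s. P (s 0) x", OF this]
  have "Pg (Suc k) (%s. P (s 0) (f2 (%n. s (Suc n))))" .
  from Pg_sub[OF T1_reindex[OF assms(2), of "%n. n"], where P = "%x s. P x (f2 s)", OF this]
  show ?thesis .
qed

lemma Sg_inst3:
  assumes "Sg (Suc k) (%s. P (s (Suc (Suc 0))) (s (Suc 0)) (s 0))" "T1 f1" "T1 f2" "T1 f3"
  shows "Sg (Suc k) (%s. P (f1 s) (f2 s) (f3 s))"
proof -
  note assms(1)
  from Sg_sub[OF T1_reindex[OF assms(4), of "%n. (Suc (Suc n))"], where P = "%x s. P (s (Suc 0)) (s 0) x", OF this]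
  have "Sg (Suc k) (%s. P (s (Suc 0)) (s 0) (f3 (%n. s (Suc (Suc n)))))" .
  from Sg_sub[OF T1_reindex[OF assms(3), of "%n. (Suc n)"], where P = "%x s. P (s 0) x (f3 (%n. s (Suc n)))", OF this]
  have "Sg (Suc k) (%s. P (s 0) (f2 (%n. s (Suc n))) (f3 (%n. s (Suc n))))" .
  from Sg_sub[OF T1_reindex[OF assms(2), of "%n. n"], where P = "%x s. P x (f2 s) (f3 s)", OF this]
  show ?thesis .
qed

lemma Sg_inst5:
  assumes "Sg (Suc k) (%s. P (s (Suc (Suc (Suc (Suc 0))))) (s (Suc (Suc (Suc 0)))) (s (Suc (Suc 0))) (s (Suc 0)) (s 0))" "T1 f1" "T1 f2" "T1 f3" "T1 f4" "T1 f5"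
  shows "Sg (Suc k) (%s. P (f1 s) (f2 s) (f3 s) (f4 s) (f5 s))"
proof -
  note assms(1)
  from Sg_sub[OF T1_reindex[OF assms(6), of "%n. (Suc (Suc (Suc (Suc n))))"], where P = "%x s. P (s (Suc (Suc (Suc 0)))) (s (Suc (Suc 0))) (s (Suc 0)) (s 0) x", OF this]
  have "Sg (Suc k) (%s. P (s (Suc (Suc (Suc 0)))) (s (Suc (Suc 0))) (s (Suc 0)) (s 0) (f5 (%n. s (Suc (Suc (Suc (Suc n)))))))" .
  from Sg_sub[OF T1_reindex[OF assms(5), of "%n. (Suc (Suc (Suc n)))"], where P = "%x s. P (s (Suc (Suc 0))) (s (Suc 0)) (s 0) x (f5 (%n. s (Suc (Suc (Suc n)))))", OF this]
  have "Sg (Suc k) (%s. P (s (Suc (Suc 0))) (s (Suc 0)) (s 0) (f4 (%n. s (Suc (Suc (Suc n))))) (f5 (%n. s (Suc (Suc (Suc n))))))" .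
  from Sg_sub[OF T1_reindex[OF assms(4), of "%n. (Suc (Suc n))"], where P = "%x s. P (s (Suc 0)) (s 0) x (f4 (%n. s (Suc (Suc n)))) (f5 (%n. s (Suc (Suc n))))", OF this]
  have "Sg (Suc k) (%s. P (s (Suc 0)) (s 0) (f3 (%n. s (Suc (Suc n)))) (f4 (%n. s (Suc (Suc n)))) (f5 (%n. s (Suc (Suc n)))))" .
  from Sg_sub[OF T1_reindex[OF assms(3), of "%n. (Suc n)"], where P = "%x s. P (s 0) x (f3 (%n. s (Suc n))) (f4 (%n. s (Suc n))) (f5 (%n. s (Suc n)))", OF this]
  have "Sg (Suc k) (%s. P (s 0) (f2 (%n. s (Suc n))) (f3 (%n. s (Suc n))) (f4 (%n. s (Suc n))) (f5 (%n. s (Suc n))))" .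
  from Sg_sub[OF T1_reindex[OF assms(2), of "%n. n"], where P = "%x s. P x (f2 s) (f3 s) (f4 s) (f5 s)", OF this]
  show ?thesis .
qed

lemma Sg_inst6:
  assumes "Sg (Suc k) (%s. P (s (Suc (Suc (Suc (Suc (Suc 0)))))) (s (Suc (Suc (Suc (Suc 0))))) (s (Suc (Suc (Suc 0)))) (s (Suc (Suc 0))) (s (Suc 0)) (s 0))" "T1 f1" "T1 f2" "T1 f3" "T1 f4" "T1 f5" "T1 f6"
  shows "Sg (Suc k) (%s. P (f1 s) (f2 s) (f3 s) (f4 s) (f5 s) (f6 s))"
proof -
  note assms(1)
  from Sg_sub[OF T1_reindex[OF assms(7), of "%n. (Suc (Suc (Suc (Suc (Suc n)))))"], where P = "%x s. P (s (Suc (Suc (Suc (Suc 0))))) (s (Suc (Suc (Suc 0)))) (s (Suc (Suc 0))) (s (Suc 0)) (s 0) x", OF this]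
  have "Sg (Suc k) (%s. P (s (Suc (Suc (Suc (Suc 0))))) (s (Suc (Suc (Suc 0)))) (s (Suc (Suc 0))) (s (Suc 0)) (s 0) (f6 (%n. s (Suc (Suc (Suc (Suc (Suc n))))))))" .
  from Sg_sub[OF T1_reindex[OF assms(6), of "%n. (Suc (Suc (Suc (Suc n))))"], where P = "%x s. P (s (Suc (Suc (Suc 0)))) (s (Suc (Suc 0))) (s (Suc 0)) (s 0) x (f6 (%n. s (Suc (Suc (Suc (Suc n))))))", OF this]
  have "Sg (Suc k) (%s. P (s (Suc (Suc (Suc 0)))) (s (Suc (Suc 0))) (s (Suc 0)) (s 0) (f5 (%n. s (Suc (Suc (Suc (Suc n)))))) (f6 (%n. s (Suc (Suc (Suc (Suc n)))))))" .
  from Sg_sub[OF T1_reindex[OF assms(5), of "%n. (Suc (Suc (Suc n)))"], where P = "%x s. P (s (Suc (Suc 0))) (s (Suc 0)) (s 0) x (f5 (%n. s (Suc (Suc (Suc n))))) (f6 (%n. s (Suc (Suc (Suc n)))))", OF this]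
  have "Sg (Suc k) (%s. P (s (Suc (Suc 0))) (s (Suc 0)) (s 0) (f4 (%n. s (Suc (Suc (Suc n))))) (f5 (%n. s (Suc (Suc (Suc n))))) (f6 (%n. s (Suc (Suc (Suc n))))))" .
  from Sg_sub[OF T1_reindex[OF assms(4), of "%n. (Suc (Suc n))"], where P = "%x s. P (s (Suc 0)) (s 0) x (f4 (%n. s (Suc (Suc n)))) (f5 (%n. s (Suc (Suc n)))) (f6 (%n. s (Suc (Suc n))))", OF this]
  have "Sg (Suc k) (%s. P (s (Suc 0)) (s 0) (f3 (%n. s (Suc (Suc n)))) (f4 (%n. s (Suc (Suc n)))) (f5 (%n. s (Suc (Suc n)))) (f6 (%n. s (Suc (Suc n)))))" .
  from Sg_sub[OF T1_reindex[OF assms(3), of "%n. (Suc n)"], where P = "%x s. P (s 0) x (f3 (%n. s (Suc n))) (f4 (%n. s (Suc n))) (f5 (%n. s (Suc n))) (f6 (%n. s (Suc n)))", OF this]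
  have "Sg (Suc k) (%s. P (s 0) (f2 (%n. s (Suc n))) (f3 (%n. s (Suc n))) (f4 (%n. s (Suc n))) (f5 (%n. s (Suc n))) (f6 (%n. s (Suc n))))" .
  from Sg_sub[OF T1_reindex[OF assms(2), of "%n. n"], where P = "%x s. P x (f2 s) (f3 s) (f4 s) (f5 s) (f6 s)", OF this]
  show ?thesis .
qed

text \<open>Two partial descriptions can belong to the same value exactly if they are
  comparable.\<close>

definition cpr :: "mm => mm => bool" where "cpr x y \<longleftrightarrow> x \<sqsubseteq> y \<or> y \<sqsubseteq> x"

lemma cpr_refl [simp]: "cpr x x" by (simp add: cpr_def)
lemma cpr_sym: "cpr x y ==> cpr y x" by (auto simp: cpr_def)
lemma cpr_0 [simp]: "cpr 0 x" "cpr x 0" by (simp_all add: cpr_def)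
lemma cpr_wc [simp]: "cpr (x @@ y) (x @@ z) \<longleftrightarrow> cpr y z" by (simp add: cpr_def)
lemma cpr_down: "cpr x y ==> x' \<sqsubseteq> x ==> y' \<sqsubseteq> y ==> cpr x' y'"
  unfolding cpr_def by (meson pre_linear pre_trans)

lemma Sg_cpr [def_intros]: "T1 f ==> T1 g ==> Sg (Suc k) (%s. cpr (f s) (g s))"
  and Pg_cpr [def_intros]: "T1 f ==> T1 g ==> Pg (Suc k) (%s. cpr (f s) (g s))"
  unfolding cpr_def by (intro def_intros; assumption)+

lemma pair_ge: "x \<le> pair x y" "y \<le> pair x y"
proof -
  have "x + y \<le> (x + y) * (x + y)" using mult_right_mono[of 1 "x + y" "x + y"] by (cases "x + y = 0") (auto simp: one_le)
  then show "x \<le> pair x y" "y \<le> pair x y" unfolding pair_def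
    using zz_nonneg[of x] zz_nonneg[of y] unfolding zify by linarith+
qed

lemma entry_ge: "t \<le> EV t \<sigma> w" "\<sigma> \<le> EV t \<sigma> w" "w \<le> EV t \<sigma> w"
  "T \<le> EVS T N \<sigma> V" "N \<le> EVS T N \<sigma> V" "\<sigma> \<le> EVS T N \<sigma> V" "V \<le> EVS T N \<sigma> V"
  "f \<le> CALL f N V w" "N \<le> CALL f N V w" "V \<le> CALL f N V w" "w \<le> CALL f N V w"
  unfolding EV_def EVS_def CALL_def by (meson pair_ge order_trans)+

context deriv
begin

section \<open>Good tables of partial evaluations\<close>

subsection \<open>Evaluation tables\<close>

text \<open>
  \<open>cap\<close> exceeds the lengths of the words in \<open>W\<close>, \<open>wid\<close> is the width of the values in an environment and bounds
  the size \<open>n\<close> of a good table, and \<open>ewid\<close> is the width of a table entry.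
\<close>

definition capw :: mm where "capw = ex (len W + 99)"
definition cap :: mm where "cap = len capw"
definition wid :: mm where "wid = 1000 * (cap * cap)"
definition ewid :: mm where "ewid = 16 * (wid * cap) + 64"
text \<open>A good table has at most \<open>wid\<close> slots of width \<open>ewid\<close>, the
  latter taken from \<open>entries_less\<close> for components of \<open>wid * cap\<close> bits. The
  common bound covers tables, entries and their components, so that all quantifiers over them are
  bounded.\<close>

definition top :: mm where "top = ex (ewid * wid + ewid)"

lemma cap_eq: "cap = len W + 100"
proof -
  have "cap = len W + 99 + 1" by (simp add: cap_def capw_def len_ex Log_add)
  then show ?thesis unfolding zify by linarith
qed

lemma Log_consts [simp]: "Log cap" "Log wid" "Log ewid" "Log (wid * i) \<longleftrightarrow> Log i" "Log (ewid * i) \<longleftrightarrow> Log i"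
proof -
  show 1: "Log cap" by (simp add: cap_def)
  then show 2: "Log wid" by (simp add: wid_def Log_times)
  then show 3: "Log ewid" using 1 by (simp add: ewid_def Log_times Log_add)
  have "1 \<le> wid" "1 \<le> ewid" by (simp_all add: one_le wid_def ewid_def cap_eq)
  then have "i \<le> wid * i" "i \<le> ewid * i" using mult_right_mono[of 1 _ i] by auto
  then show "Log (wid * i) \<longleftrightarrow> Log i" "Log (ewid * i) \<longleftrightarrow> Log i" using Log_times 2 3 Log_down by blast+
qed

lemma cap_wid: "cap \<le> wid" "100 \<le> cap"
proof -
  show "100 \<le> cap" by (simp add: cap_eq)
  have "1 * cap \<le> (1000 * cap) * cap" by (intro mult_right_mono) (auto simp: one_le cap_eq)
  then show "cap \<le> wid" by (simp add: wid_def mult.assoc)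
qed

lemma below_top:
  assumes "len x \<le> ewid * wid + ewid"
  shows "x \<le> top"
  using assms unfolding top_def by (subst (asm) len_le_iff) (auto simp: Log_add)

lemma widths: "wid \<le> wid * cap" "wid * cap \<le> ewid" "ewid \<le> ewid * wid" "cap \<le> wid * cap"
proof -
  have c: "1 \<le> cap" "1 \<le> wid" by (simp_all add: one_le wid_def cap_eq)
  then show "wid \<le> wid * cap" "ewid \<le> ewid * wid" "cap \<le> wid * cap"
    using mult_left_mono[OF c(1), of wid] mult_left_mono[OF c(2), of ewid] mult_right_mono[OF c(2), of cap] by simp_all
  have "q \<le> 16 * q + 64" for q :: mm using zz_nonneg[of q] unfolding zify by linarith
  then show "wid * cap \<le> ewid" unfolding ewid_def .
qed

lemma small_top: "len x \<le> wid * cap ==> x \<le> top" "len x \<le> ewid ==> x \<le> top" "len x \<le> ewid * wid ==> x \<le> top"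
  by (meson below_top widths order_trans add_increasing mm_nonneg order_refl add_increasing2)+

text \<open>Digit 0 marks a free slot; entries are nonzero by their tags.\<close>

definition mem :: "mm => mm => bool" where "mem e D \<longleftrightarrow> e \<noteq> 0 \<and> (\<exists>j\<le>len D. dig ewid D j = e)"

lemma Sg_mem [def_intros]: "T1 f ==> T1 g ==> Sg (Suc k) (%s. mem (f s) (g s))"
  by (rule Sg_inst2[of _ mem], unfold mem_def, intro def_intros)
lemma dig_index: "dig ewid D j \<noteq> 0 ==> j \<le> len D"
proof (rule ccontr)
  assume *: "dig ewid D j \<noteq> 0" "\<not> j \<le> len D"
  have "1 * j \<le> ewid * j" by (rule mult_right_mono) (simp_all add: one_le ewid_def)
  then have "len D \<le> ewid * j" using *(2) by simp
  then show False using dig_beyond *(1) by blast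
qed

lemma mem_iff: "mem e D \<longleftrightarrow> e \<noteq> 0 \<and> (\<exists>j. dig ewid D j = e)"
  unfolding mem_def using dig_index by auto

lemma mem_top: "mem e D ==> e \<le> top"
  unfolding mem_iff using dig_len[of ewid D] by (auto intro: small_top)

lemma mem_entry_top:
  "mem (EV t \<sigma> w) D ==> t \<le> top \<and> \<sigma> \<le> top \<and> w \<le> top"
  "mem (EVS T N \<sigma> V) D ==> T \<le> top \<and> N \<le> top \<and> \<sigma> \<le> top \<and> V \<le> top"
  "mem (CALL f N V w) D ==> f \<le> top \<and> N \<le> top \<and> V \<le> top \<and> w \<le> top"
  by (meson mem_top entry_ge order_trans)+

text \<open>The new entry becomes slot 0 and the others move up by one. The factor 1 gives the term
  the form required by \<open>dig_low\<close> and \<open>dig_high\<close>.\<close>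

definition ins :: "mm => mm => mm" where "ins D e = D * ex (ewid * 1) + e"

lemma mem_ins: "e < ex ewid ==> e \<noteq> 0 ==> mem x (ins D e) \<longleftrightarrow> x = e \<or> mem x D"
proof -
  assume e: "e < ex ewid" "e \<noteq> 0"
  have 0: "dig ewid (ins D e) 0 = e"
    unfolding ins_def using dig_low[of ewid "ewid * 1" 0 D e] dig_first[OF _ e(1)] by simp
  have S: "dig ewid (ins D e) (1 + j) = dig ewid D j" if "Log j" for j
    unfolding ins_def using e that by (intro dig_high) simp_all
  show ?thesis
  proof
    assume "mem x (ins D e)"
    then obtain j where j: "x \<noteq> 0" "j \<le> len (ins D e)" "dig ewid (ins D e) j = x" unfolding mem_def by blast
    show "x = e \<or> mem x D"
    proof (cases "j = 0")
      case False
      then obtain k where k: "j = 1 + k" using le_ex[of 1 j] by (auto simp: one_le)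
      have "Log k" using j(2) k Log_down[OF Log_len[of "ins D e"], of k] by (simp add: add_increasing order_trans[of k "1 + k"])
      then show ?thesis using S[of k] j k unfolding mem_iff by auto
    qed (use 0 j in simp)
  next
    assume "x = e \<or> mem x D"
    then show "mem x (ins D e)"
    proof
      assume "mem x D"
      then obtain j where "x \<noteq> 0" "j \<le> len D" "dig ewid D j = x" unfolding mem_def by blast
      then show ?thesis using S[of j] Log_down[OF Log_len[of D]] unfolding mem_iff by blast
    qed (use 0 e in \<open>auto simp: mem_iff\<close>)
  qed
qed

lemma len_ins: "e < ex ewid ==> len D \<le> ewid * n ==> Log n ==> len (ins D e) \<le> ewid * (n + 1)"
proof -
  assume e: "e < ex ewid" "len D \<le> ewid * n" "Log n"
  have "D + 1 \<le> ex (ewid * n)" using e by (simp add: len_le_iff less_iff)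
  then have "(D + 1) * ex ewid \<le> ex (ewid * n) * ex ewid" by (rule mult_right_mono) simp
  moreover have "ex (ewid * (n + 1)) = ex (ewid * n) * ex ewid" using e(3) by (simp add: distrib_left ex_add)
  ultimately have "ins D e < ex (ewid * (n + 1))" using e(1) unfolding ins_def zify by (simp add: algebra_simps)
  then show ?thesis using e(3) by (simp add: len_le_iff Log_add)
qed

definition val :: "mm => mm => mm" where "val \<sigma> x = dig wid \<sigma> (len x)"

definition envok :: "mm => mm => bool" where
  "envok n \<sigma> \<longleftrightarrow> len \<sigma> \<le> wid * cap \<and> (\<forall>i\<le>len capw. len (dig wid \<sigma> i) \<le> n)"

text \<open>The margin 30 leaves room for moving arguments to the environment positions from 29
  on.\<close>

definition argok :: "mm => mm => mm => bool" where
  "argok n N V \<longleftrightarrow> N + 30 \<le> cap \<and> len V \<le> wid * N \<and> (\<forall>i\<le>len capw. len (dig wid V i) \<le> n)"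

text \<open>The initial symbols \<open>\<epsilon>\<close>, \<open>s_0\<close> and \<open>s_1\<close>
  have no defining equations and are computed on the spot; all other symbols need a recorded
  call.\<close>

definition app_val :: "mm => mm => mm => mm => mm => bool" where
  "app_val D f N V w \<longleftrightarrow> (f = L EPS \<and> w = L EPS) \<or> (f = L SUC0 \<and> w = L SUC0 @@ dig wid V 0)
     \<or> (f = L SUC1 \<and> w = L SUC1 @@ dig wid V 0) \<or> mem (CALL f N V w) D"

definition rhs_plain :: "mm => mm => mm => bool" where
  "rhs_plain f N u \<longleftrightarrow> (\<exists>M\<le>W. f = s_cConst M \<and> u = s_app (L EPS) 0)
     \<or> (\<exists>I\<le>W. \<exists>M\<le>W. f = s_cProj I M \<and> s_unary I \<and> s_unary M \<and> u = s_var I)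
     \<or> (\<exists>g\<le>W. \<exists>H\<le>W. \<exists>X\<le>W. \<exists>A\<le>W. \<exists>M\<le>W. f = s_cComp g H \<and> F g \<and> LF H \<and> isVARS X M \<and> len M = N
          \<and> isAPPS H X A \<and> u = s_app g A)"

definition rec_rhs :: "mm => mm => mm => mm" where
  "rec_rhs f g X = s_app g (x0 @@ s_app f (x0 @@ X) @@ X)"

text \<open>The first letter of the recursion argument selects the equation, and the rest
  \<open>v\<close> may itself be only a known prefix. An unknown argument, the empty word, selects
  nothing.\<close>

definition rhs_rec :: "mm => mm => mm => mm => mm => bool" where
  "rhs_rec f N V u v \<longleftrightarrow> (\<exists>ge\<le>W. \<exists>g0\<le>W. \<exists>g1\<le>W. \<exists>X\<le>W. \<exists>M\<le>W. f = s_cRec ge g0 g1 \<and> F ge \<and> F g0 \<and> F g1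
     \<and> isVARS X M \<and> N = len M + 1
     \<and> ((dig wid V 0 = L EPS \<and> u = s_app ge X \<and> v = 0) \<or> (dig wid V 0 = L SUC0 @@ v \<and> u = rec_rhs f g0 X)
      \<or> (dig wid V 0 = L SUC1 @@ v \<and> u = rec_rhs f g1 X)))"

text \<open>
  A call \<open>f(V)\<close> is computed by the right hand side \<open>u\<close> of the defining equation of \<open>f\<close> that matches \<open>V\<close>, where
  \<open>c\<close> is the number of arguments that are not passed on to \<open>x\<^sub>1, x\<^sub>2, \<dots>\<close> and \<open>v\<close> is the value for \<open>x\<^sub>0\<close>.
\<close>
definition rhs :: "mm => mm => mm => mm => mm => mm => bool" where
  "rhs f N V u c v \<longleftrightarrow> (c = 0 \<and> v = 0 \<and> rhs_plain f N u) \<or> (c = 1 \<and> rhs_rec f N V u v)"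

text \<open>The environment in which a right hand side is evaluated: \<open>x0\<close> has index 28
  and receives \<open>v\<close>, and from index 29 on stand the arguments after the first
  \<open>c\<close>. Positions below 28 belong to no variable.\<close>

definition rho :: "mm => mm => mm => mm" where
  "rho c v V = (hi V (wid * c) * ex wid + v) * ex (wid * 28)"

definition okEV :: "mm => mm => mm => mm => mm => bool" where
  "okEV n D t \<sigma> w \<longleftrightarrow> TM t \<and> envok n \<sigma> \<and> len w \<le> n \<and> (w = 0 \<or> (s_is_var t \<and> w \<sqsubseteq> val \<sigma> t)
     \<or> (\<exists>f\<le>W. \<exists>T\<le>W. \<exists>N\<le>top. \<exists>V\<le>top. \<exists>w'\<le>top. t = s_app f T \<and> F f \<and> mem (EVS T N \<sigma> V) D \<and> w \<sqsubseteq> w'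
          \<and> app_val D f N V w'))"

text \<open>The condition \<open>N \<le> len T\<close> bounds the number of values by the length of
  a word of \<open>W\<close>, and thereby the size of the argument array.\<close>

definition okEVS :: "mm => mm => mm => mm => mm => mm => bool" where
  "okEVS n D T N \<sigma> V \<longleftrightarrow> TL T \<and> N \<le> len T \<and> envok n \<sigma> \<and> argok n N V \<and> ((T = 0 \<and> N = 0 \<and> V = 0)
     \<or> (\<exists>T1\<le>W. \<exists>t\<le>W. \<exists>M\<le>top. T = T1 @@ t \<and> N = M + 1 \<and> mem (EVS T1 M \<sigma> (lo V (wid * M))) D
          \<and> mem (EV t \<sigma> (hi V (wid * M))) D))"

definition okCALL :: "mm => mm => mm => mm => mm => mm => bool" where
  "okCALL n D f N V w \<longleftrightarrow> F f \<and> argok n N V \<and> len w \<le> n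
     \<and> (\<exists>u\<le>W. \<exists>c\<le>top. \<exists>v\<le>top. rhs f N V u c v \<and> mem (EV u (rho c v V) w) D)"

definition is_eval :: "mm => bool" where
  "is_eval e \<longleftrightarrow> (\<exists>t\<le>top. \<exists>\<sigma>\<le>top. \<exists>w\<le>top. e = EV t \<sigma> w) \<or> (\<exists>T\<le>top. \<exists>N\<le>top. \<exists>\<sigma>\<le>top. \<exists>V\<le>top. e = EVS T N \<sigma> V)"

definition okE :: "mm => mm => mm => bool" where
  "okE n D e \<longleftrightarrow> (\<exists>t\<le>top. \<exists>\<sigma>\<le>top. \<exists>w\<le>top. e = EV t \<sigma> w \<and> okEV n D t \<sigma> w)
     \<or> (\<exists>T\<le>top. \<exists>N\<le>top. \<exists>\<sigma>\<le>top. \<exists>V\<le>top. e = EVS T N \<sigma> V \<and> okEVS n D T N \<sigma> V)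
     \<or> (\<exists>f\<le>top. \<exists>N\<le>top. \<exists>V\<le>top. \<exists>w\<le>top. e = CALL f N V w \<and> okCALL n D f N V w)"

definition cmp :: "mm => mm => bool" where
  "cmp V V' \<longleftrightarrow> (\<forall>i\<le>len capw. cpr (dig wid V i) (dig wid V' i))"

text \<open>Only calls are constrained. For terms and lists coherence follows by induction on their
  structure, so entries for them can be added freely.\<close>

definition coh :: "mm => mm => bool" where
  "coh e e' \<longleftrightarrow> e = 0 \<or> e' = 0 \<or> is_eval e \<or> is_eval e' \<or> (\<exists>f\<le>top. \<exists>N\<le>top. \<exists>V\<le>top. \<exists>w\<le>top. \<exists>f'\<le>top. \<exists>N'\<le>top. \<exists>V'\<le>top. \<exists>w'\<le>top.
     e = CALL f N V w \<and> e' = CALL f' N' V' w' \<and> (f = f' \<and> N = N' \<and> cmp V V' --> cpr w w'))"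

text \<open>The single budget \<open>n\<close> bounds both the number of slots and the lengths of
  recorded values. No order on the entries is imposed: each is justified by the table as a
  whole.\<close>

definition G :: "mm => mm => bool" where
  "G n D \<longleftrightarrow> n \<le> wid \<and> len D \<le> ewid * n \<and> (\<forall>j\<le>len D. dig ewid D j = 0 \<or> okE n D (dig ewid D j))
     \<and> (\<forall>j\<le>len D. \<forall>j'\<le>len D. coh (dig ewid D j) (dig ewid D j'))"

definition subD :: "mm => mm => bool" where
  "subD D D' \<longleftrightarrow> (\<forall>j\<le>len D. dig ewid D j = 0 \<or> mem (dig ewid D j) D')"

definition Ach :: "mm => mm => mm => bool" where
  "Ach n D e \<longleftrightarrow> (\<exists>D'\<le>top. subD D D' \<and> G n D' \<and> mem e D')"

lemma T1_val [def_intros]: "T1 f ==> T1 g ==> T1 (%s. val (f s) (g s))"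
  unfolding val_def by (intro def_intros)

lemma T1_rec_rhs [def_intros]: "T1 f ==> T1 g ==> T1 h ==> T1 (%s. rec_rhs (f s) (g s) (h s))"
  unfolding rec_rhs_def by (intro def_intros)

lemma T1_rho [def_intros]: "T1 f ==> T1 g ==> T1 h ==> T1 (%s. rho (f s) (g s) (h s))"
  unfolding rho_def by (intro def_intros)

lemma Sg_envok [def_intros]: "T1 f1 ==> T1 f2 ==> Sg (Suc k) (%s. envok (f1 s) (f2 s))"
  by (rule Sg_inst2[of _ envok], unfold envok_def, intro def_intros)
lemma Sg_argok [def_intros]: "T1 f1 ==> T1 f2 ==> T1 f3 ==> Sg (Suc k) (%s. argok (f1 s) (f2 s) (f3 s))"
  by (rule Sg_inst3[of _ argok], unfold argok_def, intro def_intros)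
lemma Sg_cmp [def_intros]: "T1 f1 ==> T1 f2 ==> Sg (Suc k) (%s. cmp (f1 s) (f2 s))"
  by (rule Sg_inst2[of _ cmp], unfold cmp_def, intro def_intros)
lemma Pg_cmp [def_intros]: "T1 f1 ==> T1 f2 ==> Pg (Suc k) (%s. cmp (f1 s) (f2 s))"
  by (rule Pg_inst2[of _ cmp], unfold cmp_def, intro def_intros)
lemma Sg_app_val [def_intros]:
  "T1 f1 ==> T1 f2 ==> T1 f3 ==> T1 f4 ==> T1 f5 ==> Sg (Suc k) (%s. app_val (f1 s) (f2 s) (f3 s) (f4 s) (f5 s))"
  by (rule Sg_inst5[of _ app_val], unfold app_val_def, intro def_intros)
lemma Sg_rhs_plain [def_intros]: "T1 f1 ==> T1 f2 ==> T1 f3 ==> Sg (Suc k) (%s. rhs_plain (f1 s) (f2 s) (f3 s))"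
  by (rule Sg_inst3[of _ rhs_plain], unfold rhs_plain_def, intro def_intros)
lemma Sg_rhs_rec [def_intros]:
  "T1 f1 ==> T1 f2 ==> T1 f3 ==> T1 f4 ==> T1 f5 ==> Sg (Suc k) (%s. rhs_rec (f1 s) (f2 s) (f3 s) (f4 s) (f5 s))"
  by (rule Sg_inst5[of _ rhs_rec], unfold rhs_rec_def, intro def_intros)
lemma Sg_rhs [def_intros]:
  "T1 f1 ==> T1 f2 ==> T1 f3 ==> T1 f4 ==> T1 f5 ==> T1 f6 ==> Sg (Suc k) (%s. rhs (f1 s) (f2 s) (f3 s) (f4 s) (f5 s) (f6 s))"
  by (rule Sg_inst6[of _ rhs], unfold rhs_def, intro def_intros)
lemma Sg_okEV [def_intros]:
  "T1 f1 ==> T1 f2 ==> T1 f3 ==> T1 f4 ==> T1 f5 ==> Sg (Suc k) (%s. okEV (f1 s) (f2 s) (f3 s) (f4 s) (f5 s))"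
  by (rule Sg_inst5[of _ okEV], unfold okEV_def, intro def_intros)
lemma Sg_okEVS [def_intros]:
  "T1 f1 ==> T1 f2 ==> T1 f3 ==> T1 f4 ==> T1 f5 ==> T1 f6 ==> Sg (Suc k) (%s. okEVS (f1 s) (f2 s) (f3 s) (f4 s) (f5 s) (f6 s))"
  by (rule Sg_inst6[of _ okEVS], unfold okEVS_def, intro def_intros)
lemma Sg_okCALL [def_intros]:
  "T1 f1 ==> T1 f2 ==> T1 f3 ==> T1 f4 ==> T1 f5 ==> T1 f6 ==> Sg (Suc k) (%s. okCALL (f1 s) (f2 s) (f3 s) (f4 s) (f5 s) (f6 s))"
  by (rule Sg_inst6[of _ okCALL], unfold okCALL_def, intro def_intros)
lemma Sg_okE [def_intros]: "T1 f1 ==> T1 f2 ==> T1 f3 ==> Sg (Suc k) (%s. okE (f1 s) (f2 s) (f3 s))"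
  by (rule Sg_inst3[of _ okE], unfold okE_def, intro def_intros)
lemma Sg_coh [def_intros]: "T1 f1 ==> T1 f2 ==> Sg (Suc k) (%s. coh (f1 s) (f2 s))"
  by (rule Sg_inst2[of _ coh], unfold coh_def is_eval_def, intro def_intros)
lemma Sg_G [def_intros]: "T1 f1 ==> T1 f2 ==> Sg (Suc k) (%s. G (f1 s) (f2 s))"
  by (rule Sg_inst2[of _ G], unfold G_def, intro def_intros)
lemma Sg_subD [def_intros]: "T1 f1 ==> T1 f2 ==> Sg (Suc k) (%s. subD (f1 s) (f2 s))"
  by (rule Sg_inst2[of _ subD], unfold subD_def, intro def_intros)
lemma Sg_Ach [def_intros]: "T1 f1 ==> T1 f2 ==> T1 f3 ==> Sg (Suc k) (%s. Ach (f1 s) (f2 s) (f3 s))"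
  by (rule Sg_inst3[of _ Ach], unfold Ach_def, intro def_intros)

lemma subD_iff: "subD D D' \<longleftrightarrow> (\<forall>e. mem e D --> mem e D')"
  unfolding subD_def mem_def[of _ D] by auto

lemma okE_iff [simp]:
  "okE n D (EV t \<sigma> w) \<longleftrightarrow> t \<le> top \<and> \<sigma> \<le> top \<and> w \<le> top \<and> okEV n D t \<sigma> w"
  "okE n D (EVS T N \<sigma> V) \<longleftrightarrow> T \<le> top \<and> N \<le> top \<and> \<sigma> \<le> top \<and> V \<le> top \<and> okEVS n D T N \<sigma> V"
  "okE n D (CALL f N V w) \<longleftrightarrow> f \<le> top \<and> N \<le> top \<and> V \<le> top \<and> w \<le> top \<and> okCALL n D f N V w"
  unfolding okE_def by auto

lemma G_ok: "G n D ==> mem e D ==> okE n D e"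
  unfolding G_def mem_def by blast

lemma G_EV: "G n D ==> mem (EV t \<sigma> w) D ==> okEV n D t \<sigma> w"
  and G_EVS: "G n D ==> mem (EVS T N \<sigma> V) D ==> okEVS n D T N \<sigma> V"
  and G_CALL: "G n D ==> mem (CALL f N V w) D ==> okCALL n D f N V w"
  using G_ok by fastforce+

lemma G_coherent:
  assumes "G n D" "mem (CALL f N V w) D" "mem (CALL f N V' w') D" "cmp V V'"
  shows "cpr w w'"
proof -
  have "coh (CALL f N V w) (CALL f N V' w')" using assms(1-3) unfolding G_def mem_def by metis
  then show ?thesis using assms(4) unfolding coh_def is_eval_def by simp
qed

lemma G_I:
  assumes "n \<le> wid" "len D \<le> ewid * n" "\<And>e. mem e D ==> okE n D e"
    "\<And>f N V w V' w'. mem (CALL f N V w) D ==> mem (CALL f N V' w') D ==> cmp V V' ==> cpr w w'"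
  shows "G n D"
proof -
  have coh: "coh e e'" if e: "mem e D" "mem e' D" for e e'
  proof -
    have *: "is_eval e \<or> (\<exists>f N V w. e = CALL f N V w)" if "mem e D" for e
      using assms(3)[OF that] unfolding okE_def is_eval_def by blast
    show ?thesis
    proof (cases "is_eval e \<or> is_eval e'")
      case False
      then obtain f N V w f' N' V' w' where ee: "e = CALL f N V w" "e' = CALL f' N' V' w'" using * e by metis
      then have b: "f \<le> top" "N \<le> top" "V \<le> top" "w \<le> top" "f' \<le> top" "N' \<le> top" "V' \<le> top" "w' \<le> top"
        using mem_entry_top(3) e by blast+
      have imp: "f = f' \<and> N = N' \<and> cmp V V' --> cpr w w'" using assms(4) e ee by blast
      show ?thesis unfolding coh_def ee
        by (intro disjI2, rule exI, rule conjI, rule b(1), rule exI, rule conjI, rule b(2), rule exI, rule conjI, rule b(3), rule exI, rule conjI, rule b(4), rule exI, rule conjI, rule b(5), rule exI, rule conjI, rule b(6), rule exI, rule conjI, rule b(7), rule exI, rule conjI, rule b(8), simp add: imp)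
    qed (auto simp: coh_def)
  qed
  have m: "dig ewid D j = 0 \<or> mem (dig ewid D j) D" for j unfolding mem_iff by blast
  have "dig ewid D j = 0 \<or> okE n D (dig ewid D j)" for j using m[of j] assms(3) by blast
  moreover have "coh (dig ewid D j) (dig ewid D j')" for j j'
    using m[of j] m[of j'] coh by (auto simp: coh_def[of 0] coh_def[of _ 0])
  ultimately show ?thesis unfolding G_def using assms(1,2) by blast
qed

lemma env_mono: "envok n \<sigma> ==> n \<le> m ==> envok m \<sigma>" "argok n N V ==> n \<le> m ==> argok m N V"
  unfolding envok_def argok_def by (meson order_trans)+

lemma ok_mono:
  assumes "n \<le> m" "\<And>e. mem e D ==> mem e D'"
  shows "okEV n D t \<sigma> w ==> okEV m D' t \<sigma> w" "okEVS n D T N \<sigma> V ==> okEVS m D' T N \<sigma> V"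
    "okCALL n D f N V w ==> okCALL m D' f N V w" "okE n D e ==> okE m D' e"
proof -
  have a: "app_val D f N V w ==> app_val D' f N V w" for f N V w unfolding app_val_def using assms(2) by blast
  have o: "len w \<le> n ==> len w \<le> m" for w using order_trans[OF _ assms(1)] .
  have ex: "\<exists>x\<le>b. P x ==> (\<And>x. P x ==> Q x) ==> \<exists>x\<le>b. Q x" for b :: mm and P Q by blast
  show 1: "okEV n D t \<sigma> w ==> okEV m D' t \<sigma> w" for t \<sigma> w
    unfolding okEV_def
    by (elim conjE, intro conjI, assumption, erule env_mono(1)[OF _ assms(1)], erule o)
      ((erule disj_forward ex, (assumption)?)+, use a assms(2) in blast)
  show 2: "okEVS n D T N \<sigma> V ==> okEVS m D' T N \<sigma> V" for T N \<sigma> V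
    unfolding okEVS_def
    by (elim conjE, intro conjI, assumption, assumption, erule env_mono(1)[OF _ assms(1)], erule env_mono(2)[OF _ assms(1)])
      ((erule disj_forward ex, (assumption)?)+, use assms(2) in blast)
  show 3: "okCALL n D f N V w ==> okCALL m D' f N V w" for f N V w
    unfolding okCALL_def
    by (elim conjE, intro conjI, assumption, erule env_mono(2)[OF _ assms(1)], erule o)
      ((erule ex)+, use assms(2) in blast)
  show "okE n D e ==> okE m D' e"
    unfolding okE_def by (elim disj_forward; (erule ex)+; use 1 2 3 in blast)
qed

lemma G_mono: "G n D ==> n \<le> m ==> m \<le> wid ==> G m D"
proof (rule G_I)
  assume g: "G n D" "n \<le> m" "m \<le> wid"
  have "ewid * n \<le> ewid * m" using g(2) by (intro mult_left_mono) simp_all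
  then show "len D \<le> ewid * m" using g(1) unfolding G_def by (meson order_trans)
  show "mem e D ==> okE m D e" for e using ok_mono(4)[OF g(2)] G_ok[OF g(1)] by blast
  show "mem (CALL f N V w) D ==> mem (CALL f N V' w') D ==> cmp V V' ==> cpr w w'" for f N V w V' w'
    using G_coherent g(1) by blast
qed

lemma len_W: "x \<le> W ==> len x \<le> cap"
  using len_mono[of x W] zz_nonneg[of "len W"] unfolding cap_eq zify by linarith

text \<open>This closes the circle of constants: whatever satisfies the local conditions of a table
  fits into a slot.\<close>

lemma okE_small: assumes "okE m D e" "m \<le> wid" shows "e < ex ewid"
proof -
  have i: "Log (wid * cap)" "2 \<le> wid * cap"
    using cap_wid widths by (simp, unfold zify, linarith?)
  have s: "x < ex (wid * cap)" if "len x \<le> wid * cap" for x using that by (simp add: len_le_iff)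
  have c: "x \<le> W ==> len x \<le> wid * cap" for x using len_W[of x] widths(4) by (rule order_trans)
  have w: "len w \<le> m ==> len w \<le> wid * cap" for w using assms(2) widths(1) by (meson order_trans)
  have N: "N < ex (wid * cap)" if "N \<le> cap" for N
    using less_ex[OF i(1)] that widths(4) by (meson order_le_less_trans)
  have V: "len V \<le> wid * cap \<and> N \<le> cap" if "argok m N V" for N V
  proof -
    have N: "N \<le> cap" using that zz_nonneg[of N] unfolding argok_def zify by linarith
    then have "wid * N \<le> wid * cap" by (intro mult_left_mono) simp_all
    then show ?thesis using that N unfolding argok_def by (meson order_trans)
  qed
  have \<sigma>: "envok m \<sigma> ==> len \<sigma> \<le> wid * cap" for \<sigma> unfolding envok_def by blast
  have z: "(0 :: mm) < ex (wid * cap)" using s[of 0] by simp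
  note el = entries_less[OF i, folded ewid_def]
  show ?thesis using assms(1) unfolding okE_def
  proof (elim disjE exE conjE)
    fix t \<sigma> w assume "e = EV t \<sigma> w" "okEV m D t \<sigma> w"
    then show ?thesis using el(1)[OF _ _ _ z] s c[OF TM_bound] w \<sigma> unfolding okEV_def by blast
  next
    fix T N \<sigma> V assume e: "e = EVS T N \<sigma> V" "okEVS m D T N \<sigma> V"
    then have k: "TL T" "envok m \<sigma>" "argok m N V" unfolding okEVS_def by auto
    show ?thesis unfolding e(1)
      by (rule el(2)[OF s N s s]) (use k c TL_bound V \<sigma> in auto)
  next
    fix f N V w assume e: "e = CALL f N V w" "okCALL m D f N V w"
    then have k: "F f" "len w \<le> m" "argok m N V" unfolding okCALL_def by auto
    show ?thesis unfolding e(1)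
      by (rule el(3)[OF s N s s]) (use k c F_bound V w in auto)
  qed
qed

text \<open>Justification is monotone in the table, so old entries remain justified. Coherence can
  fail only between a new call and an old one, which is the last hypothesis.\<close>

lemma G_add:
  assumes "G n D" "n + 1 \<le> m" "m \<le> wid" "okE m D e" "e \<noteq> 0"
    "\<And>f N V w V' w'. e = CALL f N V w ==> mem (CALL f N V' w') D ==> cmp V V' ==> cpr w w'"
  shows "Ach m D e"
proof -
  have e: "e < ex ewid" using okE_small assms by blast
  have n: "n \<le> m" using assms(2) unfolding zify by simp
  note mi = mem_ins[OF e assms(5)]
  have Log: "Log n" using assms(1) Log_down[of wid n] unfolding G_def by simp
  have "len (ins D e) \<le> ewid * (n + 1)" using len_ins[OF e _ Log] assms(1) unfolding G_def by blast
  also have "\<dots> \<le> ewid * m" using assms(2) by (intro mult_left_mono) simp_all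
  finally have len: "len (ins D e) \<le> ewid * m" .
  have cs: "cmp V V' ==> cmp V' V" for V V' unfolding cmp_def using cpr_sym by blast
  have "G m (ins D e)"
  proof (rule G_I[OF assms(3) len])
    fix e' assume "mem e' (ins D e)"
    then show "okE m (ins D e) e'" using mi ok_mono(4)[OF n, of D] ok_mono(4)[OF order_refl, of D] assms(4) G_ok[OF assms(1)] by metis
  next
    fix f N V w V' w' assume *: "mem (CALL f N V w) (ins D e)" "mem (CALL f N V' w') (ins D e)" "cmp V V'"
    consider "CALL f N V w = e" "CALL f N V' w' = e" | "CALL f N V w = e" "mem (CALL f N V' w') D"
      | "mem (CALL f N V w) D" "CALL f N V' w' = e" | "mem (CALL f N V w) D" "mem (CALL f N V' w') D" using * mi by blast
    then show "cpr w w'"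
    proof cases
      case 1 then have "w = w'" by (metis entry_eq(3)) then show ?thesis by simp
    next
      case 2 then show ?thesis using assms(6) *(3) by metis
    next
      case 3 then show ?thesis using assms(6)[of f N V' w' V w] cs[OF *(3)] cpr_sym by metis
    next
      case 4 then show ?thesis using G_coherent[OF assms(1)] *(3) by blast
    qed
  qed
  moreover have "ewid * m \<le> ewid * wid" using assms(3) by (intro mult_left_mono) simp_all
  then have "ins D e \<le> top" using small_top(3) len by (meson order_trans)
  ultimately show ?thesis unfolding Ach_def subD_iff using mi by blast
qed

end

lemma cpr_L: "cpr (L i @@ x) (L j @@ y) ==> i = j \<and> cpr x y"
  unfolding cpr_def pre_def by (auto simp flip: wc_assoc simp del: wc_assoc)

context deriv
begin

section \<open>Determinism of the defining equations and coherence of evaluations\<close>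

lemma dig_hi: "Log c ==> Log i ==> dig wid (hi V (wid * c)) i = dig wid V (c + i)"
  using dig_high[of wid c i "lo V (wid * c)" "hi V (wid * c)"] hilo[of "wid * c" V] by simp

lemma rho_dig:
  assumes "Log c" "v < ex wid"
  shows "dig wid (rho c v V) 28 = v" "Log i ==> dig wid (rho c v V) (29 + i) = dig wid V (c + i)"
    "j < 28 ==> dig wid (rho c v V) j = 0"
proof -
  define x where "x = hi V (wid * c) * ex (wid * 1) + v"
  have r: "rho c v V = x * ex (wid * 28) + 0" by (simp add: rho_def x_def)
  have hi: "dig wid (rho c v V) (28 + i) = dig wid x i" if "Log i" for i
    unfolding r by (rule dig_high) (use that in simp_all)
  have "dig wid x 0 = v"
    unfolding x_def using dig_low[of wid "wid * 1" 0] dig_first[OF _ assms(2)] by simp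
  then show "dig wid (rho c v V) 28 = v" using hi[of 0] by simp
  show "dig wid (rho c v V) (29 + i) = dig wid V (c + i)" if "Log i" for i
  proof -
    have "dig wid x (1 + i) = dig wid (hi V (wid * c)) i"
      unfolding x_def by (rule dig_high) (use that assms(2) in simp_all)
    moreover have "29 + i = 28 + (1 + i)" unfolding zify by simp
    ultimately show ?thesis using hi[of "1 + i"] dig_hi[OF assms(1) that] that by (simp add: Log_add)
  qed
  show "dig wid (rho c v V) j = 0" if "j < 28"
  proof -
    have "wid * (j + 1) \<le> wid * 28" using that by (intro mult_left_mono) (simp_all add: less_iff)
    then show ?thesis unfolding r using dig_low[of wid "wid * 28" j x 0] by (simp add: distrib_left)
  qed
qed

lemma rho_cases:
  fixes j :: mm
  obtains "j < 28" | "j = 28" | i where "j = 29 + i"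
proof (cases "j < 28")
  case False
  then obtain k where k: "j = 28 + k" using le_ex[of 28 j] not_less by blast
  show ?thesis
  proof (cases "k = 0")
    case False
    then obtain i where "k = 1 + i" using le_ex[of 1 k] by (auto simp: one_le)
    then have "j = 29 + i" using k unfolding zify by simp
    then show ?thesis by (rule that(3))
  qed (use k that(2) in simp)
qed (rule that(1))

lemma cmp_all:
  assumes "cmp V V'" "len V \<le> wid * cap" "len V' \<le> wid * cap"
  shows "cpr (dig wid V i) (dig wid V' i)"
proof (cases "i \<le> cap")
  case False
  then have "wid * cap \<le> wid * i" by (intro mult_left_mono) simp_all
  then have "len V \<le> wid * i" using assms(2) by (rule order_trans[rotated])
  then show ?thesis using dig_beyond by simp
qed (use assms(1) in \<open>simp add: cmp_def cap_def\<close>)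

lemma argok_len: assumes "argok n N V" shows "len V \<le> wid * cap" "N \<le> cap" "Log N"
proof -
  show N: "N \<le> cap" using assms zz_nonneg[of N] unfolding argok_def zify by linarith
  then show "Log N" using Log_down Log_consts(1) by blast
  have "wid * N \<le> wid * cap" using N by (intro mult_left_mono) simp_all
  then show "len V \<le> wid * cap" using assms unfolding argok_def by (meson order_trans)
qed

text \<open>Comparability of arguments and predecessors passes to the environments of right hand
  sides, position by position.\<close>

lemma cmp_rho:
  assumes "cmp V V'" "argok n N V" "argok n N V'" "cpr v v'" "v < ex wid" "v' < ex wid" "Log c"
  shows "cmp (rho c v V) (rho c v' V')"
  unfolding cmp_def
proof (intro allI impI)
  fix j assume "j \<le> len capw"
  then have "Log j" using Log_down Log_len by blast
  note c = cmp_all[OF assms(1) argok_len(1)[OF assms(2)] argok_len(1)[OF assms(3)]]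
  show "cpr (dig wid (rho c v V) j) (dig wid (rho c v' V') j)"
  proof (cases j rule: rho_cases)
    case (3 i)
    then have "Log i" using \<open>Log j\<close> Log_down[of j i] by (simp add: add_increasing)
    then show ?thesis using 3 rho_dig(2)[OF assms(7)] assms c by simp
  qed (use rho_dig[OF assms(7)] assms in simp_all)
qed

lemma VARS_fun:
  assumes "isVARS X N" "isVARS X' N'" "len N = len N'"
  shows "X = X'"
proof -
  let ?Q = "%X. \<forall>N\<le>W. \<forall>X'\<le>W. \<forall>N'\<le>W. isVARS X N \<and> isVARS X' N' \<and> len N = len N' --> X = X'"
  have b: "X \<le> W \<and> N \<le> W" if "isVARS X N" for X N using isVARS_sub[OF that] sub_le by blast
  have "?Q X"
  proof (rule len_induct[of ?Q X W])
    show "Pg (Suc (Suc 0)) (%s. ?Q (s 0))" by (intro def_intros)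
    show "X \<le> W" using b[OF assms(1)] by simp
    fix X assume IH: "\<And>y. y \<le> W ==> len y < len X ==> ?Q y"
    show "?Q X"
    proof (intro allI impI, elim conjE)
      fix N X' N' assume *: "isVARS X N" "isVARS X' N'" "len N = len N'"
      consider "X = 0" "N = 0" | X1 N1 where "X = X1 @@ s_var (N1 @@ L MARK)" "N = N1 @@ L MARK" "isVARS X1 N1"
        using isVARS_cases[OF *(1)] by blast
      then show "X = X'"
      proof cases
        case 1
        then have "N' = 0" using *(3) by simp
        then show ?thesis using isVARS_cases[OF *(2)] 1 by auto
      next
        case (2 X1 N1)
        then have "N' \<noteq> 0" using *(3) by auto
        then obtain X2 N2 where 3: "X' = X2 @@ s_var (N2 @@ L MARK)" "N' = N2 @@ L MARK" "isVARS X2 N2"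
          using isVARS_cases[OF *(2)] by blast
        have l: "len N1 = len N2" using *(3) 2(2) 3(2) by simp
        have "len X1 < len X" using 2(1) var_nonzero[OF s_var_is_var] by (simp add: mm_pos)
        then have "X1 = X2" using IH[of X1] b[OF 2(3)] b[OF 3(3)] 2(3) 3(3) l by blast
        moreover have "s_var (N1 @@ L MARK) = s_var (N2 @@ L MARK)"
          by (rule is_var_len_inj[OF s_var_is_var s_var_is_var]) (simp add: len_s_var l)
        ultimately show ?thesis using 2 3 by simp
      qed
    qed
  qed
  then show ?thesis using b assms by blast
qed

sublocale wf: word_lists F LF W "len t" for t
proof
  show "Sg (Suc 0) (%s. F (s 0))" "Sg (Suc 0) (%s. LF (s 0))" by (intro def_intros)+
qed (fact F_bound F_nonzero LF_bound LF_cases | simp add: F_prefix)+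

lemma APPS_fun:
  assumes "isAPPS H X A" "isAPPS H X A'"
  shows "A = A'"
proof -
  let ?Q = "%A. \<forall>H\<le>W. \<forall>A'\<le>W. isAPPS H X A \<and> isAPPS H X A' --> A = A'"
  have b: "H \<le> W \<and> A \<le> W" if "isAPPS H X A" for H A using isAPPS_sub[OF that] sub_le by blast
  have "?Q A"
  proof (rule len_induct[of ?Q A W])
    show "Pg (Suc (Suc 0)) (%s. ?Q (s 0))" by (intro def_intros)
    show "A \<le> W" using b[OF assms(1)] by simp
    fix A assume IH: "\<And>y. y \<le> W ==> len y < len A ==> ?Q y"
    show "?Q A"
    proof (intro allI impI, elim conjE)
      fix H A' assume *: "isAPPS H X A" "isAPPS H X A'"
      consider "H = 0" "A = 0" | H1 A1 h N where "H = H1 @@ h" "A = A1 @@ s_app h X" "isAPPS H1 X A1" "isFUN h N"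
        using isAPPS_cases[OF *(1)] by blast
      then show "A = A'"
      proof cases
        case 1
        have "h \<noteq> 0" if "isFUN h N" for h N using that isFUN_F F_nonzero by blast
        then show ?thesis using isAPPS_cases[OF *(2)] 1 by auto
      next
        case (2 H1 A1 h N)
        then have "H \<noteq> 0" using isFUN_F F_nonzero by force
        then obtain H2 A2 k M where 3: "H = H2 @@ k" "A' = A2 @@ s_app k X" "isAPPS H2 X A2" "isFUN k M"
          using isAPPS_cases[OF *(2)] by blast
        have "H1 = H2 \<and> h = k"
          using wf.list_last[of H1 H2 h k "H @@ 1"] isAPPS_LF 2 3 isFUN_F by (simp add: less_iff)
        moreover have "len A1 < len A" using 2(2) by (simp add: mm_pos)
        ultimately show ?thesis using IH[of A1] b[OF 2(3)] b[OF 3(3)] 2 3 by blast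
      qed
    qed
  qed
  then show ?thesis using b assms by blast
qed

lemma rhs_plain_cases:
  assumes "rhs_plain f N u"
  obtains (const) M where "f = s_cConst M" "u = s_app (L EPS) 0"
  | (proj) I M where "f = s_cProj I M" "s_unary I" "s_unary M" "u = s_var I"
  | (comp) g H X A M where "f = s_cComp g H" "F g" "LF H" "isVARS X M" "len M = N" "isAPPS H X A" "u = s_app g A"
  using assms unfolding rhs_plain_def by (elim disjE exE conjE) blast+

lemma proj_inj: "s_cProj I M = s_cProj I' M' ==> s_unary I ==> s_unary I' ==> I = I'"
proof -
  assume *: "s_cProj I M = s_cProj I' M'" "s_unary I" "s_unary I'"
  then have "L PROJ @@ (I @@ L END @@ (M @@ L END)) = L PROJ @@ (I' @@ L END @@ (M' @@ L END))" by (simp add: s_cProj_def)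
  then have "I @@ L END @@ (M @@ L END) = I' @@ L END @@ (M' @@ L END)" by (simp only: wc_cancel_left)
  then show ?thesis using letter_prefix[of I END "M @@ L END" I' "M' @@ L END"] unary_no_letter * by simp
qed

lemma F_cancel: "F f ==> F f' ==> f @@ x = f' @@ y ==> f = f' \<and> x = y"
  using pre_comparable[of f x f' y] F_prefix by (metis wc_cancel_left)

lemma comp_inj: "s_cComp g H = s_cComp g' H' ==> F g ==> F g' ==> g = g' \<and> H = H'"
proof -
  assume *: "s_cComp g H = s_cComp g' H'" "F g" "F g'"
  have "L COMP @@ (g @@ (H @@ L END)) = L COMP @@ (g' @@ (H' @@ L END))" using *(1) by (simp add: code_cons)
  then have "g @@ (H @@ L END) = g' @@ (H' @@ L END)" by (simp only: wc_cancel_left)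
  then have "g = g' \<and> H @@ L END = H' @@ L END" using F_cancel[OF *(2,3)] by blast
  then show ?thesis by simp
qed

lemma rec_inj: "s_cRec ge g0 g1 = s_cRec ge' g0' g1' ==> F ge ==> F g0 ==> F ge' ==> F g0' ==> ge = ge' \<and> g0 = g0' \<and> g1 = g1'"
proof -
  assume *: "s_cRec ge g0 g1 = s_cRec ge' g0' g1'" "F ge" "F g0" "F ge'" "F g0'"
  have "L REC @@ (ge @@ (g0 @@ g1)) = L REC @@ (ge' @@ (g0' @@ g1'))" using *(1) by (simp add: code_cons)
  then have "ge @@ (g0 @@ g1) = ge' @@ (g0' @@ g1')" by (simp only: wc_cancel_left)
  then have "ge = ge'" "g0 @@ g1 = g0' @@ g1'" using F_cancel[OF *(2,4)] by blast+
  then show ?thesis using F_cancel[OF *(3,5)] by blast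
qed

lemma code_neq:
  "s_cConst M \<noteq> s_cProj I M'" "s_cProj I M' \<noteq> s_cConst M" "s_cConst M \<noteq> s_cComp g H" "s_cComp g H \<noteq> s_cConst M"
  "s_cProj I M' \<noteq> s_cComp g H" "s_cComp g H \<noteq> s_cProj I M'"
  "s_cConst M \<noteq> s_cRec ge g0 g1" "s_cProj I M' \<noteq> s_cRec ge g0 g1" "s_cComp g H \<noteq> s_cRec ge g0 g1"
  unfolding code_cons L_cons by simp_all

lemma rhs_not_letter: "rhs f N V u c v ==> f \<noteq> L EPS \<and> f \<noteq> L SUC0 \<and> f \<noteq> L SUC1"
  unfolding rhs_def rhs_rec_def rhs_plain_def code_cons by (elim disjE exE conjE) (simp_all only: L_cons_single, simp_all)

lemma rhs_plain_fun:
  assumes "rhs_plain f N u" "rhs_plain f N u'" shows "u = u'"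
  using assms(1)
proof (cases rule: rhs_plain_cases)
  case const
  from assms(2) show ?thesis by (cases rule: rhs_plain_cases) (simp_all add: const code_neq)
next
  case (proj I M)
  from assms(2) show ?thesis by (cases rule: rhs_plain_cases) (use proj proj_inj in \<open>force simp: code_neq\<close>)+
next
  case (comp g H X A M)
  from assms(2) show ?thesis
  proof (cases rule: rhs_plain_cases)
    case c': (comp g' H' X' A' M')
    then have "g = g'" "H = H'" using comp comp_inj by metis+
    moreover have "X = X'" using VARS_fun comp c' by metis
    ultimately show ?thesis using APPS_fun comp c' by metis
  qed (simp_all add: comp code_neq)
qed

text \<open>Function words are read uniquely, and recursion requires a nonempty first argument, so
  comparable arguments share its first letter and select the same equation. The monotone clause on
  \<open>v\<close> serves the comparison of a recorded call with a defining equation in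
  \<open>AX_right\<close>.\<close>

lemma rhs_fun:
  assumes "rhs f N V u c v" "rhs f N V' u' c' v'" "cpr (dig wid V 0) (dig wid V' 0)"
  shows "u = u' \<and> c = c' \<and> cpr v v' \<and> (dig wid V 0 \<sqsubseteq> dig wid V' 0 --> v \<sqsubseteq> v')"
proof -
  have nr: "\<not> (rhs_plain f N u \<and> rhs_rec f N' V u' v)" for N N' V u u' v
    unfolding rhs_rec_def by (auto elim!: rhs_plain_cases simp: code_neq code_neq[symmetric])
  consider "c = 0" "v = 0" "rhs_plain f N u" "c' = 0" "v' = 0" "rhs_plain f N u'" | "c = 1" "c' = 1" "rhs_rec f N V u v" "rhs_rec f N V' u' v'"
    using assms(1,2) nr unfolding rhs_def by metis
  then show ?thesis
  proof cases
    case 1 then show ?thesis using rhs_plain_fun by simp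
  next
    case 2
    obtain ge g0 g1 X M where r: "f = s_cRec ge g0 g1" "F ge" "F g0" "F g1" "isVARS X M" "N = len M + 1"
      "(dig wid V 0 = L EPS \<and> u = s_app ge X \<and> v = 0) \<or> (dig wid V 0 = L SUC0 @@ v \<and> u = rec_rhs f g0 X)
      \<or> (dig wid V 0 = L SUC1 @@ v \<and> u = rec_rhs f g1 X)" using 2(3) unfolding rhs_rec_def by (elim exE conjE) blast
    obtain he h0 h1 X' M' where r': "f = s_cRec he h0 h1" "F he" "F h0" "F h1" "isVARS X' M'" "N = len M' + 1"
      "(dig wid V' 0 = L EPS \<and> u' = s_app he X' \<and> v' = 0) \<or> (dig wid V' 0 = L SUC0 @@ v' \<and> u' = rec_rhs f h0 X')
      \<or> (dig wid V' 0 = L SUC1 @@ v' \<and> u' = rec_rhs f h1 X')" using 2(4) unfolding rhs_rec_def by (elim exE conjE) blast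
    have e: "ge = he" "g0 = h0" "g1 = h1" using rec_inj r(1-3) r'(1-3) by metis+
    have X: "X = X'" using VARS_fun r(5,6) r'(5,6) by simp
    have L0: "L EPS = L EPS @@ 0" by simp
    have c: "cpr (L i @@ x) (L j @@ y) ==> i = j \<and> cpr x y" for i j x y by (rule cpr_L)
    have n: "\<not> cpr (L EPS) (L SUC0 @@ x)" "\<not> cpr (L EPS) (L SUC1 @@ x)" "\<not> cpr (L SUC0 @@ x) (L EPS)" "\<not> cpr (L SUC1 @@ x) (L EPS)"
      "\<not> cpr (L SUC0 @@ x) (L SUC1 @@ y)" "\<not> cpr (L SUC1 @@ x) (L SUC0 @@ y)" for x y
      using c[of EPS 0 SUC0 x] c[of EPS 0 SUC1 x] c[of SUC0 x EPS 0] c[of SUC1 x EPS 0] c[of SUC0 x SUC1 y] c[of SUC1 x SUC0 y] by auto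
    show ?thesis using r(7) r'(7) assms(3) 2(1,2) unfolding e X
      by (elim disjE conjE) (simp_all add: n)
  qed
qed

lemma array_parts:
  assumes "len V \<le> wid * (M + 1)" "Log M"
  shows "i < M ==> dig wid V i = dig wid (lo V (wid * M)) i" "dig wid V M = hi V (wid * M)" "M < i ==> dig wid V i = 0"
    "len (lo V (wid * M)) \<le> wid * M" "hi V (wid * M) < ex wid"
proof -
  let ?h = "hi V (wid * M)" and ?l = "lo V (wid * M)"
  have V: "V = ?h * ex (wid * M) + ?l" "?l < ex (wid * M)" using hilo[of "wid * M" V] assms(2) by simp_all
  then show l: "len ?l \<le> wid * M" using assms(2) by (simp add: len_le_iff)
  have "V < ex (wid * M) * ex wid" using assms by (simp add: len_le_iff Log_add distrib_left flip: ex_add)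
  then have "?h * ex (wid * M) < ex wid * ex (wid * M)" using V(1) by (metis add_increasing2 le_less_trans mm_nonneg mult.commute order_refl)
  then show h: "?h < ex wid" using mult_right_mono[of "ex wid" ?h "ex (wid * M)"] by (meson mm_nonneg not_le)
  show "i < M ==> dig wid V i = dig wid ?l i" "dig wid V M = ?h"
    using array_snoc(1,2)[OF _ assms(2) l h] V(1) by auto
  assume "M < i"
  then have "wid * (M + 1) \<le> wid * i" by (intro mult_left_mono) (simp_all add: less_iff)
  then show "dig wid V i = 0" using dig_beyond assms(1) order_trans by blast
qed

lemma okD:
  "okEV n D t \<sigma> w ==> TM t \<and> envok n \<sigma> \<and> len w \<le> n"
  "okEVS n D T N \<sigma> V ==> TL T \<and> N \<le> len T \<and> envok n \<sigma> \<and> argok n N V"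
  by (simp_all add: okEV_def okEVS_def)

lemma app_val_cases:
  assumes "G n D" "app_val D f N V w" "app_val D f N V' w'" "cmp V V'"
  shows "cpr w w'"
proof -
  have c: "f \<noteq> L EPS \<and> f \<noteq> L SUC0 \<and> f \<noteq> L SUC1" if "mem (CALL f N V w) D" for V w
    using G_CALL[OF assms(1) that] rhs_not_letter unfolding okCALL_def by blast
  have "cpr (dig wid V 0) (dig wid V' 0)" using assms(4) unfolding cmp_def by simp
  then show ?thesis using assms(2,3) c G_coherent[OF assms(1) _ _ assms(4)] unfolding app_val_def by auto
qed

lemma G_EV_app:
  assumes "G n D" "mem (EV (s_app f T) \<sigma> w) D" "F f" "w \<noteq> 0"
  obtains N V w' where "mem (EVS T N \<sigma> V) D" "w \<sqsubseteq> w'" "app_val D f N V w'"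
proof -
  obtain f' T' N V w' where "s_app f T = s_app f' T'" "F f'" "mem (EVS T' N \<sigma> V) D" "w \<sqsubseteq> w'" "app_val D f' N V w'"
    using G_EV[OF assms(1,2)] assms(4) app_not_var[OF assms(3)] unfolding okEV_def by blast
  moreover from this have "f' = f" "T' = T" using app_inj[OF assms(3), of f' T T'] by auto
  ultimately show ?thesis using that by blast
qed

lemma G_EVS_snoc:
  assumes "G n D" "mem (EVS (T @@ t) N \<sigma> V) D" "TL T" "TM t"
  obtains M where "N = M + 1" "Log M" "mem (EVS T M \<sigma> (lo V (wid * M))) D" "mem (EV t \<sigma> (hi V (wid * M))) D" "len V \<le> wid * (M + 1)"
proof -
  have ok: "okEVS n D (T @@ t) N \<sigma> V" using G_EVS[OF assms(1,2)] .
  then obtain T1 t1 M where *: "T @@ t = T1 @@ t1" "N = M + 1" "mem (EVS T1 M \<sigma> (lo V (wid * M))) D" "mem (EV t1 \<sigma> (hi V (wid * M))) D"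
    using TM_nonzero[OF assms(4)] unfolding okEVS_def by auto
  have k: "TL T1" "argok n M (lo V (wid * M))" "TM t1" using okD(2)[OF G_EVS[OF assms(1) *(3)]] okD(1)[OF G_EV[OF assms(1) *(4)]] by auto
  then have e: "T1 = T" "t1 = t" using TL_last[OF assms(3) _ assms(4) _ *(1)] by auto
  have "len V \<le> wid * (M + 1)" using okD(2)[OF ok] *(2) unfolding argok_def by blast
  then show ?thesis using that[OF *(2) argok_len(3)[OF k(2)]] *(3,4) e by blast
qed

lemma EVS_zero: assumes "G n D" "mem (EVS 0 N \<sigma> V) D" shows "N = 0 \<and> V = 0"
proof -
  consider "N = 0 \<and> V = 0" | T1 t M where "0 = T1 @@ t" "mem (EV t \<sigma> (hi V (wid * M))) D"
    using G_EVS[OF assms] unfolding okEVS_def by blast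
  then show ?thesis
  proof cases
    case (2 T1 t M)
    then have "TM 0" using okD(1)[OF G_EV[OF assms(1) 2(2)]] by (metis wc_eq_0)
    then show ?thesis using TM_nonzero by blast
  qed
qed

text \<open>The induction stays within one term: on reaching a call, comparability of its results is
  taken from the goodness of the table, and the computation behind the call is not followed. Thus no
  well-founded order on entries is required.\<close>

lemma EV_coherent_aux:
  assumes "G n D" "x \<le> W"
  shows "(\<forall>\<sigma>\<le>top. \<forall>\<sigma>'\<le>top. \<forall>w\<le>top. \<forall>w'\<le>top. mem (EV x \<sigma> w) D \<and> mem (EV x \<sigma>' w') D \<and> cmp \<sigma> \<sigma>' --> cpr w w')
    \<and> (\<forall>N\<le>top. \<forall>N'\<le>top. \<forall>\<sigma>\<le>top. \<forall>\<sigma>'\<le>top. \<forall>V\<le>top. \<forall>V'\<le>top. mem (EVS x N \<sigma> V) D \<and> mem (EVS x N' \<sigma>' V') D \<and> cmp \<sigma> \<sigma>' --> N = N' \<and> cmp V V')"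
    (is "?Q x")
proof (rule len_induct[of ?Q x W])
  show "Pg (Suc (Suc 0)) (%s. ?Q (s 0))" by (intro def_intros)
  show "x \<le> W" by fact
  fix x assume x: "x \<le> W" and IH: "\<And>y. y \<le> W ==> len y < len x ==> ?Q y"
  have IH1: "cpr w w'" if "mem (EV y \<sigma> w) D" "mem (EV y \<sigma>' w') D" "cmp \<sigma> \<sigma>'" "len y < len x" for y \<sigma> w \<sigma>' w'
  proof -
    have "y \<le> W" using okD(1)[OF G_EV[OF assms(1) that(1)]] TM_bound by blast
    from IH[OF this that(4), THEN conjunct1, rule_format, of \<sigma> \<sigma>' w w'] show ?thesis
      using mem_entry_top(1)[OF that(1)] mem_entry_top(1)[OF that(2)] that(1-3) by blast
  qed
  have IH2: "N = N' \<and> cmp V V'" if "mem (EVS y N \<sigma> V) D" "mem (EVS y N' \<sigma>' V') D" "cmp \<sigma> \<sigma>'" "len y < len x" for y N \<sigma> V N' \<sigma>' V'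
  proof -
    have "y \<le> W" using okD(2)[OF G_EVS[OF assms(1) that(1)]] TL_bound by blast
    from IH[OF this that(4), THEN conjunct2, rule_format, of N N' \<sigma> \<sigma>' V V'] show ?thesis
      using mem_entry_top(2)[OF that(1)] mem_entry_top(2)[OF that(2)] that(1-3) by blast
  qed
  have EVx: "cpr w w'" if m: "mem (EV x \<sigma> w) D" "mem (EV x \<sigma>' w') D" "cmp \<sigma> \<sigma>'" for \<sigma> \<sigma>' w w'
  proof (cases "w = 0 \<or> w' = 0")
    case False
    note ok = G_EV[OF assms(1) m(1)] G_EV[OF assms(1) m(2)]
    have "TM x" using okD(1)[OF ok(1)] by blast
    show ?thesis
    proof (cases "s_is_var x")
      case True
      then have "w \<sqsubseteq> val \<sigma> x" "w' \<sqsubseteq> val \<sigma>' x" using ok False app_not_var unfolding okEV_def by blast+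
      moreover have "cpr (val \<sigma> x) (val \<sigma>' x)" using m(3) len_W[OF x] unfolding cmp_def val_def cap_def by blast
      ultimately show ?thesis using cpr_down by blast
    next
      case nv: False
      then obtain f T where f: "F f" "x = s_app f T" using TM_cases[OF \<open>TM x\<close>] by blast
      obtain N V v where 1: "mem (EVS T N \<sigma> V) D" "w \<sqsubseteq> v" "app_val D f N V v"
        using G_EV_app[OF assms(1) m(1)[unfolded f(2)] f(1)] False by blast
      obtain N' V' v' where 2: "mem (EVS T N' \<sigma>' V') D" "w' \<sqsubseteq> v'" "app_val D f N' V' v'"
        using G_EV_app[OF assms(1) m(2)[unfolded f(2)] f(1)] False by blast
      have "len T < len x" using len_mid[OF F_nonzero[OF f(1)], of T 0 "L END"] unfolding f(2) s_app_def by simp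
      then have "N = N'" "cmp V V'" using IH2[OF 1(1) 2(1) m(3)] by auto
      then show ?thesis using app_val_cases[OF assms(1) 1(3)] 2(3) cpr_down 1(2) 2(2) by blast
    qed
  qed auto
  have EVSx: "N = N' \<and> cmp V V'" if m: "mem (EVS x N \<sigma> V) D" "mem (EVS x N' \<sigma>' V') D" "cmp \<sigma> \<sigma>'" for N N' \<sigma> \<sigma>' V V'
  proof -
    note ok = G_EVS[OF assms(1) m(1)] G_EVS[OF assms(1) m(2)]
    have "TL x" using okD(2)[OF ok(1)] by blast
    then consider "x = 0" | T t where "x = T @@ t" "TL T" "TM t" using TL_cases by blast
    then show ?thesis
    proof cases
      case 1
      then have "N = 0 \<and> V = 0" "N' = 0 \<and> V' = 0"
        using EVS_zero[OF assms(1)] m(1,2)[unfolded 1] by blast+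
      then show ?thesis by (simp add: cmp_def)
    next
      case (2 T t)
      obtain M where M: "N = M + 1" "Log M" "mem (EVS T M \<sigma> (lo V (wid * M))) D" "mem (EV t \<sigma> (hi V (wid * M))) D" "len V \<le> wid * (M + 1)"
        using G_EVS_snoc[OF assms(1) m(1)[unfolded 2(1)] 2(2,3)] .
      obtain M' where M': "N' = M' + 1" "Log M'" "mem (EVS T M' \<sigma>' (lo V' (wid * M'))) D" "mem (EV t \<sigma>' (hi V' (wid * M'))) D" "len V' \<le> wid * (M' + 1)"
        using G_EVS_snoc[OF assms(1) m(2)[unfolded 2(1)] 2(2,3)] .
      have "len T < len x" using 2(1) TM_nonzero[OF 2(3)] by (auto simp: mm_pos)
      then have e: "M = M'" "cmp (lo V (wid * M)) (lo V' (wid * M'))" using IH2[OF M(3) M'(3) m(3)] by auto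
      have h: "cpr (hi V (wid * M)) (hi V' (wid * M'))"
      proof (cases "T = 0")
        \<comment> \<open>A list with a single term is the same word as that term, so the induction
          hypothesis does not apply. The claim for terms was established first for this
          reason.\<close>
        case True then show ?thesis using EVx[OF _ _ m(3)] M(4) M'(4) 2(1) by simp
      next
        case False
        then have "len t < len x" using 2(1) by (simp add: mm_pos)
        then show ?thesis using IH1[OF M(4) M'(4) m(3)] by blast
      qed
      have "cpr (dig wid V i) (dig wid V' i)" if "i \<le> len capw" for i
        using array_parts(1)[OF M(5,2), of i] array_parts(2)[OF M(5,2)] array_parts(3)[OF M(5,2), of i] array_parts(1)[OF M'(5,2), of i] array_parts(2)[OF M'(5,2)] array_parts(3)[OF M'(5,2), of i] e h that unfolding cmp_def
        by (cases i M rule: linorder_cases) auto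
      then show ?thesis using e M M' unfolding cmp_def by blast
    qed
  qed
  show "?Q x" by (rule conjI; intro allI impI; elim conjE; erule (2) EVx EVSx)
qed

lemma EV_coherent:
  assumes "G n D" "mem (EV t \<sigma> w) D" "mem (EV t \<sigma>' w') D" "cmp \<sigma> \<sigma>'"
  shows "cpr w w'"
proof -
  have "t \<le> W" using G_EV[OF assms(1,2)] TM_bound unfolding okEV_def by blast
  from EV_coherent_aux[OF assms(1) this, THEN conjunct1, rule_format, of \<sigma> \<sigma>' w w'] show ?thesis
    using mem_entry_top(1)[OF assms(2)] mem_entry_top(1)[OF assms(3)] assms(2-4) by blast
qed

lemma AchE: "Ach m D e ==> (\<And>D'. (\<And>x. mem x D ==> mem x D') ==> G m D' ==> mem e D' ==> thesis) ==> thesis"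
  unfolding Ach_def subD_iff by blast

lemma G_top: "G n D ==> D \<le> top"
proof -
  assume "G n D"
  moreover from this have "ewid * n \<le> ewid * wid" unfolding G_def by (intro mult_left_mono) simp_all
  ultimately show ?thesis using small_top(3) unfolding G_def by (meson order_trans)
qed

lemma AchI: "(\<And>x. mem x D ==> mem x D') ==> G n D' ==> n \<le> m ==> m \<le> wid ==> mem e D' ==> Ach m D e"
  unfolding Ach_def subD_iff using G_top G_mono by blast

lemma Ach_trans: "(\<And>x. mem x D ==> mem x D') ==> Ach m D' e ==> Ach m D e"
  unfolding Ach_def subD_iff by blast

lemma envok_top: "envok n \<sigma> ==> \<sigma> \<le> top"
  unfolding envok_def using small_top(1) by blast
lemma W_top: "x \<le> W ==> x \<le> top"
  using small_top(1)[OF order_trans[OF len_W widths(4)]] .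
lemma wid_top: "len w \<le> wid ==> w \<le> top"
  using small_top(1) widths(1) order_trans by blast
lemma cap_top: "N \<le> cap ==> N \<le> top"
proof -
  assume "N \<le> cap"
  then have "N < ex (wid * cap)" using less_ex[of "wid * cap"] widths(4) by (meson order_le_less_trans Log_consts(1,4))
  then show ?thesis using small_top(1) by (simp add: len_le_iff)
qed

lemma add_EV:
  assumes "G n D" "n + 1 \<le> m" "m \<le> wid" "okEV m D t \<sigma> w"
  shows "Ach m D (EV t \<sigma> w)"
proof (rule G_add[OF assms(1-3)])
  have "TM t" "envok m \<sigma>" "len w \<le> wid" using assms(3,4) unfolding okEV_def by (auto intro: order_trans)
  then show "okE m D (EV t \<sigma> w)" using W_top[OF TM_bound] envok_top wid_top assms(4) by simp
qed simp_all

lemma add_EVS: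
  assumes "G n D" "n + 1 \<le> m" "m \<le> wid" "okEVS m D T N \<sigma> V"
  shows "Ach m D (EVS T N \<sigma> V)"
proof (rule G_add[OF assms(1-3)])
  have "TL T" "envok m \<sigma>" "argok m N V" using assms(3,4) unfolding okEVS_def by auto
  then show "okE m D (EVS T N \<sigma> V)"
    using W_top[OF TL_bound] envok_top argok_len(1,2)[of m N V] cap_top small_top(1) assms(4) by simp
qed simp_all

text \<open>A possible clash is with an old call on compatible arguments. By \<open>rhs_fun\<close>
  both rest on the same right hand side, evaluated in compatible environments, and
  \<open>EV_coherent\<close> for the old table compares the two results.\<close>

lemma add_CALL:
  assumes "G n D" "n + 1 \<le> m" "m \<le> wid" "okCALL m D f N V w"
  shows "Ach m D (CALL f N V w)"
proof (rule G_add[OF assms(1-3)])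
  have ok: "F f" "argok m N V" "len w \<le> wid" using assms(3,4) unfolding okCALL_def by (auto intro: order_trans)
  then show "okE m D (CALL f N V w)"
    using W_top[OF F_bound] argok_len(1,2)[of m N V] cap_top small_top(1) wid_top assms(4) by simp
  fix f1 N1 V1 w1 V' w' assume e: "CALL f N V w = CALL f1 N1 V1 w1" and m: "mem (CALL f1 N1 V' w') D" "cmp V1 V'"
  obtain u c v where 1: "rhs f N V u c v" "mem (EV u (rho c v V) w) D" using assms(4) unfolding okCALL_def by blast
  have "okCALL n D f N V' w'" using G_CALL[OF assms(1)] m(1) e by simp
  then obtain u' c' v' where 2: "rhs f N V' u' c' v'" "mem (EV u' (rho c' v' V') w') D" "argok n N V'" unfolding okCALL_def by blast
  have c: "cmp V V'" using m(2) e by simp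
  then have "cpr (dig wid V 0) (dig wid V' 0)" unfolding cmp_def by simp
  then have f: "u = u'" "c = c'" "cpr v v'" using rhs_fun[OF 1(1) 2(1)] by auto
  have v: "v < ex wid \<and> Log c" if "rhs f N V u c v" for u c v V
  proof (cases "c = 0")
    case False
    then have "rhs_rec f N V u v" "c = 1" using that unfolding rhs_def by auto
    then have "v = 0 \<or> dig wid V 0 = L SUC0 @@ v \<or> dig wid V 0 = L SUC1 @@ v" unfolding rhs_rec_def by blast
    then have "v \<le> dig wid V 0 \<or> v = 0" using wc_le by metis
    then show ?thesis using dig_less[of wid V 0] \<open>c = 1\<close> by (auto simp: mm_pos)
  qed (use that in \<open>auto simp: rhs_def mm_pos\<close>)
  have "n \<le> m" using assms(2) unfolding zify by simp
  then have "cmp (rho c v V) (rho c' v' V')"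
    using cmp_rho[OF c ok(2) env_mono(2)[OF 2(3)] f(3)] v[OF 1(1)] v[OF 2(1)] f(2) by simp
  then show "cpr w1 w'" using EV_coherent[OF assms(1) 1(2)] 2(2) f(1) e by simp
qed simp

end

context deriv
begin

section \<open>Enlarging tables along the structure of terms\<close>

lemma okEV_app:
  assumes "TM (s_app f T)" "F f" "envok n \<sigma>" "len w \<le> n" "mem (EVS T N \<sigma> V) D" "w \<sqsubseteq> w'" "app_val D f N V w'" "w' \<le> top"
  shows "okEV n D (s_app f T) \<sigma> w"
proof -
  have "f \<le> W" "T \<le> W" "N \<le> top" "V \<le> top"
    using app_le[of f T] TM_bound[OF assms(1)] mem_entry_top(2)[OF assms(5)] by auto
  then have *: "\<exists>f'\<le>W. \<exists>T'\<le>W. \<exists>N\<le>top. \<exists>V\<le>top. \<exists>w'\<le>top. s_app f T = s_app f' T' \<and> F f' \<and> mem (EVS T' N \<sigma> V) D \<and> w \<sqsubseteq> w' \<and> app_val D f' N V w'"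
    using assms by blast
  show ?thesis unfolding okEV_def by (intro conjI assms(1,3,4) disjI2 *)
qed

text \<open>Entries claim prefixes only, so a weaker claim has the same justification.\<close>

lemma okEV_down: "okEV n D t \<sigma> w ==> v \<sqsubseteq> w ==> okEV n D t \<sigma> v"
proof -
  assume w: "okEV n D t \<sigma> w" "v \<sqsubseteq> w"
  have l: "len v \<le> n" using okD(1)[OF w(1)] pre_len[OF w(2)] by auto
  consider "w = 0" | "s_is_var t" "w \<sqsubseteq> val \<sigma> t"
    | "\<exists>f\<le>W. \<exists>T\<le>W. \<exists>N\<le>top. \<exists>V\<le>top. \<exists>w'\<le>top. t = s_app f T \<and> F f \<and> mem (EVS T N \<sigma> V) D \<and> w \<sqsubseteq> w' \<and> app_val D f N V w'"
    using w(1) unfolding okEV_def by (elim conjE disjE) simp_all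
  then show ?thesis
  proof cases
    case 3
    then obtain f T N V w' where "t = s_app f T" "F f" "mem (EVS T N \<sigma> V) D" "w \<sqsubseteq> w'" "w' \<le> top" "app_val D f N V w'" by blast
    then show ?thesis using okEV_app[of f T n \<sigma> v N V D w'] okD(1)[OF w(1)] l pre_trans[OF w(2)] by blast
  qed (use okD(1)[OF w(1)] l w(2) pre_trans in \<open>auto simp: okEV_def\<close>)
qed

lemma okEV_0: "TM t ==> envok n \<sigma> ==> okEV n D t \<sigma> 0"
  by (simp add: okEV_def)

lemma envok_len: "envok n \<sigma> ==> len (dig wid \<sigma> j) \<le> n"
proof (cases "j \<le> cap")
  case False
  assume "envok n \<sigma>"
  moreover have "wid * cap \<le> wid * j" using False by (intro mult_left_mono) simp_all
  ultimately have "dig wid \<sigma> j = 0" unfolding envok_def using dig_beyond order_trans by blast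
  then show ?thesis by simp
qed (simp add: envok_def cap_def)

lemma argok_dig: "argok n N V ==> len (dig wid V j) \<le> n"
  using envok_len[of n V j] argok_len(1)[of n N V] unfolding envok_def argok_def by blast

lemma okEV_var: "s_is_var x ==> x \<le> W ==> envok n \<sigma> ==> w \<sqsubseteq> val \<sigma> x ==> okEV n D x \<sigma> w"
  unfolding okEV_def using TM_var envok_len[of n \<sigma> "len x"] pre_len[of w "val \<sigma> x"] by (simp add: val_def order_trans)

lemma okEVS_nil: "TL 0 ==> envok n \<sigma> ==> okEVS n D 0 0 \<sigma> 0"
  using cap_wid(2) zz_nonneg[of cap] unfolding okEVS_def argok_def by (simp, unfold zify, linarith)

text \<open>Terms are nonempty words, so \<open>N \<le> len T\<close> is maintained. Together with
  \<open>len T \<le> len W\<close> it yields the margin demanded by \<open>argok\<close>.\<close>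

lemma okEVS_snoc:
  assumes "G n D" "mem (EVS T M \<sigma> V) D" "mem (EV t \<sigma> v) D" "TL (T @@ t)"
  shows "okEVS n D (T @@ t) (M + 1) \<sigma> (v * ex (wid * M) + V)"
proof -
  note T = okD(2)[OF G_EVS[OF assms(1,2)]] and t = okD(1)[OF G_EV[OF assms(1,3)]]
  have n: "n \<le> wid" using assms(1) unfolding G_def by blast
  have M: "Log M" "len V \<le> wid * M" using T argok_len(3) unfolding argok_def by blast+
  have v: "v < ex wid" using t n order_trans[of "len v" n wid] by (simp add: len_le_iff)
  note a = array_snoc[OF Log_consts(2) M v]
  let ?V = "v * ex (wid * M) + V"
  have len: "M + 1 \<le> len (T @@ t)" using T TM_nonzero t by (auto simp: one_le intro: add_mono)
  have "len (T @@ t) \<le> len W" using TL_bound[OF assms(4)] len_mono by blast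
  then have cap: "M + 1 + 30 \<le> cap" using len unfolding cap_eq zify by linarith
  have "len (dig wid ?V i) \<le> n" for i
  proof (cases i M rule: linorder_cases)
    case less then show ?thesis using a(2) argok_dig T by auto
  next
    case equal then show ?thesis using a(1) t by simp
  next
    case greater
    then have "wid * (M + 1) \<le> wid * i" by (intro mult_left_mono) (simp_all add: less_iff)
    then show ?thesis using dig_beyond[OF order_trans[OF a(3)]] by simp
  qed
  then have arg: "argok n (M + 1) ?V" using cap a(3) unfolding argok_def by blast
  have *: "\<exists>T1\<le>W. \<exists>t1\<le>W. \<exists>M1\<le>top. T @@ t = T1 @@ t1 \<and> M + 1 = M1 + 1 \<and> mem (EVS T1 M1 \<sigma> (lo ?V (wid * M1))) D
          \<and> mem (EV t1 \<sigma> (hi ?V (wid * M1))) D"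
    using T t TL_bound TM_bound mem_entry_top(2)[OF assms(2)] assms(2,3) a(4,5)
    by (intro exI[of _ T] exI[of _ t] exI[of _ M] conjI) auto
  have "envok n \<sigma>" using T by blast
  then show ?thesis unfolding okEVS_def by (intro conjI assms(4) len arg disjI2 *)
qed

lemma ok_up: "okEV n D t \<sigma> w ==> n \<le> m ==> (\<And>x. mem x D ==> mem x D') ==> okEV m D' t \<sigma> w"
  "okEVS n D T N \<sigma> V ==> n \<le> m ==> (\<And>x. mem x D ==> mem x D') ==> okEVS m D' T N \<sigma> V"
  using ok_mono(1,2)[of n m D D'] by blast+

lemma le_trans_add: "(a :: mm) + b \<le> c ==> a \<le> c"
  using zz_nonneg[of b] unfolding zify by linarith

text \<open>
  All transformations of evaluations follow the structure of a term. \<open>S t w\<close> and \<open>SS T N V\<close> say which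
  evaluations are wanted; \<open>S_step\<close> and \<open>SS_step\<close> reduce them to evaluations of smaller words.
\<close>
lemma evaluate:
  assumes D: "G n D"
    and Sg_S: "Sg (Suc 0) (%s. S (s (Suc 0)) (s 0))"
    and Sg_SS: "Sg (Suc 0) (%s. SS (s (Suc (Suc 0))) (s (Suc 0)) (s 0))"
    and S_step: "\<And>t w. S t w ==> okEV n D t \<sigma> w \<or> (TM t \<and> len w \<le> n \<and> (\<exists>f T N V w'. t = s_app f T \<and> F f
      \<and> SS T N V \<and> w \<sqsubseteq> w' \<and> w' \<le> top \<and> app_val D f N V w'))"
    and SS_bound: "\<And>T N V. SS T N V ==> TL T \<and> N \<le> top \<and> V \<le> top"
    and SS_step: "\<And>T N V. SS T N V ==> mem (EVS T N \<sigma> V) D \<or> okEVS n D T N \<sigma> V \<or>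
      (\<exists>T1 t M V1 v. T = T1 @@ t \<and> TM t \<and> N = M + 1 \<and> V = v * ex (wid * M) + V1 \<and> SS T1 M V1 \<and> S t v)"
  shows "(S x w --> n + 2 * len x \<le> m + 1 --> m \<le> wid --> Ach m D (EV x \<sigma> w))
    \<and> (SS x N V --> n + 2 * len x + 1 \<le> m --> m \<le> wid --> Ach m D (EVS x N \<sigma> V))"
proof (cases "x \<le> W")
  case False
  then show ?thesis using S_step[of x w] SS_bound[of x N V] TM_bound TL_bound okD(1) by blast
next
  case True
  \<comment> \<open>\<open>S\<close> and \<open>SS\<close> refer to the fixed table
    \<open>D\<close>, while entries are added to a growing \<open>D'\<close>; hence the
    generalization over \<open>D'\<close> and its budget. A term costs at most
    \<open>2 * len x - 1\<close> entries and a list at most \<open>2 * len x + 1\<close>.\<close>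
  let ?Q1 = "%x. \<forall>n'\<le>wid. \<forall>D'\<le>top. \<forall>m\<le>wid. \<forall>w\<le>top. G n' D' \<and> subD D D' \<and> n \<le> n' \<and> S x w \<and> n' + 2 * len x \<le> m + 1 --> Ach m D' (EV x \<sigma> w)"
  let ?Q2 = "%x. \<forall>n'\<le>wid. \<forall>D'\<le>top. \<forall>m\<le>wid. \<forall>N\<le>top. \<forall>V\<le>top. G n' D' \<and> subD D D' \<and> n \<le> n' \<and> SS x N V \<and> n' + 2 * len x + 1 \<le> m --> Ach m D' (EVS x N \<sigma> V)"
  have S_top: "w \<le> top" if "S t w" for t w
  proof -
    have "len w \<le> n" using S_step[OF that] okD(1) by blast
    then show ?thesis using D wid_top unfolding G_def by (meson order_trans)
  qed
  have G_wid: "n' \<le> wid" if "G n' D'" for n' D' using that unfolding G_def by blast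
  have "?Q1 x \<and> ?Q2 x"
  proof (rule len_induct[of "%x. ?Q1 x \<and> ?Q2 x" x W])
    show "Pg (Suc (Suc 0)) (%s. ?Q1 (s 0) \<and> ?Q2 (s 0))"
      by (intro Pg_conj Pg_ball Pg_imp; (rule Sg_Pg)?; intro def_intros Sg_inst2[OF Sg_lift[OF Sg_S]] Sg_inst3[OF Sg_lift[OF Sg_SS]])
    show "x \<le> W" by fact
    fix x assume "x \<le> W" and IH: "\<And>y. y \<le> W ==> len y < len x ==> ?Q1 y \<and> ?Q2 y"
    have IH1: "Ach m D' (EV y \<sigma> w)" if "len y < len x" "y \<le> W" "G n' D'" "subD D D'" "n \<le> n'" "S y w" "n' + 2 * len y \<le> m + 1" "m \<le> wid" for y n' D' m w
      using IH[OF that(2,1), THEN conjunct1, rule_format, of n' D' m w] that G_wid G_top S_top by blast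
    have IH2: "Ach m D' (EVS y N \<sigma> V)" if "len y < len x" "G n' D'" "subD D D'" "n \<le> n'" "SS y N V" "n' + 2 * len y + 1 \<le> m" "m \<le> wid" for y n' D' m N V
      using IH[OF _ that(1), THEN conjunct2, rule_format, of n' D' m N V] that G_wid G_top SS_bound[OF that(5)] TL_bound by blast
    have Q1: "Ach m D' (EV x \<sigma> w)" if a: "G n' D'" "subD D D'" "n \<le> n'" "S x w" "n' + 2 * len x \<le> m + 1" "m \<le> wid" for n' D' m w
    proof -
      have sub: "mem e D ==> mem e D'" for e using a(2) unfolding subD_iff by blast
      have "TM x" using S_step[OF a(4)] okD(1) by blast
      then have x1: "1 \<le> len x" using TM_nonzero by (simp add: one_le)
      then have nm: "n' + 1 \<le> m" "n' \<le> m" using a(5) unfolding zify by linarith+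
      show ?thesis
      proof (cases "okEV n D x \<sigma> w")
        case True
        then have "okEV m D' x \<sigma> w" using ok_up(1)[OF _ _ sub] a(3) nm(2) order_trans by blast
        then show ?thesis using add_EV[OF a(1) nm(1) a(6)] by blast
      next
        case False
        then obtain f T N V w' where f: "TM x" "len w \<le> n" "x = s_app f T" "F f" "SS T N V" "w \<sqsubseteq> w'" "w' \<le> top" "app_val D f N V w'"
          using S_step[OF a(4)] by blast
        have lT: "len x = len f + len T + len (L END)" using f(3) by (simp add: s_app_def)
        have l1: "1 \<le> len f" "1 \<le> len (L END)" using F_nonzero[OF f(4)] by (simp_all add: one_le)
        have lx: "len T < len x" using lT l1 zz_nonneg[of "len T"] unfolding zify by linarith
        define m' where "m' = n' + 2 * len T + 1"
        have m': "m' + 1 \<le> m" using a(5) lT l1 unfolding m'_def zify by linarith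
        have "m' \<le> wid" using le_trans_add[OF m'] a(6) by (rule order_trans)
        then have "Ach m' D' (EVS T N \<sigma> V)" using IH2[OF lx a(1-3) f(5)] by (simp add: m'_def)
        then obtain D2 where D2: "\<And>e. mem e D' ==> mem e D2" "G m' D2" "mem (EVS T N \<sigma> V) D2" by (rule AchE) blast
        have "envok m' \<sigma>" using okD(2)[OF G_EVS[OF D2(2,3)]] by blast
        moreover have "app_val D2 f N V w'" using f(8) sub D2(1) unfolding app_val_def by blast
        moreover have "len w \<le> m" "m' \<le> m" using f(2) a(3) nm(2) order_trans le_trans_add[OF m'] by blast+
        ultimately have "okEV m D2 x \<sigma> w" using okEV_app[of f T m \<sigma> w N V D2 w'] f env_mono(1) D2(3) by blast
        then have "Ach m D2 (EV x \<sigma> w)" by (rule add_EV[OF D2(2) m' a(6)])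
        then show ?thesis using Ach_trans D2(1) by blast
      qed
    qed
    have Q2: "Ach m D' (EVS x N \<sigma> V)" if a: "G n' D'" "subD D D'" "n \<le> n'" "SS x N V" "n' + 2 * len x + 1 \<le> m" "m \<le> wid" for n' D' m N V
    proof -
      have sub: "mem e D ==> mem e D'" for e using a(2) unfolding subD_iff by blast
      have nm: "n' + 1 \<le> m" "n' \<le> m" using a(5) zz_nonneg[of "len x"] unfolding zify by linarith+
      consider "mem (EVS x N \<sigma> V) D" | "okEVS n D x N \<sigma> V"
        | T1 t M V1 v where "x = T1 @@ t" "TM t" "N = M + 1" "V = v * ex (wid * M) + V1" "SS T1 M V1" "S t v" using SS_step[OF a(4)] by blast
      then show ?thesis
      proof cases
        case 1 then show ?thesis using AchI[OF _ a(1) nm(2) a(6)] sub by blast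
      next
        case 2
        then have "okEVS m D' x N \<sigma> V" using ok_up(2)[OF _ _ sub] a(3) nm(2) order_trans by blast
        then show ?thesis using add_EVS[OF a(1) nm(1) a(6)] by blast
      next
        case (3 T1 t M V1 v)
        have l1: "len x = len T1 + len t" "1 \<le> len t" using 3(1) TM_nonzero[OF 3(2)] by (simp_all add: one_le)
        then have lT: "len T1 < len x" unfolding zify by linarith
        define m1 where "m1 = n' + 2 * len T1 + 1"
        \<comment> \<open>The entry that the last term saves against \<open>2 * len t\<close> pays
          for the entry of the extended list. The budget is written with \<open>m2 + 1\<close> to
          avoid subtraction.\<close>
        obtain m2 where m2: "m2 + 1 = m1 + 2 * len t"
          using le_ex[of 1 "m1 + 2 * len t"] unfolding m1_def by (metis add.commute add_increasing2 le_add2 mm_nonneg one_le)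
        have m2': "m1 \<le> m2" "m2 + 1 \<le> m" "n' \<le> m1" using a(5) m2 l1 zz_nonneg[of "len T1"] unfolding m1_def zify by linarith+
        have w: "m2 \<le> wid" "m1 \<le> wid" using le_trans_add[OF m2'(2)] a(6) m2'(1) order_trans by blast+
        have "Ach m1 D' (EVS T1 M \<sigma> V1)" using IH2[OF lT a(1-3) 3(5)] w by (simp add: m1_def)
        then obtain D1 where D1: "\<And>e. mem e D' ==> mem e D1" "G m1 D1" "mem (EVS T1 M \<sigma> V1) D1" by (rule AchE) blast
        have s1: "subD D D1" "n \<le> m1" using D1(1) sub m2'(3) a(3) order_trans unfolding subD_iff by blast+
        have "Ach m2 D1 (EV t \<sigma> v)"
        proof (cases "T1 = 0")
          case True
          then have "t = x" using 3(1) by simp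
          then show ?thesis using Q1[OF D1(2) s1 _ _ w(1)] 3(6) m2 by simp
        next
          case False
          then have "len t < len x" using 3(1) by (simp add: mm_pos)
          then show ?thesis using IH1[OF _ TM_bound[OF 3(2)] D1(2) s1 3(6) _ w(1)] m2 by simp
        qed
        then obtain D2 where D2: "\<And>e. mem e D1 ==> mem e D2" "G m2 D2" "mem (EV t \<sigma> v) D2" by (rule AchE) blast
        have "okEVS m2 D2 x N \<sigma> V"
          using okEVS_snoc[OF D2(2) D2(1)[OF D1(3)] D2(3)] SS_bound[OF a(4)] 3(1,3,4) by simp
        then have "okEVS m D2 x N \<sigma> V" using ok_up(2)[of m2 D2 x N \<sigma> V m D2] le_trans_add[OF m2'(2)] by blast
        then have "Ach m D2 (EVS x N \<sigma> V)" by (rule add_EVS[OF D2(2) m2'(2) a(6)])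
        then show ?thesis using Ach_trans D1(1) D2(1) by blast
      qed
    qed
    show "?Q1 x \<and> ?Q2 x"
      by (rule conjI; intro allI impI; elim conjE; (rule Q1; assumption | rule Q2; assumption))
  qed
  note Q = this
  have "subD D D" unfolding subD_iff by blast
  then show ?thesis
    using Q[THEN conjunct1, rule_format, of n D m w] Q[THEN conjunct2, rule_format, of n D m N V] G_wid[OF D] G_top[OF D] S_top SS_bound D by blast
qed

lemma letter_len: "len (L EPS) = 5" "len (L SUC0) = 6" "len (L SUC1) = 7"
  by (simp_all add: len_L)

lemma app_val_top: assumes "G n D" "app_val D f N V w" "argok n N V" shows "w \<le> top"
proof -
  have "100 * wid \<le> cap * wid" using cap_wid(2) by (intro mult_right_mono) simp_all
  then have c: "100 * wid \<le> wid * cap" by (simp add: mult.commute)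
  have w: "100 \<le> wid" "n \<le> wid" using cap_wid assms(1) unfolding G_def by auto
  have "len (dig wid V 0) \<le> n" using argok_dig assms(3) by blast
  then have "len w \<le> wid * cap" if "len w \<le> 7 + len (dig wid V 0)"
    using that w c unfolding zify by linarith
  then have "w \<le> top" if "len w \<le> 7 + len (dig wid V 0)" using that small_top(1) by blast
  moreover have "len w \<le> 7 + len (dig wid V 0)"
    if "w = L EPS \<or> w = L SUC0 @@ dig wid V 0 \<or> w = L SUC1 @@ dig wid V 0"
    using that zz_nonneg[of "len (dig wid V 0)"] by (elim disjE) (simp_all add: letter_len, unfold zify, linarith+)
  ultimately show ?thesis using assms(2) mem_entry_top(3)[of f N V w D] unfolding app_val_def by blast
qed

lemma app_source:
  assumes "G n D" "mem (EV (s_app f T) \<sigma> w) D" "F f" "w \<noteq> 0"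
  obtains N V w' where "mem (EVS T N \<sigma> V) D" "w \<sqsubseteq> w'" "w' \<le> top" "app_val D f N V w'" "len w \<le> n"
proof -
  obtain N V w' where *: "mem (EVS T N \<sigma> V) D" "w \<sqsubseteq> w'" "app_val D f N V w'" using G_EV_app[OF assms] .
  have "w' \<le> top" using app_val_top[OF assms(1) *(3)] okD(2)[OF G_EVS[OF assms(1) *(1)]] by blast
  moreover have "len w \<le> n" using okD(1)[OF G_EV[OF assms(1,2)]] by blast
  ultimately show ?thesis using that * by blast
qed

lemma var_source:
  assumes "G n D" "mem (EV x \<sigma> w) D" "s_is_var x"
  shows "w \<sqsubseteq> val \<sigma> x"
proof -
  consider "w = 0" | "w \<sqsubseteq> val \<sigma> x" | f T where "x = s_app f T" "F f"
    using G_EV[OF assms(1,2)] unfolding okEV_def by blast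
  then show ?thesis using app_not_var assms(3) by cases auto
qed

lemma snoc_source:
  assumes "G n D" "mem (EVS (T @@ t) N \<sigma> V) D" "TL T" "TM t"
  obtains M V1 v where "N = M + 1" "V = v * ex (wid * M) + V1" "mem (EVS T M \<sigma> V1) D" "mem (EV t \<sigma> v) D"
proof -
  obtain M where M: "N = M + 1" "Log M" "mem (EVS T M \<sigma> (lo V (wid * M))) D" "mem (EV t \<sigma> (hi V (wid * M))) D" "len V \<le> wid * (M + 1)"
    using G_EVS_snoc[OF assms] .
  then show ?thesis using that[OF M(1) _ M(3,4)] hilo(1)[of "wid * M" V] by simp
qed

lemma evaluateI:
  assumes "G n D"
    and "Sg (Suc 0) (%s. S (s (Suc 0)) (s 0))" "Sg (Suc 0) (%s. SS (s (Suc (Suc 0))) (s (Suc 0)) (s 0))"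
    and "\<And>t w. S t w ==> okEV n D t \<sigma> w \<or> (TM t \<and> len w \<le> n \<and> (\<exists>f T N V w'. t = s_app f T \<and> F f
      \<and> SS T N V \<and> w \<sqsubseteq> w' \<and> w' \<le> top \<and> app_val D f N V w'))"
    and "\<And>T N V. SS T N V ==> TL T \<and> N \<le> top \<and> V \<le> top"
    and "\<And>T N V. SS T N V ==> mem (EVS T N \<sigma> V) D \<or> okEVS n D T N \<sigma> V \<or>
      (\<exists>T1 t M V1 v. T = T1 @@ t \<and> TM t \<and> N = M + 1 \<and> V = v * ex (wid * M) + V1 \<and> SS T1 M V1 \<and> S t v)"
    and "S x w" "n + 2 * len x \<le> m + 1" "m \<le> wid"
  shows "Ach m D (EV x \<sigma> w)"
  using evaluate[OF assms(1-6)] assms(7-9) by blast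

text \<open>\<open>B t t'\<close> says that \<open>t'\<close> has the shape of \<open>t\<close>
  except at places where a known value of \<open>t'\<close> directly justifies the claim for
  \<open>t\<close>. Applications reuse the recorded argument arrays and calls, so a change of terms
  or environments costs only entries for the subterms, never a recomputation of a function.\<close>

lemma EV_simulate:
  assumes D: "G n D" "envok n \<sigma>"
    and B: "Sg (Suc 0) (%s. B (s (Suc 0)) (s 0))" "Sg (Suc 0) (%s. BS (s (Suc 0)) (s 0))"
    and B_TM: "\<And>t t'. B t t' ==> TM t \<and> TM t'"
    and B_step: "\<And>t t' w. B t t' ==> mem (EV t' \<rho> w) D ==>
      okEV n D t \<sigma> w \<or> (\<exists>f T T'. F f \<and> BS T T' \<and> t = s_app f T \<and> t' = s_app f T')"
    and BS_step: "\<And>T T'. BS T T' ==> TL T \<and> TL T' \<and>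
      (T = 0 \<and> T' = 0 \<or> (\<exists>T1 t T1' t'. T = T1 @@ t \<and> T' = T1' @@ t' \<and> BS T1 T1' \<and> B t t'))"
    and t: "B t t'" "mem (EV t' \<rho> w) D" "n + 2 * len t \<le> m + 1" "m \<le> wid"
  shows "Ach m D (EV t \<sigma> w)"
proof (rule evaluateI[where S = "%t w. \<exists>t'\<le>W. B t t' \<and> mem (EV t' \<rho> w) D"
      and SS = "%T N V. \<exists>T'\<le>W. BS T T' \<and> mem (EVS T' N \<rho> V) D", OF D(1) _ _ _ _ _ _ t(3,4)])
  show "Sg (Suc 0) (%s. \<exists>t'\<le>W. B (s (Suc 0)) t' \<and> mem (EV t' \<rho> (s 0)) D)"
    "Sg (Suc 0) (%s. \<exists>T'\<le>W. BS (s (Suc (Suc 0))) T' \<and> mem (EVS T' (s (Suc 0)) \<rho> (s 0)) D)"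
    by (intro def_intros Sg_inst2[OF B(1)] Sg_inst2[OF B(2)])+
  have S: "\<exists>t'\<le>W. B t t' \<and> mem (EV t' \<rho> w) D" if "B t t'" "mem (EV t' \<rho> w) D" for t t' w
    using that B_TM[OF that(1)] TM_bound by blast
  have SS: "\<exists>T'\<le>W. BS T T' \<and> mem (EVS T' N \<rho> V) D" if "BS T T'" "mem (EVS T' N \<rho> V) D" for T T' N V
    using that BS_step[OF that(1)] TL_bound by blast
  show "\<exists>t'\<le>W. B t t' \<and> mem (EV t' \<rho> w) D" using S t by blast
  {
    fix t w assume "\<exists>t'\<le>W. B t t' \<and> mem (EV t' \<rho> w) D"
    then obtain t' where a: "B t t'" "mem (EV t' \<rho> w) D" by blast
    have TM: "TM t" using B_TM[OF a(1)] by blast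
    show "okEV n D t \<sigma> w \<or> (TM t \<and> len w \<le> n \<and> (\<exists>f T N V w'. t = s_app f T \<and> F f
        \<and> (\<exists>T'\<le>W. BS T T' \<and> mem (EVS T' N \<rho> V) D) \<and> w \<sqsubseteq> w' \<and> w' \<le> top \<and> app_val D f N V w'))"
    proof (cases "w = 0 \<or> okEV n D t \<sigma> w")
      case True then show ?thesis using okEV_0 TM D(2) by blast
    next
      case False
      then obtain f T T' where f: "F f" "BS T T'" "t = s_app f T" "t' = s_app f T'" using B_step[OF a] by blast
      obtain N V w' where "mem (EVS T' N \<rho> V) D" "w \<sqsubseteq> w'" "w' \<le> top" "app_val D f N V w'" "len w \<le> n"
        using app_source[OF D(1) a(2)[unfolded f(4)] f(1)] False by blast
      then show ?thesis using TM f(1,3) SS[OF f(2)] by blast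
    qed
  }
  {
    fix T N V assume "\<exists>T'\<le>W. BS T T' \<and> mem (EVS T' N \<rho> V) D"
    then obtain T' where a: "BS T T'" "mem (EVS T' N \<rho> V) D" by blast
    show "TL T \<and> N \<le> top \<and> V \<le> top" using BS_step[OF a(1)] mem_entry_top(2)[OF a(2)] by blast
    consider "T = 0" "T' = 0" | T1 T1' t t' where "T = T1 @@ t" "T' = T1' @@ t'" "BS T1 T1'" "B t t'"
      using BS_step[OF a(1)] by blast
    then show "mem (EVS T N \<sigma> V) D \<or> okEVS n D T N \<sigma> V \<or> (\<exists>T1 t M V1 v. T = T1 @@ t \<and> TM t \<and> N = M + 1
      \<and> V = v * ex (wid * M) + V1 \<and> (\<exists>T'\<le>W. BS T1 T' \<and> mem (EVS T' M \<rho> V1) D) \<and> (\<exists>t'\<le>W. B t t' \<and> mem (EV t' \<rho> v) D))"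
    proof cases
      case 1
      then show ?thesis using EVS_zero[OF D(1)] a(2) okEVS_nil[OF _ D(2)] BS_step[OF a(1)] by metis
    next
      case (2 T1 T1' t t')
      obtain M V1 v where "N = M + 1" "V = v * ex (wid * M) + V1" "mem (EVS T1' M \<rho> V1) D" "mem (EV t' \<rho> v) D"
        using snoc_source[OF D(1) a(2)[unfolded 2(2)]] BS_step[OF 2(3)] B_TM[OF 2(4)] by blast
      then show ?thesis using 2(1) B_TM[OF 2(4)] SS[OF 2(3)] S[OF 2(4)] by blast
    qed
  }
qed

text \<open>Simulation of a term by itself in another environment. The class \<open>R\<close> limits
  the variables on which the environments have to be compared.\<close>

lemma EV_transfer:
  assumes D: "G n D" "envok n \<sigma>"
    and R: "Sg (Suc 0) (%s. R (s 0))" "Sg (Suc 0) (%s. RL (s 0))"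
    and R_cases: "\<And>t. R t ==> TM t \<and> (s_is_var t \<and> val \<rho> t \<sqsubseteq> val \<sigma> t \<or> (\<exists>f T. F f \<and> RL T \<and> t = s_app f T))"
    and RL_cases: "\<And>T. RL T ==> TL T \<and> (T = 0 \<or> (\<exists>T1 t. T = T1 @@ t \<and> RL T1 \<and> R t))"
    and t: "R t" "mem (EV t \<rho> w) D" "n + 2 * len t \<le> m + 1" "m \<le> wid"
  shows "Ach m D (EV t \<sigma> w)"
proof (rule EV_simulate[where B = "%t t'. R t \<and> t = t'" and BS = "%T T'. RL T \<and> T = T'", OF D _ _ _ _ _ _ t(2-4)])
  show "Sg (Suc 0) (%s. R (s (Suc 0)) \<and> s (Suc 0) = s 0)" "Sg (Suc 0) (%s. RL (s (Suc 0)) \<and> s (Suc 0) = s 0)"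
    by (intro def_intros Sg_inst[OF R(1)] Sg_inst[OF R(2)])+
  fix t t' w assume a: "R t \<and> t = t'" "mem (EV t' \<rho> w) D"
  have "okEV n D t \<sigma> w" if "s_is_var t" "val \<rho> t \<sqsubseteq> val \<sigma> t"
    using okEV_var[OF that(1) _ D(2)] pre_trans[OF var_source[OF D(1)] that(2)] that(1) a R_cases TM_bound by blast
  then show "okEV n D t \<sigma> w \<or> (\<exists>f T T'. F f \<and> (RL T \<and> T = T') \<and> t = s_app f T \<and> t' = s_app f T')" using R_cases a(1) by blast
qed (use R_cases RL_cases t(1) in blast)+

lemma EV_mono:
  assumes "G n D" "envok n \<sigma>" "mem (EV t \<rho> w) D" "\<And>y. s_is_var y ==> val \<rho> y \<sqsubseteq> val \<sigma> y" "n + 2 * len t \<le> m + 1" "m \<le> wid"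
  shows "Ach m D (EV t \<sigma> w)"
proof (rule EV_transfer[OF assms(1,2), where R = TM and RL = TL, OF _ _ _ _ _ assms(3,5,6)])
  show "Sg (Suc 0) (%s. TM (s 0))" "Sg (Suc 0) (%s. TL (s 0))" by (intro def_intros)+
  show "TM t" using okD(1)[OF G_EV[OF assms(1,3)]] by blast
  show "TM t ==> TM t \<and> (s_is_var t \<and> val \<rho> t \<sqsubseteq> val \<sigma> t \<or> (\<exists>f T. F f \<and> TL T \<and> t = s_app f T))" for t
    using TM_cases[of t] assms(4)[of t] by blast
  show "TL T ==> TL T \<and> (T = 0 \<or> (\<exists>T1 t. T = T1 @@ t \<and> TL T1 \<and> TM t))" for T using TL_cases[of T] by blast
qed

lemma subst_env:
  assumes "G n D" "envok n \<sigma>" "x \<le> W"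
  obtains \<sigma>' where "envok n \<sigma>'" "val \<sigma>' x = 0 \<or> mem (EV r \<sigma> (val \<sigma>' x)) D" "\<And>w. mem (EV r \<sigma> w) D ==> w \<sqsubseteq> val \<sigma>' x"
    "\<And>y. s_is_var x ==> s_is_var y ==> y \<noteq> x ==> val \<sigma>' y = val \<sigma> y"
proof -
  \<comment> \<open>If the table contains no value of \<open>r\<close>, then 0 is chosen: nothing is
    known of the variable.\<close>
  have "\<exists>v. (v = 0 \<or> mem (EV r \<sigma> v) D) \<and> (\<forall>u. mem (EV r \<sigma> u) D --> u \<sqsubseteq> v)"
  proof (cases "\<exists>v. mem (EV r \<sigma> v) D")
    case True
    then obtain u where u: "mem (EV r \<sigma> u) D" by blast
    have Sg: "Sg (Suc (Suc 0)) (%s. mem (EV r \<sigma> (s 0)) D)" by (intro def_intros)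
    have b: "v \<le> top" if "mem (EV r \<sigma> v) D" for v using mem_entry_top(1)[OF that] by blast
    obtain v where v: "mem (EV r \<sigma> v) D" "\<forall>u. mem (EV r \<sigma> u) D --> len u \<le> len v"
      using longest[of "%v. mem (EV r \<sigma> v) D" u top, OF Sg u b] by blast
    have "u \<sqsubseteq> v" if "mem (EV r \<sigma> u) D" for u
    proof -
      have "cpr u v" using EV_coherent[OF assms(1) that v(1)] by (simp add: cmp_def)
      then show ?thesis using v(2) that pre_len_antisym unfolding cpr_def by (metis pre_refl)
    qed
    then show ?thesis using v(1) by blast
  qed auto
  then obtain v where v: "v = 0 \<or> mem (EV r \<sigma> v) D" "\<And>u. mem (EV r \<sigma> u) D ==> u \<sqsubseteq> v" by blast
  have l: "len v \<le> n" using v(1) okD(1)[OF G_EV[OF assms(1)]] by auto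
  have "n \<le> wid" using assms(1) unfolding G_def by blast
  then have "v < ex wid" using l order_trans[of "len v" n wid] by (simp add: len_le_iff flip: len_le_iff)
  moreover have "len x + 1 \<le> cap" using len_mono[OF assms(3)] unfolding cap_eq zify by linarith
  moreover have "len \<sigma> \<le> wid * cap" using assms(2) unfolding envok_def by blast
  ultimately obtain \<sigma>' where s: "dig wid \<sigma>' (len x) = v" "\<forall>i. i \<noteq> len x --> dig wid \<sigma>' i = dig wid \<sigma> i" "len \<sigma>' \<le> wid * cap"
    using array_update[of wid "len x" v \<sigma> cap] by auto
  have "len (dig wid \<sigma>' i) \<le> n" for i using s(1,2) l envok_len[OF assms(2), of i] by (cases "i = len x") auto
  then have "envok n \<sigma>'" using s(3) unfolding envok_def by blast
  then show ?thesis
    by (rule that) (use s v is_var_len_inj in \<open>auto simp: val_def\<close>)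
qed

text \<open>Where \<open>t\<close> has the variable \<open>x\<close>, the other side offers a value
  of \<open>r\<close>; it is a prefix of what the new environment assigns to
  \<open>x\<close>.\<close>

lemma SUB_down:
  assumes D: "G n D" "envok n \<sigma>'" "\<And>w. mem (EV r \<sigma> w) D ==> w \<sqsubseteq> val \<sigma>' x"
    "\<And>y. s_is_var x ==> s_is_var y ==> y \<noteq> x ==> val \<sigma>' y = val \<sigma> y"
    and t: "isSUB t x r t'" "mem (EV t' \<sigma> w) D" "n + 2 * len t \<le> m + 1" "m \<le> wid"
  shows "Ach m D (EV t \<sigma>' w)"
proof (rule EV_simulate[where B = "%t t'. isSUB t x r t'" and BS = "%T T'. isSUBS T x r T'", OF D(1,2) _ _ _ _ _ t])
  show "Sg (Suc 0) (%s. isSUB (s (Suc 0)) x r (s 0))" "Sg (Suc 0) (%s. isSUBS (s (Suc 0)) x r (s 0))" by (intro def_intros)+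
  fix t t' w assume a: "isSUB t x r t'" "mem (EV t' \<sigma> w) D"
  have "okEV n D t \<sigma>' w" if "t = x" "t' = r" "s_is_var x"
    using okEV_var[OF _ TM_bound D(2)] SUB_TM[OF a(1)] D(3) a(2) that by blast
  moreover have "okEV n D t \<sigma>' w" if "t' = t" "s_is_var t" "s_is_var x" "t \<noteq> x"
    using okEV_var[OF that(2) TM_bound D(2)] SUB_TM[OF a(1)] var_source[OF D(1) a(2)] D(4) that by simp
  ultimately show "okEV n D t \<sigma>' w \<or> (\<exists>f T T'. F f \<and> isSUBS T x r T' \<and> t = s_app f T \<and> t' = s_app f T')"
    using isSUB_cases[OF a(1)] isFUN_F by blast
next
  fix T T' assume "isSUBS T x r T'"
  then show "TL T \<and> TL T' \<and> (T = 0 \<and> T' = 0 \<or> (\<exists>T1 t T1' t'. T = T1 @@ t \<and> T' = T1' @@ t' \<and> isSUBS T1 x r T1' \<and> isSUB t x r t'))"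
    using TL_subs isSUBS_cases by blast
qed (rule SUB_TM)

text \<open>Where \<open>t'\<close> has \<open>x\<close>, its known value is a prefix of the
  assigned one, which the table attests for \<open>r\<close>; if 0 is assigned, nothing is
  claimed.\<close>

lemma SUB_up:
  assumes D: "G n D" "envok n \<sigma>" "val \<sigma>' x = 0 \<or> mem (EV r \<sigma> (val \<sigma>' x)) D"
    "\<And>y. s_is_var x ==> s_is_var y ==> y \<noteq> x ==> val \<sigma>' y = val \<sigma> y"
    and t: "isSUB t' x r t" "mem (EV t' \<sigma>' w) D" "n + 2 * len t \<le> m + 1" "m \<le> wid"
  shows "Ach m D (EV t \<sigma> w)"
proof (rule EV_simulate[where B = "%t t'. isSUB t' x r t" and BS = "%T T'. isSUBS T' x r T", OF D(1,2) _ _ _ _ _ t])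
  show "Sg (Suc 0) (%s. isSUB (s 0) x r (s (Suc 0)))" "Sg (Suc 0) (%s. isSUBS (s 0) x r (s (Suc 0)))" by (intro def_intros)+
  fix t t' w assume a: "isSUB t' x r t" "mem (EV t' \<sigma>' w) D"
  have TM: "TM t" using SUB_TM[OF a(1)] by blast
  have "okEV n D t \<sigma> w" if "t' = x" "t = r" "s_is_var x"
  proof -
    have w: "w \<sqsubseteq> val \<sigma>' x" using var_source[OF D(1)] a(2) that by blast
    show ?thesis
    proof (cases "val \<sigma>' x = 0")
      case True then show ?thesis using w okEV_0[OF TM D(2)] by simp
    next
      case False
      then have "okEV n D t \<sigma> (val \<sigma>' x)" using G_EV[OF D(1)] D(3) that(2) by blast
      then show ?thesis using w okEV_down by blast
    qed
  qed
  moreover have "okEV n D t \<sigma> w" if "t = t'" "s_is_var t" "s_is_var x" "t' \<noteq> x"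
    using okEV_var[OF that(2) TM_bound[OF TM] D(2)] var_source[OF D(1) a(2)] D(4) that by simp
  ultimately show "okEV n D t \<sigma> w \<or> (\<exists>f T T'. F f \<and> isSUBS T' x r T \<and> t = s_app f T \<and> t' = s_app f T')"
    using isSUB_cases[OF a(1)] isFUN_F by blast
next
  fix T T' assume "isSUBS T' x r T"
  then show "TL T \<and> TL T' \<and> (T = 0 \<and> T' = 0 \<or> (\<exists>T1 t T1' t'. T = T1 @@ t \<and> T' = T1' @@ t' \<and> isSUBS T1' x r T1 \<and> isSUB t' x r t))"
    using TL_subs isSUBS_cases by blast
qed (use SUB_TM in blast)

end

lemma shift_less: "Log a ==> Log b ==> x < ex a ==> v < ex b ==> x * ex b + v < ex (a + b)"
proof -
  assume *: "Log a" "Log b" "x < ex a" "v < ex b"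
  then have "(x + 1) * ex b \<le> ex a * ex b" by (intro mult_right_mono) (simp_all add: less_iff)
  then show ?thesis using *(4) ex_add[OF *(1,2)] unfolding zify by (simp add: algebra_simps)
qed

context deriv
begin

lemma PROJ_arity:
  assumes "isFUN (s_cProj I N) N" "s_unary I"
  shows "1 \<le> len I" "len I \<le> len N" "s_unary N"
proof -
  have "s_step W W (s_judge FUN [s_cProj I N, N])" using assms(1) entry_step by (simp add: isFUN_def)
  then have st: "s_step_fun W W (s_judge FUN [s_cProj I N, N])"
    unfolding s_step_def s_step_fun_def s_step_term_def s_step_sub_def s_step_prf_def by (simp add: s_judge_neq)
  have c: "\<forall>w \<in> set [s_cProj I N, N]. clean w" using isFUN_clean[OF assms(1)] by simp
  have j: "s_judge FUN [s_cProj I N, N] = s_judge FUN [f, M] \<longleftrightarrow> s_cProj I N = f \<and> N = M" for f M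
    using s_judge_eq[OF c, of "[f, M]"] by simp
  have n: "s_cProj I N \<noteq> L EPS" "s_cProj I N \<noteq> L SUC0" "s_cProj I N \<noteq> L SUC1"
    unfolding code_cons by (simp_all only: L_cons_single) simp_all
  from st have "\<exists>I'. s_cProj I N = s_cProj I' N \<and> s_unary I' \<and> s_unary N \<and> L MARK \<le> I' \<and> I' \<le> N"
    unfolding s_step_fun_def j by (auto simp: n code_neq s_judge_neq)
  then obtain I' where "s_cProj I N = s_cProj I' N" "s_unary I'" "L MARK \<le> I'" "I' \<le> N" and "s_unary N" by blast
  then have "L MARK \<le> I" "I \<le> N" using proj_inj assms(2) by metis+
  then show "1 \<le> len I" "len I \<le> len N" "s_unary N" using \<open>s_unary N\<close> len_mono[of I N] by (auto simp: one_le)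
qed

lemma Ach_up: "Ach n D e ==> n \<le> m ==> m \<le> wid ==> Ach m D e"
  unfolding Ach_def using G_mono by blast

section \<open>Evaluation of argument lists consisting of variables\<close>

subsection \<open>Variable lists\<close>

lemma dig_lo: "Log N ==> i < N ==> dig wid (lo V (wid * N)) i = dig wid V i"
proof -
  assume N: "Log N" "i < N"
  have "wid * (i + 1) \<le> wid * N" using N(2) by (intro mult_left_mono) (simp_all add: less_iff)
  then show ?thesis using dig_low[of wid "wid * N" i "hi V (wid * N)" "lo V (wid * N)"] hilo(1)[of "wid * N" V] N(1)
    by (simp add: distrib_left)
qed

lemma lo_Suc: assumes "Log K" shows "lo V (wid * (K + 1)) = dig wid V K * ex (wid * K) + lo V (wid * K)"
proof -
  obtain A R where *: "V = (A * ex wid + dig wid V K) * ex (wid * K) + R" "R < ex (wid * K)" "dig wid V K < ex wid"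
    using dig_split[of wid K V] assms by auto
  have R: "lo V (wid * K) = R" using hilo_unique(2)[OF _ *(1,2)] assms by simp
  have "wid * (K + 1) = wid + wid * K" by (simp add: distrib_left add.commute)
  then have e: "ex (wid * (K + 1)) = ex wid * ex (wid * K)" using assms ex_add[of wid "wid * K"] by simp
  have "dig wid V K * ex (wid * K) + R < ex (wid * (K + 1))"
    using shift_less[OF _ _ *(3,2)] assms by (simp add: distrib_left add.commute)
  note lt = this
  have eq: "V = A * ex (wid * (K + 1)) + (dig wid V K * ex (wid * K) + R)" using *(1) unfolding e by (simp add: algebra_simps)
  have "Log (wid * (K + 1))" using assms by (simp add: Log_add)
  then show ?thesis unfolding R by (rule hilo_unique(2)[OF _ eq lt])
qed

lemma var_len: "len (s_var (N @@ L MARK)) = 29 + len N"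
proof -
  have "len (L MARK) = 1" by (simp add: len_L)
  then show ?thesis unfolding len_s_var len_wc zify by simp
qed

lemma VARS_len: "isVARS X M ==> len M \<le> len W \<and> len M \<le> cap \<and> Log (len M)"
  using isVARS_sub[of X M] sub_le[of M W] len_W[of M] len_mono[of M W] by auto

text \<open>The argument list of a defining equation is a head \<open>T0\<close> of at most one term
  followed by variables. Given a value for the head, the full arguments are read off the
  environment.\<close>

lemma vars_eval:
  assumes D: "G n D" "mem (EVS T0 c \<sigma> V0) D"
    and X: "isVARS X M" "list_head T0" "T0 @@ X \<le> W" "c = 0 \<or> c = 1" and m: "n + 2 * len (T0 @@ X) + 1 \<le> m" "m \<le> wid"
  obtains V where "Ach m D (EVS (T0 @@ X) (c + len M) \<sigma> V)" "\<And>i. i < len M ==> dig wid V (c + i) = dig wid \<sigma> (29 + i)"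
    "c = 1 ==> dig wid V 0 = dig wid V0 0"
proof -
  have c: "Log c" using X(4) by auto
  note ok = okD(2)[OF G_EVS[OF D]]
  have V0: "V0 < ex (wid * c)" using ok c unfolding argok_def by (simp add: len_le_iff)
  \<comment> \<open>The environment positions from 29 on are moved down to position
    \<open>c\<close>, right above the values of the head. The array wanted for an initial part of
    the list is a truncation of this one.\<close>
  define Vx where "Vx = hi \<sigma> (wid * 29) * ex (wid * c) + V0"
  have dx: "dig wid Vx (c + i) = dig wid \<sigma> (29 + i)" if "Log i" for i
    unfolding Vx_def using dig_high[of wid c i V0] V0 c that dig_hi[of 29 i \<sigma>] by simp
  have lox: "lo Vx (wid * c) = V0" using hilo_unique(2)[of "wid * c" Vx "hi \<sigma> (wid * 29)" V0] V0 c by (simp add: Vx_def)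
  define S where "S t w \<longleftrightarrow> s_is_var t \<and> t \<le> W \<and> w = val \<sigma> t" for t w
  define SS where "SS T N V \<longleftrightarrow> (\<exists>X'\<le>W. \<exists>M'\<le>W. isVARS X' M' \<and> T = T0 @@ X' \<and> T \<le> W \<and> N = c + len M' \<and> V = lo Vx (wid * N))" for T N V
  have SSI: "SS (T0 @@ X') (c + len M') (lo Vx (wid * (c + len M')))" if "isVARS X' M'" "T0 @@ X' \<le> W" for X' M'
    unfolding SS_def using that isVARS_sub[OF that(1)] sub_le by blast
  have "(S t w --> n + 2 * len t \<le> m + 1 --> m \<le> wid --> Ach m D (EV t \<sigma> w))
    \<and> (SS t N V --> n + 2 * len t + 1 \<le> m --> m \<le> wid --> Ach m D (EVS t N \<sigma> V))" for t w N V
  proof (rule evaluate[OF D(1)])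
    show "Sg (Suc 0) (%s. S (s (Suc 0)) (s 0))" "Sg (Suc 0) (%s. SS (s (Suc (Suc 0))) (s (Suc 0)) (s 0))"
      unfolding S_def SS_def by (intro def_intros)+
    fix t w assume "S t w"
    then have "okEV n D t \<sigma> w" unfolding S_def using okEV_var ok by simp
    then show "okEV n D t \<sigma> w \<or> (TM t \<and> len w \<le> n \<and> (\<exists>f T N V w'. t = s_app f T \<and> F f
      \<and> SS T N V \<and> w \<sqsubseteq> w' \<and> w' \<le> top \<and> app_val D f N V w'))" by blast
  next
    fix T N V assume "SS T N V"
    then obtain X' M' where s: "isVARS X' M'" "T = T0 @@ X'" "T \<le> W" "N = c + len M'" "V = lo Vx (wid * N)" unfolding SS_def by blast
    have N: "N \<le> cap"
    proof -
      have "c \<le> 1" using X(4) by auto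
      then show ?thesis using VARS_len[OF s(1)] unfolding s(4) cap_eq zify by linarith
    qed
    then have "Log N" using Log_down[OF Log_consts(1)] by blast
    then have "len V \<le> wid * N" unfolding s(5) using hilo(2)[of "wid * N" Vx] by (simp add: len_le_iff)
    moreover have "wid * N \<le> wid * cap" using N by (intro mult_left_mono) simp_all
    ultimately show "TL T \<and> N \<le> top \<and> V \<le> top"
      using TL_vars[OF X(2) s(1)] s(2,3) cap_top[OF N] small_top(1) order_trans by blast
    from isVARS_cases[OF s(1)] show "mem (EVS T N \<sigma> V) D \<or> okEVS n D T N \<sigma> V \<or>
      (\<exists>T1 t M V1 v. T = T1 @@ t \<and> TM t \<and> N = M + 1 \<and> V = v * ex (wid * M) + V1 \<and> SS T1 M V1 \<and> S t v)"
    proof (elim disjE exE conjE)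
      assume "X' = 0" "M' = 0"
      then show ?thesis using D(2) s lox by simp
    next
      fix X1 M1 assume x: "X' = X1 @@ s_var (M1 @@ L MARK)" "M' = M1 @@ L MARK" "isVARS X1 M1"
      define K where "K = c + len M1"
      have l1: "len (L MARK) = 1" by (simp add: len_L)
      have NK: "N = K + 1" unfolding s(4) x(2) K_def len_wc l1 by (simp add: add.assoc)
      have LK: "Log K" unfolding K_def using c by (simp add: Log_add)
      have T: "T = (T0 @@ X1) @@ s_var (M1 @@ L MARK)" using s(2) x(1) by simp
      then have b: "T0 @@ X1 \<le> W" "s_var (M1 @@ L MARK) \<le> W" using s(3) wc_le order_trans by blast+
      have v: "dig wid Vx K = val \<sigma> (s_var (M1 @@ L MARK))" unfolding K_def val_def var_len by (rule dx) simp
      have "V = val \<sigma> (s_var (M1 @@ L MARK)) * ex (wid * K) + lo Vx (wid * K)" unfolding s(5) NK lo_Suc[OF LK] v by simp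
      moreover have "SS (T0 @@ X1) K (lo Vx (wid * K))" unfolding K_def by (rule SSI[OF x(3) b(1)])
      moreover have "S (s_var (M1 @@ L MARK)) (val \<sigma> (s_var (M1 @@ L MARK)))" unfolding S_def using s_var_is_var b(2) by blast
      ultimately show ?thesis using T NK TM_var[OF s_var_is_var b(2)] by blast
    qed
  qed
  then have A: "Ach m D (EVS (T0 @@ X) (c + len M) \<sigma> (lo Vx (wid * (c + len M))))" using SSI[OF X(1,3)] m by blast
  have L: "Log (c + len M)" using c by (simp add: Log_add)
  show ?thesis
  proof (rule that[OF A])
    fix i assume i: "i < len M"
    then have "Log i" using Log_down[of "len M" i] by simp
    then show "dig wid (lo Vx (wid * (c + len M))) (c + i) = dig wid \<sigma> (29 + i)" using dig_lo[OF L] dx i by simp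
  next
    assume "c = 1"
    then have "0 < c + len M" "0 < c" by (auto simp: mm_pos)
    then show "dig wid (lo Vx (wid * (c + len M))) 0 = dig wid V0 0" using dig_lo[OF L] dig_lo[OF c, of 0 Vx] lox by simp
  qed
qed

text \<open>Recorded values may be shorter than the environment permits, so the converse of
  \<open>vars_eval\<close> gives prefixes only.\<close>

lemma vars_inv:
  assumes D: "G n D" and X: "isVARS X M" "list_head T0" "T0 @@ X \<le> W" "mem (EVS (T0 @@ X) N \<sigma> V) D"
  obtains c V0 where "N = c + len M" "mem (EVS T0 c \<sigma> V0) D" "c \<noteq> 0 ==> dig wid V0 0 = dig wid V 0"
    "\<And>i. i < len M ==> dig wid V (c + i) \<sqsubseteq> dig wid \<sigma> (29 + i)"
proof -
  let ?C = "%M N V. \<exists>c\<le>top. \<exists>V0\<le>top. N = c + len M \<and> mem (EVS T0 c \<sigma> V0) D \<and> (c \<noteq> 0 --> dig wid V0 0 = dig wid V 0)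
    \<and> (\<forall>i\<le>len capw. i < len M --> dig wid V (c + i) \<sqsubseteq> dig wid \<sigma> (29 + i))"
  let ?Q = "%X. \<forall>M\<le>W. \<forall>N\<le>top. \<forall>V\<le>top. isVARS X M \<and> T0 @@ X \<le> W \<and> mem (EVS (T0 @@ X) N \<sigma> V) D --> ?C M N V"
  have b: "X \<le> W \<and> M \<le> W" if "isVARS X M" for X M using isVARS_sub[OF that] sub_le by blast
  have "?Q X"
  proof (rule len_induct[of ?Q X W])
    show "Pg (Suc (Suc 0)) (%s. ?Q (s 0))"
      by (intro Pg_ball Pg_imp; (rule Sg_Pg)?; intro def_intros)
    show "X \<le> W" using b[OF X(1)] by simp
    fix X assume IH: "\<And>y. y \<le> W ==> len y < len X ==> ?Q y"
    show "?Q X"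
    proof (intro allI impI, elim conjE)
      fix M N V assume a: "isVARS X M" "T0 @@ X \<le> W" "mem (EVS (T0 @@ X) N \<sigma> V) D"
      consider "X = 0" "M = 0" | X1 M1 where "X = X1 @@ s_var (M1 @@ L MARK)" "M = M1 @@ L MARK" "isVARS X1 M1"
        using isVARS_cases[OF a(1)] by blast
      then show "?C M N V"
      proof cases
        case 1
        then have "N = N + len M" "mem (EVS T0 N \<sigma> V) D" "\<And>i. \<not> i < len M" using a(3) by (simp_all add: not_less)
        then show ?thesis using mem_entry_top(2)[OF a(3)] by blast
      next
        case (2 X1 M1)
        let ?x = "s_var (M1 @@ L MARK)"
        have T: "T0 @@ X = (T0 @@ X1) @@ ?x" using 2(1) by simp
        then have w: "T0 @@ X1 \<le> W" "?x \<le> W" using a(2) wc_le order_trans by metis+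
        obtain K where K: "N = K + 1" "Log K" "mem (EVS (T0 @@ X1) K \<sigma> (lo V (wid * K))) D" "mem (EV ?x \<sigma> (hi V (wid * K))) D" "len V \<le> wid * (K + 1)"
          using G_EVS_snoc[OF D a(3)[unfolded T] TL_vars[OF X(2) 2(3) w(1)] TM_var[OF s_var_is_var w(2)]] .
        have "len X1 < len X" using 2(1) var_nonzero[OF s_var_is_var] by (simp add: mm_pos)
        then have "?C M1 K (lo V (wid * K))"
          using IH[of X1, rule_format, of M1 K "lo V (wid * K)"] b[OF 2(3)] 2(3) w(1) K(3) mem_entry_top(2)[OF K(3)] by blast
        then obtain c V0 where c: "c \<le> top" "V0 \<le> top" "K = c + len M1" "mem (EVS T0 c \<sigma> V0) D" "c \<noteq> 0 --> dig wid V0 0 = dig wid (lo V (wid * K)) 0"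
          "\<forall>i\<le>len capw. i < len M1 --> dig wid (lo V (wid * K)) (c + i) \<sqsubseteq> dig wid \<sigma> (29 + i)" by blast
        have lM: "len M = len M1 + 1" using 2(2) by (simp add: len_L)
        have N: "N = c + len M" using K(1) c(3) lM by (simp add: add.assoc)
        have 0: "dig wid V0 0 = dig wid V 0" if "c \<noteq> 0"
          using c(5) that dig_lo[OF K(2), of 0 V] c(3) by (auto simp: mm_pos)
        have "dig wid V (c + i) \<sqsubseteq> dig wid \<sigma> (29 + i)" if i: "i \<le> len capw" "i < len M" for i
        proof (cases "i < len M1")
          case True
          then have "c + i < K" using c(3) by simp
          then show ?thesis using c(6)[rule_format, OF i(1) True] dig_lo[OF K(2), of "c + i" V] by simp
        next
          case False
          have "i + 1 \<le> len M1 + 1" using i(2) lM less_iff by simp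
          then have "i = len M1" using False by simp
          then have "dig wid V (c + i) = hi V (wid * K)" using array_parts(2)[OF K(5,2)] c(3) by simp
          then show ?thesis using var_source[OF D K(4) s_var_is_var] \<open>i = len M1\<close> by (simp add: val_def var_len)
        qed
        then show ?thesis using c(1,2,4) N 0 by blast
      qed
    qed
  qed
  from this[rule_format, of M N V] have "?C M N V" using b[OF X(1)] X mem_entry_top(2)[OF X(4)] by blast
  then obtain c V0 where c: "N = c + len M" "mem (EVS T0 c \<sigma> V0) D" "c \<noteq> 0 --> dig wid V0 0 = dig wid V 0"
    "\<forall>i\<le>len capw. i < len M --> dig wid V (c + i) \<sqsubseteq> dig wid \<sigma> (29 + i)" by blast
  have "i < len M ==> i \<le> len capw" for i using VARS_len[OF X(1)] unfolding cap_def by auto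
  then show ?thesis using that[of c V0] c by blast
qed

section \<open>Preservation of evaluations by defining equations\<close>

subsection \<open>Defining equations\<close>

text \<open>Lists and terms of right hand sides, with variables among \<open>x_1, ..., x_N\<close>
  for \<open>N = len M\<close>, and \<open>x0\<close> if \<open>K\<close> is true. The environment
  \<open>rho\<close> speaks about just these variables. Initial parts \<open>Y\<close> of
  \<open>X\<close> occur because lists are taken apart from the right.\<close>

definition RL :: "mm => mm => bool => mm => bool" where
  "RL X M K T \<longleftrightarrow> T \<le> W \<and> ((\<exists>H\<le>W. isAPPS H X T) \<or> (\<exists>Y\<le>W. \<exists>M'\<le>W. isVARS Y M' \<and> len M' \<le> len M
     \<and> (T = Y \<or> (K \<and> (T = x0 @@ Y \<or> (\<exists>f\<le>W. F f \<and> T = x0 @@ s_app f (x0 @@ X) @@ Y))))))"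

definition RT :: "mm => mm => bool => mm => bool" where
  "RT X M K t \<longleftrightarrow> t \<le> W \<and> ((s_is_var t \<and> ((K \<and> t = x0) \<or> (28 < len t \<and> len t \<le> 28 + len M)))
     \<or> (\<exists>f\<le>W. \<exists>T\<le>W. F f \<and> RL X M K T \<and> t = s_app f T))"

lemma Sg_RL: "T1 f ==> Sg (Suc k) (%s. RL X M K (f s))"
  by (rule Sg_inst[of "RL X M K"], unfold RL_def, intro def_intros Sg_bool)
lemma Sg_RT: "T1 f ==> Sg (Suc k) (%s. RT X M K (f s))"
  by (rule Sg_inst[of "RT X M K"], unfold RT_def, intro def_intros Sg_bool Sg_RL)

lemma RL_vars: "isVARS Y M' ==> len M' \<le> len M ==> T \<le> W ==>
    T = Y \<or> (K \<and> (T = x0 @@ Y \<or> (\<exists>f\<le>W. F f \<and> T = x0 @@ s_app f (x0 @@ X) @@ Y))) ==> RL X M K T"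
  unfolding RL_def using isVARS_sub[of Y M'] sub_le[of Y W] sub_le[of M' W] by blast
lemma RL_apps: "isAPPS H X T ==> RL X M K T"
  unfolding RL_def using isAPPS_sub[of H X T] sub_le[of H W] sub_le[of T W] by blast

lemma RT_app: "F f ==> RL X M K T ==> s_app f T \<le> W ==> RT X M K (s_app f T)"
  unfolding RT_def using app_le[of f T] by blast

lemma x0_var: "s_is_var x0" "len x0 = 28" by (simp_all add: x0_def s_var_is_var len_s_var)

lemma RL_TL: assumes "RL X M K T" "isVARS X M" shows "TL T"
proof -
  have b: "T \<le> W" "X \<le> W" "M \<le> W" using assms(1) isVARS_sub[OF assms(2)] sub_le unfolding RL_def by auto
  consider H where "isAPPS H X T" | Y M' where "isVARS Y M'" "T = Y" | Y M' where "isVARS Y M'" "T = x0 @@ Y"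
    | Y M' f where "isVARS Y M'" "F f" "f \<le> W" "T = x0 @@ s_app f (x0 @@ X) @@ Y" using assms(1) unfolding RL_def by blast
  then show ?thesis
  proof cases
    case 1 then show ?thesis using TL_apps by blast
  next
    case 2 then show ?thesis using TL_app_arg by blast
  next
    case 3 then show ?thesis using TL_vars[of x0] b(1) by simp
  next
    case (4 Y M' f)
    then have "list_head (x0 @@ s_app f (x0 @@ X))" unfolding list_head_def using assms(2) b by blast
    then show ?thesis using TL_vars[OF _ 4(1)] 4(4) b(1) by simp
  qed
qed

lemma RL_cases:
  assumes "RL X M K T" "isVARS X M"
  shows "TL T \<and> (T = 0 \<or> (\<exists>T1 t. T = T1 @@ t \<and> RL X M K T1 \<and> RT X M K t))"
proof -
  have TW: "T \<le> W" using assms(1) unfolding RL_def by blast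
  have v0: "isVARS 0 0" using vars_0[OF assms(2)] .
  have var: "?thesis" if Y: "isVARS Y M'" "len M' \<le> len M" "Y \<noteq> 0" "T = T0 @@ Y"
    and T0: "\<And>Y. T0 @@ Y = Y \<or> (K \<and> (T0 @@ Y = x0 @@ Y \<or> (\<exists>f\<le>W. F f \<and> T0 @@ Y = x0 @@ s_app f (x0 @@ X) @@ Y)))" for Y M' T0
  proof -
    obtain Y1 M1 where y: "Y = Y1 @@ s_var (M1 @@ L MARK)" "M' = M1 @@ L MARK" "isVARS Y1 M1"
      using isVARS_cases[OF Y(1)] Y(3) by blast
    have T: "T = (T0 @@ Y1) @@ s_var (M1 @@ L MARK)" using Y(4) y(1) by simp
    have w: "T0 @@ Y1 \<le> W" "s_var (M1 @@ L MARK) \<le> W" using TW unfolding T using wc_le order_trans by blast+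
    have l: "len M1 + 1 \<le> len M" using Y(2) y(2) by (simp add: len_L)
    have "RL X M K (T0 @@ Y1)" using RL_vars[OF y(3) _ w(1) T0] le_trans_add[OF l] by blast
    moreover have "28 < len (s_var (M1 @@ L MARK))" "len (s_var (M1 @@ L MARK)) \<le> 28 + len M"
      by (insert l zz_nonneg[of "len M1"], unfold var_len zify, linarith+)
    then have "RT X M K (s_var (M1 @@ L MARK))" unfolding RT_def using w(2) s_var_is_var by blast
    ultimately show ?thesis using T RL_TL[OF assms] by blast
  qed
  consider H where "isAPPS H X T" | Y M' where "isVARS Y M'" "len M' \<le> len M" "T = Y"
    | Y M' where K "isVARS Y M'" "len M' \<le> len M" "T = x0 @@ Y"
    | Y M' f where K "isVARS Y M'" "len M' \<le> len M" "F f" "f \<le> W" "T = x0 @@ s_app f (x0 @@ X) @@ Y" using assms(1) unfolding RL_def by blast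
  then show ?thesis
  proof cases
    case (1 H)
    have XW: "X \<le> W" using isVARS_sub[OF assms(2)] sub_le by blast
    have "RT X M K (s_app h X)" if "T = A @@ s_app h X" "isFUN h N" for A h N
      using RT_app[OF isFUN_F[OF that(2)] RL_vars[OF assms(2) order_refl XW]] wc_le(2)[of "s_app h X" A] that(1) TW by simp
    then show ?thesis using isAPPS_cases[OF 1] RL_apps RL_TL[OF assms] by blast
  next
    case (2 Y M')
    show ?thesis
    proof (cases "Y = 0")
      case True then show ?thesis using 2 RL_TL[OF assms] by blast
    next
      case False show ?thesis using var[OF 2(1,2) False, of 0] 2(3) by simp
    qed
  next
    case (3 Y M')
    show ?thesis
    proof (cases "Y = 0")
      case True
      then have "T = 0 @@ x0" using 3(4) by simp
      moreover have "RL X M K 0" using RL_vars[OF v0] by simp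
      moreover have "RT X M K x0" unfolding RT_def using x0_var 3(1) \<open>T = 0 @@ x0\<close> TW by simp
      ultimately show ?thesis using RL_TL[OF assms] by blast
    next
      case False show ?thesis using var[OF 3(2,3) False, of x0] 3(1,4) by simp
    qed
  next
    case (4 Y M' f)
    show ?thesis
    proof (cases "Y = 0")
      case True
      then have T: "T = x0 @@ s_app f (x0 @@ X)" using 4(6) by simp
      then have w: "x0 \<le> W" "s_app f (x0 @@ X) \<le> W" using TW wc_le order_trans by blast+
      then have "RL X M K x0" "RL X M K (x0 @@ X)"
        using RL_vars[OF v0 _ w(1)] RL_vars[OF assms(2) order_refl, of "x0 @@ X"] app_le[OF w(2)] 4(1) by simp_all
      then show ?thesis using T RT_app[OF 4(4) _ w(2)] RL_TL[OF assms] by blast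
    next
      case False
      show ?thesis using var[OF 4(2,3) False, of "x0 @@ s_app f (x0 @@ X)"] 4(1,4,5,6) by blast
    qed
  qed
qed

lemma RT_cases:
  assumes "RT X M K t" "isVARS X M"
  shows "TM t \<and> (s_is_var t \<and> ((K \<and> t = x0) \<or> (28 < len t \<and> len t \<le> 28 + len M)) \<or> (\<exists>f T. F f \<and> RL X M K T \<and> t = s_app f T))"
proof -
  have w: "t \<le> W" using assms(1) unfolding RT_def by blast
  consider "s_is_var t" "(K \<and> t = x0) \<or> (28 < len t \<and> len t \<le> 28 + len M)" | f T where "F f" "RL X M K T" "t = s_app f T"
    using assms(1) unfolding RT_def by blast
  then show ?thesis
  proof cases
    case 1 then show ?thesis using TM_var w by blast
  next
    case (2 f T) then show ?thesis using TM_app[OF 2(1) RL_TL[OF 2(2) assms(2)]] w by blast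
  qed
qed

lemma single_inv:
  assumes "G n D" "mem (EVS t N \<sigma> V) D" "TM t" "TL 0"
  shows "N = 1 \<and> mem (EV t \<sigma> V) D \<and> dig wid V 0 = V"
proof -
  obtain M V1 v where *: "N = M + 1" "V = v * ex (wid * M) + V1" "mem (EVS 0 M \<sigma> V1) D" "mem (EV t \<sigma> v) D"
    using snoc_source[OF assms(1) _ assms(4,3)] assms(2) by (metis wc_0(1))
  then have V: "N = 1" "V = v" using EVS_zero[OF assms(1) *(3)] by simp_all
  have "len v \<le> wid" using okD(1)[OF G_EV[OF assms(1) *(4)]] assms(1) unfolding G_def by (meson order_trans)
  then show ?thesis using V *(4) dig_first[of wid v] by (simp add: len_le_iff)
qed

lemma single_eval:
  assumes "Ach m D (EV t \<sigma> v)" "TL 0" "TL t" "m + 2 \<le> wid"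
  shows "Ach (m + 2) D (EVS t 1 \<sigma> v)"
proof -
  have m: "m + 1 + 1 \<le> m + 2" "m + 1 + 1 = m + 2" "m + 1 \<le> wid" using assms(4) unfolding zify by simp_all
  obtain D1 where D1: "\<And>e. mem e D ==> mem e D1" "G m D1" "mem (EV t \<sigma> v) D1" using assms(1) by (rule AchE) blast
  have "envok m \<sigma>" using okD(1)[OF G_EV[OF D1(2,3)]] by blast
  then have "okEVS (m + 1) D1 0 0 \<sigma> 0" using okEVS_nil assms(2) env_mono(1) by simp
  then have "Ach (m + 1) D1 (EVS 0 0 \<sigma> 0)" using add_EVS[OF D1(2) order_refl m(3)] by blast
  then obtain D2 where D2: "\<And>e. mem e D1 ==> mem e D2" "G (m + 1) D2" "mem (EVS 0 0 \<sigma> 0) D2" by (rule AchE) blast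
  have "okEVS (m + 1) D2 t 1 \<sigma> v" using okEVS_snoc[OF D2(2,3) D2(1)[OF D1(3)]] assms(3) by simp
  then have "okEVS (m + 2) D2 t 1 \<sigma> v" using ok_up(2)[of "m + 1" D2 t 1 \<sigma> v "m + 2" D2] le_trans_add[OF m(1)] by blast
  then have "Ach (m + 2) D2 (EVS t 1 \<sigma> v)" by (rule add_EVS[OF D2(2) m(1) assms(4)])
  then show ?thesis using Ach_trans D1(1) D2(1) by blast
qed

lemma suc_head:
  assumes k: "k = SUC0 \<or> k = SUC1" and w: "s_app (L k) x0 \<le> W" "isVARS X M"
  shows "TM (s_app (L k) x0)" "F (L k)" "TL x0" "TL 0" "TL (s_app (L k) x0)" "TM x0"
proof -
  have b: "L k \<le> W" "x0 \<le> W" using app_le[OF w(1)] by auto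
  show "F (L k)" using k b F_letters by blast
  moreover show 0: "TL x0" using TL_vars[OF list_heads(2) vars_0[OF w(2)]] b by simp
  ultimately show "TM (s_app (L k) x0)" using TM_app w(1) by blast
  show "TL 0" using TL_app_arg[OF vars_0[OF w(2)]] .
  have "list_head (s_app (L k) x0)" using k by auto
  then show "TL (s_app (L k) x0)" using TL_vars[OF _ vars_0[OF w(2)]] w(1) by simp
  show "TM x0" using TM_var x0_var b by blast
qed

text \<open>A few entries are added, and the value grows by at most 7 bits, the length of the letter
  of \<open>s_1\<close>. The steps 10 and 20 in the budget are rounded up.\<close>

lemma suc_eval:
  assumes k: "k = SUC0 \<or> k = SUC1" and w: "s_app (L k) x0 \<le> W" "isVARS X M"
    and D: "G n D" "envok n \<sigma>" "n + 20 \<le> wid"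
  shows "Ach (n + 20) D (EVS (s_app (L k) x0) 1 \<sigma> (L k @@ dig wid \<sigma> 28))"
proof -
  note h = suc_head[OF k w]
  have m: "n + 1 \<le> wid" "n + 1 + 2 \<le> wid" "n + 1 + 2 + 1 \<le> n + 10" "n + 10 \<le> wid" "n + 10 + 2 \<le> wid" "n + 10 + 2 \<le> n + 20" "n \<le> n + 10" "n \<le> n + 1"
    using D(3) unfolding zify by simp_all
  have "okEV (n + 1) D x0 \<sigma> (dig wid \<sigma> 28)"
    using okEV_var[OF x0_var(1) TM_bound[OF h(6)] env_mono(1)[OF D(2) m(8)]] by (simp add: val_def x0_var)
  then have "Ach (n + 1) D (EV x0 \<sigma> (dig wid \<sigma> 28))" by (rule add_EV[OF D(1) order_refl m(1)])
  then have "Ach (n + 1 + 2) D (EVS x0 1 \<sigma> (dig wid \<sigma> 28))" using single_eval h(3,4) m(2) by blast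
  then obtain D1 where D1: "\<And>e. mem e D ==> mem e D1" "G (n + 1 + 2) D1" "mem (EVS x0 1 \<sigma> (dig wid \<sigma> 28)) D1" by (rule AchE) blast
  have l: "len (dig wid \<sigma> 28) \<le> n" using envok_len D(2) by blast
  have "len (L k) \<le> 7" using k by (auto simp: len_L)
  then have "len (L k @@ dig wid \<sigma> 28) \<le> n + 10" using l unfolding len_wc zify by linarith
  moreover have "dig wid (dig wid \<sigma> 28) 0 = dig wid \<sigma> 28" using dig_first dig_less by simp
  then have "app_val D1 (L k) 1 (dig wid \<sigma> 28) (L k @@ dig wid \<sigma> 28)" using k unfolding app_val_def by auto
  ultimately have "okEV (n + 10) D1 (s_app (L k) x0) \<sigma> (L k @@ dig wid \<sigma> 28)"
    using okEV_app[OF h(1,2) env_mono(1)[OF D(2) m(7)] _ D1(3) pre_refl] wid_top order_trans[OF _ m(4)] by blast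
  then have "Ach (n + 10) D1 (EV (s_app (L k) x0) \<sigma> (L k @@ dig wid \<sigma> 28))" by (rule add_EV[OF D1(2) m(3,4)])
  then have "Ach (n + 10 + 2) D1 (EVS (s_app (L k) x0) 1 \<sigma> (L k @@ dig wid \<sigma> 28))" using single_eval h(4,5) m(5) by blast
  then show ?thesis using Ach_up[OF Ach_trans[OF D1(1)] m(6) D(3)] by blast
qed

lemma letter_val: "G n D ==> app_val D (L EPS) N V w ==> w = L EPS"
  "G n D ==> app_val D (L SUC0) N V w ==> w = L SUC0 @@ dig wid V 0"
  "G n D ==> app_val D (L SUC1) N V w ==> w = L SUC1 @@ dig wid V 0"
  using G_CALL[of n D _ N V w] rhs_not_letter unfolding app_val_def okCALL_def by force+

lemma suc_inv:
  assumes k: "k = SUC0 \<or> k = SUC1" and w: "s_app (L k) x0 \<le> W" "isVARS X M"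
    and D: "G n D" "mem (EVS (s_app (L k) x0) N \<sigma> V) D"
  shows "N = 1 \<and> dig wid V 0 \<sqsubseteq> L k @@ dig wid \<sigma> 28"
proof -
  note h = suc_head[OF k w]
  have s: "N = 1" "mem (EV (s_app (L k) x0) \<sigma> V) D" "dig wid V 0 = V" using single_inv[OF D h(1,4)] by auto
  have "V \<sqsubseteq> L k @@ dig wid \<sigma> 28"
  proof (cases "V = 0")
    case False
    obtain N' V' w' where e: "mem (EVS x0 N' \<sigma> V') D" "V \<sqsubseteq> w'" "app_val D (L k) N' V' w'" using G_EV_app[OF D(1) s(2) h(2) False] .
    have "mem (EV x0 \<sigma> V') D" "dig wid V' 0 = V'" using single_inv[OF D(1) e(1) h(6,4)] by auto
    then have "dig wid V' 0 \<sqsubseteq> dig wid \<sigma> 28" using var_source[OF D(1) _ x0_var(1)] by (simp add: val_def x0_var)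
    moreover have "w' = L k @@ dig wid V' 0" using letter_val[OF D(1)] e(3) k by blast
    ultimately show ?thesis using e(2) pre_trans pre_wc_iff by metis
  qed simp
  then show ?thesis using s by simp
qed

lemma eps_head:
  assumes w: "s_app (L EPS) 0 \<le> W" "isVARS X M"
  shows "TM (s_app (L EPS) 0)" "TL 0" "TL (s_app (L EPS) 0)" "F (L EPS)"
proof -
  show F: "F (L EPS)" using app_le[OF w(1)] F_letters by blast
  show 0: "TL 0" using TL_app_arg[OF vars_0[OF w(2)]] .
  show "TM (s_app (L EPS) 0)" using TM_app[OF F 0] w(1) by blast
  show "TL (s_app (L EPS) 0)" using TL_vars[OF list_heads(3) vars_0[OF w(2)]] w(1) by simp
qed

lemma eps_eval:
  assumes w: "s_app (L EPS) 0 \<le> W" "isVARS X M" and D: "G n D" "envok n \<sigma>" "n + 20 \<le> wid"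
  shows "Ach (n + 20) D (EVS (s_app (L EPS) 0) 1 \<sigma> (L EPS))"
proof -
  note h = eps_head[OF w]
  have m: "n + 1 \<le> wid" "n + 1 + 1 \<le> n + 10" "n + 10 \<le> wid" "n + 10 + 2 \<le> wid" "n + 10 + 2 \<le> n + 20" "n \<le> n + 10" "n \<le> n + 1" "5 \<le> n + 10"
    using D(3) zz_nonneg[of n] unfolding zify by simp_all
  have "okEVS (n + 1) D 0 0 \<sigma> 0" using okEVS_nil[OF h(2) env_mono(1)[OF D(2) m(7)]] .
  then have "Ach (n + 1) D (EVS 0 0 \<sigma> 0)" by (rule add_EVS[OF D(1) order_refl m(1)])
  then obtain D1 where D1: "\<And>e. mem e D ==> mem e D1" "G (n + 1) D1" "mem (EVS 0 0 \<sigma> 0) D1" by (rule AchE) blast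
  have l: "len (L EPS) \<le> n + 10" using m(8) letter_len by simp
  have "app_val D1 (L EPS) 0 0 (L EPS)" unfolding app_val_def by simp
  then have "okEV (n + 10) D1 (s_app (L EPS) 0) \<sigma> (L EPS)"
    using okEV_app[OF h(1,4) env_mono(1)[OF D(2) m(6)] l D1(3) pre_refl] wid_top order_trans[OF l m(3)] by blast
  then have "Ach (n + 10) D1 (EV (s_app (L EPS) 0) \<sigma> (L EPS))" by (rule add_EV[OF D1(2) m(2,3)])
  then have "Ach (n + 10 + 2) D1 (EVS (s_app (L EPS) 0) 1 \<sigma> (L EPS))" using single_eval h(2,3) m(4) by blast
  then show ?thesis using Ach_up[OF Ach_trans[OF D1(1)] m(5) D(3)] by blast
qed

lemma eps_inv:
  assumes w: "s_app (L EPS) 0 \<le> W" "isVARS X M" and D: "G n D" "mem (EVS (s_app (L EPS) 0) N \<sigma> V) D"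
  shows "N = 1 \<and> dig wid V 0 \<sqsubseteq> L EPS"
proof -
  note h = eps_head[OF w]
  have s: "N = 1" "mem (EV (s_app (L EPS) 0) \<sigma> V) D" "dig wid V 0 = V" using single_inv[OF D h(1,2)] by auto
  have "V \<sqsubseteq> L EPS"
  proof (cases "V = 0")
    case False
    then show ?thesis using G_EV_app[OF D(1) s(2) h(4) False] letter_val(1)[OF D(1)] by metis
  qed simp
  then show ?thesis using s by simp
qed

end

context deriv
begin

lemma plain_data:
  assumes "s_def_eq W W t u" "t \<le> W" "u \<le> W"
  obtains (plain) f X M where "F f" "isVARS X M" "t = s_app f X" "rhs_plain f (len M) u" "RT X M False u"
  | (rec) ge g0 g1 X M where "F (s_cRec ge g0 g1)" "F ge" "F g0" "F g1" "isVARS X M"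
      "t = s_app (s_cRec ge g0 g1) (s_app (L EPS) 0 @@ X) \<and> u = s_app ge X
      \<or> t = s_app (s_cRec ge g0 g1) (s_app (L SUC0) x0 @@ X) \<and> u = rec_rhs (s_cRec ge g0 g1) g0 X
      \<or> t = s_app (s_cRec ge g0 g1) (s_app (L SUC1) x0 @@ X) \<and> u = rec_rhs (s_cRec ge g0 g1) g1 X"
proof -
  from assms(1) show ?thesis
  proof (cases rule: def_eq_cases)
    case (const N X)
    have N: "N \<le> W" using isVARS_sub[OF const(4)] sub_le by blast
    have "RL X N False 0" using RL_vars[OF vars_0[OF const(4)], of N 0] by simp
    then have "RT X N False u" unfolding const(2) using RT_app assms(3) const(2) F_letters(1) app_le[of "L EPS" 0] by blast
    moreover have "\<exists>M\<le>W. s_cConst N = s_cConst M \<and> u = s_app (L EPS) 0" using N const(2) by blast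
    then have "rhs_plain (s_cConst N) (len N) u" unfolding rhs_plain_def by (rule disjI1)
    ultimately show ?thesis using plain[OF isFUN_F[OF const(3)] const(4,1)] by blast
  next
    case (proj I N X)
    have b: "1 \<le> len I" "len I \<le> len N" "s_unary N" using PROJ_arity[OF proj(4,3)] .
    have "28 < len (s_var I)" "len (s_var I) \<le> 28 + len N" by (insert b(1,2), unfold len_s_var zify, linarith+)
    then have "RT X N False u" unfolding RT_def using proj(2) s_var_is_var assms(3) by simp
    moreover have "I \<le> s_cProj I N" unfolding s_cProj_def by (meson wc_le order_trans)
    then have "I \<le> W" "N \<le> W" using F_bound[OF isFUN_F[OF proj(4)]] isVARS_sub[OF proj(5)] sub_le by auto
    then have "\<exists>I'\<le>W. \<exists>M\<le>W. s_cProj I N = s_cProj I' M \<and> s_unary I' \<and> s_unary M \<and> u = s_var I'" using proj b(3) by blast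
    then have "rhs_plain (s_cProj I N) (len N) u" unfolding rhs_plain_def by (intro disjI2 disjI1)
    ultimately show ?thesis using plain[OF isFUN_F[OF proj(4)] proj(5,1)] by blast
  next
    case (comp g H M N X A)
    have f: "F (s_cComp g H)" using F_comp[OF comp(3,4)] app_le comp(1) assms(2) by blast
    have b: "g \<le> W" "H \<le> W" "X \<le> W" "A \<le> W" "N \<le> W"
      using isFUN_sub[OF comp(3)] isAPPS_sub[OF comp(6)] isVARS_sub[OF comp(5)] sub_le by auto
    have "RT X N False u" unfolding comp(2) using RT_app[OF isFUN_F[OF comp(3)] RL_apps[OF comp(6)]] assms(3) comp(2) by blast
    moreover have "\<exists>g'\<le>W. \<exists>H'\<le>W. \<exists>X\<le>W. \<exists>A\<le>W. \<exists>M\<le>W. s_cComp g H = s_cComp g' H' \<and> F g' \<and> LF H' \<and> isVARS X M \<and> len M = len N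
          \<and> isAPPS H' X A \<and> u = s_app g' A" using b comp isFUN_F[OF comp(3)] isFUNS_LF[OF comp(4)] by blast
    then have "rhs_plain (s_cComp g H) (len N) u" unfolding rhs_plain_def by (intro disjI2)
    ultimately show ?thesis using plain[OF f comp(5,1)] by blast
  next
    case rec': (rec ge g0 g1 N X)
    have "F (s_cRec ge g0 g1)" using rec'(5) assms(2) F_rec[OF rec'(1-3)] app_le by blast
    then show ?thesis using rec[OF _ _ _ _ rec'(4,5)[folded rec_rhs_def]] isFUN_F rec'(1-3) by blast
  qed
qed

text \<open>All defining equations in one shape, so that each direction needs a single argument:
  \<open>T0\<close> is the head of the arguments of the left side, \<open>c\<close> the number of
  its terms, and \<open>V0\<close> its best value under \<open>\<sigma>\<close>. The last two
  clauses say that this value can be recorded and that nothing else about the head can.\<close>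

lemma axiom_data:
  assumes "s_def_eq W W t u" "t \<le> W" "u \<le> W"
  obtains f X M T0 K c v V0 where "F f" "isVARS X M" "t = s_app f (T0 @@ X)" "list_head T0" "RT X M K u" "c = 0 \<or> c = 1"
    "v = (if K then dig wid \<sigma> 28 else 0)"
    "\<And>V. c = 1 ==> dig wid V 0 = V0 ==> rhs f (c + len M) V u c v" "\<And>V. c = 0 ==> rhs f (c + len M) V u c v"
    "\<And>n D. G n D ==> envok n \<sigma> ==> n + 20 \<le> wid ==> Ach (n + 20) D (EVS T0 c \<sigma> V0)"
    "\<And>n D c' V'. G n D ==> mem (EVS T0 c' \<sigma> V') D ==> c' = c \<and> (c = 1 --> dig wid V' 0 \<sqsubseteq> V0)"
  using assms
proof (cases rule: plain_data)
  case (plain f X M)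
  have 0: "TL 0" using TL_app_arg[OF vars_0[OF plain(2)]] .
  show ?thesis
  proof (rule that[of f X M 0 False 0 0 0])
    fix n D assume *: "G n D" "envok n \<sigma>" "n + 20 \<le> wid"
    have m: "n + 1 \<le> n + 20" "n \<le> n + 20" unfolding zify by simp_all
    show "Ach (n + 20) D (EVS 0 0 \<sigma> 0)" by (rule add_EVS[OF *(1) m(1) *(3) okEVS_nil[OF 0 env_mono(1)[OF *(2) m(2)]]])
  next
    fix n D c' V' assume "G n D" "mem (EVS 0 c' \<sigma> V') D"
    then show "c' = 0 \<and> (0 = (1 :: mm) --> dig wid V' 0 \<sqsubseteq> 0)" using EVS_zero by simp
  qed (use plain in \<open>simp_all add: rhs_def\<close>)
next
  case (rec ge g0 g1 X M)
  note thesisI = that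
  let ?f = "s_cRec ge g0 g1"
  have b: "X \<le> W" "M \<le> W" using isVARS_sub[OF rec(5)] sub_le by auto
  have rr: "rhs_rec ?f (1 + len M) V u v" if "(dig wid V 0 = L EPS \<and> u = s_app ge X \<and> v = 0) \<or> (dig wid V 0 = L SUC0 @@ v \<and> u = rec_rhs ?f g0 X)
      \<or> (dig wid V 0 = L SUC1 @@ v \<and> u = rec_rhs ?f g1 X)" for V v
    unfolding rhs_rec_def
    by (rule exI[of _ ge], rule conjI, rule F_bound, rule rec(2), rule exI[of _ g0], rule conjI, rule F_bound, rule rec(3),
        rule exI[of _ g1], rule conjI, rule F_bound, rule rec(4), rule exI[of _ X], rule conjI, rule b(1), rule exI[of _ M], rule conjI, rule b(2))
      (intro conjI refl rec(2-5) that add.commute)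
  have suc: ?thesis if k: "k = SUC0 \<or> k = SUC1" and g: "F g" "t = s_app ?f (s_app (L k) x0 @@ X)" "u = rec_rhs ?f g X"
    and r: "\<And>V v. dig wid V 0 = L k @@ v ==> rhs_rec ?f (1 + len M) V u v" for k g
  proof -
    have w: "s_app (L k) x0 \<le> W" using app_le[of ?f] g(2) assms(2) wc_le order_trans by blast
    have T: "x0 @@ s_app ?f (x0 @@ X) @@ X \<le> W" using app_le[of g] g(3) assms(3) unfolding rec_rhs_def by blast
    have RT: "RT X M True u" unfolding g(3) rec_rhs_def
      by (rule RT_app[OF g(1) RL_vars[OF rec(5) order_refl T]]) (use rec(1) F_bound g(3) assms(3) in \<open>auto simp: rec_rhs_def\<close>)
    have lh: "list_head (s_app (L k) x0)" using k by auto
    show ?thesis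
    proof (rule thesisI[of ?f X M "s_app (L k) x0" True 1 "dig wid \<sigma> 28" "L k @@ dig wid \<sigma> 28"])
      fix n D c' V' assume "G n D" "mem (EVS (s_app (L k) x0) c' \<sigma> V') D"
      then show "c' = 1 \<and> (1 = (1 :: mm) --> dig wid V' 0 \<sqsubseteq> L k @@ dig wid \<sigma> 28)" using suc_inv[OF k w rec(5)] by blast
    next
      fix V assume "dig wid V 0 = L k @@ dig wid \<sigma> 28"
      then show "rhs ?f (1 + len M) V u 1 (dig wid \<sigma> 28)" unfolding rhs_def using r by blast
    qed (use rec(1,5) g(2) lh RT suc_eval[OF k w rec(5)] in simp_all)
  qed
  consider "t = s_app ?f (s_app (L EPS) 0 @@ X)" "u = s_app ge X"
    | "t = s_app ?f (s_app (L SUC0) x0 @@ X)" "u = rec_rhs ?f g0 X"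
    | "t = s_app ?f (s_app (L SUC1) x0 @@ X)" "u = rec_rhs ?f g1 X" using rec(6) by blast
  then show ?thesis
  proof cases
    case 1
    have w: "s_app (L EPS) 0 \<le> W" using app_le[of ?f] 1(1) assms(2) wc_le order_trans by blast
    have RT: "RT X M False u" unfolding 1(2) by (rule RT_app[OF rec(2) RL_vars[OF rec(5) order_refl b(1)]]) (use 1(2) assms(3) in auto)
    show ?thesis
    proof (rule thesisI[of ?f X M "s_app (L EPS) 0" False 1 0 "L EPS"])
      fix n D c' V' assume "G n D" "mem (EVS (s_app (L EPS) 0) c' \<sigma> V') D"
      then show "c' = 1 \<and> (1 = (1 :: mm) --> dig wid V' 0 \<sqsubseteq> L EPS)" using eps_inv[OF w rec(5)] by blast
    next
      fix V assume "dig wid V 0 = L EPS"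
      then show "rhs ?f (1 + len M) V u 1 0" unfolding rhs_def using rr 1(2) by blast
    qed (use rec(1,5) 1(1) RT eps_eval[OF w rec(5)] in simp_all)
  next
    case 2 then show ?thesis using suc[OF _ rec(3)] rr by blast
  next
    case 3 then show ?thesis using suc[OF _ rec(4)] rr by blast
  qed
qed

lemma rho_envok:
  assumes "argok n N V" "len v \<le> n" "n \<le> wid" "Log c"
  shows "envok n (rho c v V)"
proof -
  note a = argok_len[OF assms(1)]
  have v: "v < ex wid" using assms(2,3) order_trans[of "len v" n wid] by (simp add: len_le_iff flip: len_le_iff)
  have "hi V (wid * c) * 1 \<le> hi V (wid * c) * ex (wid * c)"
    using assms(4) is_pow_nonzero[OF is_pow_ex] by (intro mult_left_mono) (simp_all add: one_le)
  then have "hi V (wid * c) \<le> V" using hilo(1)[of "wid * c" V] assms(4) by (metis Log_consts(4) add_increasing2 mm_nonneg mult_1_right)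
  moreover have "V < ex (wid * N)" using assms(1) a(3) unfolding argok_def by (simp add: len_le_iff)
  ultimately have h: "hi V (wid * c) < ex (wid * N)" by (rule le_less_trans)
  have s1: "hi V (wid * c) * ex wid + v < ex (wid * N + wid)" by (rule shift_less) (use h v a in simp_all)
  have "(hi V (wid * c) * ex wid + v) * ex (wid * 28) + 0 < ex (wid * N + wid + wid * 28)"
    by (rule shift_less[OF _ _ s1]) (use a in \<open>simp_all add: Log_add mm_pos is_pow_nonzero[OF is_pow_ex]\<close>)
  moreover have "wid * N + wid + wid * 28 = wid * (N + 29)" unfolding zify by (simp add: algebra_simps)
  ultimately have l: "len (rho c v V) \<le> wid * (N + 29)" unfolding rho_def using a(3) by (simp add: len_le_iff Log_add)
  have "N + 29 \<le> cap" using assms(1) unfolding argok_def zify by linarith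
  then have "wid * (N + 29) \<le> wid * cap" by (intro mult_left_mono) simp_all
  moreover have "len (dig wid (rho c v V) j) \<le> n" if "j \<le> len capw" for j
  proof -
    have "Log j" using that Log_down Log_len by blast
    show ?thesis
    proof (cases j rule: rho_cases)
      case (3 i)
      then have "Log i" using \<open>Log j\<close> Log_down[of j i] by (simp add: add_increasing)
      then show ?thesis using 3 rho_dig(2)[OF assms(4) v] argok_dig[OF assms(1)] by simp
    qed (use rho_dig[OF assms(4) v] assms(2) in simp_all)
  qed
  ultimately show ?thesis unfolding envok_def using l order_trans by blast
qed

text \<open>The arguments of \<open>t\<close> are evaluated as fully as \<open>\<sigma>\<close>
  allows. On the variables of \<open>u\<close> the resulting environment \<open>rho\<close> then
  knows no less than \<open>\<sigma>\<close>, so the evaluation of \<open>u\<close> can be moved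
  there, where it justifies a call and with it an evaluation of \<open>t\<close>.\<close>

lemma AX_left:
  assumes ax: "s_def_eq W W t u" "t \<le> W" "u \<le> W" and D: "G n D" "mem (EV u \<sigma> w) D" "n + 5 * cap \<le> m" "m \<le> wid"
  shows "Ach m D (EV t \<sigma> w)"
proof (cases "w = 0")
  case True
  have "n + 1 \<le> m" "n \<le> m" using D(3) cap_wid(2) unfolding zify by linarith+
  then show ?thesis using add_EV[OF D(1) _ D(4)] okEV_0 DEF_TM[OF ax] env_mono(1) okD(1)[OF G_EV[OF D(1,2)]] True by blast
next
  case False
  show ?thesis
  proof (rule axiom_data[OF ax, where \<sigma> = \<sigma>])
  fix f X M T0 K c v V0 assume a: "F f" "isVARS X M" "t = s_app f (T0 @@ X)" "list_head T0" "RT X M K u" "c = 0 \<or> c = 1"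
    "v = (if K then dig wid \<sigma> 28 else 0)"
    "\<And>V. c = 1 ==> dig wid V 0 = V0 ==> rhs f (c + len M) V u c v" "\<And>V. c = 0 ==> rhs f (c + len M) V u c v"
    "\<And>n D. G n D ==> envok n \<sigma> ==> n + 20 \<le> wid ==> Ach (n + 20) D (EVS T0 c \<sigma> V0)"
    "\<And>n D c' V'. G n D ==> mem (EVS T0 c' \<sigma> V') D ==> c' = c \<and> (c = 1 --> dig wid V' 0 \<sqsubseteq> V0)"
  note ok = okD(1)[OF G_EV[OF D(1,2)]]
  have TW: "T0 @@ X \<le> W" using app_le[of f "T0 @@ X"] ax(2) a(3) by simp
  have lens: "len (T0 @@ X) + 100 \<le> cap" "len u + 100 \<le> cap" using len_mono[OF TW] len_mono[OF ax(3)] by (simp_all add: cap_eq)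
  have u1: "1 \<le> len u" using ok TM_nonzero by (simp add: one_le)
  \<comment> \<open>The budgets for the head, for the argument list and for the transfer of
    \<open>u\<close>; the call and the entry for \<open>t\<close> need two more. Both words are at
    least 100 shorter than \<open>cap\<close>, so \<open>5 * cap\<close> suffices.\<close>
  define m1 m2 m3 where "m1 = n + 20" and "m2 = m1 + 2 * len (T0 @@ X) + 1" and "m3 = m2 + 2 * len u"
  have ms: "n \<le> m1" "m1 \<le> wid" "m1 \<le> m2" "n \<le> m2" "m2 \<le> wid" "m2 + 2 * len u \<le> m3 + 1" "m3 \<le> wid" "m3 + 1 \<le> wid" "m3 + 1 + 1 \<le> m" "m2 \<le> m3 + 1" "n \<le> m3 + 1" "m3 + 1 \<le> m" "n \<le> m" "m2 \<le> m3"
    by (insert D(3,4) lens zz_nonneg[of "len (T0 @@ X)"] zz_nonneg[of "len u"], unfold m1_def m2_def m3_def zify, linarith+)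
  have "Ach m1 D (EVS T0 c \<sigma> V0)" using a(10)[OF D(1)] ok ms(2) unfolding m1_def by blast
  then obtain D1 where D1: "\<And>e. mem e D ==> mem e D1" "G m1 D1" "mem (EVS T0 c \<sigma> V0) D1" by (rule AchE) blast
  obtain V where V: "Ach m2 D1 (EVS (T0 @@ X) (c + len M) \<sigma> V)" "\<And>i. i < len M ==> dig wid V (c + i) = dig wid \<sigma> (29 + i)"
    "c = 1 ==> dig wid V 0 = dig wid V0 0"
    using vars_eval[OF D1(2,3) a(2,4) TW a(6), of m2] ms(5) unfolding m2_def by blast
  obtain D2 where D2: "\<And>e. mem e D1 ==> mem e D2" "G m2 D2" "mem (EVS (T0 @@ X) (c + len M) \<sigma> V) D2" using V(1) by (rule AchE) blast
  note okV = okD(2)[OF G_EVS[OF D2(2,3)]]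
  have c: "Log c" using a(6) by auto
  have lv: "len v \<le> n" using a(7) envok_len ok by auto
  have v: "v < ex wid" using lv ms(4,5) order_trans[of "len v" n wid] by (simp add: len_le_iff flip: len_le_iff)
  have env: "envok m2 (rho c v V)" using rho_envok[OF _ order_trans[OF lv ms(4)] ms(5) c] okV by blast
  have V0: "dig wid V0 0 = V0" if "c = 1"
  proof -
    have "len V0 \<le> wid" using okD(2)[OF G_EVS[OF D1(2,3)]] that unfolding argok_def by simp
    then show ?thesis using dig_first[of wid V0] by (simp add: len_le_iff)
  qed
  have rhs: "rhs f (c + len M) V u c v" using a(6,8,9) V(3) V0 by auto
  have "Ach m3 D2 (EV u (rho c v V) w)"
  proof (rule EV_transfer[OF D2(2) env, where R = "RT X M K" and RL = "RL X M K", OF _ _ _ _ a(5) _ ms(6,7)])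
    show "Sg (Suc 0) (%s. RT X M K (s 0))" "Sg (Suc 0) (%s. RL X M K (s 0))" by (intro Sg_RT Sg_RL def_intros)+
    show "mem (EV u \<sigma> w) D2" using D(2) D1(1) D2(1) by blast
    show "RL X M K T ==> TL T \<and> (T = 0 \<or> (\<exists>T1 t. T = T1 @@ t \<and> RL X M K T1 \<and> RT X M K t))" for T using RL_cases a(2) by blast
    fix t assume t: "RT X M K t"
    have "val \<sigma> t \<sqsubseteq> val (rho c v V) t" if "(K \<and> t = x0) \<or> (28 < len t \<and> len t \<le> 28 + len M)"
      using that
    proof
      assume "K \<and> t = x0"
      then show ?thesis using rho_dig(1)[OF c v] a(7) by (simp add: val_def x0_var)
    next
      assume l: "28 < len t \<and> len t \<le> 28 + len M"
      then have "28 + 1 \<le> len t" by (simp add: less_iff)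
      then obtain i where i: "len t = 29 + i" using le_ex[of 29 "len t"] by (metis add_One numeral_plus_one semiring_norm(4) semiring_norm(5))
      have "Log i" using Log_down[OF Log_len[of t], of i] i by (simp add: add_increasing)
      moreover have "i < len M" using l i unfolding zify by linarith
      ultimately show ?thesis using rho_dig(2)[OF c v] V(2) i by (simp add: val_def)
    qed
    then show "TM t \<and> (s_is_var t \<and> val \<sigma> t \<sqsubseteq> val (rho c v V) t \<or> (\<exists>f T. F f \<and> RL X M K T \<and> t = s_app f T))"
      using RT_cases[OF t a(2)] by blast
  qed
  then obtain D3 where D3: "\<And>e. mem e D2 ==> mem e D3" "G m3 D3" "mem (EV u (rho c v V) w) D3" by (rule AchE) blast
  have lw: "len w \<le> n" using ok by blast
  have "c \<le> top" "v \<le> top" using cap_top[of c] a(6) cap_wid(2) wid_top lv ms(4,5) order_trans by (auto simp: one_le cap_eq)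
  then have "\<exists>u'\<le>W. \<exists>c'\<le>top. \<exists>v'\<le>top. rhs f (c + len M) V u' c' v' \<and> mem (EV u' (rho c' v' V) w) D3" using rhs D3(3) ax(3) by blast
  then have "okCALL (m3 + 1) D3 f (c + len M) V w"
    unfolding okCALL_def using a(1) env_mono(2)[OF _ ms(10)] okV order_trans[OF lw ms(11)] by blast
  then have "Ach (m3 + 1) D3 (CALL f (c + len M) V w)" by (rule add_CALL[OF D3(2) order_refl ms(8)])
  then obtain D4 where D4: "\<And>e. mem e D3 ==> mem e D4" "G (m3 + 1) D4" "mem (CALL f (c + len M) V w) D4" by (rule AchE) blast
  have "app_val D4 f (c + len M) V w" unfolding app_val_def using D4(3) by blast
  moreover have "mem (EVS (T0 @@ X) (c + len M) \<sigma> V) D4" using D2(3) D3(1) D4(1) by blast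
  moreover have "TM (s_app f (T0 @@ X))" using DEF_TM[OF ax] a(3) by simp
  ultimately have "okEV m D4 t \<sigma> w"
    unfolding a(3) using okEV_app[of f "T0 @@ X" m \<sigma> w "c + len M" V D4 w] a(1) env_mono(1)[OF _ ms(13)] ok order_trans[OF lw ms(13)]
      mem_entry_top(3)[OF D4(3)] pre_refl by blast
  then have "Ach m D4 (EV t \<sigma> w)" by (rule add_EV[OF D4(2) ms(9) D(4)])
  then show ?thesis using Ach_trans[of D D4] D1(1) D2(1) D3(1) D4(1) by blast
  qed
qed

text \<open>The recorded call behind \<open>t\<close> rests on an evaluation of its right hand side.
  Its arguments are prefixes of what \<open>\<sigma>\<close> gives, so \<open>rhs_fun\<close>
  identifies that side with \<open>u\<close>, and \<open>EV_mono\<close> lifts the evaluation from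
  \<open>rho\<close> to \<open>\<sigma>\<close>.\<close>

lemma AX_right:
  assumes ax: "s_def_eq W W t u" "t \<le> W" "u \<le> W" and D: "G n D" "mem (EV t \<sigma> w) D" "n + 5 * cap \<le> m" "m \<le> wid"
  shows "Ach m D (EV u \<sigma> w)"
proof (cases "w = 0")
  case True
  have "n + 1 \<le> m" "n \<le> m" using D(3) cap_wid(2) unfolding zify by linarith+
  then show ?thesis using add_EV[OF D(1) _ D(4)] okEV_0 DEF_TM[OF ax] env_mono(1) okD(1)[OF G_EV[OF D(1,2)]] True by blast
next
  case False
  show ?thesis
  proof (rule axiom_data[OF ax, where \<sigma> = \<sigma>])
  fix f X M T0 K c v V0 assume a: "F f" "isVARS X M" "t = s_app f (T0 @@ X)" "list_head T0" "RT X M K u" "c = 0 \<or> c = 1"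
    "v = (if K then dig wid \<sigma> 28 else 0)"
    "\<And>V. c = 1 ==> dig wid V 0 = V0 ==> rhs f (c + len M) V u c v" "\<And>V. c = 0 ==> rhs f (c + len M) V u c v"
    "\<And>n D. G n D ==> envok n \<sigma> ==> n + 20 \<le> wid ==> Ach (n + 20) D (EVS T0 c \<sigma> V0)"
    "\<And>n D c' V'. G n D ==> mem (EVS T0 c' \<sigma> V') D ==> c' = c \<and> (c = 1 --> dig wid V' 0 \<sqsubseteq> V0)"
  have env: "envok n \<sigma>" using okD(1)[OF G_EV[OF D(1,2)]] by blast
  have TW: "T0 @@ X \<le> W" using app_le[of f "T0 @@ X"] ax(2) a(3) by simp
  obtain N V w' where e: "mem (EVS (T0 @@ X) N \<sigma> V) D" "w \<sqsubseteq> w'" "app_val D f N V w'"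
    using G_EV_app[OF D(1) D(2)[unfolded a(3)] a(1) False] .
  obtain c' V1 where i: "N = c' + len M" "mem (EVS T0 c' \<sigma> V1) D" "c' \<noteq> 0 ==> dig wid V1 0 = dig wid V 0"
    "\<And>i. i < len M ==> dig wid V (c' + i) \<sqsubseteq> dig wid \<sigma> (29 + i)" using vars_inv[OF D(1) a(2,4) TW e(1)] by blast
  have c': "c' = c" "c = 1 ==> dig wid V 0 \<sqsubseteq> V0" using a(11)[OF D(1) i(2)] i(3) by auto
  have cL: "Log c" using a(6) by auto
  have "n + 20 \<le> wid" using D(3,4) cap_wid(2) unfolding zify by linarith
  \<comment> \<open>Recording the head in an auxiliary table serves to bound the size of
    \<open>V0\<close>.\<close>
  from a(10)[OF D(1) env this] obtain D' where D': "G (n + 20) D'" "mem (EVS T0 c \<sigma> V0) D'" by (rule AchE) blast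
  have V0w: "V0 < ex wid" if "c = 1"
    using okD(2)[OF G_EVS[OF D']] that unfolding argok_def by (simp add: len_le_iff)
  \<comment> \<open>Of the argument array \<open>rhs\<close> inspects only digit 0. For
    \<open>c = 1\<close> the one-digit array \<open>V0\<close> represents the fully known head, with
    which the recorded arguments are compared.\<close>
  define V2 where "V2 = (if c = 1 then V0 else V)"
  have V2: "rhs f (c + len M) V2 u c v" "dig wid V 0 \<sqsubseteq> dig wid V2 0"
    using a(6,8,9) c'(2) dig_first[of wid V0] V0w unfolding V2_def by auto
  have nl: "\<not> (f = L EPS \<or> f = L SUC0 \<or> f = L SUC1)" using rhs_not_letter[OF V2(1)] by blast
  then have C: "mem (CALL f N V w') D" using e(3) unfolding app_val_def by blast
  obtain u' c2 v' where r: "rhs f N V u' c2 v'" "mem (EV u' (rho c2 v' V) w') D" "argok n N V" using G_CALL[OF D(1) C] unfolding okCALL_def by blast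
  have "u' = u \<and> c2 = c \<and> v' \<sqsubseteq> v" using rhs_fun[OF r(1)[unfolded i(1) c'(1)] V2(1)] V2(2) unfolding cpr_def by blast
  then have r': "mem (EV u (rho c v' V) w') D" "v' \<sqsubseteq> v" using r(2) by auto
  have n: "n \<le> wid" using D(1) unfolding G_def by blast
  have "len v' \<le> n" using pre_len[OF r'(2)] a(7) envok_len[OF env, of 28] by (auto intro: order_trans)
  then have v': "v' < ex wid" using n order_trans[of "len v'" n wid] by (simp add: len_le_iff flip: len_le_iff)
  have mono: "val (rho c v' V) y \<sqsubseteq> val \<sigma> y" for y
    unfolding val_def
  proof (cases "len y" rule: rho_cases)
    case 2 then show "dig wid (rho c v' V) (len y) \<sqsubseteq> dig wid \<sigma> (len y)" using rho_dig(1)[OF cL v'] r'(2) a(7) by (auto split: if_splits)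
  next
    case (3 j)
    then have Lj: "Log j" using Log_down[OF Log_len[of y], of j] by (simp add: add_increasing)
    show "dig wid (rho c v' V) (len y) \<sqsubseteq> dig wid \<sigma> (len y)"
    proof (cases "j < len M")
      case True then show ?thesis using rho_dig(2)[OF cL v' Lj] i(4) c'(1) 3 by simp
    next
      case False
      then have "wid * N \<le> wid * (c + j)" unfolding i(1) c'(1) by (intro mult_left_mono) simp_all
      then have "dig wid V (c + j) = 0" using r(3) dig_beyond order_trans unfolding argok_def by blast
      then show ?thesis using rho_dig(2)[OF cL v' Lj] 3 by simp
    qed
  qed (use rho_dig(3)[OF cL v'] in simp)
  have lens: "len u + 100 \<le> cap" using len_mono[OF ax(3)] by (simp add: cap_eq)
  define m1 where "m1 = n + 2 * len u"
  have ms: "n + 2 * len u \<le> m1 + 1" "m1 \<le> wid" "m1 + 1 \<le> m" "m1 \<le> m"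
    by (insert D(3,4) lens zz_nonneg[of "len u"], unfold m1_def zify, linarith+)
  have "Ach m1 D (EV u \<sigma> w')" by (rule EV_mono[OF D(1) env r'(1) mono ms(1,2)])
  then obtain D1 where D1: "\<And>e. mem e D ==> mem e D1" "G m1 D1" "mem (EV u \<sigma> w') D1" by (rule AchE) blast
  have "okEV m D1 u \<sigma> w" using ok_up(1)[OF okEV_down[OF G_EV[OF D1(2,3)] e(2)] ms(4)] by blast
  then have "Ach m D1 (EV u \<sigma> w)" by (rule add_EV[OF D1(2) ms(3) D(4)])
  then show ?thesis using Ach_trans D1(1) by blast
  qed
qed

end

context deriv
begin

section \<open>Induction on derivations and the contradiction\<close>

subsection \<open>Evaluations along derivations\<close>

text \<open>Symmetrized, since evaluations must be carried in both directions: symmetry becomes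
  trivial and every other rule is treated once.\<close>

definition EQ :: "mm => mm => mm => bool" where "EQ p t u \<longleftrightarrow> isPRF p t u \<or> isPRF p u t"
definition EQS :: "mm => mm => mm => bool" where "EQS P T U \<longleftrightarrow> (\<exists>N\<le>W. isPRFS P T U N \<or> isPRFS P U T N)"

lemma Sg_EQ [def_intros]: "T1 f1 ==> T1 f2 ==> T1 f3 ==> Sg (Suc k) (%s. EQ (f1 s) (f2 s) (f3 s))"
  by (rule Sg_inst3[of _ EQ], unfold EQ_def, intro def_intros)
lemma Sg_EQS [def_intros]: "T1 f1 ==> T1 f2 ==> T1 f3 ==> Sg (Suc k) (%s. EQS (f1 s) (f2 s) (f3 s))"
  by (rule Sg_inst3[of _ EQS], unfold EQS_def, intro def_intros)

lemma EQ_bound: "EQ p t u ==> p \<le> W \<and> t \<le> W \<and> u \<le> W"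
  unfolding EQ_def using isPRF_sub sub_le by blast
lemma EQS_bound: "EQS P T U ==> P \<le> W \<and> T \<le> W \<and> U \<le> W"
  unfolding EQS_def using isPRFS_sub sub_le by blast
lemma EQS_I: "isPRFS P T U N ==> EQS P T U \<and> EQS P U T"
  unfolding EQS_def using isPRFS_sub[of P T U N] sub_le by blast
lemma EQ_TM: "EQ p t u ==> TM t \<and> TM u" unfolding EQ_def using PRF_TM by blast
lemma EQS_TL: "EQS P T U ==> TL T \<and> TL U" unfolding EQS_def using TL_prfs by blast

lemma node_len: "len P + 1 \<le> len (s_node k t u P)"
  using one_le[of "len (L k)"] zz_nonneg[of "len t"] zz_nonneg[of "len u"]
  by (simp add: s_node_def, unfold zify, simp)

lemma EQ_cases:
  assumes "EQ p t u"
  obtains (ax) "s_def_eq W W t u \<or> s_def_eq W W u t" "1 \<le> len p" | (refl) "t = u" "1 \<le> len p" | (sym) q where "EQ q t u" "len q + 1 \<le> len p"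
  | (trans) q q' v where "EQ q t v" "EQ q' v u" "len q + len q' + 1 \<le> len p"
  | (cong) P f T U where "F f" "t = s_app f T" "u = s_app f U" "EQS P T U" "len P + 1 \<le> len p"
  | (subst) q t0 u0 x r where "EQ q t0 u0" "isSUB t0 x r t" "isSUB u0 x r u" "len q + 1 \<le> len p"
proof -
  have *: "(s_def_eq W W t u \<and> 1 \<le> len p) \<or> (t = u \<and> 1 \<le> len p) \<or> (\<exists>q. isPRF q u t \<and> len q + 1 \<le> len p)
    \<or> (\<exists>q q' v. isPRF q t v \<and> isPRF q' v u \<and> len q + len q' + 1 \<le> len p)
    \<or> (\<exists>P f N T U. t = s_app f T \<and> u = s_app f U \<and> isFUN f N \<and> isPRFS P T U N \<and> len P + 1 \<le> len p)
    \<or> (\<exists>q t0 u0 x r. isPRF q t0 u0 \<and> isSUB t0 x r t \<and> isSUB u0 x r u \<and> len q + 1 \<le> len p)" if p: "isPRF p t u" for t u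
    using isPRF_cases[OF p]
  proof (elim disjE exE conjE)
    assume "p = s_node AX t u 0" "s_def_eq W W t u" then show ?thesis using node_len[of 0 AX t u] by simp
  next
    assume "u = t" "p = s_node REFL t t 0" then show ?thesis using node_len[of 0 REFL t t] by simp
  next
    fix q assume "p = s_node SYM t u q" "isPRF q u t" then show ?thesis using node_len[of q SYM t u] by blast
  next
    fix q q' v assume "p = s_node TRANS t u (q @@ q')" "isPRF q t v" "isPRF q' v u"
    then show ?thesis using node_len[of "q @@ q'" TRANS t u] by (metis len_wc)
  next
    fix P f N T U assume "t = s_app f T" "u = s_app f U" "p = s_node CONG t u P" "isFUN f N" "isPRFS P T U N"
    then show ?thesis using node_len[of P CONG t u] by blast
  next
    fix q t0 u0 x r assume "p = s_node SUBST t u q" "isPRF q t0 u0" "isSUB t0 x r t" "isSUB u0 x r u"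
    then show ?thesis using node_len[of q SUBST t u] by blast
  qed
  from assms show ?thesis unfolding EQ_def
  proof
    assume "isPRF p t u"
    from *[OF this] show ?thesis
    proof (elim disjE exE conjE)
      fix q q' v assume "isPRF q t v" "isPRF q' v u" "len q + len q' + 1 \<le> len p"
      then show ?thesis by (intro trans[of q v q']) (simp_all add: EQ_def)
    next
      fix P f N T U assume "t = s_app f T" "u = s_app f U" "isFUN f N" "isPRFS P T U N" "len P + 1 \<le> len p"
      then show ?thesis using cong[OF isFUN_F] EQS_I by blast
    next
      fix q t0 u0 x r assume "isPRF q t0 u0" "isSUB t0 x r t" "isSUB u0 x r u" "len q + 1 \<le> len p"
      then show ?thesis using subst[of q t0 u0] by (simp add: EQ_def)
    next
      fix q assume "isPRF q u t" "len q + 1 \<le> len p" then show ?thesis using sym[of q] by (simp add: EQ_def)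
    qed (use ax refl in auto)
  next
    assume "isPRF p u t"
    from *[OF this] show ?thesis
    proof (elim disjE exE conjE)
      fix q q' v assume "isPRF q u v" "isPRF q' v t" "len q + len q' + 1 \<le> len p"
      then show ?thesis by (intro trans[of q' v q]) (simp_all add: EQ_def add.commute)
    next
      fix P f N T U assume "u = s_app f T" "t = s_app f U" "isFUN f N" "isPRFS P T U N" "len P + 1 \<le> len p"
      then show ?thesis using cong[OF isFUN_F] EQS_I by blast
    next
      fix q t0 u0 x r assume "isPRF q t0 u0" "isSUB t0 x r u" "isSUB u0 x r t" "len q + 1 \<le> len p"
      then show ?thesis using subst[of q u0 t0] by (simp add: EQ_def)
    next
      fix q assume "isPRF q t u" "len q + 1 \<le> len p" then show ?thesis using sym[of q] by (simp add: EQ_def)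
    qed (use ax refl in auto)
  qed
qed

lemma EQS_cases:
  assumes "EQS P T U"
  obtains "P = 0" "T = 0" "U = 0" | P' T' U' q t u where "P = P' @@ q" "T = T' @@ t" "U = U' @@ u" "EQS P' T' U'" "EQ q t u"
proof -
  obtain N where "isPRFS P T U N \<or> isPRFS P U T N" using assms unfolding EQS_def by blast
  then show ?thesis
  proof
    assume "isPRFS P T U N"
    from isPRFS_cases[OF this] show ?thesis
    proof (elim disjE exE conjE)
      fix P' T' U' N' q t u assume "P = P' @@ q" "T = T' @@ t" "U = U' @@ u" "isPRFS P' T' U' N'" "isPRF q t u"
      then show ?thesis using that(2)[of P' q T' t U' u] EQS_I by (simp add: EQ_def)
    qed (rule that(1))
  next
    assume "isPRFS P U T N"
    from isPRFS_cases[OF this] show ?thesis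
    proof (elim disjE exE conjE)
      fix P' T' U' N' q t u assume "P = P' @@ q" "U = T' @@ t" "T = U' @@ u" "isPRFS P' T' U' N'" "isPRF q t u"
      then show ?thesis using that(2)[of P' q U' u T' t] EQS_I by (simp add: EQ_def)
    qed (rule that(1))
  qed
qed

text \<open>Entries allowed per unit of length of a derivation. An axiom needs
  \<open>5 * cap\<close> and a substitution \<open>4 * cap\<close>, so the factor 10 is
  ample.\<close>

definition cost :: mm where "cost = 10 * cap"

lemma cost_mono: "a \<le> b ==> cost * a \<le> cost * b" by (intro mult_left_mono) simp_all
lemma cost_Suc: "a + 1 \<le> b ==> cost * a + cost \<le> cost * b"
  using cost_mono[of "a + 1" b] by (simp add: distrib_left)

text \<open>Budgets are additive in the length of \<open>p\<close>, and the codes of the premises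
  are disjoint parts of it. For a single derivation one entry is kept in reserve, which pays for the
  list entry in the simultaneous claim for \<open>PRFS\<close>. Quantifying over all tables makes
  the claim \<Pi>2 and lets the enlarged table of one premise be the starting point of the
  next.\<close>

lemma preserve:
  assumes "p \<le> W"
  shows "(\<forall>t\<le>W. \<forall>u\<le>W. \<forall>n\<le>wid. \<forall>D\<le>top. \<forall>\<sigma>\<le>top. \<forall>w\<le>top. \<forall>m\<le>wid.
      EQ p t u \<and> G n D \<and> mem (EV t \<sigma> w) D \<and> n + cost * len p \<le> m + 1 --> Ach m D (EV u \<sigma> w))
    \<and> (\<forall>T\<le>W. \<forall>U\<le>W. \<forall>n\<le>wid. \<forall>D\<le>top. \<forall>N\<le>top. \<forall>\<sigma>\<le>top. \<forall>V\<le>top. \<forall>m\<le>wid.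
      EQS p T U \<and> G n D \<and> mem (EVS T N \<sigma> V) D \<and> n + cost * len p \<le> m --> Ach m D (EVS U N \<sigma> V))"
    (is "?Q1 p \<and> ?Q2 p")
proof (rule len_induct[of "%p. ?Q1 p \<and> ?Q2 p" p W])
  show "Pg (Suc (Suc 0)) (%s. ?Q1 (s 0) \<and> ?Q2 (s 0))"
    by (intro Pg_conj Pg_ball Pg_imp; (rule Sg_Pg)?; intro def_intros)
  show "p \<le> W" by fact
  fix p assume "p \<le> W" and IH: "\<And>y. y \<le> W ==> len y < len p ==> ?Q1 y \<and> ?Q2 y"
  have G_wid: "n \<le> wid" if "G n D" for n D using that unfolding G_def by blast
  have IH1: "Ach m D (EV u \<sigma> w)" if "len q < len p" "EQ q t u" "G n D" "mem (EV t \<sigma> w) D" "n + cost * len q \<le> m + 1" "m \<le> wid" for q t u n D \<sigma> w m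
    using IH[OF _ that(1), THEN conjunct1, rule_format, of t u n D \<sigma> w m] EQ_bound[OF that(2)] G_wid[OF that(3)] G_top[OF that(3)]
      mem_entry_top(1)[OF that(4)] that by blast
  have IH2: "Ach m D (EVS U N \<sigma> V)" if "len q < len p" "EQS q T U" "G n D" "mem (EVS T N \<sigma> V) D" "n + cost * len q \<le> m" "m \<le> wid" for q T U n D N \<sigma> V m
    using IH[OF _ that(1), THEN conjunct2, rule_format, of T U n D N \<sigma> V m] EQS_bound[OF that(2)] G_wid[OF that(3)] G_top[OF that(3)]
      mem_entry_top(2)[OF that(4)] that by blast
  have cc: "100 \<le> cap" "cost = 10 * cap" using cap_wid(2) by (simp_all add: cost_def)
  have lt: "a + 1 \<le> b ==> a < b" for a b :: mm by (simp add: less_iff)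
  have Q1: "Ach m D (EV u \<sigma> w)" if a: "EQ p t u" "G n D" "mem (EV t \<sigma> w) D" "n + cost * len p \<le> m + 1" "m \<le> wid" for t u n D \<sigma> w m
    using a(1)
  proof (cases rule: EQ_cases)
    case ax
    have "cost \<le> cost * len p" using cost_mono[OF ax(2)] by simp
    then have "n + 5 * cap \<le> m" using a(4) cc unfolding zify by linarith
    then show ?thesis using ax(1) AX_left[OF _ _ _ a(2,3) _ a(5)] AX_right[OF _ _ _ a(2,3) _ a(5)] EQ_bound[OF a(1)] by blast
  next
    case refl
    have "cost \<le> cost * len p" using cost_mono[OF refl(2)] by simp
    then have "n \<le> m" using a(4) cc unfolding zify by linarith
    then show ?thesis using AchI[OF _ a(2) _ a(5)] a(3) refl by blast
  next
    case (sym q)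
    have "n + cost * len q \<le> m + 1" using a(4) cost_Suc[OF sym(2)] cc unfolding zify by linarith
    then show ?thesis using IH1[OF lt[OF sym(2)] sym(1) a(2,3) _ a(5)] by blast
  next
    case (trans q q' v)
    \<comment> \<open>The budget spent on the first premise; the table it produces is the input for
      the second.\<close>
    define m1 where "m1 = n + cost * len q"
    have l: "cost * len q + cost * len q' + cost \<le> cost * len p" using cost_Suc[OF trans(3)] by (simp add: distrib_left)
    have lq: "len q < len p" "len q' < len p"
      using trans(3) zz_nonneg[of "len q"] zz_nonneg[of "len q'"] unfolding zify by linarith+
    have ms: "n + cost * len q \<le> m1 + 1" "m1 + cost * len q' \<le> m + 1" "m1 \<le> wid"
      by (insert a(4,5) l cc zz_nonneg[of "cost * len q'"], unfold m1_def zify, linarith+)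
    obtain D1 where D1: "\<And>e. mem e D ==> mem e D1" "G m1 D1" "mem (EV v \<sigma> w) D1"
      using IH1[OF lq(1) trans(1) a(2,3) ms(1,3)] by (rule AchE) blast
    show ?thesis using Ach_trans[OF D1(1) IH1[OF lq(2) trans(2) D1(2,3) ms(2) a(5)]] .
  next
    case (cong P f T U)
    note ok = okD(1)[OF G_EV[OF a(2,3)]]
    define m1 where "m1 = n + cost * len P"
    have ms: "m1 + 1 \<le> m" "m1 \<le> wid" "n + cost * len P \<le> m1" "n \<le> m" "n + 1 \<le> m"
      by (insert a(4,5) cost_Suc[OF cong(5)] cc zz_nonneg[of "cost * len P"], unfold m1_def zify, linarith+)
    show ?thesis
    proof (cases "w = 0")
      case True
      then show ?thesis using add_EV[OF a(2) ms(5) a(5)] okEV_0 EQ_TM[OF a(1)] env_mono(1)[OF _ ms(4)] ok by blast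
    next
      case False
      obtain N V w' where e: "mem (EVS T N \<sigma> V) D" "w \<sqsubseteq> w'" "w' \<le> top" "app_val D f N V w'" "len w \<le> n"
        using app_source[OF a(2) a(3)[unfolded cong(2)] cong(1) False] .
      obtain D1 where D1: "\<And>e. mem e D ==> mem e D1" "G m1 D1" "mem (EVS U N \<sigma> V) D1"
        using IH2[OF lt[OF cong(5)] cong(4) a(2) e(1) ms(3,2)] by (rule AchE) blast
      have "app_val D1 f N V w'" using e(4) D1(1) unfolding app_val_def by blast
      then have "okEV m D1 u \<sigma> w"
        unfolding cong(3) using okEV_app[of f U m \<sigma> w N V D1 w'] EQ_TM[OF a(1)] cong(1,3) env_mono(1)[OF _ ms(4)] ok D1(3) e(2,3) order_trans[OF e(5) ms(4)] by blast
      then have "Ach m D1 (EV u \<sigma> w)" by (rule add_EV[OF D1(2) ms(1) a(5)])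
      then show ?thesis using Ach_trans D1(1) by blast
    qed
  next
    case (subst q t0 u0 x r)
    have x: "x \<le> W" using isSUB_sub[OF subst(2)] sub_le by blast
    have b: "len t0 \<le> cap" "len u \<le> cap" using len_W EQ_bound[OF subst(1)] EQ_bound[OF a(1)] by auto
    define m1 m2 where "m1 = n + 2 * len t0" and "m2 = m1 + cost * len q"
    have ms: "n + 2 * len t0 \<le> m1 + 1" "m1 \<le> wid" "m1 + cost * len q \<le> m2 + 1" "m2 \<le> wid" "m2 + 2 * len u \<le> m + 1" "n \<le> m2"
      by (insert a(4,5) b cc cost_Suc[OF subst(4)] zz_nonneg[of "cost * len q"] zz_nonneg[of "len t0"] zz_nonneg[of "len u"], unfold m1_def m2_def zify, linarith+)
    have env: "envok n \<sigma>" using okD(1)[OF G_EV[OF a(2,3)]] by blast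
    show ?thesis
    proof (rule subst_env[OF a(2) env x, where r = r])
      fix \<sigma>' assume s: "envok n \<sigma>'" "val \<sigma>' x = 0 \<or> mem (EV r \<sigma> (val \<sigma>' x)) D" "\<And>w. mem (EV r \<sigma> w) D ==> w \<sqsubseteq> val \<sigma>' x"
        "\<And>y. s_is_var x ==> s_is_var y ==> y \<noteq> x ==> val \<sigma>' y = val \<sigma> y"
      have "Ach m1 D (EV t0 \<sigma>' w)"
        by (rule SUB_down[OF a(2) s(1) _ _ subst(2) a(3) ms(1,2)]) (erule s(3), rule s(4))
      then obtain D1 where D1: "\<And>e. mem e D ==> mem e D1" "G m1 D1" "mem (EV t0 \<sigma>' w) D1" by (rule AchE) blast
      obtain D2 where D2: "\<And>e. mem e D1 ==> mem e D2" "G m2 D2" "mem (EV u0 \<sigma>' w) D2"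
        using IH1[OF lt[OF subst(4)] subst(1) D1(2,3) ms(3,4)] by (rule AchE) blast
      have v: "val \<sigma>' x = 0 \<or> mem (EV r \<sigma> (val \<sigma>' x)) D2" using s(2) D1(1) D2(1) by blast
      have "Ach m D2 (EV u \<sigma> w)"
        by (rule SUB_up[OF D2(2) env_mono(1)[OF env ms(6)] v _ subst(3) D2(3) ms(5) a(5)]) (rule s(4))
      then show ?thesis using Ach_trans D1(1) D2(1) by blast
    qed
  qed
  have Q2: "Ach m D (EVS U N \<sigma> V)" if a: "EQS p T U" "G n D" "mem (EVS T N \<sigma> V) D" "n + cost * len p \<le> m" "m \<le> wid" for T U n D N \<sigma> V m
    using a(1)
  proof (cases rule: EQS_cases)
    case 1
    have "n \<le> m" using le_trans_add[OF a(4)] .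
    then show ?thesis using AchI[OF _ a(2) _ a(5)] a(3) 1 by blast
  next
    case (2 P' T' U' q t u)
    obtain M V1 v where s: "N = M + 1" "V = v * ex (wid * M) + V1" "mem (EVS T' M \<sigma> V1) D" "mem (EV t \<sigma> v) D"
      using snoc_source[OF a(2) a(3)[unfolded 2(2)]] EQS_TL[OF 2(4)] EQ_TM[OF 2(5)] by blast
    have lp: "len p = len P' + len q" using 2(1) by simp
    have q: "q \<noteq> 0"
    proof
      assume "q = 0"
      from 2(5) show False by (cases rule: EQ_cases) (use \<open>q = 0\<close> in \<open>auto simp: one_le\<close>)
    qed
    then have q1: "1 \<le> len q" by (simp add: one_le)
    have lP: "len P' < len p" using lp q by (simp add: mm_pos)
    define m1 m2 where "m1 = n + cost * len P'" and "m2 = m1 + cost * len q"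
    have m2m: "m2 \<le> m" using a(4) lp unfolding m1_def m2_def by (simp add: distrib_left add.assoc)
    have "cost \<le> cost * len q" using cost_mono[OF q1] by simp
    then have "1 \<le> m2" using cc zz_nonneg[of n] zz_nonneg[of "cost * len P'"] unfolding m2_def m1_def zify by linarith
    \<comment> \<open>The derivation of the last equation uses one entry less than its share, and
      the new list takes that place.\<close>
    then obtain m3 where m3: "m2 = m3 + 1" using le_ex[of 1 m2] by (metis add.commute)
    have ms: "m1 \<le> wid" "m1 + cost * len q \<le> m3 + 1" "m3 \<le> wid" "m3 + 1 \<le> m" "m3 \<le> m"
      by (insert m2m m3 a(5) zz_nonneg[of "cost * len q"], unfold m2_def zify, linarith+)
    obtain D1 where D1: "\<And>e. mem e D ==> mem e D1" "G m1 D1" "mem (EVS U' M \<sigma> V1) D1"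
      using IH2[OF lP 2(4) a(2) s(3) _ ms(1)] m1_def by (metis AchE order_refl)
    have "Ach m3 D1 (EV u \<sigma> v)"
    proof (cases "P' = 0")
      case True
      then show ?thesis using Q1[OF _ D1(2) D1(1)[OF s(4)] _ ms(3)] 2(1,5) ms(2) by simp
    next
      case False
      then have "len q < len p" using lp by (simp add: mm_pos)
      then show ?thesis using IH1[OF _ 2(5) D1(2) D1(1)[OF s(4)] ms(2,3)] by blast
    qed
    then obtain D2 where D2: "\<And>e. mem e D1 ==> mem e D2" "G m3 D2" "mem (EV u \<sigma> v) D2" by (rule AchE) blast
    have "okEVS m3 D2 U N \<sigma> V" using okEVS_snoc[OF D2(2) D2(1)[OF D1(3)] D2(3)] EQS_TL[OF a(1)] 2(3) s(1,2) by simp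
    then have "okEVS m D2 U N \<sigma> V" using ok_up(2)[OF _ ms(5)] by blast
    then have "Ach m D2 (EVS U N \<sigma> V)" by (rule add_EVS[OF D2(2) ms(4) a(5)])
    then show ?thesis using Ach_trans D1(1) D2(1) by blast
  qed
  show "?Q1 p \<and> ?Q2 p"
    by (rule conjI; intro allI impI; elim conjE; (rule Q1; assumption | rule Q2; assumption))
qed

theorem consistent: "\<not> isPRF p eps_code s1_eps_code"
proof
  assume P: "isPRF p eps_code s1_eps_code"
  have b: "p \<le> W" "eps_code \<le> W" "s1_eps_code \<le> W" using isPRF_sub[OF P] sub_le by auto
  have F: "F (L EPS)" "F (L SUC1)"
    using F_letters app_le[of "L EPS" 0] app_le[of "L SUC1" eps_code] b unfolding eps_code_def s1_eps_code_def by auto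
  have TM: "TM (s_app (L EPS) 0)" using PRF_TM[OF P] unfolding eps_code_def by blast
  have TL: "TL 0" using TM_cases[OF TM] app_not_var[OF F(1)] app_inj[OF F(1)] by metis
  \<comment> \<open>The start is the empty table. The environment 0 leaves all variables unknown,
    and \<open>\<epsilon>\<close> is evaluated to its one-letter word within a budget of 10.\<close>
  have G0: "G 0 0" by (rule G_I) (simp_all add: mem_iff)
  have e0: "envok n 0" for n by (simp add: envok_def)
  have w: "100 \<le> wid" using cap_wid by auto
  have "1 \<le> wid" "(1 :: mm) + 1 \<le> 10" "10 \<le> wid" "(5 :: mm) \<le> 10" "(0 :: mm) + 1 \<le> 1" using w unfolding zify by simp_all
  note w = this
  have "Ach 1 0 (EVS 0 0 0 0)" by (rule add_EVS[OF G0 w(5,1) okEVS_nil[OF TL e0]])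
  then obtain D1 where D1: "G 1 D1" "mem (EVS 0 0 0 0) D1" by (rule AchE) blast
  have l: "len (L EPS) \<le> 10" using w(4) by (simp add: letter_len)
  have "app_val D1 (L EPS) 0 0 (L EPS)" unfolding app_val_def by simp
  then have "okEV 10 D1 (s_app (L EPS) 0) 0 (L EPS)"
    using okEV_app[OF TM F(1) e0 l D1(2) pre_refl] wid_top order_trans[OF l w(3)] by blast
  then have "Ach 10 D1 (EV (s_app (L EPS) 0) 0 (L EPS))" by (rule add_EV[OF D1(1) w(2,3)])
  then obtain D2 where D2: "G 10 D2" "mem (EV eps_code 0 (L EPS)) D2" unfolding eps_code_def by (rule AchE) blast
  \<comment> \<open>The derivation is a subword of \<open>W\<close>, so its cost is at most
    \<open>10 * cap * cap\<close>. The factor 1000 in \<open>wid\<close> leaves room for it and for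
    the initial table.\<close>
  have "cap * len p \<le> cap * cap" using len_W[OF b(1)] by (intro mult_left_mono) simp_all
  moreover have "100 * 100 \<le> cap * cap" using cap_wid(2) by (intro mult_mono) simp_all
  ultimately have m: "10 + cost * len p \<le> wid + 1" unfolding cost_def wid_def mult.assoc zify by linarith
  have "EQ p eps_code s1_eps_code" using P by (simp add: EQ_def)
  then have "Ach wid D2 (EV s1_eps_code 0 (L EPS))"
    using preserve[OF b(1), THEN conjunct1, rule_format, of eps_code s1_eps_code 10 D2 0 "L EPS" wid] b D2 m w(3) G_top[OF D2(1)]
      mem_entry_top(1)[OF D2(2)] by simp
  then obtain D3 where D3: "G wid D3" "mem (EV (s_app (L SUC1) eps_code) 0 (L EPS)) D3" unfolding s1_eps_code_def by (rule AchE) blast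
  obtain N V w' where "L EPS \<sqsubseteq> w'" "app_val D3 (L SUC1) N V w'" using G_EV_app[OF D3 F(2) L_nonzero] by blast
  then have "L EPS \<sqsubseteq> L SUC1 @@ dig wid V 0" using letter_val(3)[OF D3(1)] by simp
  then have "cpr (L EPS @@ 0) (L SUC1 @@ dig wid V 0)" by (simp add: cpr_def)
  then show False using cpr_L by fastforce
qed

end

theorem theorem1:
  shows "S2 2 \<turnstile> Con_PVm"
proof (rule Con_if_MM)
  fix s
  have "\<not> s_entry W (s_judge PRF [p, eps_code, s1_eps_code])" if "s_formation_seq W" for W p
  proof -
    interpret deriv W by unfold_locales (fact that)
    show ?thesis using consistent unfolding isPRF_def .
  qed
  then show "holds MM s Con_PVm" unfolding means_Con by blast
qed

end
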